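(* Let $\tau\ge 1$ be a fixed integer and let $c>0$. Let $\mathbf e_k=(\varepsilon_{1k},\dots,\varepsilon_{Nk})'$, $k=1,2,\dots,T+\tau$, be $N$-dimensional random vectors whose components $\varepsilon_{ik}$ ($1\le i\le N$, $1\le k\le T+\tau$) are independent complex random variables with $\mathrm E\,\varepsilon_{ik}=0$ and $\mathrm E|\varepsilon_{ik}|^2=1$. Suppose that $N,T\to\infty$ with $N/(T+\tau)\to c$, and that for every $\eta>0$ $$\frac{1}{\eta^2 N(T+\tau)}\sum_{i=1}^{N}\sum_{k=1}^{T+\tau}\mathrm E\Big(|\varepsilon_{ik}|^2\, I\big(|\varepsilon_{ik}|\ge \eta\sqrt{T+\tau}\big)\Big)\to 0 .$$ Put $$\mathbf M_N=\sum_{k=1}^{T}\big(\boldsymbol\gamma_k\boldsymbol\gamma_{k+\tau}^{*}+\boldsymbol\gamma_{k+\tau}\boldsymbol\gamma_k^{*}\big),\qquad \boldsymbol\gamma_k=\frac{1}{\sqrt{2T}}\,\mathbf e_k .$$ Then, almost surely, the empirical spectral distribution of $\mathbf M_N$ converges weakly to a non-random limit $F_c$, and the Stieltjes transform $m(z)$ of $F_c$ satisfies, for all $z\in\mathbb C$ with $\Im z>0$, $$\big(1-c^2m^2(z)\big)\big(c+c\,z\,m(z)-1\big)^2=1 .$$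
   Context: $*$ denotes the conjugate transpose and $I(\cdot)$ the indicator function. The empirical spectral distribution of an $N\times N$ Hermitian matrix $A$ with eigenvalues $\lambda_1,\dots,\lambda_N$ is the distribution function $F^{A}(x)=\frac1N\#\{i:\lambda_i\le x\}$. The Stieltjes transform of a distribution function $F$ on $\mathbb R$ is $m(z)=\int \frac{1}{x-z}\,dF(x)$ for $\Im z>0$. *)

theory Defs
  imports
    "HOL-Probability.Probability"
    "Jordan_Normal_Form.Char_Poly"
    "Jordan_Normal_Form.Schur_Decomposition"
begin

(* The eigenvalues are the roots of the characteristic polynomial, counted with multiplicity.
   For Hermitian A they are real; Re only serves to move from complex to real. *)
definition esd :: "complex mat \<Rightarrow> real \<Rightarrow> real" where
  "esd A x = real (size {#l \<in># proots (char_poly A). Re l \<le> x#}) / real (dim_row A)"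

(* A distribution function F is represented by its probability measure mu, F = cdf mu. *)
definition stieltjes :: "real measure \<Rightarrow> complex \<Rightarrow> complex" where
  "stieltjes \<mu> z = (LINT x|\<mu>. 1 / (of_real x - z))"

(* gamma_k as an N x 1 matrix, for a realisation e i k of the entries with i, k counted from 1;
   matrix rows are counted from 0. *)
definition gamma_col :: "nat \<Rightarrow> nat \<Rightarrow> (nat \<Rightarrow> nat \<Rightarrow> complex) \<Rightarrow> nat \<Rightarrow> complex mat" where
  "gamma_col N T e k = mat N 1 (\<lambda>(i, _). 1 / of_real (sqrt (2 * real T)) * e (i + 1) k)"

(* Matrices of term-valued dimension form no additive monoid type, so the sum over k is
   taken entrywise. *)
definition autocov_mat :: "nat \<Rightarrow> nat \<Rightarrow> nat \<Rightarrow> (nat \<Rightarrow> nat \<Rightarrow> complex) \<Rightarrow> complex mat" where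
  "autocov_mat \<tau> N T e = mat N N (\<lambda>ij. \<Sum>k=1..T.
     (let g = gamma_col N T e k; h = gamma_col N T e (k + \<tau>)
      in g * mat_adjoint h + h * mat_adjoint g) $$ ij)"

end

theory Submission
  imports Defs "HOL-Complex_Analysis.Complex_Analysis" "HOL-Real_Asymp.Real_Asymp"
begin

text \<open>
Let Y be the N x (T + tau) array of the entries divided by sqrt T, and let C be the symmetric Toeplitz matrix with
  1/2 on the two diagonals at distance tau from the main one. Then M_N = Y C Y*, and the normalized trace m_N(z) of the
  resolvent G = (Y C Y* - z)^-1 is the Stieltjes transform of its empirical spectral distribution. It is shown that the mean
  of m_N(i v) converges for large v, that m_N stays close to its mean, and that this determines the weak limit.

  The mean is found by the cavity method, for bounded centred entries and a general Hermitian contraction C. The companion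
  matrix R = C - C Y* G Y C, and its versions R_i built without the row y_i of Y, satisfy G_ii (y_i R_i y_i* - z) = 1
  (resolvent_diag_cavity), and the trace of R B is the trace of C B minus the sum of all G_ii y_i R_i B C y_i*
  (trace_coresolvent_mult). As y_i is independent of R_i, each quadratic form is close to a trace divided by T
  (trace_concentration). If B approximately inverts 1 + (N / T) E m_N C, the unknown traces cancel, and E m_N (rho - z) is
  close to 1, where rho is the trace of C B divided by T (mean_equation_estimate).

  For the lag matrix everything is explicit. The symbol of C is cos (tau x), and for a = - 2 q / (1 + q^2) the function
  1 / (1 + a cos x) is a multiple of the Poisson kernel with parameter q. Hence the Toeplitz matrix B with this symbol
  inverts 1 + a C up to an error near the boundary (inv_lag_error), and rho = sigma q with
  sigma = (1 + q^2) / (1 - q^2) (trace_lag_inv_lag). In the limit c m = - 2 q / (1 + q^2) and m (sigma q - z) = 1;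
  eliminating q gives the equation of the theorem (solution_identity). High on the imaginary axis only one solution
  is compatible with |q| <= 1/2 (fixed_point_unique), so E m_N converges (mean_limit).

  Entries with two moments are reduced to bounded ones by truncation at eta sqrt (T + tau). The Lindeberg condition makes
  the truncated part small in mean square, and the trace depends on the array continuously in the Frobenius norm
  (raw_trunc_trace_diff); eta is sent to 0 after N.

  Replacing one row of Y moves m_N by at most 4 / (N Im z), so the bounded differences inequality makes deviations from
  the mean exponentially unlikely in N (norm_trace_tail). Since T = O(N), the Borel-Cantelli lemma applies after a union
  over the possible values of T for each N (pair_borel_cantelli).

  Finally, convergence of the Stieltjes transforms at the points i v, with v rational and large, to a limit s with
  v Im s(v) -> 1, implies tightness and determines the weak limit (stieltjes_continuity), and analytic continuation carries
  the equation from these points to the upper half plane (stieltjes_equation_extend).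
\<close>

section \<open>Resolvents of Hermitian matrices\<close>

lemma sum_mult_assoc:
  fixes f :: "'a \<Rightarrow> 'c::comm_semiring_0"
  shows "(\<Sum>b\<in>B. (\<Sum>a\<in>A. f a * g a b) * h b) = (\<Sum>a\<in>A. f a * (\<Sum>b\<in>B. g a b * h b))"
  unfolding sum_distrib_left sum_distrib_right by (subst sum.swap) (simp add: mult.assoc)

lemma sum_mult_sum:
  fixes f :: "'a \<Rightarrow> 'b \<Rightarrow> 'c::comm_semiring_0"
  shows "(\<Sum>k\<in>K. (\<Sum>a\<in>A. x a * f a k) * (\<Sum>c\<in>B. y c * g c k)) = (\<Sum>c\<in>B. (\<Sum>a\<in>A. x a * (\<Sum>k\<in>K. f a k * g c k)) * y c)"
proof -
  have "(\<Sum>k\<in>K. (\<Sum>a\<in>A. x a * f a k) * (\<Sum>c\<in>B. y c * g c k))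
      = (\<Sum>k\<in>K. \<Sum>c\<in>B. (\<Sum>a\<in>A. x a * f a k) * g c k * y c)"
    by (simp add: sum_distrib_left mult_ac)
  also have "\<dots> = (\<Sum>c\<in>B. (\<Sum>k\<in>K. (\<Sum>a\<in>A. x a * f a k) * g c k) * y c)"
    by (subst sum.swap) (simp add: sum_distrib_right)
  finally show ?thesis by (simp add: sum_mult_assoc)
qed

lemma cmod_sum_mult_square_le:
  "(cmod (\<Sum>i\<in>I. a i * b i))\<^sup>2 \<le> (\<Sum>i\<in>I. (cmod (a i))\<^sup>2) * (\<Sum>i\<in>I. (cmod (b i))\<^sup>2)"
proof -
  have "(cmod (\<Sum>i\<in>I. a i * b i))\<^sup>2 \<le> (\<Sum>i\<in>I. cmod (a i) * cmod (b i))\<^sup>2"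
    by (intro power_mono order_trans[OF norm_sum]) (auto simp: norm_mult)
  also have "\<dots> \<le> (\<Sum>i\<in>I. (cmod (a i))\<^sup>2) * (\<Sum>i\<in>I. (cmod (b i))\<^sup>2)"
    by (rule Cauchy_Schwarz_ineq_sum)
  finally show ?thesis .
qed

lemma sum_delta_mult:
  fixes f :: "nat \<Rightarrow> complex"
  shows "i < N \<Longrightarrow> (\<Sum>k<N. (if i = k then 1 else 0) * f k) = f i"
    and "i < N \<Longrightarrow> (\<Sum>k<N. f k * (if k = i then 1 else 0)) = f i"
proof -
  have 1: "(\<Sum>k<N. (if i = k then 1 else 0) * f k) = (\<Sum>k<N. if i = k then f k else 0)"
    and 2: "(\<Sum>k<N. f k * (if k = i then 1 else 0)) = (\<Sum>k<N. if k = i then f k else 0)"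
    by (intro sum.cong; simp)+
  show "(\<Sum>k<N. (if i = k then 1 else 0) * f k) = f i" if "i < N"
    unfolding 1 using that by simp
  show "(\<Sum>k<N. f k * (if k = i then 1 else 0)) = f i" if "i < N"
    unfolding 2 using that by simp
qed

definition hermitian_on :: "nat \<Rightarrow> (nat \<Rightarrow> nat \<Rightarrow> complex) \<Rightarrow> bool" where
  "hermitian_on N M \<longleftrightarrow> (\<forall>i<N. \<forall>j<N. cnj (M i j) = M j i)"

lemma hermitian_form_real:
  assumes "hermitian_on N M"
  shows "Im (\<Sum>i<N. cnj (u i) * (\<Sum>k<N. M i k * u k)) = 0"
proof -
  let ?Q = "\<Sum>i<N. cnj (u i) * (\<Sum>k<N. M i k * u k)"
  have "cnj ?Q = (\<Sum>i<N. \<Sum>k<N. u i * (M k i * cnj (u k)))"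
    using assms by (auto simp: sum_distrib_left hermitian_on_def intro!: sum.cong)
  also have "\<dots> = ?Q"
    by (subst sum.swap) (auto simp: sum_distrib_left intro!: sum.cong)
  finally show ?thesis by (metis Reals_cnj_iff complex_is_Real_iff)
qed

text \<open>The number u* M u is real, so the imaginary part of u* M u = u* f + z |u|^2 leaves Im z |u|^2 = -
  Im (u* f), and the Cauchy-Schwarz inequality bounds the right-hand side.\<close>
lemma hermitian_shift_bound:
  assumes "hermitian_on N M"
    and eq: "\<And>i. i < N \<Longrightarrow> (\<Sum>k<N. M i k * u k) = f i + z * u i"
  shows "(Im z)\<^sup>2 * (\<Sum>i<N. (cmod (u i))\<^sup>2) \<le> (\<Sum>i<N. (cmod (f i))\<^sup>2)"
proof -
  define S where "S = (\<Sum>i<N. (cmod (u i))\<^sup>2)"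
  define F where "F = (\<Sum>i<N. (cmod (f i))\<^sup>2)"
  define I where "I = (\<Sum>i<N. cnj (u i) * f i)"
  have "(\<Sum>i<N. cnj (u i) * (\<Sum>k<N. M i k * u k)) = (\<Sum>i<N. cnj (u i) * f i + z * (cnj (u i) * u i))"
    using eq by (intro sum.cong) (auto simp: algebra_simps)
  also have "\<dots> = I + z * of_real S"
    unfolding S_def I_def
    by (simp add: sum.distrib sum_distrib_left complex_norm_square mult.commute del: of_real_power)
  finally have eq2: "(\<Sum>i<N. cnj (u i) * (\<Sum>k<N. M i k * u k)) = I + z * of_real S" .
  have "Im (I + z * of_real S) = 0" using hermitian_form_real[OF assms(1), of u] unfolding eq2 .
  then have "Im z * S = - Im I" by simp
  then have "(Im z * S)\<^sup>2 \<le> (cmod I)\<^sup>2" using abs_Im_le_cmod[of I] by (metis abs_le_square_iff abs_minus_cancel abs_norm_cancel)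
  also have "\<dots> \<le> S * F" unfolding I_def S_def F_def
    using cmod_sum_mult_square_le[of "\<lambda>i. cnj (u i)" f "{..<N}"] by simp
  finally have *: "((Im z)\<^sup>2 * S) * S \<le> F * S" by (simp add: power2_eq_square algebra_simps)
  have "S \<ge> 0" "F \<ge> 0" by (auto simp: S_def F_def sum_nonneg)
  then show ?thesis using * unfolding S_def[symmetric] F_def[symmetric]
    by (cases "S = 0") auto
qed

definition shifted_mat :: "nat \<Rightarrow> complex \<Rightarrow> (nat \<Rightarrow> nat \<Rightarrow> complex) \<Rightarrow> complex mat" where
  "shifted_mat N z M = mat N N (\<lambda>(i, j). M i j - (if i = j then z else 0))"

text \<open>(M - z)^-1 by Cramer's rule. Arrays indexed by numbers, instead of matrices over a finite type,
  let the size be a term that tends to infinity, and the quotient of two polynomials makes the measurability in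
  M evident.\<close>
definition resolvent :: "nat \<Rightarrow> complex \<Rightarrow> (nat \<Rightarrow> nat \<Rightarrow> complex) \<Rightarrow> nat \<Rightarrow> nat \<Rightarrow> complex" where
  "resolvent N z M i j = adj_mat (shifted_mat N z M) $$ (i, j) / det (shifted_mat N z M)"

lemma shifted_mat_carrier [simp]: "shifted_mat N z M \<in> carrier_mat N N"
  by (simp add: shifted_mat_def)

lemma det_shifted_nonzero:
  assumes "hermitian_on N M" "Im z \<noteq> 0"
  shows "det (shifted_mat N z M) \<noteq> 0"
proof
  assume "det (shifted_mat N z M) = 0"
  then obtain w where w: "w \<in> carrier_vec N" "w \<noteq> 0\<^sub>v N" "shifted_mat N z M *\<^sub>v w = 0\<^sub>v N"
    using det_0_iff_vec_prod_zero[OF shifted_mat_carrier] by blast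
  have "(\<Sum>k<N. M i k * w $ k) = 0 + z * w $ i" if "i < N" for i
  proof -
    have "0 = (shifted_mat N z M *\<^sub>v w) $ i" using w that by simp
    also have "\<dots> = (\<Sum>k<N. (M i k - (if i = k then z else 0)) * w $ k)"
      using w(1) that
      by (auto simp: shifted_mat_def scalar_prod_def row_def lessThan_atLeast0 intro!: sum.cong)
    also have "\<dots> = (\<Sum>k<N. M i k * w $ k) - (\<Sum>k<N. if i = k then z * w $ k else 0)"
      unfolding sum_subtractf[symmetric] by (intro sum.cong) (auto simp: algebra_simps)
    also have "(\<Sum>k<N. if i = k then z * w $ k else 0) = z * w $ i"
      using that by simp
    finally show ?thesis by simp
  qed
  from hermitian_shift_bound[OF assms(1) this]
  have "(Im z)\<^sup>2 * (\<Sum>i<N. (cmod (w $ i))\<^sup>2) \<le> 0" by simp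
  then have "(\<Sum>i<N. (cmod (w $ i))\<^sup>2) \<le> 0" using assms(2)
    by (meson mult_le_0_iff not_le zero_less_power2)
  then have "(\<Sum>i<N. (cmod (w $ i))\<^sup>2) = 0" by (meson order_antisym sum_nonneg zero_le_power2)
  then have "\<forall>i<N. w $ i = 0" by (subst (asm) sum_nonneg_eq_0_iff) auto
  then show False using w by (metis carrier_vecD eq_vecI index_zero_vec(1,2))
qed

lemma
  assumes "hermitian_on N M" "Im z \<noteq> 0" "i < N" "j < N"
  shows resolvent_right: "(\<Sum>k<N. M i k * resolvent N z M k j) = (if i = j then 1 else 0) + z * resolvent N z M i j"
    and resolvent_left: "(\<Sum>k<N. resolvent N z M i k * M k j) = (if i = j then 1 else 0) + z * resolvent N z M i j"
proof -
  let ?A = "shifted_mat N z M"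
  let ?d = "det ?A"
  let ?G = "resolvent N z M"
  have d: "?d \<noteq> 0" using det_shifted_nonzero assms by blast
  have cancel: "X = (if i = j then 1 else 0) + z * g" if "(if i = j then ?d else 0) = ?d * (X - z * g)" for X g
  proof -
    have "?d * (X - z * g) = ?d * (if i = j then 1 else 0)" using that by (simp split: if_splits)
    then have "X - z * g = (if i = j then 1 else 0)" using d mult_left_cancel by blast
    then show ?thesis by (simp add: diff_eq_eq)
  qed
  note adj = adj_mat[OF shifted_mat_carrier[of N z M]]
  have A: "?A $$ (a, b) = M a b - (if a = b then z else 0)" if "a < N" "b < N" for a b
    using that by (simp add: shifted_mat_def)
  have "(if i = j then ?d else 0) = (?A * adj_mat ?A) $$ (i, j)"
    using adj assms by simp
  also have "\<dots> = (\<Sum>k<N. ?A $$ (i, k) * adj_mat ?A $$ (k, j))"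
    using adj(1) shifted_mat_carrier[of N z M] assms
    by (auto simp: scalar_prod_def row_def col_def lessThan_atLeast0 times_mat_def simp del: shifted_mat_carrier intro!: sum.cong)
  also have "\<dots> = (\<Sum>k<N. ?d * (M i k * ?G k j) - (if i = k then ?d * (z * ?G k j) else 0))"
    using assms d by (intro sum.cong) (auto simp: A resolvent_def field_simps)
  also have "\<dots> = ?d * ((\<Sum>k<N. M i k * ?G k j) - z * ?G i j)"
    unfolding sum_subtractf using assms by (simp add: sum_distrib_left right_diff_distrib)
  finally show "(\<Sum>k<N. M i k * ?G k j) = (if i = j then 1 else 0) + z * ?G i j"
    by (rule cancel)
  have "(if i = j then ?d else 0) = (adj_mat ?A * ?A) $$ (i, j)"
    using adj assms by simp
  also have "\<dots> = (\<Sum>k<N. adj_mat ?A $$ (i, k) * ?A $$ (k, j))"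
    using adj(1) shifted_mat_carrier[of N z M] assms
    by (auto simp: scalar_prod_def row_def col_def lessThan_atLeast0 times_mat_def simp del: shifted_mat_carrier intro!: sum.cong)
  also have "\<dots> = (\<Sum>k<N. ?d * (?G i k * M k j) - (if k = j then ?d * (z * ?G i k) else 0))"
    using assms d by (intro sum.cong) (auto simp: A resolvent_def field_simps)
  also have "\<dots> = ?d * ((\<Sum>k<N. ?G i k * M k j) - z * ?G i j)"
    unfolding sum_subtractf using assms by (simp add: sum_distrib_left right_diff_distrib)
  finally show "(\<Sum>k<N. ?G i k * M k j) = (if i = j then 1 else 0) + z * ?G i j"
    by (rule cancel)
qed

lemma resolvent_unique:
  assumes "hermitian_on N M" "Im z \<noteq> 0" "b < N"
    and H: "\<And>a. a < N \<Longrightarrow> (\<Sum>k<N. M a k * h k) = (if a = b then 1 else 0) + z * h a"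
    and "a < N"
  shows "resolvent N z M a b = h a"
proof -
  let ?G = "resolvent N z M"
  have "(\<Sum>k<N. (\<Sum>l<N. ?G a l * M l k) * h k) = (\<Sum>l<N. ?G a l * (\<Sum>k<N. M l k * h k))"
    by (rule sum_mult_assoc)
  also have "\<dots> = (\<Sum>l<N. ?G a l * (if l = b then 1 else 0) + z * (?G a l * h l))"
    by (intro sum.cong refl) (subst H, auto simp: algebra_simps)
  also have "\<dots> = ?G a b + z * (\<Sum>l<N. ?G a l * h l)"
    using assms by (simp add: sum.distrib sum_delta_mult sum_distrib_left)
  also have "(\<Sum>k<N. (\<Sum>l<N. ?G a l * M l k) * h k) = (\<Sum>k<N. (if a = k then 1 else 0) * h k + z * (?G a k * h k))"
    using assms by (intro sum.cong refl) (subst resolvent_left, auto simp: distrib_right)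
  also have "\<dots> = h a + z * (\<Sum>l<N. ?G a l * h l)"
    using assms by (simp add: sum.distrib sum_delta_mult sum_distrib_left)
  finally show ?thesis by simp
qed

lemma resolvent_cnj:
  assumes "hermitian_on N M" "Im z \<noteq> 0" "a < N" "b < N"
  shows "resolvent N (cnj z) M a b = cnj (resolvent N z M b a)"
proof (rule resolvent_unique)
  fix a' assume a': "a' < N"
  have "(\<Sum>k<N. M a' k * cnj (resolvent N z M b k)) = cnj (\<Sum>k<N. resolvent N z M b k * M k a')"
    using assms a' unfolding cnj_sum complex_cnj_mult
    by (intro sum.cong) (auto simp: hermitian_on_def)
  also have "\<dots> = (if a' = b then 1 else 0) + cnj z * cnj (resolvent N z M b a')"
    using assms a' by (simp add: resolvent_left)
  finally show "(\<Sum>k<N. M a' k * cnj (resolvent N z M b k)) = (if a' = b then 1 else 0) + cnj z * cnj (resolvent N z M b a')" .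
qed (use assms in auto)

text \<open>Acting with the resolvent from the left, or in the next lemma from the right, solves an equation
  to which the shift bound applies. So G has operator norm at most 1 / |Im z|.\<close>
lemma resolvent_contraction:
  assumes "hermitian_on N M" "Im z \<noteq> 0"
  shows "(Im z)\<^sup>2 * (\<Sum>i<N. (cmod (\<Sum>k<N. resolvent N z M i k * f k))\<^sup>2) \<le> (\<Sum>i<N. (cmod (f i))\<^sup>2)"
proof (rule hermitian_shift_bound[OF assms(1)])
  fix i assume i: "i < N"
  let ?G = "resolvent N z M"
  have "(\<Sum>k<N. M i k * (\<Sum>l<N. ?G k l * f l)) = (\<Sum>l<N. (\<Sum>k<N. M i k * ?G k l) * f l)"
    by (rule sum_mult_assoc[symmetric])
  also have "\<dots> = (\<Sum>l<N. (if i = l then 1 else 0) * f l + z * (?G i l * f l))"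
    using assms i by (intro sum.cong) (auto simp: resolvent_right algebra_simps)
  also have "\<dots> = f i + z * (\<Sum>l<N. ?G i l * f l)"
    using i by (simp add: sum.distrib sum_delta_mult sum_distrib_left)
  finally show "(\<Sum>k<N. M i k * (\<Sum>l<N. ?G k l * f l)) = f i + z * (\<Sum>l<N. ?G i l * f l)" .
qed

lemma resolvent_contraction_row:
  assumes "hermitian_on N M" "Im z \<noteq> 0"
  shows "(Im z)\<^sup>2 * (\<Sum>i<N. (cmod (\<Sum>k<N. f k * resolvent N z M k i))\<^sup>2) \<le> (\<Sum>i<N. (cmod (f i))\<^sup>2)"
proof -
  have eq: "cmod (\<Sum>k<N. f k * resolvent N z M k i) = cmod (\<Sum>k<N. resolvent N (cnj z) M i k * cnj (f k))" if "i < N" for i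
  proof -
    have "(\<Sum>k<N. resolvent N (cnj z) M i k * cnj (f k)) = cnj (\<Sum>k<N. f k * resolvent N z M k i)"
      unfolding cnj_sum complex_cnj_mult
      using assms that by (intro sum.cong) (auto simp: resolvent_cnj)
    then show ?thesis by (simp only: complex_mod_cnj)
  qed
  have "(\<Sum>i<N. (cmod (\<Sum>k<N. f k * resolvent N z M k i))\<^sup>2)
      = (\<Sum>i<N. (cmod (\<Sum>k<N. resolvent N (cnj z) M i k * cnj (f k)))\<^sup>2)"
    by (intro sum.cong refl) (simp only: eq lessThan_iff)
  then show ?thesis
    using resolvent_contraction[OF assms(1), of "cnj z" "\<lambda>k. cnj (f k)"] assms(2)
    by simp
qed

text \<open>The Ward identities: (M - z) G = 1 gives G - G* = 2 i Im z G G* = 2 i Im z G* G, and these are the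
  diagonal entries. They turn sums of N squares into a single entry of G, without losing a factor N.\<close>
lemma
  assumes "hermitian_on N M" "Im z \<noteq> 0" "j < N"
  shows ward_column: "Im z * (\<Sum>i<N. (cmod (resolvent N z M i j))\<^sup>2) = Im (resolvent N z M j j)"
    and ward_row: "Im z * (\<Sum>i<N. (cmod (resolvent N z M j i))\<^sup>2) = Im (resolvent N z M j j)"
proof -
  have *: "Im z * (\<Sum>i<N. (cmod (resolvent N z M i j))\<^sup>2) = Im (resolvent N z M j j)" if "Im z \<noteq> 0" for z
  proof -
    let ?G = "resolvent N z M"
    have "(\<Sum>i<N. cnj (?G i j) * (\<Sum>k<N. M i k * ?G k j)) =
       (\<Sum>i<N. cnj (?G i j) * (if i = j then 1 else 0) + z * (?G i j * cnj (?G i j)))"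
      using assms that by (intro sum.cong) (auto simp: resolvent_right algebra_simps)
    also have "\<dots> = cnj (?G j j) + z * of_real (\<Sum>i<N. (cmod (?G i j))\<^sup>2)"
      using assms by (simp add: sum.distrib sum_delta_mult sum_distrib_left complex_norm_square del: of_real_power)
    finally have eq: "(\<Sum>i<N. cnj (?G i j) * (\<Sum>k<N. M i k * ?G k j)) =
       cnj (?G j j) + z * of_real (\<Sum>i<N. (cmod (?G i j))\<^sup>2)" .
    show ?thesis
      using hermitian_form_real[OF assms(1), of "\<lambda>i. ?G i j"] unfolding eq by simp
  qed
  show "Im z * (\<Sum>i<N. (cmod (resolvent N z M i j))\<^sup>2) = Im (resolvent N z M j j)"
    using * assms(2) by blast
  show "Im z * (\<Sum>i<N. (cmod (resolvent N z M j i))\<^sup>2) = Im (resolvent N z M j j)"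
    using *[of "cnj z"] assms by (simp add: resolvent_cnj)
qed

lemma resolvent_diag_nonzero:
  assumes "hermitian_on N M" "Im z \<noteq> 0" "j < N"
  shows "resolvent N z M j j \<noteq> 0"
proof
  assume 0: "resolvent N z M j j = 0"
  then have "Im z * (\<Sum>i<N. (cmod (resolvent N z M i j))\<^sup>2) = 0" using ward_column[OF assms] by simp
  then have "(\<Sum>i<N. (cmod (resolvent N z M i j))\<^sup>2) = 0" using assms(2) by simp
  then have "\<forall>i<N. resolvent N z M i j = 0" by (subst (asm) sum_nonneg_eq_0_iff) auto
  then have "(\<Sum>k<N. M j k * resolvent N z M k j) = 0" by simp
  then show False using resolvent_right[OF assms assms(3)] 0 by simp
qed

lemma resolvent_diag_bound:
  assumes "hermitian_on N M" "Im z \<noteq> 0" "j < N"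
  shows "cmod (resolvent N z M j j) \<le> 1 / \<bar>Im z\<bar>"
proof -
  let ?g = "cmod (resolvent N z M j j)"
  have "\<bar>Im z\<bar> * ?g\<^sup>2 \<le> \<bar>Im z\<bar> * (\<Sum>i<N. (cmod (resolvent N z M i j))\<^sup>2)"
    using assms by (intro mult_left_mono member_le_sum[of j _ "\<lambda>i. (cmod (resolvent N z M i j))\<^sup>2"]) auto
  also have "\<dots> = \<bar>Im z * (\<Sum>i<N. (cmod (resolvent N z M i j))\<^sup>2)\<bar>"
    by (simp add: abs_mult sum_nonneg)
  also have "\<dots> \<le> ?g" unfolding ward_column[OF assms] by (rule abs_Im_le_cmod)
  finally have "\<bar>Im z\<bar> * ?g * ?g \<le> 1 * ?g" by (simp add: power2_eq_square mult.assoc)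
  moreover have "?g > 0" using resolvent_diag_nonzero[OF assms] by simp
  ultimately have "\<bar>Im z\<bar> * ?g \<le> 1" by (metis mult_le_cancel_right_pos)
  then show ?thesis using assms(2) by (simp add: field_simps)
qed

text \<open>Deleting row and column i changes G by a Schur complement. Zeroing the row and the column keeps
  the size N; the price is the isolated entry - 1 / z at (i, i). The right-hand side is checked to solve the
  equation of the resolvent.\<close>
lemma resolvent_zeroed:
  assumes M: "hermitian_on N M" and z: "Im z \<noteq> 0" and i: "i < N" and ab: "a < N" "b < N"
    and M': "\<And>a b. a < N \<Longrightarrow> b < N \<Longrightarrow> M' a b = (if a = i \<or> b = i then 0 else M a b)"
  shows "resolvent N z M' a b = resolvent N z M a b
     - resolvent N z M a i * resolvent N z M i b / resolvent N z M i i - (if a = i \<and> b = i then 1 / z else 0)"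
proof (rule resolvent_unique[of N M' z b "\<lambda>a. resolvent N z M a b
     - resolvent N z M a i * resolvent N z M i b / resolvent N z M i i - (if a = i \<and> b = i then 1 / z else 0)"])
  show "hermitian_on N M'" using M M' unfolding hermitian_on_def by auto
  let ?G = "resolvent N z M"
  have nz: "?G i i \<noteq> 0" using resolvent_diag_nonzero[OF M z i] .
  have z0: "z \<noteq> 0" using z by auto
  fix a assume a: "a < N"
  show "(\<Sum>k<N. M' a k * (?G k b - ?G k i * ?G i b / ?G i i - (if k = i \<and> b = i then 1 / z else 0))) =
    (if a = b then 1 else 0) + z * (?G a b - ?G a i * ?G i b / ?G i i - (if a = i \<and> b = i then 1 / z else 0))"
  proof (cases "a = i")
    case True
    have "(\<Sum>k<N. M' a k * (?G k b - ?G k i * ?G i b / ?G i i - (if k = i \<and> b = i then 1 / z else 0))) = 0"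
      using True a M' by (intro sum.neutral) auto
    then show ?thesis using True nz z0 by (auto simp: field_simps)
  next
    case False
    have "(\<Sum>k<N. M' a k * (?G k b - ?G k i * ?G i b / ?G i i - (if k = i \<and> b = i then 1 / z else 0)))
       = (\<Sum>k<N. M a k * ?G k b - M a k * ?G k i * (?G i b / ?G i i))"
      using False a M' nz by (intro sum.cong) (auto simp: algebra_simps)
    also have "\<dots> = ((if a = b then 1 else 0) + z * ?G a b) - z * ?G a i * (?G i b / ?G i i)"
      unfolding sum_subtractf sum_distrib_right[symmetric] using resolvent_right[OF M z a] i ab False by simp
    finally show ?thesis using False by (simp add: algebra_simps)
  qed
qed (use assms in auto)

text \<open>The correction of the trace is (G G)_ii / G_ii up to 1 / z, and by the Ward identities |(G G)_ii|
  is at most Im G_ii / Im z. The bound is therefore independent of N.\<close>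
lemma trace_resolvent_zeroed:
  assumes M: "hermitian_on N M" and z: "Im z \<noteq> 0" and i: "i < N"
    and M': "\<And>a b. a < N \<Longrightarrow> b < N \<Longrightarrow> M' a b = (if a = i \<or> b = i then 0 else M a b)"
  shows "cmod ((\<Sum>a<N. resolvent N z M' a a) - (\<Sum>a<N. resolvent N z M a a)) \<le> 2 / \<bar>Im z\<bar>"
proof -
  let ?G = "resolvent N z M"
  have nz: "?G i i \<noteq> 0" using resolvent_diag_nonzero[OF M z i] .
  let ?S = "\<Sum>a<N. ?G i a * ?G a i"
  have "(\<Sum>a<N. resolvent N z M' a a) - (\<Sum>a<N. ?G a a) = (\<Sum>a<N. - (?G i a * ?G a i) / ?G i i - (if a = i then 1 / z else 0))"
    unfolding sum_subtractf[symmetric]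
    by (intro sum.cong refl, subst resolvent_zeroed[OF M z i _ _ M']) (auto simp: mult.commute)
  also have "\<dots> = - ?S / ?G i i - 1 / z"
    using i by (simp add: sum_subtractf sum_negf sum_divide_distrib)
  finally have eq: "(\<Sum>a<N. resolvent N z M' a a) - (\<Sum>a<N. ?G a a) = - ?S / ?G i i - 1 / z" .
  have "(cmod ?S)\<^sup>2 \<le> (\<Sum>a<N. (cmod (?G i a))\<^sup>2) * (\<Sum>a<N. (cmod (?G a i))\<^sup>2)"
    by (rule cmod_sum_mult_square_le)
  also have "(\<Sum>a<N. (cmod (?G i a))\<^sup>2) = Im (?G i i) / Im z"
    using ward_row[OF M z i] z by (metis nonzero_mult_div_cancel_left)
  also have "(\<Sum>a<N. (cmod (?G a i))\<^sup>2) = Im (?G i i) / Im z"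
    using ward_column[OF M z i] z by (metis nonzero_mult_div_cancel_left)
  also have "Im (?G i i) / Im z * (Im (?G i i) / Im z) = (Im (?G i i) / Im z)\<^sup>2"
    by (simp add: power2_eq_square)
  finally have "cmod ?S \<le> \<bar>Im (?G i i) / Im z\<bar>" by (metis abs_le_square_iff abs_norm_cancel)
  also have "\<dots> \<le> cmod (?G i i) / \<bar>Im z\<bar>" by (simp add: abs_divide abs_Im_le_cmod divide_right_mono)
  finally have 1: "cmod (?S / ?G i i) \<le> 1 / \<bar>Im z\<bar>" using nz by (simp add: norm_divide field_simps)
  have "\<bar>Im z\<bar> \<le> cmod z" by (rule abs_Im_le_cmod)
  then have 2: "cmod (1 / z) \<le> 1 / \<bar>Im z\<bar>" using z by (simp add: norm_divide frac_le)
  have "cmod (- ?S / ?G i i - 1 / z) \<le> cmod (?S / ?G i i) + cmod (1 / z)"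
    using norm_triangle_ineq4[of "- ?S / ?G i i" "1 / z"] by (simp add: norm_minus_cancel)
  then show ?thesis unfolding eq using 1 2 by simp
qed

section \<open>Removing one row of a Gram matrix\<close>

definition gram :: "nat \<Rightarrow> (nat \<Rightarrow> nat \<Rightarrow> complex) \<Rightarrow> (nat \<Rightarrow> nat \<Rightarrow> complex) \<Rightarrow> nat \<Rightarrow> nat \<Rightarrow> complex" where
  "gram n C Y i j = (\<Sum>k<n. \<Sum>l<n. Y i k * C k l * cnj (Y j l))"

definition row_mult :: "nat \<Rightarrow> (nat \<Rightarrow> nat \<Rightarrow> complex) \<Rightarrow> (nat \<Rightarrow> nat \<Rightarrow> complex) \<Rightarrow> nat \<Rightarrow> nat \<Rightarrow> complex" where
  "row_mult n Y C i l = (\<Sum>k<n. Y i k * C k l)"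

text \<open>C - C Y* G Y C with G the resolvent of Y C Y*. When C is invertible this is (C^-1 - Y* Y / z)^-1
  by the Woodbury identity; the form chosen here makes sense for every C.\<close>
definition coresolvent :: "nat \<Rightarrow> nat \<Rightarrow> complex \<Rightarrow> (nat \<Rightarrow> nat \<Rightarrow> complex) \<Rightarrow> (nat \<Rightarrow> nat \<Rightarrow> complex) \<Rightarrow> nat \<Rightarrow> nat \<Rightarrow> complex" where
  "coresolvent N n z C Y k l = C k l -
     (\<Sum>a<N. \<Sum>b<N. cnj (row_mult n Y C a k) * resolvent N z (gram n C Y) a b * row_mult n Y C b l)"

text \<open>Setting a row to zero plays the role of deleting it, so that all arrays keep their size.\<close>
definition zero_row :: "nat \<Rightarrow> (nat \<Rightarrow> nat \<Rightarrow> complex) \<Rightarrow> nat \<Rightarrow> nat \<Rightarrow> complex" where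
  "zero_row i Y a k = (if a = i then 0 else Y a k)"

locale cavity =
  fixes N n :: nat and z :: complex and C Y :: "nat \<Rightarrow> nat \<Rightarrow> complex"
  assumes C: "hermitian_on n C" and z: "Im z \<noteq> 0"
begin

abbreviation "G \<equiv> resolvent N z (gram n C Y)"
abbreviation "Z \<equiv> row_mult n Y C"
abbreviation "R \<equiv> coresolvent N n z C Y"
abbreviation "R\<^sub>0 i \<equiv> coresolvent N n z C (zero_row i Y)"

lemma gram_row_mult: "gram n C Y i j = (\<Sum>l<n. Z i l * cnj (Y j l))"
  unfolding gram_def row_mult_def sum_distrib_right by (rule sum.swap)

lemma cnj_row_mult: "k < n \<Longrightarrow> cnj (Z i k) = (\<Sum>l<n. C k l * cnj (Y i l))"
  using C unfolding row_mult_def cnj_sum complex_cnj_mult hermitian_on_def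
  by (intro sum.cong) auto

lemma gram_cnj_row_mult: "(\<Sum>k<n. Y i k * cnj (Z j k)) = gram n C Y i j"
proof -
  have "(\<Sum>k<n. Y i k * cnj (Z j k)) = (\<Sum>k<n. Y i k * (\<Sum>l<n. C k l * cnj (Y j l)))"
    by (intro sum.cong refl) (simp add: cnj_row_mult)
  then show ?thesis unfolding gram_def by (simp add: sum_distrib_left mult.assoc)
qed

lemma hermitian_gram: "hermitian_on N (gram n C Y)"
proof -
  have "cnj (gram n C Y i j) = gram n C Y j i" for i j
  proof -
    have "cnj (gram n C Y i j) = (\<Sum>k<n. cnj (Y i k) * Z j k)"
      unfolding gram_cnj_row_mult[symmetric] by simp
    also have "\<dots> = gram n C Y j i" unfolding gram_row_mult by (simp add: mult.commute)
    finally show ?thesis .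
  qed
  then show ?thesis unfolding hermitian_on_def by blast
qed

lemma gram_zeroed: "gram n C (zero_row i Y) a b = (if a = i \<or> b = i then 0 else gram n C Y a b)"
  unfolding gram_def zero_row_def by auto

lemma row_mult_zeroed: "row_mult n (zero_row i Y) C a l = (if a = i then 0 else Z a l)"
  unfolding row_mult_def zero_row_def by auto

lemmas G_right = resolvent_right[OF hermitian_gram z]
lemmas G_left = resolvent_left[OF hermitian_gram z]
lemmas G_nonzero = resolvent_diag_nonzero[OF hermitian_gram z]

lemma trace_resolvent_zeroed_row:
  assumes "i < N"
  shows "cmod ((\<Sum>a<N. resolvent N z (gram n C (zero_row i Y)) a a) - (\<Sum>a<N. G a a)) \<le> 2 / \<bar>Im z\<bar>"
  by (rule trace_resolvent_zeroed[OF hermitian_gram z assms]) (rule gram_zeroed)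

text \<open>The resolvent of the matrix without row and column i, extended by zero at the index i.\<close>
definition minor :: "nat \<Rightarrow> nat \<Rightarrow> nat \<Rightarrow> complex" where
  "minor i a b = G a b - G a i * G i b / G i i"

text \<open>The zeroed row contributes nothing, so the entry - 1 / z by which the resolvent of the zeroed
  matrix differs from the minor drops out.\<close>
lemma coresolvent_zeroed:
  assumes i: "i < N"
  shows "R\<^sub>0 i k l = C k l - (\<Sum>a<N. \<Sum>b<N. cnj (Z a k) * minor i a b * Z b l)"
proof -
  have eq: "cnj (row_mult n (zero_row i Y) C a k) * resolvent N z (gram n C (zero_row i Y)) a b * row_mult n (zero_row i Y) C b l
     = cnj (Z a k) * minor i a b * Z b l" if "a < N" "b < N" for a b
    using resolvent_zeroed[OF hermitian_gram z i that gram_zeroed] G_nonzero[OF i]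
    by (auto simp: row_mult_zeroed minor_def)
  have "(\<Sum>a<N. \<Sum>b<N. cnj (row_mult n (zero_row i Y) C a k) * resolvent N z (gram n C (zero_row i Y)) a b * row_mult n (zero_row i Y) C b l)
      = (\<Sum>a<N. \<Sum>b<N. cnj (Z a k) * minor i a b * Z b l)"
    by (rule sum.cong[OF refl], rule sum.cong[OF refl]) (simp only: lessThan_iff eq)
  then show ?thesis unfolding coresolvent_def by (simp only:)
qed

lemma gram_minor:
  assumes "i < N" "b < N"
  shows "(\<Sum>a<N. gram n C Y i a * minor i a b) = (if i = b then 1 else 0) - G i b / G i i"
proof -
  have "(\<Sum>a<N. gram n C Y i a * minor i a b)
    = (\<Sum>a<N. gram n C Y i a * G a b - gram n C Y i a * G a i * (G i b / G i i))"
    unfolding minor_def by (intro sum.cong) (auto simp: algebra_simps)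
  also have "\<dots> = (if i = b then 1 else 0) + z * G i b - (1 + z * G i i) * (G i b / G i i)"
    unfolding sum_subtractf sum_distrib_right[symmetric] using assms by (simp add: G_right)
  finally show ?thesis using G_nonzero[OF assms(1)] by (simp add: field_simps)
qed

lemma minor_gram:
  assumes "i < N" "a < N"
  shows "(\<Sum>b<N. minor i a b * gram n C Y b i) = (if a = i then 1 else 0) - G a i / G i i"
proof -
  have "(\<Sum>b<N. minor i a b * gram n C Y b i)
    = (\<Sum>b<N. G a b * gram n C Y b i - (G a i / G i i) * (G i b * gram n C Y b i))"
    unfolding minor_def by (intro sum.cong) (auto simp: algebra_simps)
  also have "\<dots> = (if a = i then 1 else 0) + z * G a i - (G a i / G i i) * (1 + z * G i i)"
    unfolding sum_subtractf sum_distrib_left[symmetric] using assms by (simp add: G_left)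
  finally show ?thesis using G_nonzero[OF assms(1)] by (simp add: field_simps)
qed

text \<open>Multiplied by the removed row of the Gram matrix, the minor collapses to a multiple of row i of
  G.\<close>
lemma row_coresolvent:
  assumes i: "i < N"
  shows "(\<Sum>k<n. Y i k * R\<^sub>0 i k l) = (\<Sum>j<N. G i j * Z j l) / G i i"
proof -
  have "(\<Sum>k<n. Y i k * R\<^sub>0 i k l) = Z i l - (\<Sum>k<n. Y i k * (\<Sum>a<N. cnj (Z a k) * (\<Sum>b<N. minor i a b * Z b l)))"
    unfolding coresolvent_zeroed[OF i] row_mult_def[of n Y C i]
    by (simp add: right_diff_distrib sum_subtractf sum_distrib_left mult.assoc)
  also have "(\<Sum>k<n. Y i k * (\<Sum>a<N. cnj (Z a k) * (\<Sum>b<N. minor i a b * Z b l)))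
     = (\<Sum>a<N. (\<Sum>k<n. Y i k * cnj (Z a k)) * (\<Sum>b<N. minor i a b * Z b l))"
    by (rule sum_mult_assoc[symmetric])
  also have "\<dots> = (\<Sum>b<N. (\<Sum>a<N. gram n C Y i a * minor i a b) * Z b l)"
    unfolding gram_cnj_row_mult by (rule sum_mult_assoc[symmetric])
  also have "\<dots> = (\<Sum>b<N. (if i = b then 1 else 0) * Z b l - G i b * Z b l / G i i)"
    using i by (intro sum.cong refl) (auto simp: gram_minor algebra_simps)
  also have "\<dots> = Z i l - (\<Sum>j<N. G i j * Z j l) / G i i"
    unfolding sum_subtractf sum_delta_mult[OF i] by (simp add: sum_divide_distrib)
  finally show ?thesis by simp
qed

lemma coresolvent_column:
  assumes i: "i < N" and k: "k < n"
  shows "(\<Sum>l<n. R\<^sub>0 i k l * cnj (Y i l)) = (\<Sum>j<N. cnj (Z j k) * G j i) / G i i"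
proof -
  have R0: "R\<^sub>0 i k l = C k l - (\<Sum>b<N. (\<Sum>a<N. cnj (Z a k) * minor i a b) * Z b l)" for l
    unfolding coresolvent_zeroed[OF i] sum_distrib_right by (subst sum.swap) (rule refl)
  have "(\<Sum>l<n. R\<^sub>0 i k l * cnj (Y i l)) = cnj (Z i k) - (\<Sum>l<n. (\<Sum>b<N. (\<Sum>a<N. cnj (Z a k) * minor i a b) * Z b l) * cnj (Y i l))"
    unfolding R0 cnj_row_mult[OF k] by (simp add: left_diff_distrib sum_subtractf)
  also have "(\<Sum>l<n. (\<Sum>b<N. (\<Sum>a<N. cnj (Z a k) * minor i a b) * Z b l) * cnj (Y i l))
     = (\<Sum>b<N. (\<Sum>a<N. cnj (Z a k) * minor i a b) * (\<Sum>l<n. Z b l * cnj (Y i l)))"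
    by (rule sum_mult_assoc)
  also have "\<dots> = (\<Sum>a<N. cnj (Z a k) * (\<Sum>b<N. minor i a b * gram n C Y b i))"
    unfolding gram_row_mult[symmetric] by (rule sum_mult_assoc)
  also have "\<dots> = (\<Sum>a<N. cnj (Z a k) * (if a = i then 1 else 0) - cnj (Z a k) * G a i / G i i)"
    using i by (intro sum.cong refl) (subst minor_gram, auto simp: right_diff_distrib)
  also have "\<dots> = cnj (Z i k) - (\<Sum>j<N. cnj (Z j k) * G j i) / G i i"
    unfolding sum_subtractf sum_delta_mult[OF i] by (simp add: sum_divide_distrib)
  finally show ?thesis by simp
qed

text \<open>The Schur complement formula 1 / G_ii = y_i R_i y_i* - z, where R_i is built without the row y_i.
  For independent rows the two factors of the quadratic form are independent.\<close>
lemma resolvent_diag_cavity: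
  assumes i: "i < N"
  shows "G i i * ((\<Sum>l<n. (\<Sum>k<n. Y i k * R\<^sub>0 i k l) * cnj (Y i l)) - z) = 1"
proof -
  have "(\<Sum>l<n. (\<Sum>k<n. Y i k * R\<^sub>0 i k l) * cnj (Y i l)) = (\<Sum>l<n. (\<Sum>j<N. G i j * Z j l) * cnj (Y i l)) / G i i"
    unfolding row_coresolvent[OF i] times_divide_eq_left sum_divide_distrib[symmetric] ..
  also have "(\<Sum>l<n. (\<Sum>j<N. G i j * Z j l) * cnj (Y i l)) = (\<Sum>j<N. G i j * gram n C Y j i)"
    unfolding gram_row_mult by (rule sum_mult_assoc)
  also have "\<dots> = 1 + z * G i i" using G_left[OF i i] by simp
  finally show ?thesis using G_nonzero[OF i] by (simp add: field_simps)
qed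

text \<open>Restoring row i is a perturbation of rank one, which lets the trace of R replace the trace of R_i
  simultaneously for all i.\<close>
lemma coresolvent_diff:
  assumes i: "i < N" and k: "k < n"
  shows "R\<^sub>0 i k l - R k l = G i i * (\<Sum>m<n. R\<^sub>0 i k m * cnj (Y i m)) * (\<Sum>m<n. Y i m * R\<^sub>0 i m l)"
proof -
  have "R\<^sub>0 i k l - R k l = (\<Sum>a<N. \<Sum>b<N. cnj (Z a k) * (G a b - minor i a b) * Z b l)"
    unfolding coresolvent_zeroed[OF i] unfolding coresolvent_def right_diff_distrib left_diff_distrib sum_subtractf
    by simp
  also have "\<dots> = (\<Sum>a<N. \<Sum>b<N. (cnj (Z a k) * G a i) * (G i b * Z b l) / G i i)"
    unfolding minor_def by (intro sum.cong refl) simp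
  also have "\<dots> = (\<Sum>a<N. cnj (Z a k) * G a i) * (\<Sum>b<N. G i b * Z b l) / G i i"
    unfolding sum_product sum_divide_distrib ..
  finally show ?thesis
    unfolding row_coresolvent[OF i] coresolvent_column[OF i k] using G_nonzero[OF i] by simp
qed

text \<open>The trace of R B, expanded over the rows into quadratic forms in the removed row. Together with
  the formula for the diagonal of G this closes the equation for the trace of G, once B is chosen as an inverse
  of 1 + a C.\<close>
lemma trace_coresolvent_mult:
  "(\<Sum>k<n. \<Sum>l<n. R k l * B l k) = (\<Sum>k<n. \<Sum>l<n. C k l * B l k)
    - (\<Sum>i<N. G i i * (\<Sum>l<n. (\<Sum>k<n. Y i k * (\<Sum>m<n. R\<^sub>0 i k m * (\<Sum>p<n. B m p * C p l))) * cnj (Y i l)))"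
proof -
  have i: "G i i * (\<Sum>l<n. (\<Sum>k<n. Y i k * (\<Sum>m<n. R\<^sub>0 i k m * (\<Sum>p<n. B m p * C p l))) * cnj (Y i l))
     = (\<Sum>k<n. \<Sum>l<n. cnj (Z i k) * ((\<Sum>j<N. G i j * Z j l) * B l k))" if i: "i < N" for i
  proof -
    have gen: "(\<Sum>m<n. s m * (\<Sum>p<n. B m p * c p)) = (\<Sum>m<n. \<Sum>p<n. c p * (s m * B m p))" for s c :: "nat \<Rightarrow> complex"
      by (simp add: sum_distrib_left mult_ac)
    define D where "D m l = (\<Sum>p<n. B m p * C p l)" for m l
    have "(\<Sum>l<n. (\<Sum>k<n. Y i k * (\<Sum>m<n. R\<^sub>0 i k m * D m l)) * cnj (Y i l))
       = (\<Sum>l<n. (\<Sum>m<n. (\<Sum>k<n. Y i k * R\<^sub>0 i k m) * D m l) * cnj (Y i l))"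
      by (subst sum_mult_assoc) (rule refl)
    also have "\<dots> = (\<Sum>m<n. (\<Sum>k<n. Y i k * R\<^sub>0 i k m) * (\<Sum>l<n. D m l * cnj (Y i l)))"
      by (rule sum_mult_assoc)
    also have "\<dots> = (\<Sum>m<n. (\<Sum>j<N. G i j * Z j m) / G i i * (\<Sum>p<n. B m p * cnj (Z i p)))"
      unfolding D_def sum_mult_assoc row_coresolvent[OF i]
      by (intro sum.cong refl arg_cong2[of _ _ _ _ "(*)"]) (simp add: cnj_row_mult)
    finally have "G i i * (\<Sum>l<n. (\<Sum>k<n. Y i k * (\<Sum>m<n. R\<^sub>0 i k m * D m l)) * cnj (Y i l))
       = (\<Sum>m<n. (\<Sum>j<N. G i j * Z j m) * (\<Sum>p<n. B m p * cnj (Z i p)))"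
      using G_nonzero[OF i] by (simp add: sum_distrib_left[of "G i i"])
    also have "\<dots> = (\<Sum>m<n. \<Sum>p<n. cnj (Z i p) * ((\<Sum>j<N. G i j * Z j m) * B m p))"
      by (rule gen)
    also have "\<dots> = (\<Sum>p<n. \<Sum>m<n. cnj (Z i p) * ((\<Sum>j<N. G i j * Z j m) * B m p))"
      by (rule sum.swap)
    finally show ?thesis unfolding D_def .
  qed
  have R: "R k l * B l k = C k l * B l k - (\<Sum>i<N. cnj (Z i k) * ((\<Sum>j<N. G i j * Z j l) * B l k))" for k l
    unfolding coresolvent_def
    by (simp add: left_diff_distrib sum_distrib_left sum_distrib_right mult.assoc)
  have "(\<Sum>k<n. \<Sum>l<n. R k l * B l k) = (\<Sum>k<n. \<Sum>l<n. C k l * B l k)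
     - (\<Sum>k<n. \<Sum>l<n. \<Sum>i<N. cnj (Z i k) * ((\<Sum>j<N. G i j * Z j l) * B l k))"
    unfolding R sum_subtractf ..
  also have "(\<Sum>k<n. \<Sum>l<n. \<Sum>i<N. cnj (Z i k) * ((\<Sum>j<N. G i j * Z j l) * B l k))
     = (\<Sum>k<n. \<Sum>i<N. \<Sum>l<n. cnj (Z i k) * ((\<Sum>j<N. G i j * Z j l) * B l k))"
    by (rule sum.cong[OF refl]) (rule sum.swap)
  also have "\<dots> = (\<Sum>i<N. \<Sum>k<n. \<Sum>l<n. cnj (Z i k) * ((\<Sum>j<N. G i j * Z j l) * B l k))"
    by (rule sum.swap)
  finally show ?thesis by (simp add: i)
qed

end

definition frob :: "nat \<Rightarrow> nat \<Rightarrow> (nat \<Rightarrow> nat \<Rightarrow> complex) \<Rightarrow> real" where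
  "frob N n A = (\<Sum>i<N. \<Sum>k<n. (cmod (A i k))\<^sup>2)"

lemma frob_nonneg [simp]: "0 \<le> frob N n A"
  by (simp add: frob_def sum_nonneg)

lemma frob_swap: "frob N n A = (\<Sum>k<n. \<Sum>i<N. (cmod (A i k))\<^sup>2)"
  unfolding frob_def by (rule sum.swap)

lemma cmod_frob_inner_square_le:
  "(cmod (\<Sum>i<N. \<Sum>k<n. A i k * B i k))\<^sup>2 \<le> frob N n A * frob N n B"
  unfolding frob_def sum.cartesian_product using cmod_sum_mult_square_le[of "\<lambda>x. A (fst x) (snd x)" "\<lambda>x. B (fst x) (snd x)" "{..<N} \<times> {..<n}"]
  by (simp add: case_prod_unfold)

text \<open>The squared Frobenius norm of Y* G Y is the trace of G W G* W with W = Y Y*, so only the N x N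
  matrix W and the operator norm of G enter.\<close>
lemma frob_conj_resolvent_le:
  fixes Y :: "nat \<Rightarrow> nat \<Rightarrow> complex" and n :: nat
  assumes M: "hermitian_on N M" and z: "Im z \<noteq> 0"
  defines "W \<equiv> (\<lambda>a b. \<Sum>k<n. Y a k * cnj (Y b k))"
  shows "(Im z)\<^sup>2 * frob n n (\<lambda>k l. \<Sum>a<N. \<Sum>b<N. cnj (Y a k) * resolvent N z M a b * Y b l) \<le> frob N N W"
proof -
  let ?G = "resolvent N z M"
  define A where "A = (\<lambda>k l. \<Sum>a<N. \<Sum>b<N. cnj (Y a k) * ?G a b * Y b l)"
  define U where "U c b = (\<Sum>a<N. W c a * ?G a b)" for c b
  define V where "V b c = (\<Sum>d<N. W b d * cnj (?G c d))" for b c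
  define X where "X a l = (\<Sum>b<N. ?G a b * Y b l)" for a l
  have A: "A k l = (\<Sum>a<N. X a l * cnj (Y a k))" for k l
    unfolding A_def X_def by (simp add: sum_distrib_left sum_distrib_right mult_ac)
  have UX: "(\<Sum>a<N. W c a * X a l) = (\<Sum>b<N. U c b * Y b l)" for c l
    unfolding U_def X_def sum_mult_assoc ..
  have "complex_of_real (frob n n A) = (\<Sum>k<n. \<Sum>l<n. A k l * cnj (A k l))"
    unfolding frob_def by (simp add: complex_norm_square del: of_real_power)
  also have "\<dots> = (\<Sum>l<n. \<Sum>k<n. (\<Sum>a<N. X a l * cnj (Y a k)) * (\<Sum>c<N. cnj (X c l) * Y c k))"
    unfolding A by (subst sum.swap) simp
  also have "\<dots> = (\<Sum>l<n. \<Sum>c<N. (\<Sum>a<N. W c a * X a l) * cnj (X c l))"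
    unfolding sum_mult_sum W_def by (simp add: mult.commute)
  also have "\<dots> = (\<Sum>c<N. \<Sum>l<n. (\<Sum>b<N. U c b * Y b l) * (\<Sum>d<N. cnj (?G c d) * cnj (Y d l)))"
    unfolding UX by (subst sum.swap) (simp add: X_def)
  also have "\<dots> = (\<Sum>c<N. \<Sum>d<N. (\<Sum>b<N. U c b * W b d) * cnj (?G c d))"
    unfolding sum_mult_sum W_def ..
  also have "\<dots> = (\<Sum>c<N. \<Sum>b<N. U c b * V b c)"
    unfolding V_def sum_mult_assoc ..
  finally have "(frob n n A)\<^sup>2 = (cmod (\<Sum>c<N. \<Sum>b<N. U c b * V b c))\<^sup>2"
    by (metis norm_of_real power2_abs)
  also have "\<dots> \<le> frob N N U * frob N N (\<lambda>c b. V b c)"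
    by (rule cmod_frob_inner_square_le)
  finally have *: "(frob n n A)\<^sup>2 \<le> frob N N U * frob N N (\<lambda>c b. V b c)" .
  have U: "(Im z)\<^sup>2 * frob N N U \<le> frob N N W"
    unfolding frob_def sum_distrib_left[of _ _ "{..<N}"] U_def
    by (rule sum_mono) (use resolvent_contraction_row[OF M z] in \<open>simp add: sum_distrib_left[symmetric]\<close>)
  have V: "(Im z)\<^sup>2 * frob N N (\<lambda>c b. V b c) \<le> frob N N W"
  proof -
    have "(\<Sum>c<N. (Im z)\<^sup>2 * (cmod (V b c))\<^sup>2) \<le> (\<Sum>d<N. (cmod (W b d))\<^sup>2)" for b
    proof -
      have "cmod (V b c) = cmod (\<Sum>d<N. ?G c d * cnj (W b d))" for c
      proof -
        have "cnj (V b c) = (\<Sum>d<N. ?G c d * cnj (W b d))" unfolding V_def by (simp add: mult.commute)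
        then show ?thesis by (metis complex_mod_cnj)
      qed
      then show ?thesis using resolvent_contraction[OF M z, of "\<lambda>d. cnj (W b d)"] by (simp add: sum_distrib_left)
    qed
    then show ?thesis
      unfolding frob_swap[of N N "\<lambda>c b. V b c"] frob_def[of N N W] sum_distrib_left[of _ _ "{..<N}"]
      by (rule sum_mono)
  qed
  have "((Im z)\<^sup>2 * frob n n A)\<^sup>2 = ((Im z)\<^sup>2 * (Im z)\<^sup>2) * (frob n n A)\<^sup>2" by (simp add: power2_eq_square)
  also have "\<dots> \<le> ((Im z)\<^sup>2 * (Im z)\<^sup>2) * (frob N N U * frob N N (\<lambda>c b. V b c))"
    using * by (intro mult_left_mono) auto
  also have "\<dots> = ((Im z)\<^sup>2 * frob N N U) * ((Im z)\<^sup>2 * frob N N (\<lambda>c b. V b c))" by simp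
  also have "\<dots> \<le> (frob N N W)\<^sup>2" unfolding power2_eq_square[of "frob N N W"] using U V by (intro mult_mono) auto
  finally show ?thesis unfolding A_def[symmetric] by (rule power2_le_imp_le) simp
qed

section \<open>Linear and quadratic forms in independent variables\<close>

lemma borel_measurable_cnj [measurable (raw)]:
  "f \<in> borel_measurable M \<Longrightarrow> (\<lambda>x. cnj (f x)) \<in> borel_measurable M"
  by (rule measurable_compose[of f _ borel]) (auto intro!: borel_measurable_continuous_onI continuous_intros)

text \<open>Fubini for the joint law of an independent pair: freeze the second variable, bound the expectation
  over the first, and average. It replaces conditional expectations.\<close>
lemma (in prob_space) indep_expectation_le:
  fixes f :: "'b \<times> 'b \<Rightarrow> real" and g :: "'b \<Rightarrow> real"
  assumes ind: "indep_var S X U Y" and f [measurable]: "f \<in> borel_measurable (S \<Otimes>\<^sub>M U)"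
    and f0: "\<And>p. 0 \<le> f p"
    and int: "\<And>y. y \<in> space U \<Longrightarrow> integrable M (\<lambda>\<omega>. f (X \<omega>, y))"
    and le: "\<And>y. y \<in> space U \<Longrightarrow> expectation (\<lambda>\<omega>. f (X \<omega>, y)) \<le> g y"
    and g [measurable]: "g \<in> borel_measurable U" and gint: "integrable M (\<lambda>\<omega>. g (Y \<omega>))"
  shows "integrable M (\<lambda>\<omega>. f (X \<omega>, Y \<omega>))"
    and "expectation (\<lambda>\<omega>. f (X \<omega>, Y \<omega>)) \<le> expectation (\<lambda>\<omega>. g (Y \<omega>))"
proof -
  have X [measurable]: "X \<in> measurable M S" and Y [measurable]: "Y \<in> measurable M U"
    using indep_var_rv1[OF ind] indep_var_rv2[OF ind] by auto
  have g0: "0 \<le> g y" if "y \<in> space U" for y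
    using le[OF that] f0 by (meson Bochner_Integration.integral_nonneg order_trans)
  interpret DX: prob_space "distr M S X" by (rule prob_space_distr) simp
  interpret DY: prob_space "distr M U Y" by (rule prob_space_distr) simp
  interpret D: pair_sigma_finite "distr M S X" "distr M U Y" ..
  have "(\<integral>\<^sup>+\<omega>. ennreal (f (X \<omega>, Y \<omega>)) \<partial>M) = (\<integral>\<^sup>+p. ennreal (f p) \<partial>distr M (S \<Otimes>\<^sub>M U) (\<lambda>\<omega>. (X \<omega>, Y \<omega>)))"
    by (subst nn_integral_distr) auto
  also have "distr M (S \<Otimes>\<^sub>M U) (\<lambda>\<omega>. (X \<omega>, Y \<omega>)) = distr M S X \<Otimes>\<^sub>M distr M U Y"
    using ind by (simp add: indep_var_distribution_eq)
  also have "(\<integral>\<^sup>+p. ennreal (f p) \<partial>(distr M S X \<Otimes>\<^sub>M distr M U Y)) = (\<integral>\<^sup>+y. \<integral>\<^sup>+x. ennreal (f (x, y)) \<partial>distr M S X \<partial>distr M U Y)"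
    by (rule D.nn_integral_snd[symmetric]) simp
  also have "\<dots> \<le> (\<integral>\<^sup>+y. ennreal (g y) \<partial>distr M U Y)"
  proof (rule nn_integral_mono)
    fix y assume "y \<in> space (distr M U Y)"
    then have y: "y \<in> space U" by simp
    then have [measurable]: "(\<lambda>x. f (x, y)) \<in> borel_measurable S" by measurable
    have "(\<integral>\<^sup>+x. ennreal (f (x, y)) \<partial>distr M S X) = (\<integral>\<^sup>+\<omega>. ennreal (f (X \<omega>, y)) \<partial>M)"
      by (subst nn_integral_distr) auto
    also have "\<dots> = ennreal (expectation (\<lambda>\<omega>. f (X \<omega>, y)))"
      using int[OF y] f0 by (intro nn_integral_eq_integral) auto
    also have "\<dots> \<le> ennreal (g y)" using le[OF y] by (rule ennreal_leI)
    finally show "(\<integral>\<^sup>+x. ennreal (f (x, y)) \<partial>distr M S X) \<le> ennreal (g y)" .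
  qed
  also have "\<dots> = (\<integral>\<^sup>+\<omega>. ennreal (g (Y \<omega>)) \<partial>M)" by (subst nn_integral_distr) auto
  also have "\<dots> = ennreal (expectation (\<lambda>\<omega>. g (Y \<omega>)))"
    using gint g0 measurable_space[OF Y] by (intro nn_integral_eq_integral AE_I2) auto
  finally have *: "(\<integral>\<^sup>+\<omega>. ennreal (f (X \<omega>, Y \<omega>)) \<partial>M) \<le> ennreal (expectation (\<lambda>\<omega>. g (Y \<omega>)))" .
  show i: "integrable M (\<lambda>\<omega>. f (X \<omega>, Y \<omega>))"
    using * f0 by (intro integrableI_nonneg) (auto simp: top_unique less_top[symmetric])
  have "ennreal (expectation (\<lambda>\<omega>. f (X \<omega>, Y \<omega>))) \<le> ennreal (expectation (\<lambda>\<omega>. g (Y \<omega>)))"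
    using * nn_integral_eq_integral[OF i] f0 by simp
  moreover have "0 \<le> expectation (\<lambda>\<omega>. g (Y \<omega>))"
    using g0 measurable_space[OF Y] by (intro Bochner_Integration.integral_nonneg_AE AE_I2) auto
  ultimately show "expectation (\<lambda>\<omega>. f (X \<omega>, Y \<omega>)) \<le> expectation (\<lambda>\<omega>. g (Y \<omega>))" by simp
qed

lemma cmod_add_square: "(cmod (p + d))\<^sup>2 = (cmod p)\<^sup>2 + 2 * Re (cnj p * d) + (cmod d)\<^sup>2"
  unfolding cmod_power2 by (simp add: power2_eq_square algebra_simps)

lemma cmod_add3_square_le: "(cmod (x + y + z))\<^sup>2 \<le> 3 * ((cmod x)\<^sup>2 + (cmod y)\<^sup>2 + (cmod z)\<^sup>2)"
proof -
  have "(cmod (x + y + z))\<^sup>2 \<le> (cmod x + cmod y + cmod z)\<^sup>2"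
    by (intro power_mono norm_triangle_le add_mono norm_triangle_ineq) auto
  also have "\<dots> \<le> 3 * ((cmod x)\<^sup>2 + (cmod y)\<^sup>2 + (cmod z)\<^sup>2)"
    using sum_squares_bound[of "cmod x" "cmod y"] sum_squares_bound[of "cmod x" "cmod z"] sum_squares_bound[of "cmod z" "cmod y"]
    by (simp add: power2_eq_square algebra_simps)
  finally show ?thesis .
qed

text \<open>The increment is centred, so the second moments of p and of the increment add up. The factor 3
  comes from its three summands, and bounding |X|^4 by b^2 |X|^2 produces the term in b.\<close>
lemma (in prob_space) martingale_step:
  assumes X [measurable]: "X \<in> borel_measurable M" and b: "\<And>\<omega>. \<omega> \<in> space M \<Longrightarrow> cmod (X \<omega>) \<le> b"
    and mean: "expectation X = 0" and var: "expectation (\<lambda>\<omega>. (cmod (X \<omega>))\<^sup>2) = s" and s: "s \<le> 1"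
  shows "integrable M (\<lambda>\<omega>. (cmod (p + (X \<omega> * u + cnj (X \<omega>) * w + a * of_real ((cmod (X \<omega>))\<^sup>2 - s))))\<^sup>2)" (is "integrable M ?f")
    and "expectation (\<lambda>\<omega>. (cmod (p + (X \<omega> * u + cnj (X \<omega>) * w + a * of_real ((cmod (X \<omega>))\<^sup>2 - s))))\<^sup>2)
      \<le> (cmod p)\<^sup>2 + 3 * ((cmod u)\<^sup>2 + (cmod w)\<^sup>2 + b\<^sup>2 * (cmod a)\<^sup>2)"
proof -
  have [simp]: "integrable M X" by (rule integrable_const_bound[of _ b]) (use b in auto)
  have [simp]: "integrable M (\<lambda>\<omega>. cnj (X \<omega>))" by (rule integrable_const_bound[of _ b]) (use b in auto)
  have sq: "(cmod (X \<omega>))\<^sup>2 \<le> b\<^sup>2" if "\<omega> \<in> space M" for \<omega> using b[OF that] by (intro power_mono) auto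
  have [simp]: "integrable M (\<lambda>\<omega>. (cmod (X \<omega>))\<^sup>2)" by (rule integrable_const_bound[of _ "b\<^sup>2"]) (use sq in auto)
  have [simp]: "integrable M (\<lambda>\<omega>. complex_of_real ((cmod (X \<omega>))\<^sup>2))" by (rule integrable_of_real) simp
  have s0: "0 \<le> s" unfolding var[symmetric] by simp
  define d where "d \<omega> = X \<omega> * u + cnj (X \<omega>) * w + a * of_real ((cmod (X \<omega>))\<^sup>2 - s)" for \<omega>
  have [measurable]: "d \<in> borel_measurable M" unfolding d_def by measurable
  have "integrable M (\<lambda>\<omega>. complex_of_real ((cmod (X \<omega>))\<^sup>2 - s))" by (intro integrable_of_real) simp
  then have di: "integrable M d" unfolding d_def by (simp del: of_real_diff of_real_power)
  have dE: "expectation d = 0"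
  proof -
    have "expectation (\<lambda>\<omega>. cnj (X \<omega>)) = 0" using mean by simp
    moreover have "expectation (\<lambda>\<omega>. complex_of_real ((cmod (X \<omega>))\<^sup>2)) = of_real s"
      using var by (simp del: of_real_power)
    ultimately show ?thesis unfolding d_def using mean by (simp add: prob_space del: of_real_power)
  qed
  have fourth: "((cmod (X \<omega>))\<^sup>2)\<^sup>2 \<le> b\<^sup>2 * (cmod (X \<omega>))\<^sup>2" if "\<omega> \<in> space M" for \<omega>
    using mult_right_mono[OF sq[OF that], of "(cmod (X \<omega>))\<^sup>2"] by (simp add: power2_eq_square)
  have d2: "(cmod (d \<omega>))\<^sup>2 \<le> 3 * ((cmod (X \<omega>))\<^sup>2 * (cmod u)\<^sup>2 + (cmod (X \<omega>))\<^sup>2 * (cmod w)\<^sup>2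
      + (cmod a)\<^sup>2 * (b\<^sup>2 * (cmod (X \<omega>))\<^sup>2 - 2 * s * (cmod (X \<omega>))\<^sup>2 + s\<^sup>2))" if "\<omega> \<in> space M" for \<omega>
  proof -
    have "(cmod (d \<omega>))\<^sup>2 \<le> 3 * ((cmod (X \<omega>))\<^sup>2 * (cmod u)\<^sup>2 + (cmod (X \<omega>))\<^sup>2 * (cmod w)\<^sup>2
      + (cmod a)\<^sup>2 * ((cmod (X \<omega>))\<^sup>2 - s)\<^sup>2)"
      unfolding d_def using cmod_add3_square_le[of "X \<omega> * u" "cnj (X \<omega>) * w" "a * of_real ((cmod (X \<omega>))\<^sup>2 - s)"]
      unfolding norm_mult norm_of_real power_mult_distrib power2_abs complex_mod_cnj .
    moreover have "((cmod (X \<omega>))\<^sup>2 - s)\<^sup>2 \<le> b\<^sup>2 * (cmod (X \<omega>))\<^sup>2 - 2 * s * (cmod (X \<omega>))\<^sup>2 + s\<^sup>2"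
      using fourth[OF that] by (simp add: power2_diff)
    ultimately show ?thesis
      by (smt (verit) mult_left_mono zero_le_power2)
  qed
  have di2: "integrable M (\<lambda>\<omega>. (cmod (d \<omega>))\<^sup>2)"
    by (rule Bochner_Integration.integrable_bound[of _ "\<lambda>\<omega>. 3 * ((cmod (X \<omega>))\<^sup>2 * (cmod u)\<^sup>2 + (cmod (X \<omega>))\<^sup>2 * (cmod w)\<^sup>2
      + (cmod a)\<^sup>2 * (b\<^sup>2 * (cmod (X \<omega>))\<^sup>2 - 2 * s * (cmod (X \<omega>))\<^sup>2 + s\<^sup>2))"])
      (use d2 in \<open>auto intro!: AE_I2 order_trans[OF _ abs_ge_self]\<close>)
  have "expectation (\<lambda>\<omega>. (cmod (d \<omega>))\<^sup>2) \<le> expectation (\<lambda>\<omega>. 3 * ((cmod (X \<omega>))\<^sup>2 * (cmod u)\<^sup>2 + (cmod (X \<omega>))\<^sup>2 * (cmod w)\<^sup>2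
      + (cmod a)\<^sup>2 * (b\<^sup>2 * (cmod (X \<omega>))\<^sup>2 - 2 * s * (cmod (X \<omega>))\<^sup>2 + s\<^sup>2)))"
    by (rule integral_mono[OF di2 _ d2]) auto
  also have "\<dots> = 3 * (s * (cmod u)\<^sup>2 + s * (cmod w)\<^sup>2 + (cmod a)\<^sup>2 * (b\<^sup>2 * s - 2 * s * s + s\<^sup>2))"
    by (simp add: var prob_space)
  also have "\<dots> \<le> 3 * (1 * (cmod u)\<^sup>2 + 1 * (cmod w)\<^sup>2 + (cmod a)\<^sup>2 * (b\<^sup>2 * 1))"
  proof -
    have "b\<^sup>2 * s - 2 * s * s + s\<^sup>2 \<le> b\<^sup>2 * 1"
      using mult_left_mono[OF s, of "b\<^sup>2"] s0 by (simp add: power2_eq_square) (smt (verit) mult_nonneg_nonneg)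
    then show ?thesis using s s0 by (intro mult_left_mono add_mono mult_right_mono) auto
  qed
  finally have E2: "expectation (\<lambda>\<omega>. (cmod (d \<omega>))\<^sup>2) \<le> 3 * ((cmod u)\<^sup>2 + (cmod w)\<^sup>2 + b\<^sup>2 * (cmod a)\<^sup>2)"
    by (simp add: mult.commute)
  define r where "r \<omega> = Re (cnj p * d \<omega>)" for \<omega>
  have f: "(cmod (p + (X \<omega> * u + cnj (X \<omega>) * w + a * of_real ((cmod (X \<omega>))\<^sup>2 - s))))\<^sup>2
      = (cmod p)\<^sup>2 + 2 * r \<omega> + (cmod (d \<omega>))\<^sup>2" for \<omega>
    unfolding d_def r_def by (rule cmod_add_square)
  have ri: "integrable M r" unfolding r_def using di by (intro integrable_Re) simp
  have "expectation (\<lambda>\<omega>. Re (cnj p * d \<omega>)) = Re (expectation (\<lambda>\<omega>. cnj p * d \<omega>))"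
    using di by (intro integral_Re) simp
  then have r0: "expectation r = 0" using dE unfolding r_def by simp
  show "integrable M ?f" unfolding f using ri di2 by simp
  show "expectation ?f \<le> (cmod p)\<^sup>2 + 3 * ((cmod u)\<^sup>2 + (cmod w)\<^sup>2 + b\<^sup>2 * (cmod a)\<^sup>2)"
    unfolding f using E2 ri di2 r0 by (simp add: prob_space)
qed

lemma (in prob_space) indep_vars_insert:
  assumes "indep_vars (\<lambda>_. borel) x (insert k F)" "k \<notin> F"
  shows "indep_var (PiM {k} (\<lambda>_. borel)) (\<lambda>\<omega>. restrict (\<lambda>i. x i \<omega>) {k}) (PiM F (\<lambda>_. borel)) (\<lambda>\<omega>. restrict (\<lambda>i. x i \<omega>) F)"
  using assms by (intro indep_var_restrict) auto

locale bounded_indep = prob_space +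
  fixes x :: "'i \<Rightarrow> 'a \<Rightarrow> complex" and K :: "'i set" and b :: real and s :: "'i \<Rightarrow> real"
  assumes K: "finite K" and indep: "indep_vars (\<lambda>_. borel) x K"
    and bound: "\<And>k \<omega>. k \<in> K \<Longrightarrow> \<omega> \<in> space M \<Longrightarrow> cmod (x k \<omega>) \<le> b"
    and mean: "\<And>k. k \<in> K \<Longrightarrow> expectation (x k) = 0"
    and var: "\<And>k. k \<in> K \<Longrightarrow> expectation (\<lambda>\<omega>. (cmod (x k \<omega>))\<^sup>2) = s k"
    and s_le: "\<And>k. k \<in> K \<Longrightarrow> s k \<le> 1"
begin

lemma rv [measurable]: "k \<in> K \<Longrightarrow> x k \<in> borel_measurable M"
  using indep by (auto simp: indep_vars_def)

lemma linear_form: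
  assumes "F \<subseteq> K"
  shows "integrable M (\<lambda>\<omega>. (cmod (\<Sum>k\<in>F. a k * x k \<omega>))\<^sup>2) \<and>
    expectation (\<lambda>\<omega>. (cmod (\<Sum>k\<in>F. a k * x k \<omega>))\<^sup>2) \<le> 3 * (\<Sum>k\<in>F. (cmod (a k))\<^sup>2)"
  using finite_subset[OF assms K] assms
proof (induction F rule: finite_induct)
  case empty
  then show ?case by simp
next
  case (insert k F)
  then have k: "k \<in> K" and F: "F \<subseteq> K" "finite F" "k \<notin> F" by auto
  note IH = insert.IH[OF F(1)]
  let ?S = "\<lambda>y::'i \<Rightarrow> complex. \<Sum>l\<in>F. a l * y l"
  let ?f = "\<lambda>(\<xi> :: 'i \<Rightarrow> complex, y). (cmod (?S y + (\<xi> k * a k + cnj (\<xi> k) * 0 + 0 * of_real ((cmod (\<xi> k))\<^sup>2 - s k))))\<^sup>2"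
  let ?g = "\<lambda>y. (cmod (?S y))\<^sup>2 + 3 * (cmod (a k))\<^sup>2"
  let ?Y = "\<lambda>\<omega>. restrict (\<lambda>i. x i \<omega>) F" and ?X = "\<lambda>\<omega>. restrict (\<lambda>i. x i \<omega>) {k}"
  have SY: "?S (?Y \<omega>) = (\<Sum>l\<in>F. a l * x l \<omega>)" for \<omega> by simp
  have ind: "indep_var (PiM {k} (\<lambda>_. borel)) ?X (PiM F (\<lambda>_. borel)) ?Y"
    using F k by (intro indep_vars_insert indep_vars_subset[OF indep]) auto
  note step = martingale_step[OF rv[OF k] bound[OF k] mean[OF k] var[OF k] s_le[OF k], of "?S y" "a k" 0 0 for y]
  have m: "?f \<in> borel_measurable (PiM {k} (\<lambda>_. borel) \<Otimes>\<^sub>M PiM F (\<lambda>_. borel))" "?g \<in> borel_measurable (PiM F (\<lambda>_. borel))"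
    using F by measurable
  have gi: "integrable M (\<lambda>\<omega>. ?g (?Y \<omega>))" using IH unfolding SY by simp
  have "integrable M (\<lambda>\<omega>. ?f (?X \<omega>, ?Y \<omega>))"
    "expectation (\<lambda>\<omega>. ?f (?X \<omega>, ?Y \<omega>)) \<le> expectation (\<lambda>\<omega>. ?g (?Y \<omega>))"
    by (rule indep_expectation_le[where f = ?f and g = ?g and X = ?X and Y = ?Y, OF ind m(1) _ _ _ m(2) gi]; use step in auto)+
  moreover have "?f (?X \<omega>, ?Y \<omega>) = (cmod (\<Sum>k\<in>insert k F. a k * x k \<omega>))\<^sup>2" for \<omega>
    using F by (simp add: SY algebra_simps)
  moreover have "expectation (\<lambda>\<omega>. ?g (?Y \<omega>)) \<le> 3 * (\<Sum>k\<in>insert k F. (cmod (a k))\<^sup>2)"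
    using IH F unfolding SY by (simp add: prob_space)
  ultimately show ?case by simp
qed

text \<open>Induction over the index set. Adding the variable x_k adds the increment x_k u + cnj x_k w + A_kk
  (|x_k|^2 - s_k), where u and w are linear forms in the earlier variables; it is centred given these, so second
  moments add up, and those of u and w are given by the previous lemma.\<close>
lemma quadratic_form_centered:
  assumes "F \<subseteq> K"
  shows "integrable M (\<lambda>\<omega>. (cmod (\<Sum>k\<in>F. \<Sum>l\<in>F. x k \<omega> * A k l * cnj (x l \<omega>) - (if k = l then A k k * of_real (s k) else 0)))\<^sup>2) \<and>
    expectation (\<lambda>\<omega>. (cmod (\<Sum>k\<in>F. \<Sum>l\<in>F. x k \<omega> * A k l * cnj (x l \<omega>) - (if k = l then A k k * of_real (s k) else 0)))\<^sup>2)
     \<le> (9 + 3 * b\<^sup>2) * (\<Sum>k\<in>F. \<Sum>l\<in>F. (cmod (A k l))\<^sup>2)"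
  using finite_subset[OF assms K] assms
proof (induction F rule: finite_induct)
  case empty
  then show ?case by simp
next
  case (insert k F)
  then have k: "k \<in> K" and F: "F \<subseteq> K" "finite F" "k \<notin> F" by auto
  note IH = insert.IH[OF F(1)]
  let ?p = "\<lambda>y::'i \<Rightarrow> complex. \<Sum>k\<in>F. \<Sum>l\<in>F. y k * A k l * cnj (y l) - (if k = l then A k k * of_real (s k) else 0)"
  let ?u = "\<lambda>y::'i \<Rightarrow> complex. \<Sum>l\<in>F. A k l * cnj (y l)"
  let ?w = "\<lambda>y::'i \<Rightarrow> complex. \<Sum>l\<in>F. A l k * y l"
  let ?f = "\<lambda>(\<xi> :: 'i \<Rightarrow> complex, y). (cmod (?p y + (\<xi> k * ?u y + cnj (\<xi> k) * ?w y + A k k * of_real ((cmod (\<xi> k))\<^sup>2 - s k))))\<^sup>2"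
  let ?g = "\<lambda>y. (cmod (?p y))\<^sup>2 + 3 * ((cmod (?u y))\<^sup>2 + (cmod (?w y))\<^sup>2 + b\<^sup>2 * (cmod (A k k))\<^sup>2)"
  let ?Y = "\<lambda>\<omega>. restrict (\<lambda>i. x i \<omega>) F" and ?X = "\<lambda>\<omega>. restrict (\<lambda>i. x i \<omega>) {k}"
  have pY: "?p (?Y \<omega>) = ?p (\<lambda>i. x i \<omega>)" and uY: "cmod (?u (?Y \<omega>)) = cmod (\<Sum>l\<in>F. cnj (A k l) * x l \<omega>)"
    and wY: "?w (?Y \<omega>) = (\<Sum>l\<in>F. A l k * x l \<omega>)" for \<omega>
  proof -
    show "?p (?Y \<omega>) = ?p (\<lambda>i. x i \<omega>)" by (intro sum.cong refl) simp
    have "?u (?Y \<omega>) = cnj (\<Sum>l\<in>F. cnj (A k l) * x l \<omega>)" by simp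
    then show "cmod (?u (?Y \<omega>)) = cmod (\<Sum>l\<in>F. cnj (A k l) * x l \<omega>)" by (simp only: complex_mod_cnj)
  qed simp
  have ind: "indep_var (PiM {k} (\<lambda>_. borel)) ?X (PiM F (\<lambda>_. borel)) ?Y"
    using F k by (intro indep_vars_insert indep_vars_subset[OF indep]) auto
  note step = martingale_step[OF rv[OF k] bound[OF k] mean[OF k] var[OF k] s_le[OF k], of "?p y" "?u y" "?w y" "A k k" for y]
  have m: "?f \<in> borel_measurable (PiM {k} (\<lambda>_. borel) \<Otimes>\<^sub>M PiM F (\<lambda>_. borel))" "?g \<in> borel_measurable (PiM F (\<lambda>_. borel))"
    using F by measurable
  note lin1 = linear_form[OF F(1), of "\<lambda>l. cnj (A k l)"] and lin2 = linear_form[OF F(1), of "\<lambda>l. A l k"]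
  have gi: "integrable M (\<lambda>\<omega>. ?g (?Y \<omega>))" unfolding pY uY wY using IH lin1 lin2 by simp
  have "integrable M (\<lambda>\<omega>. ?f (?X \<omega>, ?Y \<omega>))"
    "expectation (\<lambda>\<omega>. ?f (?X \<omega>, ?Y \<omega>)) \<le> expectation (\<lambda>\<omega>. ?g (?Y \<omega>))"
    by (rule indep_expectation_le[where f = ?f and g = ?g and X = ?X and Y = ?Y, OF ind m(1) _ _ _ m(2) gi]; use step in auto)+
  moreover have "?f (?X \<omega>, ?Y \<omega>) = (cmod (\<Sum>i\<in>insert k F. \<Sum>l\<in>insert k F. x i \<omega> * A i l * cnj (x l \<omega>) - (if i = l then A i i * of_real (s i) else 0)))\<^sup>2" for \<omega>
  proof -
    have 1: "(\<Sum>l\<in>F. x k \<omega> * A k l * cnj (x l \<omega>) - (if k = l then A k k * of_real (s k) else 0)) = x k \<omega> * ?u (?Y \<omega>)"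
      using F by (auto simp: sum_distrib_left mult.assoc intro!: sum.cong)
    have 2: "(\<Sum>l\<in>F. x l \<omega> * A l k * cnj (x k \<omega>) - (if l = k then A l l * of_real (s l) else 0)) = cnj (x k \<omega>) * ?w (?Y \<omega>)"
      using F by (auto simp: sum_distrib_left mult_ac intro!: sum.cong)
    define h where "h i l = x i \<omega> * A i l * cnj (x l \<omega>) - (if i = l then A i i * of_real (s i) else 0)" for i l
    have "(\<Sum>i\<in>insert k F. \<Sum>l\<in>insert k F. h i l) = h k k + (\<Sum>l\<in>F. h k l) + (\<Sum>l\<in>F. h l k) + (\<Sum>i\<in>F. \<Sum>l\<in>F. h i l)"
      using F by (simp add: sum.distrib)
    also have "\<dots> = (x k \<omega> * A k k * cnj (x k \<omega>) - A k k * of_real (s k)) + x k \<omega> * ?u (?Y \<omega>) + cnj (x k \<omega>) * ?w (?Y \<omega>) + ?p (?Y \<omega>)"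
      unfolding h_def pY 1 2 by simp
    also have "x k \<omega> * A k k * cnj (x k \<omega>) - A k k * of_real (s k) = A k k * of_real ((cmod (x k \<omega>))\<^sup>2 - s k)"
      by (simp add: complex_norm_square algebra_simps del: of_real_power)
    finally have e: "(\<Sum>i\<in>insert k F. \<Sum>l\<in>insert k F. h i l)
      = ?p (?Y \<omega>) + (x k \<omega> * ?u (?Y \<omega>) + cnj (x k \<omega>) * ?w (?Y \<omega>) + A k k * of_real ((cmod (x k \<omega>))\<^sup>2 - s k))"
      by (simp only: add_ac)
    have "?X \<omega> k = x k \<omega>" by simp
    then show ?thesis unfolding prod.case e[unfolded h_def] by (simp only:)
  qed
  moreover have "expectation (\<lambda>\<omega>. ?g (?Y \<omega>)) \<le> (9 + 3 * b\<^sup>2) * (\<Sum>i\<in>insert k F. \<Sum>l\<in>insert k F. (cmod (A i l))\<^sup>2)"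
  proof -
    let ?a = "\<Sum>k\<in>F. \<Sum>l\<in>F. (cmod (A k l))\<^sup>2" let ?r = "\<Sum>l\<in>F. (cmod (A k l))\<^sup>2" let ?c = "\<Sum>l\<in>F. (cmod (A l k))\<^sup>2"
    have "expectation (\<lambda>\<omega>. ?g (?Y \<omega>)) \<le> (9 + 3 * b\<^sup>2) * ?a + 3 * (3 * ?r + 3 * ?c + b\<^sup>2 * (cmod (A k k))\<^sup>2)"
      unfolding pY uY wY using IH lin1 lin2 by (simp add: prob_space)
    also have "\<dots> \<le> (9 + 3 * b\<^sup>2) * (?a + ?r + ?c + (cmod (A k k))\<^sup>2)"
    proof -
      have "0 \<le> 3 * b\<^sup>2 * (?r + ?c)" by (intro mult_nonneg_nonneg add_nonneg_nonneg sum_nonneg) auto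
      then show ?thesis by (simp add: algebra_simps)
    qed
    also have "?a + ?r + ?c + (cmod (A k k))\<^sup>2 = (\<Sum>i\<in>insert k F. \<Sum>l\<in>insert k F. (cmod (A i l))\<^sup>2)"
      using F by (simp add: sum.distrib)
    finally show ?thesis .
  qed
  ultimately show ?case by simp
qed

text \<open>Truncated variables have variances s_k slightly below 1. Their deviation from 1 enters through the
  sum of 1 - s_k, which the Lindeberg condition controls on average over the rows.\<close>
lemma quadratic_form:
  shows "integrable M (\<lambda>\<omega>. (cmod ((\<Sum>k\<in>K. \<Sum>l\<in>K. x k \<omega> * A k l * cnj (x l \<omega>)) - (\<Sum>k\<in>K. A k k)))\<^sup>2)"
    and "expectation (\<lambda>\<omega>. (cmod ((\<Sum>k\<in>K. \<Sum>l\<in>K. x k \<omega> * A k l * cnj (x l \<omega>)) - (\<Sum>k\<in>K. A k k)))\<^sup>2)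
     \<le> 2 * (9 + 3 * b\<^sup>2 + (\<Sum>k\<in>K. 1 - s k)) * (\<Sum>k\<in>K. \<Sum>l\<in>K. (cmod (A k l))\<^sup>2)"
proof -
  define q where "q \<omega> = (\<Sum>k\<in>K. \<Sum>l\<in>K. x k \<omega> * A k l * cnj (x l \<omega>) - (if k = l then A k k * of_real (s k) else 0))" for \<omega>
  define d where "d = (\<Sum>k\<in>K. A k k * of_real (1 - s k))"
  have q: "integrable M (\<lambda>\<omega>. (cmod (q \<omega>))\<^sup>2)" "expectation (\<lambda>\<omega>. (cmod (q \<omega>))\<^sup>2) \<le> (9 + 3 * b\<^sup>2) * (\<Sum>k\<in>K. \<Sum>l\<in>K. (cmod (A k l))\<^sup>2)"
    using quadratic_form_centered[of K A] unfolding q_def by auto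
  have s0: "0 \<le> s k" if "k \<in> K" for k unfolding var[OF that, symmetric] by simp
  have "(cmod d)\<^sup>2 \<le> (\<Sum>k\<in>K. (cmod (A k k))\<^sup>2) * (\<Sum>k\<in>K. 1 - s k)"
  proof -
    have "cmod d \<le> (\<Sum>k\<in>K. cmod (A k k) * (1 - s k))"
      unfolding d_def using s_le by (intro sum_norm_le) (simp add: norm_mult del: of_real_diff)
    then have "(cmod d)\<^sup>2 \<le> (\<Sum>k\<in>K. cmod (A k k) * (1 - s k))\<^sup>2" by (intro power_mono) auto
    also have "\<dots> \<le> (\<Sum>k\<in>K. (cmod (A k k))\<^sup>2) * (\<Sum>k\<in>K. (1 - s k)\<^sup>2)" by (rule Cauchy_Schwarz_ineq_sum)
    also have "\<dots> \<le> (\<Sum>k\<in>K. (cmod (A k k))\<^sup>2) * (\<Sum>k\<in>K. 1 - s k)"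
      using s0 s_le by (intro mult_left_mono sum_mono sum_nonneg) (auto simp: power2_eq_square intro!: mult_left_le)
    finally show ?thesis .
  qed
  also have "\<dots> \<le> (\<Sum>k\<in>K. \<Sum>l\<in>K. (cmod (A k l))\<^sup>2) * (\<Sum>k\<in>K. 1 - s k)"
    using s_le K by (intro mult_right_mono sum_mono sum_nonneg member_le_sum) auto
  finally have d: "(cmod d)\<^sup>2 \<le> (\<Sum>k\<in>K. \<Sum>l\<in>K. (cmod (A k l))\<^sup>2) * (\<Sum>k\<in>K. 1 - s k)" .
  have eq: "(\<Sum>k\<in>K. \<Sum>l\<in>K. x k \<omega> * A k l * cnj (x l \<omega>)) - (\<Sum>k\<in>K. A k k) = q \<omega> - d" for \<omega>
    unfolding q_def d_def using K by (simp add: sum_subtractf right_diff_distrib)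
  have le: "(cmod (q \<omega> - d))\<^sup>2 \<le> 2 * (cmod (q \<omega>))\<^sup>2 + 2 * (cmod d)\<^sup>2" for \<omega>
  proof -
    have "(cmod (q \<omega> - d))\<^sup>2 \<le> (cmod (q \<omega>) + cmod d)\<^sup>2" by (intro power_mono norm_triangle_ineq4) auto
    also have "\<dots> \<le> 2 * (cmod (q \<omega>))\<^sup>2 + 2 * (cmod d)\<^sup>2"
      using sum_squares_bound[of "cmod (q \<omega>)" "cmod d"] by (simp add: power2_sum)
    finally show ?thesis .
  qed
  have [measurable]: "q \<in> borel_measurable M" unfolding q_def by measurable
  have i: "integrable M (\<lambda>\<omega>. (cmod (q \<omega> - d))\<^sup>2)"
    by (rule Bochner_Integration.integrable_bound[of _ "\<lambda>\<omega>. 2 * (cmod (q \<omega>))\<^sup>2 + 2 * (cmod d)\<^sup>2"]) (use le q in auto)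
  show "integrable M (\<lambda>\<omega>. (cmod ((\<Sum>k\<in>K. \<Sum>l\<in>K. x k \<omega> * A k l * cnj (x l \<omega>)) - (\<Sum>k\<in>K. A k k)))\<^sup>2)"
    unfolding eq by (rule i)
  have "expectation (\<lambda>\<omega>. (cmod (q \<omega> - d))\<^sup>2) \<le> expectation (\<lambda>\<omega>. 2 * (cmod (q \<omega>))\<^sup>2 + 2 * (cmod d)\<^sup>2)"
    using q by (intro integral_mono i le) auto
  also have "\<dots> \<le> 2 * (9 + 3 * b\<^sup>2 + (\<Sum>k\<in>K. 1 - s k)) * (\<Sum>k\<in>K. \<Sum>l\<in>K. (cmod (A k l))\<^sup>2)"
    using q d by (simp add: prob_space algebra_simps)
  finally show "expectation (\<lambda>\<omega>. (cmod ((\<Sum>k\<in>K. \<Sum>l\<in>K. x k \<omega> * A k l * cnj (x l \<omega>)) - (\<Sum>k\<in>K. A k k)))\<^sup>2)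
     \<le> 2 * (9 + 3 * b\<^sup>2 + (\<Sum>k\<in>K. 1 - s k)) * (\<Sum>k\<in>K. \<Sum>l\<in>K. (cmod (A k l))\<^sup>2)"
    unfolding eq .
qed

end

section \<open>Frobenius norms of Gram resolvents\<close>

lemma cmod_diff_square_le: "(cmod (x - y))\<^sup>2 \<le> 2 * ((cmod x)\<^sup>2 + (cmod y)\<^sup>2)"
proof -
  have "(cmod (x - y))\<^sup>2 \<le> (cmod x + cmod y)\<^sup>2" by (intro power_mono norm_triangle_ineq4) auto
  also have "\<dots> \<le> 2 * ((cmod x)\<^sup>2 + (cmod y)\<^sup>2)"
    using sum_squares_bound[of "cmod x" "cmod y"] by (simp add: power2_sum)
  finally show ?thesis .
qed

lemma frob_diff_le: "frob N n (\<lambda>i k. A i k - B i k) \<le> 2 * (frob N n A + frob N n B)"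
  unfolding frob_def sum.distrib[symmetric] sum_distrib_left
  by (intro sum_mono cmod_diff_square_le)

text \<open>K bounds the square of the operator norm of u -> u D.\<close>
definition row_bound :: "nat \<Rightarrow> real \<Rightarrow> (nat \<Rightarrow> nat \<Rightarrow> complex) \<Rightarrow> bool" where
  "row_bound n K D \<longleftrightarrow> (\<forall>u. (\<Sum>l<n. (cmod (\<Sum>k<n. u k * D k l))\<^sup>2) \<le> K * (\<Sum>k<n. (cmod (u k))\<^sup>2))"

lemma row_boundD: "row_bound n K D \<Longrightarrow> (\<Sum>l<n. (cmod (\<Sum>k<n. u k * D k l))\<^sup>2) \<le> K * (\<Sum>k<n. (cmod (u k))\<^sup>2)"
  unfolding row_bound_def by blast

lemma frob_mult_row_bound:
  assumes "row_bound n K D"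
  shows "frob N n (\<lambda>i l. \<Sum>k<n. A i k * D k l) \<le> K * frob N n A"
  unfolding frob_def sum_distrib_left[of K "\<lambda>i. \<Sum>k<n. (cmod (A i k))\<^sup>2" "{..<N}"]
  by (rule sum_mono) (rule row_boundD[OF assms])

lemma hermitian_column_bound:
  assumes "row_bound n K C" "hermitian_on n C"
  shows "(\<Sum>k<n. (cmod (\<Sum>l<n. C k l * u l))\<^sup>2) \<le> K * (\<Sum>k<n. (cmod (u k))\<^sup>2)"
proof -
  have "cmod (\<Sum>l<n. C k l * u l) = cmod (\<Sum>l<n. cnj (u l) * C l k)" if "k < n" for k
  proof -
    have "cnj (\<Sum>l<n. C k l * u l) = (\<Sum>l<n. cnj (u l) * C l k)"
      using assms(2) that unfolding cnj_sum by (intro sum.cong) (auto simp: hermitian_on_def)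
    then show ?thesis by (metis complex_mod_cnj)
  qed
  then have "(\<Sum>k<n. (cmod (\<Sum>l<n. C k l * u l))\<^sup>2) = (\<Sum>k<n. (cmod (\<Sum>l<n. cnj (u l) * C l k))\<^sup>2)"
    by (intro sum.cong refl) (simp only: lessThan_iff)
  also have "\<dots> \<le> K * (\<Sum>k<n. (cmod (cnj (u k)))\<^sup>2)" by (rule row_boundD[OF assms(1)])
  finally show ?thesis by simp
qed

lemma frob_mult_left:
  assumes "row_bound n K C" "hermitian_on n C"
  shows "frob n n (\<lambda>k l. \<Sum>m<n. C k m * A m l) \<le> K * frob n n A"
  unfolding frob_swap[of n n "\<lambda>k l. \<Sum>m<n. C k m * A m l"] frob_swap[of n n A] sum_distrib_left[of K "\<lambda>k. \<Sum>i<n. (cmod (A i k))\<^sup>2" "{..<n}"]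
  by (rule sum_mono) (rule hermitian_column_bound[OF assms])

lemma row_bound_id: "row_bound n 1 (\<lambda>k l. if k = l then 1 else 0)"
  unfolding row_bound_def by (simp add: sum_delta_mult)

lemma frob_id: "frob n n (\<lambda>k l. if k = l then 1 else 0) = n"
  unfolding frob_def by (simp add: if_distrib[of cmod] if_distrib[of "\<lambda>x. x\<^sup>2"] cong: if_cong)

lemma frob_le_of_row_bound:
  assumes "row_bound n K D"
  shows "frob n n D \<le> K * n"
proof -
  have "frob n n D = frob n n (\<lambda>i l. \<Sum>k<n. (if i = k then 1 else 0) * D k l)"
    unfolding frob_def by (intro sum.cong refl) (simp add: sum_delta_mult)
  also have "\<dots> \<le> K * frob n n (\<lambda>k l. if k = l then 1 else 0)" by (rule frob_mult_row_bound[OF assms])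
  finally show ?thesis by (simp add: frob_id)
qed

definition outer_gram :: "nat \<Rightarrow> (nat \<Rightarrow> nat \<Rightarrow> complex) \<Rightarrow> nat \<Rightarrow> nat \<Rightarrow> complex" where
  "outer_gram n Y a b = (\<Sum>k<n. Y a k * cnj (Y b k))"

text \<open>R = C - C Y* G Y C, where multiplying by C is a contraction, so the Frobenius norm of R is
  governed by those of C and of Y Y*; both are of the order sqrt n in the mean.\<close>
lemma (in cavity) frob_coresolvent_le:
  assumes K: "row_bound n 1 C"
  shows "frob n n R \<le> 2 * (n + frob N N (outer_gram n Y) / (Im z)\<^sup>2)"
proof -
  define A where "A k l = (\<Sum>a<N. \<Sum>b<N. cnj (Y a k) * G a b * Y b l)" for k l
  have A: "(Im z)\<^sup>2 * frob n n A \<le> frob N N (outer_gram n Y)"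
    using frob_conj_resolvent_le[OF hermitian_gram z, of n Y] unfolding A_def outer_gram_def by simp
  have "(\<Sum>a<N. \<Sum>b<N. cnj (Z a k) * G a b * Z b l) = (\<Sum>m<n. (\<Sum>p<n. C k p * A p m) * C m l)" if k: "k < n" for k l
  proof -
    have A': "A p m = (\<Sum>b<N. (\<Sum>a<N. cnj (Y a p) * G a b) * Y b m)" for p m
      unfolding A_def sum_distrib_right by (rule sum.swap)
    have "(\<Sum>m<n. (\<Sum>p<n. C k p * A p m) * C m l) = (\<Sum>p<n. C k p * (\<Sum>m<n. A p m * C m l))"
      by (rule sum_mult_assoc)
    also have "\<dots> = (\<Sum>p<n. C k p * (\<Sum>b<N. (\<Sum>a<N. cnj (Y a p) * G a b) * Z b l))"
      unfolding A' sum_mult_assoc[of "\<lambda>b. \<Sum>a<N. cnj (Y a _) * G a b"] row_mult_def ..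
    also have "\<dots> = (\<Sum>p<n. C k p * (\<Sum>a<N. cnj (Y a p) * (\<Sum>b<N. G a b * Z b l)))"
      unfolding sum_mult_assoc ..
    also have "\<dots> = (\<Sum>a<N. (\<Sum>p<n. C k p * cnj (Y a p)) * (\<Sum>b<N. G a b * Z b l))"
      by (rule sum_mult_assoc[symmetric])
    also have "\<dots> = (\<Sum>a<N. \<Sum>b<N. cnj (Z a k) * G a b * Z b l)"
      unfolding cnj_row_mult[OF k, symmetric] by (simp add: sum_distrib_left mult.assoc)
    finally show ?thesis by simp
  qed
  then have "frob n n R = frob n n (\<lambda>k l. C k l - (\<Sum>m<n. (\<Sum>p<n. C k p * A p m) * C m l))"
    unfolding frob_def coresolvent_def by (intro sum.cong refl) simp
  also have "\<dots> \<le> 2 * (frob n n C + frob n n (\<lambda>k l. \<Sum>m<n. (\<Sum>p<n. C k p * A p m) * C m l))"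
    by (rule frob_diff_le)
  also have "frob n n (\<lambda>k l. \<Sum>m<n. (\<Sum>p<n. C k p * A p m) * C m l) \<le> 1 * frob n n (\<lambda>k m. \<Sum>p<n. C k p * A p m)"
    by (rule frob_mult_row_bound[OF K])
  also have "frob n n (\<lambda>k m. \<Sum>p<n. C k p * A p m) \<le> 1 * frob n n A"
    by (rule frob_mult_left[OF K C])
  also have "frob n n A \<le> frob N N (outer_gram n Y) / (Im z)\<^sup>2"
    using A z by (simp add: field_simps)
  also have "frob n n C \<le> 1 * real n" by (rule frob_le_of_row_bound[OF K])
  finally show ?thesis by simp
qed

lemma frob_outer_gram_zero_row: "frob N N (outer_gram n (zero_row i Y)) \<le> frob N N (outer_gram n Y)"
proof -
  have "cmod (outer_gram n (zero_row i Y) a b) \<le> cmod (outer_gram n Y a b)" for a b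
    by (cases "a = i \<or> b = i") (auto simp: outer_gram_def zero_row_def)
  then show ?thesis unfolding frob_def by (intro sum_mono power_mono) auto
qed

lemma (in cavity) frob_coresolvent_zeroed_le:
  assumes K: "row_bound n 1 C"
  shows "frob n n (R\<^sub>0 i) \<le> 2 * (n + frob N N (outer_gram n Y) / (Im z)\<^sup>2)"
proof -
  interpret Z: cavity N n z C "zero_row i Y" by unfold_locales (use C z in auto)
  have "frob n n (R\<^sub>0 i) \<le> 2 * (n + frob N N (outer_gram n (zero_row i Y)) / (Im z)\<^sup>2)"
    by (rule Z.frob_coresolvent_le[OF K])
  also have "\<dots> \<le> 2 * (n + frob N N (outer_gram n Y) / (Im z)\<^sup>2)"
    using frob_outer_gram_zero_row by (intro mult_left_mono add_left_mono divide_right_mono) auto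
  finally show ?thesis .
qed

text \<open>The resolvent identity g - h = - h (Y C Y* - V C V*) g reduces the difference to traces of g h A C
  B*, with A or B equal to Y - V. As g h has norm at most 1 / (Im z)^2, the Cauchy-Schwarz inequality for the
  Frobenius inner product applies.\<close>
lemma trace_resolvent_diff_le:
  fixes C Y V :: "nat \<Rightarrow> nat \<Rightarrow> complex" and N n :: nat
  assumes C: "hermitian_on n C" and z: "Im z \<noteq> 0" and K: "row_bound n 1 C"
  defines "g \<equiv> resolvent N z (gram n C Y)" and "h \<equiv> resolvent N z (gram n C V)"
  shows "(Im z)\<^sup>2 * cmod ((\<Sum>i<N. g i i) - (\<Sum>i<N. h i i))
    \<le> sqrt (frob N n (\<lambda>i k. Y i k - V i k)) * (sqrt (frob N n Y) + sqrt (frob N n V))"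
proof -
  interpret Y: cavity N n z C Y by unfold_locales fact+
  interpret V: cavity N n z C V by unfold_locales fact+
  define U where "U i k = V i k - Y i k" for i k
  define P where "P i j = (\<Sum>k<N. g i k * h k j)" for i j
  define S where "S A B = (\<Sum>j<N. \<Sum>i<N. P i j * (\<Sum>l<n. row_mult n A C j l * cnj (B i l)))" for A B :: "nat \<Rightarrow> nat \<Rightarrow> complex"
  have S_bound: "(Im z)\<^sup>2 * cmod (S A B) \<le> sqrt (frob N n A) * sqrt (frob N n B)" for A B
  proof -
    define Q where "Q l j = (\<Sum>i<N. cnj (B i l) * P i j)" for l j
    have "S A B = (\<Sum>j<N. \<Sum>l<n. row_mult n A C j l * Q l j)"
    proof -
      have "(\<Sum>i<N. P i j * (\<Sum>l<n. row_mult n A C j l * cnj (B i l))) = (\<Sum>l<n. row_mult n A C j l * Q l j)" for j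
      proof -
        have "(\<Sum>i<N. P i j * (\<Sum>l<n. row_mult n A C j l * cnj (B i l))) = (\<Sum>i<N. \<Sum>l<n. row_mult n A C j l * (cnj (B i l) * P i j))"
          by (simp add: sum_distrib_left mult_ac)
        also have "\<dots> = (\<Sum>l<n. row_mult n A C j l * Q l j)"
          unfolding Q_def sum_distrib_left by (rule sum.swap)
        finally show ?thesis .
      qed
      then show ?thesis unfolding S_def by simp
    qed
    then have "(cmod (S A B))\<^sup>2 \<le> frob N n (row_mult n A C) * frob N n (\<lambda>j l. Q l j)"
      using cmod_frob_inner_square_le[where A = "row_mult n A C" and B = "\<lambda>j l. Q l j" and N = N and n = n] by simp
    note S2 = this
    have f1: "frob N n (row_mult n A C) \<le> 1 * frob N n A"
      using frob_mult_row_bound[OF K, of N A] unfolding row_mult_def[abs_def] .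
    have f2: "frob N n (\<lambda>j l. Q l j) \<le> frob N n B / ((Im z)\<^sup>2)\<^sup>2"
    proof -
      have "((Im z)\<^sup>2)\<^sup>2 * (\<Sum>j<N. (cmod (Q l j))\<^sup>2) \<le> (\<Sum>i<N. (cmod (B i l))\<^sup>2)" for l
      proof -
        have Q: "Q l j = (\<Sum>k<N. (\<Sum>i<N. cnj (B i l) * g i k) * h k j)" for j
          unfolding Q_def P_def by (rule sum_mult_assoc[symmetric])
        have "(Im z)\<^sup>2 * ((Im z)\<^sup>2 * (\<Sum>j<N. (cmod (Q l j))\<^sup>2)) \<le> (Im z)\<^sup>2 * (\<Sum>k<N. (cmod (\<Sum>i<N. cnj (B i l) * g i k))\<^sup>2)"
          unfolding Q h_def by (intro mult_left_mono resolvent_contraction_row V.hermitian_gram z) auto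
        also have "\<dots> \<le> (\<Sum>i<N. (cmod (cnj (B i l)))\<^sup>2)"
          unfolding g_def by (intro resolvent_contraction_row Y.hermitian_gram z)
        finally show ?thesis by (simp add: power2_eq_square mult.assoc)
      qed
      then have "((Im z)\<^sup>2)\<^sup>2 * frob N n (\<lambda>j l. Q l j) \<le> frob N n B"
        unfolding frob_swap sum_distrib_left[of _ _ "{..<n}"] by (intro sum_mono)
      then show ?thesis using z by (simp add: field_simps)
    qed
    have "(cmod (S A B))\<^sup>2 \<le> 1 * frob N n A * (frob N n B / ((Im z)\<^sup>2)\<^sup>2)"
      using S2 mult_mono[OF f1 f2] by simp
    then have "((Im z)\<^sup>2 * cmod (S A B))\<^sup>2 \<le> frob N n A * frob N n B"
      using z by (simp add: field_simps)
    then show ?thesis by (simp add: real_le_rsqrt real_sqrt_mult[symmetric])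
  qed
  have diff: "g a b - h a b = - (\<Sum>i<N. \<Sum>j<N. h a i * (gram n C Y i j - gram n C V i j) * g j b)" if ab: "a < N" "b < N" for a b
  proof -
    have "(\<Sum>i<N. \<Sum>j<N. h a i * (gram n C Y i j - gram n C V i j) * g j b)
      = (\<Sum>i<N. h a i * (\<Sum>j<N. gram n C Y i j * g j b)) - (\<Sum>i<N. h a i * (\<Sum>j<N. gram n C V i j * g j b))"
      by (simp add: sum_subtractf[symmetric] right_diff_distrib left_diff_distrib sum_distrib_left mult.assoc)
    also have "(\<Sum>i<N. h a i * (\<Sum>j<N. gram n C V i j * g j b)) = (\<Sum>j<N. (\<Sum>i<N. h a i * gram n C V i j) * g j b)"
      by (rule sum_mult_assoc[symmetric])
    also have "\<dots> = (\<Sum>j<N. (if a = j then 1 else 0) * g j b + z * (h a j * g j b))"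
      using ab unfolding h_def by (intro sum.cong refl) (subst V.G_left, auto simp: distrib_right)
    also have "\<dots> = g a b + z * (\<Sum>j<N. h a j * g j b)"
      using ab by (simp add: sum.distrib sum_delta_mult sum_distrib_left)
    also have "(\<Sum>i<N. h a i * (\<Sum>j<N. gram n C Y i j * g j b)) = (\<Sum>i<N. h a i * (if i = b then 1 else 0) + z * (h a i * g i b))"
      using ab unfolding g_def by (intro sum.cong refl) (subst Y.G_right, auto simp: distrib_left)
    also have "\<dots> = h a b + z * (\<Sum>j<N. h a j * g j b)"
      using ab by (simp add: sum.distrib sum_delta_mult sum_distrib_left)
    finally show ?thesis by simp
  qed
  have gramdiff: "gram n C Y j i - gram n C V j i = - ((\<Sum>l<n. row_mult n U C j l * cnj (V i l)) + (\<Sum>l<n. row_mult n Y C j l * cnj (U i l)))" for j i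
  proof -
    have rU: "row_mult n U C j l = row_mult n V C j l - row_mult n Y C j l" for l
      by (simp add: row_mult_def U_def left_diff_distrib sum_subtractf)
    show ?thesis
      unfolding Y.gram_row_mult V.gram_row_mult sum.distrib[symmetric] sum_negf[symmetric] sum_subtractf[symmetric]
      by (intro sum.cong refl) (simp add: rU U_def algebra_simps)
  qed
  have "(\<Sum>i<N. g i i) - (\<Sum>i<N. h i i) = (\<Sum>a<N. - (\<Sum>j<N. \<Sum>i<N. h a j * (gram n C Y j i - gram n C V j i) * g i a))"
    unfolding sum_subtractf[symmetric] by (intro sum.cong refl) (simp add: diff)
  also have "\<dots> = (\<Sum>a<N. \<Sum>j<N. \<Sum>i<N. g i a * h a j * ((\<Sum>l<n. row_mult n U C j l * cnj (V i l)) + (\<Sum>l<n. row_mult n Y C j l * cnj (U i l))))"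
    unfolding gramdiff sum_negf[symmetric] by (intro sum.cong refl) (simp add: algebra_simps)
  also have "\<dots> = (\<Sum>j<N. \<Sum>a<N. \<Sum>i<N. g i a * h a j * ((\<Sum>l<n. row_mult n U C j l * cnj (V i l)) + (\<Sum>l<n. row_mult n Y C j l * cnj (U i l))))"
    by (rule sum.swap)
  also have "\<dots> = (\<Sum>j<N. \<Sum>i<N. P i j * ((\<Sum>l<n. row_mult n U C j l * cnj (V i l)) + (\<Sum>l<n. row_mult n Y C j l * cnj (U i l))))"
    unfolding P_def sum_distrib_right by (rule sum.cong[OF refl]) (rule sum.swap)
  also have "\<dots> = S U V + S Y U"
    unfolding S_def by (simp add: distrib_left sum.distrib)
  finally have eq: "(\<Sum>i<N. g i i) - (\<Sum>i<N. h i i) = S U V + S Y U" .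
  have fU: "frob N n U = frob N n (\<lambda>i k. Y i k - V i k)" unfolding frob_def U_def by (simp add: norm_minus_commute)
  have "(Im z)\<^sup>2 * cmod (S U V + S Y U) \<le> (Im z)\<^sup>2 * cmod (S U V) + (Im z)\<^sup>2 * cmod (S Y U)"
    unfolding distrib_left[symmetric] by (intro mult_left_mono norm_triangle_ineq) auto
  also have "\<dots> \<le> sqrt (frob N n U) * sqrt (frob N n V) + sqrt (frob N n Y) * sqrt (frob N n U)"
    by (intro add_mono S_bound)
  finally show ?thesis unfolding eq fU by (simp add: algebra_simps)
qed

lemma det_measurable:
  assumes "\<And>i j. i < N \<Longrightarrow> j < N \<Longrightarrow> (\<lambda>\<omega>. F \<omega> i j) \<in> borel_measurable M"
  shows "(\<lambda>\<omega>. det (mat N N (\<lambda>(i, j). F \<omega> i j)) :: complex) \<in> borel_measurable M"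
proof -
  have "det (mat N N (\<lambda>(i, j). F \<omega> i j)) = (\<Sum>p\<in>{p. p permutes {0..<N}}. signof p * (\<Prod>i=0..<N. F \<omega> i (p i)))" for \<omega>
    by (subst det_def'[of _ N]) (auto intro!: sum.cong prod.cong simp: permutes_in_image)
  moreover have "(\<lambda>\<omega>. \<Sum>p\<in>{p. p permutes {0..<N}}. signof p * (\<Prod>i=0..<N. F \<omega> i (p i))) \<in> borel_measurable M"
    by (intro borel_measurable_sum borel_measurable_times borel_measurable_prod borel_measurable_const assms)
       (auto dest: permutes_in_image)
  ultimately show ?thesis by simp
qed

lemma resolvent_measurable:
  assumes F: "\<And>i j. i < N \<Longrightarrow> j < N \<Longrightarrow> (\<lambda>\<omega>. F \<omega> i j) \<in> borel_measurable M" and ij: "i < N" "j < N"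
  shows "(\<lambda>\<omega>. resolvent N z (F \<omega>) i j) \<in> borel_measurable M"
proof -
  have 1: "(\<lambda>\<omega>. det (shifted_mat N z (F \<omega>))) \<in> borel_measurable M"
    unfolding shifted_mat_def by (rule det_measurable) (use F in measurable)
  have idx: "(if a < c then a else Suc a) < N" if "a < N - 1" for a c using that by auto
  have "mat_delete (shifted_mat N z (F \<omega>)) j i = mat (N - 1) (N - 1)
     (\<lambda>(a, b). (\<lambda>a b. F \<omega> (if a < j then a else Suc a) (if b < i then b else Suc b)
        - (if (if a < j then a else Suc a) = (if b < i then b else Suc b) then z else 0)) a b)" for \<omega>
    unfolding mat_delete_def shifted_mat_def by (intro eq_matI) auto
  then have "det (mat_delete (shifted_mat N z (F \<omega>)) j i) = det (mat (N - 1) (N - 1)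
     (\<lambda>(a, b). (\<lambda>a b. F \<omega> (if a < j then a else Suc a) (if b < i then b else Suc b)
        - (if (if a < j then a else Suc a) = (if b < i then b else Suc b) then z else 0)) a b))" for \<omega> by simp
  moreover have "(\<lambda>\<omega>. det (mat (N - 1) (N - 1)
     (\<lambda>(a, b). (\<lambda>a b. F \<omega> (if a < j then a else Suc a) (if b < i then b else Suc b)
        - (if (if a < j then a else Suc a) = (if b < i then b else Suc b) then z else 0)) a b))) \<in> borel_measurable M"
    by (rule det_measurable) (intro borel_measurable_diff F[OF idx idx] borel_measurable_const)
  ultimately have 2: "(\<lambda>\<omega>. det (mat_delete (shifted_mat N z (F \<omega>)) j i)) \<in> borel_measurable M" by simp
  have "resolvent N z (F \<omega>) i j = (-1) ^ (j + i) * det (mat_delete (shifted_mat N z (F \<omega>)) j i) / det (shifted_mat N z (F \<omega>))" for \<omega>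
    unfolding resolvent_def adj_mat_def cofactor_def using ij by (simp add: shifted_mat_def)
  then show ?thesis using 1 2 by simp
qed

lemma
  assumes Y: "\<And>i k. i < N \<Longrightarrow> k < n \<Longrightarrow> (\<lambda>\<omega>. Y \<omega> i k) \<in> borel_measurable M"
  shows gram_resolvent_measurable: "i < N \<Longrightarrow> j < N \<Longrightarrow> (\<lambda>\<omega>. resolvent N z (gram n C (Y \<omega>)) i j) \<in> borel_measurable M"
    and coresolvent_measurable: "(\<lambda>\<omega>. coresolvent N n z C (Y \<omega>) k l) \<in> borel_measurable M"
    and outer_gram_measurable: "i < N \<Longrightarrow> j < N \<Longrightarrow> (\<lambda>\<omega>. outer_gram n (Y \<omega>) i j) \<in> borel_measurable M"
    and frob_measurable: "(\<lambda>\<omega>. frob N n (Y \<omega>)) \<in> borel_measurable M"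
proof -
  have gram: "(\<lambda>\<omega>. gram n C (Y \<omega>) i j) \<in> borel_measurable M" if "i < N" "j < N" for i j
    unfolding gram_def using that
    by (intro borel_measurable_sum borel_measurable_times borel_measurable_cnj Y borel_measurable_const) auto
  show res: "(\<lambda>\<omega>. resolvent N z (gram n C (Y \<omega>)) i j) \<in> borel_measurable M" if "i < N" "j < N" for i j
    by (rule resolvent_measurable[OF gram that])
  have row: "(\<lambda>\<omega>. row_mult n (Y \<omega>) C i l) \<in> borel_measurable M" if "i < N" for i l
    unfolding row_mult_def using that
    by (intro borel_measurable_sum borel_measurable_times Y borel_measurable_const) auto
  show "(\<lambda>\<omega>. coresolvent N n z C (Y \<omega>) k l) \<in> borel_measurable M"
    unfolding coresolvent_def
    by (intro borel_measurable_sum borel_measurable_times borel_measurable_diff borel_measurable_cnj res row borel_measurable_const) auto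
  show "(\<lambda>\<omega>. outer_gram n (Y \<omega>) i j) \<in> borel_measurable M" if "i < N" "j < N"
    unfolding outer_gram_def using that
    by (intro borel_measurable_sum borel_measurable_times borel_measurable_cnj Y) auto
  show "(\<lambda>\<omega>. frob N n (Y \<omega>)) \<in> borel_measurable M"
    unfolding frob_def by (intro borel_measurable_sum borel_measurable_power measurable_compose[OF Y borel_measurable_norm]) auto
qed

section \<open>Spectral measures and their Stieltjes transforms\<close>

lemma logderiv_proots:
  fixes S :: "complex multiset"
  assumes "z \<notin># S"
  shows "poly (pderiv (\<Prod>x\<in>#S. [:- x, 1:])) z = (\<Sum>x\<in>#S. 1 / (z - x)) * poly (\<Prod>x\<in>#S. [:- x, 1:]) z"
  using assms
proof (induction S)
  case (add x S)
  then have zx: "z - x \<noteq> 0" by auto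
  define p where "p = (\<Prod>x\<in>#S. [:- x, 1:])"
  define s where "s = (\<Sum>x\<in>#S. 1 / (z - x))"
  have "poly (pderiv p) z = s * poly p z" using add unfolding p_def s_def by simp
  moreover have "poly (pderiv ([:- x, 1:] * p)) z = poly p z + (z - x) * poly (pderiv p) z"
    by (simp add: pderiv_mult pderiv_pCons del: mult_pCons_left)
  moreover have "poly ([:- x, 1:] * p) z = (z - x) * poly p z" by (simp del: mult_pCons_left)
  ultimately have "poly (pderiv ([:- x, 1:] * p)) z = (1 / (z - x) + s) * poly ([:- x, 1:] * p) z"
    using zx by (simp only: distrib_right) (simp add: field_simps)
  then show ?case unfolding p_def s_def by (simp del: mult_pCons_left)
qed simp

text \<open>By Cramer's rule the trace of the resolvent is a sum of principal minors over the determinant.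
  That sum is the derivative of the characteristic polynomial, so the trace is a logarithmic derivative, whose
  partial fractions count the eigenvalues with multiplicity.\<close>
lemma trace_resolvent_eq_proots:
  assumes M: "hermitian_on N M" and z: "Im z \<noteq> 0"
  defines "A \<equiv> mat N N (\<lambda>(i, j). M i j)"
  shows "(\<Sum>i<N. resolvent N z M i i) = (\<Sum>x\<in>#proots (char_poly A). 1 / (x - z))"
proof (cases "N = 0")
  case True
  then have "char_poly A = 1" unfolding char_poly_def A_def char_poly_matrix_def by (simp add: det_dim_zero)
  then show ?thesis using True by simp
next
  case False
  let ?S = "shifted_mat N z M"
  have A: "A \<in> carrier_mat N N" by (simp add: A_def)
  have cm: "char_matrix A z = ?S" unfolding char_matrix_def A_def shifted_mat_def by (intro eq_matI) auto
  have neg: "det (- B) = (-1) ^ k * det B" if "B \<in> carrier_mat k k" for B :: "complex mat" and k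
  proof -
    have "- B = (-1) \<cdot>\<^sub>m B" by (intro eq_matI) auto
    then show ?thesis using that by simp
  qed
  have p: "poly (char_poly A) z = (-1) ^ N * det ?S"
    unfolding char_poly_matrix[OF A] cm by (rule neg) simp
  have d: "det ?S \<noteq> 0" using det_shifted_nonzero[OF M z] .
  have lead: "lead_coeff (char_poly A) = 1" using degree_monic_char_poly[OF A] by simp
  have dec: "(\<Prod>x\<in>#proots (char_poly A). [:- x, 1:]) = char_poly A"
    using complex_poly_decompose_multiset[of "char_poly A"] lead by simp
  have cp0: "char_poly A \<noteq> 0" using lead by auto
  have zn: "z \<notin># proots (char_poly A)" using p d cp0 by (simp add: set_count_proots)
  have del: "poly (char_poly (mat_delete A i i)) z = (-1) ^ (N - 1) * det (mat_delete ?S i i)" if i: "i < N" for i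
  proof -
    have dA: "mat_delete A i i \<in> carrier_mat (N - 1) (N - 1)" by (rule mat_delete_carrier[OF A])
    have "char_matrix (mat_delete A i i) z = mat_delete ?S i i"
      using False i unfolding char_matrix_def mat_delete_def A_def shifted_mat_def by (intro eq_matI) auto
    then show ?thesis unfolding char_poly_matrix[OF dA]
      by (simp add: neg[OF mat_delete_carrier[OF shifted_mat_carrier]])
  qed
  have "poly (pderiv (char_poly A)) z = (\<Sum>i<N. (-1) ^ (N - 1) * det (mat_delete ?S i i))"
    unfolding pderiv_char_poly[OF A] poly_sum by (intro sum.cong refl) (simp add: del)
  also have "\<dots> = (-1) ^ (N - 1) * det ?S * (\<Sum>i<N. resolvent N z M i i)"
    unfolding sum_distrib_left resolvent_def using d
    by (intro sum.cong refl) (simp add: adj_mat_def cofactor_def shifted_mat_def power_add[symmetric] flip: mult_2)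
  finally have 1: "poly (pderiv (char_poly A)) z = (-1) ^ (N - 1) * det ?S * (\<Sum>i<N. resolvent N z M i i)" .
  have 2: "poly (pderiv (char_poly A)) z = (\<Sum>x\<in>#proots (char_poly A). 1 / (z - x)) * ((-1) ^ N * det ?S)"
    using logderiv_proots[OF zn] unfolding dec p .
  have neg_sum: "- (\<Sum>x\<in>#S. f x) = (\<Sum>x\<in>#S. - f x)" for f :: "complex \<Rightarrow> complex" and S
    by (induction S) auto
  have "(-1) ^ N = - ((-1) ^ (N - 1) :: complex)" using False by (cases N) auto
  then have "s * ((-1) ^ N * det ?S) = (-1) ^ (N - 1) * det ?S * - s" for s by simp
  then have "(-1) ^ (N - 1) * det ?S * (\<Sum>i<N. resolvent N z M i i) = (-1) ^ (N - 1) * det ?S * - (\<Sum>x\<in>#proots (char_poly A). 1 / (z - x))"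
    using 1 2 by metis
  moreover have "(-1) ^ (N - 1) * det ?S \<noteq> 0" using d by simp
  ultimately have "(\<Sum>i<N. resolvent N z M i i) = - (\<Sum>x\<in>#proots (char_poly A). 1 / (z - x))"
    using mult_left_cancel by blast
  also have "\<dots> = (\<Sum>x\<in>#proots (char_poly A). - (1 / (z - x)))"
    by (rule neg_sum)
  also have "\<dots> = (\<Sum>x\<in>#proots (char_poly A). 1 / (x - z))"
    by (intro arg_cong[where f = sum_mset] image_mset_cong) (metis minus_diff_eq minus_divide_right)
  finally show ?thesis .
qed

lemma hermitian_proots_real:
  assumes M: "hermitian_on N M" and x: "x \<in># proots (char_poly (mat N N (\<lambda>(i, j). M i j)))"
  shows "complex_of_real (Re x) = x"
proof (rule ccontr)
  let ?A = "mat N N (\<lambda>(i, j). M i j)"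
  assume "complex_of_real (Re x) \<noteq> x"
  then have "Im x \<noteq> 0" by (auto simp: complex_eq_iff)
  then have d: "det (shifted_mat N x M) \<noteq> 0" by (rule det_shifted_nonzero[OF M])
  have A: "?A \<in> carrier_mat N N" by simp
  have "char_matrix ?A x = shifted_mat N x M" unfolding char_matrix_def shifted_mat_def by (intro eq_matI) auto
  then have "\<not> eigenvalue ?A x" using eigenvalue_det[OF A] d by simp
  then have px: "poly (char_poly ?A) x \<noteq> 0" using eigenvalue_root_char_poly[OF A] by blast
  then have "char_poly ?A \<noteq> 0" by auto
  from set_count_proots[OF this] have "poly (char_poly ?A) x = 0" using x by blast
  then show False using px by contradiction
qed

definition spectral_measure :: "complex mat \<Rightarrow> real measure" where
  "spectral_measure A = distr (measure_pmf (pmf_of_multiset (proots (char_poly A)))) borel Re"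

lemma measure_pmf_of_multiset:
  assumes "S \<noteq> {#}"
  shows "measure_pmf.prob (pmf_of_multiset S) {x. P x} = size {#x \<in># S. P x#} / size S"
proof -
  have "measure_pmf.prob (pmf_of_multiset S) {x. P x} = measure_pmf.prob (pmf_of_multiset S) ({x. P x} \<inter> set_mset S)"
    using measure_Int_set_pmf[of "pmf_of_multiset S" "{x. P x}"] assms by simp
  also have "\<dots> = (\<Sum>x\<in>{x. P x} \<inter> set_mset S. real (count S x) / size S)"
    using assms by (subst measure_measure_pmf_finite) auto
  also have "\<dots> = real (\<Sum>x\<in>{x. P x} \<inter> set_mset S. count S x) / size S" by (simp add: sum_divide_distrib)
  also have "(\<Sum>x\<in>{x. P x} \<inter> set_mset S. count S x) = size {#x \<in># S. P x#}"
    unfolding size_multiset_overloaded_eq by (intro sum.cong) auto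
  finally show ?thesis .
qed

lemma sum_count_mult:
  fixes f :: "'a \<Rightarrow> complex"
  assumes "finite A" "set_mset S \<subseteq> A"
  shows "(\<Sum>x\<in>A. of_nat (count S x) * f x) = (\<Sum>x\<in>#S. f x)"
  using assms(2)
proof (induction S)
  case (add y S)
  have "(\<Sum>x\<in>A. of_nat (count (add_mset y S) x) * f x) = (\<Sum>x\<in>A. of_nat (count S x) * f x + (if x = y then f x else 0))"
    by (intro sum.cong) (auto simp: algebra_simps)
  then show ?case using add assms(1) by (simp add: sum.distrib add.commute)
qed simp

lemma integral_pmf_of_multiset:
  fixes f :: "'a \<Rightarrow> complex"
  assumes "S \<noteq> {#}"
  shows "(LINT x|measure_pmf (pmf_of_multiset S). f x) = (\<Sum>x\<in>#S. f x) / of_nat (size S)"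
proof -
  have "(LINT x|measure_pmf (pmf_of_multiset S). f x) = (\<Sum>x\<in>set_mset S. (count S x / size S) *\<^sub>R f x)"
    using assms by (subst integral_measure_pmf[of "set_mset S"]) auto
  also have "\<dots> = (\<Sum>x\<in>set_mset S. of_nat (count S x) * f x) / of_nat (size S)"
    by (simp add: sum_divide_distrib scaleR_conv_of_real)
  also have "(\<Sum>x\<in>set_mset S. of_nat (count S x) * f x) = (\<Sum>x\<in>#S. f x)"
    by (rule sum_count_mult) auto
  finally show ?thesis .
qed

lemma
  assumes A: "A \<in> carrier_mat N N" "N > 0"
  shows real_distribution_spectral_measure: "real_distribution (spectral_measure A)"
    and cdf_spectral_measure: "cdf (spectral_measure A) = esd A"
proof -
  have size: "size (proots (char_poly A)) = N"
    using degree_monic_char_poly[OF A(1)] by (simp add: size_proots_complex)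
  then have ne: "proots (char_poly A) \<noteq> {#}" using A by auto
  show "real_distribution (spectral_measure A)" unfolding spectral_measure_def
    by (intro real_distribution.intro real_distribution_axioms.intro prob_space.prob_space_distr measure_pmf.prob_space_axioms) auto
  show "cdf (spectral_measure A) = esd A"
  proof
    fix x
    have "cdf (spectral_measure A) x = measure_pmf.prob (pmf_of_multiset (proots (char_poly A))) {l. Re l \<le> x}"
      unfolding cdf_def spectral_measure_def by (subst measure_distr) (auto simp: vimage_def)
    then show "cdf (spectral_measure A) x = esd A x"
      unfolding measure_pmf_of_multiset[OF ne] esd_def using size A by simp
  qed
qed

lemma stieltjes_spectral_measure:
  assumes M: "hermitian_on N M" and z: "Im z > 0" and N: "N > 0"
  shows "stieltjes (spectral_measure (mat N N (\<lambda>(i, j). M i j))) z = (\<Sum>i<N. resolvent N z M i i) / of_nat N"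
proof -
  let ?A = "mat N N (\<lambda>(i, j). M i j)"
  have A: "?A \<in> carrier_mat N N" by simp
  have size: "size (proots (char_poly ?A)) = N"
    using degree_monic_char_poly[OF A] by (simp add: size_proots_complex)
  then have ne: "proots (char_poly ?A) \<noteq> {#}" using N by auto
  have "stieltjes (spectral_measure ?A) z = (LINT x|measure_pmf (pmf_of_multiset (proots (char_poly ?A))). 1 / (of_real (Re x) - z))"
    unfolding stieltjes_def spectral_measure_def
  proof (subst integral_distr)
    show "(\<lambda>x. 1 / (complex_of_real x - z)) \<in> borel_measurable borel" by measurable
  qed auto
  also have "\<dots> = (\<Sum>x\<in>#proots (char_poly ?A). 1 / (of_real (Re x) - z)) / of_nat N"
    using integral_pmf_of_multiset[OF ne] size by simp
  also have "(\<Sum>x\<in>#proots (char_poly ?A). 1 / (of_real (Re x) - z)) = (\<Sum>x\<in>#proots (char_poly ?A). 1 / (x - z))"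
    by (intro arg_cong[where f = sum_mset] image_mset_cong) (use hermitian_proots_real[OF M] in simp)
  also have "\<dots> = (\<Sum>i<N. resolvent N z M i i)"
    using trace_resolvent_eq_proots[OF M] z by simp
  finally show ?thesis .
qed

section \<open>The bounded differences inequality\<close>

text \<open>Induction over the coordinates: integrating out one coordinate multiplies the exponential moment
  by at most exp (l^2 c^2 / 2), by Hoeffding's lemma, and leaves a function with the same differences in the
  other coordinates.\<close>
lemma (in product_prob_space) bounded_differences_exp_moment:
  fixes f :: "('i \<Rightarrow> 'a) \<Rightarrow> real" and c l B :: real
  assumes "finite J" "l > 0" "c \<ge> 0"
    and "f \<in> borel_measurable (PiM J M)" "\<And>x. x \<in> space (PiM J M) \<Longrightarrow> \<bar>f x\<bar> \<le> B"
    and "\<And>x i y. x \<in> space (PiM J M) \<Longrightarrow> i \<in> J \<Longrightarrow> y \<in> space (M i) \<Longrightarrow> \<bar>f (x(i := y)) - f x\<bar> \<le> c"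
  shows "(\<integral>\<^sup>+x. exp (l * (f x - (\<integral>x. f x \<partial>PiM J M))) \<partial>PiM J M) \<le> ennreal (exp (l\<^sup>2 * c\<^sup>2 / 2 * card J))"
  using assms(1,4-)
proof (induction J arbitrary: f rule: finite_induct)
  case empty
  interpret E: prob_space "PiM {} M" by (rule prob_space_PiM) (rule prob_space)
  have const: "f x = f (\<lambda>_. undefined)" if "x \<in> space (PiM {} M)" for x using that by (simp add: space_PiM)
  have "(\<integral>x. f x \<partial>PiM {} M) = (\<integral>x. f (\<lambda>_. undefined) \<partial>PiM {} M)"
    by (intro Bochner_Integration.integral_cong refl) (rule const)
  then have E: "(\<integral>x. f x \<partial>PiM {} M) = f (\<lambda>_. undefined)" by (simp add: E.prob_space)
  have "(\<integral>\<^sup>+x. ennreal (exp (l * (f x - f (\<lambda>_. undefined)))) \<partial>PiM {} M) = (\<integral>\<^sup>+x. 1 \<partial>PiM {} M)"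
    by (intro nn_integral_cong) (simp add: space_PiM)
  then show ?case unfolding E by (simp add: E.emeasure_space_1)
next
  case (insert i J)
  note f [measurable] = insert.prems(1)
  interpret J: prob_space "PiM J M" by (rule prob_space_PiM) (rule prob_space)
  interpret iJ: prob_space "PiM (insert i J) M" by (rule prob_space_PiM) (rule prob_space)
  have [measurable]: "(\<lambda>(x, y). x(i := y)) \<in> measurable (PiM J M \<Otimes>\<^sub>M M i) (PiM (insert i J) M)"
    by (rule measurable_add_dim)
  have fm [measurable]: "(\<lambda>p. f ((fst p)(i := snd p))) \<in> borel_measurable (PiM J M \<Otimes>\<^sub>M M i)"
    by (rule measurable_compose[OF _ f]) (rule measurable_add_dim[of i J M, unfolded case_prod_unfold])
  have fx [measurable]: "(\<lambda>y. f (x(i := y))) \<in> borel_measurable (M i)" if "x \<in> space (PiM J M)" for x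
    using measurable_compose[OF measurable_Pair1'[OF that] fm] by simp
  have upd: "x(i := y) \<in> space (PiM (insert i J) M)" if "x \<in> space (PiM J M)" "y \<in> space (M i)" for x y
    using that by (auto simp: space_PiM PiE_def extensional_def Pi_iff)
  have fB: "\<bar>f (x(i := y))\<bar> \<le> B" if "x \<in> space (PiM J M)" "y \<in> space (M i)" for x y
    using insert.prems(2)[OF upd[OF that]] .
  \<comment> \<open>the coordinate i is integrated out; the induction hypothesis applies to h\<close>
  define h where "h x = (\<integral>y. f (x(i := y)) \<partial>M i)" for x
  have hm [measurable]: "h \<in> borel_measurable (PiM J M)" unfolding h_def
    by (rule sigma_finite_measure.borel_measurable_lebesgue_integral[OF sigma_finite_measures]) (use fm in \<open>simp add: case_prod_unfold\<close>)
  have fi: "integrable (M i) (\<lambda>y. f (x(i := y)))" if "x \<in> space (PiM J M)" for x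
    by (rule M.integrable_const_bound[of _ B]) (use fB fx that in auto)
  have hB: "\<bar>h x\<bar> \<le> B" if "x \<in> space (PiM J M)" for x
  proof -
    have "\<bar>h x\<bar> \<le> (\<integral>y. \<bar>f (x(i := y))\<bar> \<partial>M i)" unfolding h_def by (rule integral_abs_bound)
    also have "\<dots> \<le> (\<integral>y. B \<partial>M i)" using fB that fi[OF that] by (intro integral_mono) auto
    finally show ?thesis by (simp add: M.prob_space)
  qed
  have hd: "\<bar>h (x(j := y)) - h x\<bar> \<le> c" if x: "x \<in> space (PiM J M)" and j: "j \<in> J" and y: "y \<in> space (M j)" for x j y
  proof -
    have x': "x(j := y) \<in> space (PiM J M)" using x j y by (auto simp: space_PiM PiE_def extensional_def Pi_iff)
    have ij: "j \<noteq> i" using j insert.hyps by auto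
    have "\<bar>h (x(j := y)) - h x\<bar> = \<bar>\<integral>w. f (x(j := y, i := w)) - f (x(i := w)) \<partial>M i\<bar>"
      unfolding h_def using fi[OF x] fi[OF x'] by simp
    also have "\<dots> \<le> (\<integral>w. \<bar>f (x(j := y, i := w)) - f (x(i := w))\<bar> \<partial>M i)" by (rule integral_abs_bound)
    also have "\<dots> \<le> (\<integral>w. c \<partial>M i)"
    proof (rule integral_mono)
      show "integrable (M i) (\<lambda>w. \<bar>f (x(j := y, i := w)) - f (x(i := w))\<bar>)" using fi[OF x] fi[OF x'] by simp
      fix w assume w: "w \<in> space (M i)"
      show "\<bar>f (x(j := y, i := w)) - f (x(i := w))\<bar> \<le> c"
        using insert.prems(3)[OF upd[OF x w], of j y] j y unfolding fun_upd_twist[OF ij] by blast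
    qed simp
    finally show ?thesis by (simp add: M.prob_space)
  qed
  have Ef: "(\<integral>x. f x \<partial>PiM (insert i J) M) = (\<integral>x. h x \<partial>PiM J M)"
    unfolding h_def
    by (rule product_integral_insert[OF insert.hyps])
       (rule iJ.integrable_const_bound[of _ B], use insert.prems in auto)
  have hoeffding: "(\<integral>\<^sup>+y. exp (l * (f (x(i := y)) - h x)) \<partial>M i) \<le> ennreal (exp (l\<^sup>2 * c\<^sup>2 / 2))" if x: "x \<in> space (PiM J M)" for x
  proof -
    obtain y0 where y0: "y0 \<in> space (M i)" using M.not_empty by auto
    have "\<bar>f (x(i := y)) - f (x(i := y0))\<bar> \<le> c" if "y \<in> space (M i)" for y
      using insert.prems(3)[OF upd[OF x y0], of i y] that unfolding fun_upd_upd by blast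
    then have ab: "f (x(i := y)) \<in> {f (x(i := y0)) - c .. f (x(i := y0)) + c}" if "y \<in> space (M i)" for y
      using that by (force simp: abs_le_iff)
    interpret R: interval_bounded_random_variable "M i" "\<lambda>y. f (x(i := y))" "f (x(i := y0)) - c" "f (x(i := y0)) + c"
      by unfold_locales (use fx[OF x] ab in auto)
    show ?thesis using R.Hoeffdings_lemma_nn_integral[OF \<open>l > 0\<close>]
      unfolding h_def by (simp add: power2_eq_square algebra_simps)
  qed
  let ?E = "\<integral>x. f x \<partial>PiM (insert i J) M"
  have "(\<integral>\<^sup>+x. exp (l * (f x - ?E)) \<partial>PiM (insert i J) M)
      = (\<integral>\<^sup>+x. (\<integral>\<^sup>+y. exp (l * (f (x(i := y)) - ?E)) \<partial>M i) \<partial>PiM J M)"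
    by (rule product_nn_integral_insert[OF insert.hyps]) simp
  also have "\<dots> = (\<integral>\<^sup>+x. exp (l * (h x - ?E)) * (\<integral>\<^sup>+y. exp (l * (f (x(i := y)) - h x)) \<partial>M i) \<partial>PiM J M)"
  proof (rule nn_integral_cong)
    fix x assume x: "x \<in> space (PiM J M)"
    note fx[OF x, measurable]
    have "(\<integral>\<^sup>+y. exp (l * (f (x(i := y)) - ?E)) \<partial>M i) = (\<integral>\<^sup>+y. ennreal (exp (l * (h x - ?E))) * ennreal (exp (l * (f (x(i := y)) - h x))) \<partial>M i)"
      by (intro nn_integral_cong) (simp add: ennreal_mult'[symmetric] exp_add[symmetric] algebra_simps)
    also have "\<dots> = exp (l * (h x - ?E)) * (\<integral>\<^sup>+y. exp (l * (f (x(i := y)) - h x)) \<partial>M i)"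
      by (rule nn_integral_cmult) simp
    finally show "(\<integral>\<^sup>+y. exp (l * (f (x(i := y)) - ?E)) \<partial>M i) = exp (l * (h x - ?E)) * (\<integral>\<^sup>+y. exp (l * (f (x(i := y)) - h x)) \<partial>M i)" .
  qed
  also have "\<dots> \<le> (\<integral>\<^sup>+x. ennreal (exp (l * (h x - ?E))) * ennreal (exp (l\<^sup>2 * c\<^sup>2 / 2)) \<partial>PiM J M)"
    using hoeffding by (intro nn_integral_mono mult_left_mono) auto
  also have "\<dots> = (\<integral>\<^sup>+x. exp (l * (h x - ?E)) \<partial>PiM J M) * ennreal (exp (l\<^sup>2 * c\<^sup>2 / 2))"
    by (rule nn_integral_multc) simp
  also have "\<dots> \<le> ennreal (exp (l\<^sup>2 * c\<^sup>2 / 2 * card J)) * ennreal (exp (l\<^sup>2 * c\<^sup>2 / 2))"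
    unfolding Ef using insert.IH[OF hm hB hd] by (intro mult_right_mono) auto
  also have "\<dots> = ennreal (exp (l\<^sup>2 * c\<^sup>2 / 2 * card (insert i J)))"
    using insert.hyps by (simp add: ennreal_mult'[symmetric] exp_add[symmetric] algebra_simps)
  finally show ?case .
qed

text \<open>Markov's inequality for the exponential moment, applied to the joint law, which is a product
  measure by independence.\<close>
lemma (in prob_space) bounded_differences_upper_tail:
  fixes f :: "('i \<Rightarrow> 'b) \<Rightarrow> real" and c d B :: real
  assumes I: "finite I" "I \<noteq> {}" and ind: "indep_vars S X I" and c: "c > 0" and d: "d > 0"
    and f [measurable]: "f \<in> borel_measurable (PiM I S)" and B: "\<And>x. x \<in> space (PiM I S) \<Longrightarrow> \<bar>f x\<bar> \<le> B"
    and diff: "\<And>x i y. x \<in> space (PiM I S) \<Longrightarrow> i \<in> I \<Longrightarrow> y \<in> space (S i) \<Longrightarrow> \<bar>f (x(i := y)) - f x\<bar> \<le> c"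
  defines "F \<equiv> (\<lambda>\<omega>. f (\<lambda>i\<in>I. X i \<omega>))"
  shows "prob {\<omega> \<in> space M. d \<le> F \<omega> - expectation F} \<le> exp (- (d\<^sup>2 / (2 * c\<^sup>2 * card I)))"
proof -
  have rv: "X i \<in> measurable M (S i)" if "i \<in> I" for i using ind that by (auto simp: indep_vars_def)
  define D where "D i = (if i \<in> I then distr M (S i) (X i) else return (count_space UNIV) undefined)" for i
  have "prob_space (D i)" for i unfolding D_def using rv by (auto intro!: prob_space_distr prob_space_return)
  then interpret D: product_prob_space D by (rule product_prob_spaceI)
  have DPi: "PiM I D = PiM I (\<lambda>i. distr M (S i) (X i))" by (intro PiM_cong) (auto simp: D_def)
  have XI [measurable]: "(\<lambda>\<omega>. \<lambda>i\<in>I. X i \<omega>) \<in> measurable M (PiM I S)"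
    using rv by (intro measurable_restrict) auto
  have distr: "distr M (PiM I S) (\<lambda>\<omega>. \<lambda>i\<in>I. X i \<omega>) = PiM I D"
    unfolding DPi using indep_vars_iff_distr_eq_PiM'[OF I(2) rv] ind by simp
  have sets: "sets (PiM I D) = sets (PiM I S)" unfolding distr[symmetric] by simp
  have sp: "space (PiM I D) = space (PiM I S)" unfolding distr[symmetric] by simp
  have spi: "space (D i) = space (S i)" if "i \<in> I" for i using that by (simp add: D_def)
  have fD: "f \<in> borel_measurable (PiM I D)" using f measurable_cong_sets[OF sets refl] by blast
  have EF: "(\<integral>x. f x \<partial>PiM I D) = expectation F" unfolding distr[symmetric] F_def by (subst integral_distr) auto
  \<comment> \<open>the minimiser of the exponent l^2 c^2 |I| / 2 - l d\<close>
  define l where "l = d / (c\<^sup>2 * card I)"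
  have cI: "real (card I) > 0" using I by (simp add: card_gt_0_iff)
  have l: "l > 0" unfolding l_def using d c cI by simp
  have [measurable]: "F \<in> borel_measurable M" unfolding F_def by measurable
  have "(\<integral>\<^sup>+\<omega>. exp (l * (F \<omega> - expectation F)) \<partial>M) = (\<integral>\<^sup>+x. exp (l * (f x - expectation F)) \<partial>distr M (PiM I S) (\<lambda>\<omega>. \<lambda>i\<in>I. X i \<omega>))"
    unfolding F_def by (subst nn_integral_distr) auto
  also have "\<dots> \<le> ennreal (exp (l\<^sup>2 * c\<^sup>2 / 2 * card I))"
    unfolding distr EF[symmetric]
    by (rule D.bounded_differences_exp_moment[OF I(1) l _ fD, of c B]) (use c B diff sp spi in auto)
  finally have mom: "(\<integral>\<^sup>+\<omega>. exp (l * (F \<omega> - expectation F)) \<partial>M) \<le> ennreal (exp (l\<^sup>2 * c\<^sup>2 / 2 * card I))" .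
  have "emeasure M {\<omega> \<in> space M. d \<le> F \<omega> - expectation F}
      \<le> emeasure M {\<omega> \<in> space M. 1 \<le> ennreal (exp (- (l * d))) * ennreal (exp (l * (F \<omega> - expectation F)))}"
  proof (rule emeasure_mono)
    show "{\<omega> \<in> space M. d \<le> F \<omega> - expectation F} \<subseteq> {\<omega> \<in> space M. 1 \<le> ennreal (exp (- (l * d))) * ennreal (exp (l * (F \<omega> - expectation F)))}"
      using l by (auto simp: ennreal_mult'[symmetric] exp_add[symmetric] ennreal_le_1[symmetric] one_le_exp_iff mult_left_mono ennreal_ge_1)
  qed measurable
  also have "\<dots> \<le> ennreal (exp (- (l * d))) * (\<integral>\<^sup>+\<omega>. ennreal (exp (l * (F \<omega> - expectation F))) * indicator (space M) \<omega> \<partial>M)"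
    by (rule nn_integral_Markov_inequality) simp_all
  also have "(\<integral>\<^sup>+\<omega>. ennreal (exp (l * (F \<omega> - expectation F))) * indicator (space M) \<omega> \<partial>M) = (\<integral>\<^sup>+\<omega>. exp (l * (F \<omega> - expectation F)) \<partial>M)"
    by (intro nn_integral_cong) auto
  also have "ennreal (exp (- (l * d))) * \<dots> \<le> ennreal (exp (- (l * d))) * ennreal (exp (l\<^sup>2 * c\<^sup>2 / 2 * card I))"
    by (intro mult_left_mono mom) simp
  also have "\<dots> = ennreal (exp (- (d\<^sup>2 / (2 * c\<^sup>2 * card I))))"
  proof -
    have "- (l * d) + l\<^sup>2 * c\<^sup>2 / 2 * card I = - (d\<^sup>2 / (2 * c\<^sup>2 * card I))"
      unfolding l_def using c cI by (simp add: field_simps power2_eq_square)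
    then show ?thesis by (simp add: ennreal_mult'[symmetric] exp_add[symmetric])
  qed
  finally show ?thesis by (simp add: emeasure_eq_measure)
qed

lemma (in prob_space) bounded_differences_tail:
  fixes f :: "('i \<Rightarrow> 'b) \<Rightarrow> real" and c d B :: real
  assumes I: "finite I" "I \<noteq> {}" and ind: "indep_vars S X I" and c: "c > 0" and d: "d > 0"
    and f [measurable]: "f \<in> borel_measurable (PiM I S)" and B: "\<And>x. x \<in> space (PiM I S) \<Longrightarrow> \<bar>f x\<bar> \<le> B"
    and diff: "\<And>x i y. x \<in> space (PiM I S) \<Longrightarrow> i \<in> I \<Longrightarrow> y \<in> space (S i) \<Longrightarrow> \<bar>f (x(i := y)) - f x\<bar> \<le> c"
  defines "F \<equiv> (\<lambda>\<omega>. f (\<lambda>i\<in>I. X i \<omega>))"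
  shows "prob {\<omega> \<in> space M. d \<le> \<bar>F \<omega> - expectation F\<bar>} \<le> 2 * exp (- (d\<^sup>2 / (2 * c\<^sup>2 * card I)))"
proof -
  have rv: "X i \<in> measurable M (S i)" if "i \<in> I" for i using ind that by (auto simp: indep_vars_def)
  have XI [measurable]: "(\<lambda>\<omega>. \<lambda>i\<in>I. X i \<omega>) \<in> measurable M (PiM I S)"
    using rv by (intro measurable_restrict) auto
  have [measurable]: "F \<in> borel_measurable M" unfolding F_def by measurable
  have 1: "prob {\<omega> \<in> space M. d \<le> F \<omega> - expectation F} \<le> exp (- (d\<^sup>2 / (2 * c\<^sup>2 * card I)))"
    unfolding F_def by (rule bounded_differences_upper_tail[OF I ind c d f B diff])
  have "\<bar>- f (x(i := y)) - - f x\<bar> \<le> c" if "x \<in> space (PiM I S)" "i \<in> I" "y \<in> space (S i)" for x i y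
    using diff[OF that] by simp
  from bounded_differences_upper_tail[OF I ind c d, of "\<lambda>x. - f x" B, OF _ _ this]
  have 2: "prob {\<omega> \<in> space M. d \<le> - F \<omega> + expectation F} \<le> exp (- (d\<^sup>2 / (2 * c\<^sup>2 * card I)))"
    unfolding F_def using B by simp
  have "prob {\<omega> \<in> space M. d \<le> \<bar>F \<omega> - expectation F\<bar>}
     \<le> prob ({\<omega> \<in> space M. d \<le> F \<omega> - expectation F} \<union> {\<omega> \<in> space M. d \<le> - F \<omega> + expectation F})"
    by (rule finite_measure_mono) (auto simp: abs_if split: if_splits)
  also have "\<dots> \<le> prob {\<omega> \<in> space M. d \<le> F \<omega> - expectation F} + prob {\<omega> \<in> space M. d \<le> - F \<omega> + expectation F}"
    by (rule measure_Un_le) measurable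
  finally show ?thesis using 1 2 by simp
qed

section \<open>Convergence of measures from Stieltjes transforms\<close>

lemma cmod_inverse_shift_le:
  assumes "Im z > 0"
  shows "cmod (1 / (complex_of_real x - z)) \<le> 1 / Im z"
proof -
  have "Im z \<le> cmod (complex_of_real x - z)" using abs_Im_le_cmod[of "complex_of_real x - z"] assms by simp
  then show ?thesis using assms by (simp add: norm_divide frac_le)
qed

lemma shift_nonzero: "Im z > 0 \<Longrightarrow> complex_of_real x - z \<noteq> 0"
  by (auto simp: complex_eq_iff)

lemma complex_exp_limit:
  fixes w :: complex
  shows "(\<lambda>n. (1 + w / of_nat n) ^ n) \<longlonglongrightarrow> exp w"
proof (cases "w = 0")
  case False
  have "((\<lambda>h. Ln h) has_field_derivative 1 / 1) (at 1)"
    by (rule has_field_derivative_Ln[of 1, unfolded inverse_eq_divide]) auto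
  then have "((\<lambda>h. (Ln (1 + h) - Ln 1) / h) \<longlongrightarrow> 1) (at 0)"
    unfolding DERIV_def by simp
  then have L: "((\<lambda>h. Ln (1 + h) / h) \<longlongrightarrow> 1) (at 0)" by simp
  have "(\<lambda>n. w / of_nat n) \<longlonglongrightarrow> 0" by (rule lim_const_over_n)
  then have "filterlim (\<lambda>n. w / of_nat n) (at 0) sequentially"
    using False by (auto simp: filterlim_at intro!: eventually_mono[OF eventually_gt_at_top[of 0]])
  from filterlim_compose[OF L this]
  have "(\<lambda>n. w * (Ln (1 + w / of_nat n) / (w / of_nat n))) \<longlonglongrightarrow> w * 1" by (intro tendsto_mult tendsto_const)
  then have "(\<lambda>n. exp (w * (Ln (1 + w / of_nat n) / (w / of_nat n)))) \<longlonglongrightarrow> exp w" by (intro tendsto_exp) simp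
  moreover have "eventually (\<lambda>n. exp (w * (Ln (1 + w / of_nat n) / (w / of_nat n))) = (1 + w / of_nat n) ^ n) sequentially"
  proof -
    have "eventually (\<lambda>n. dist (w / of_nat n) 0 < 1) sequentially"
      using tendstoD[OF \<open>(\<lambda>n. w / of_nat n) \<longlonglongrightarrow> 0\<close>, of 1] by simp
    then show ?thesis using eventually_gt_at_top[of 0]
    proof eventually_elim
      case (elim n)
      then have "1 + w / of_nat n \<noteq> 0"
        by (metis add_eq_0_iff dist_0_norm dist_commute less_irrefl norm_minus_cancel norm_one)
      moreover have "w * (Ln (1 + w / of_nat n) / (w / of_nat n)) = of_nat n * Ln (1 + w / of_nat n)"
        using False elim by (simp add: field_simps)
      ultimately show ?case by (simp add: exp_of_nat_mult)
    qed
  qed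
  ultimately show ?thesis by (rule Lim_transform_eventually)
qed simp

context real_distribution begin

lemma integrable_bounded_continuous:
  fixes f :: "real \<Rightarrow> complex"
  assumes "continuous_on UNIV f" "\<And>x. cmod (f x) \<le> B"
  shows "integrable M f"
  by (rule integrable_const_bound[of _ B]) (use assms in \<open>auto intro!: measurable_finite_borel borel_measurable_continuous_onI\<close>)

text \<open>The products 1 / (x - z)^k * 1 / (x - w) serve two purposes: k = 1 is the difference quotient of
  the Stieltjes transform, and letting k grow recovers the characteristic function.\<close>
lemma integrable_resolvent_powers:
  assumes "Im z > 0" "Im w > 0"
  shows "integrable M (\<lambda>x. 1 / (of_real x - z) ^ k * (1 / (of_real x - w)))"
proof (rule integrable_bounded_continuous)
  show "continuous_on UNIV (\<lambda>x. 1 / (complex_of_real x - z) ^ k * (1 / (complex_of_real x - w)))"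
    by (intro continuous_intros) (use shift_nonzero assms in auto)
  show "cmod (1 / (complex_of_real x - z) ^ k * (1 / (complex_of_real x - w))) \<le> (1 / Im z) ^ k * (1 / Im w)" for x
    using cmod_inverse_shift_le[OF assms(1), of x] cmod_inverse_shift_le[OF assms(2), of x] assms
    unfolding norm_mult power_one_over[symmetric] norm_power by (intro mult_mono power_mono) auto
qed

lemma integral_resolvent_tendsto:
  assumes z: "Im z > 0" and w: "\<And>m. Im (w m) \<ge> d" "d > 0" "w \<longlonglongrightarrow> w0" "Im w0 > 0"
  shows "(\<lambda>m. (LINT x|M. 1 / (of_real x - z) ^ k * (1 / (of_real x - w m)))) \<longlonglongrightarrow> (LINT x|M. 1 / (of_real x - z) ^ k * (1 / (of_real x - w0)))"
proof (rule integral_dominated_convergence[where w = "\<lambda>_. (1 / Im z) ^ k * (1 / d)"])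
  have wm: "Im (w m) > 0" for m using w(1)[of m] w(2) by simp
  show "(\<lambda>x. 1 / (complex_of_real x - z) ^ k * (1 / (complex_of_real x - w0))) \<in> borel_measurable M"
    using integrable_resolvent_powers[OF z w(4)] by (rule borel_measurable_integrable)
  show "(\<lambda>x. 1 / (complex_of_real x - z) ^ k * (1 / (complex_of_real x - w m))) \<in> borel_measurable M" for m
    using integrable_resolvent_powers[OF z wm] by (rule borel_measurable_integrable)
  show "AE x in M. (\<lambda>m. 1 / (complex_of_real x - z) ^ k * (1 / (complex_of_real x - w m))) \<longlonglongrightarrow> 1 / (complex_of_real x - z) ^ k * (1 / (complex_of_real x - w0))"
    using shift_nonzero[OF w(4)] by (intro AE_I2 tendsto_intros w(3)) auto
  show "AE x in M. cmod (1 / (complex_of_real x - z) ^ k * (1 / (complex_of_real x - w m))) \<le> (1 / Im z) ^ k * (1 / d)" for m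
  proof (rule AE_I2)
    fix x
    have "1 / Im (w m) \<le> 1 / d" using w(1)[of m] w(2) by (simp add: frac_le)
    then have "cmod (1 / (complex_of_real x - w m)) \<le> 1 / d" using cmod_inverse_shift_le[OF wm, of x m] by simp
    then show "cmod (1 / (complex_of_real x - z) ^ k * (1 / (complex_of_real x - w m))) \<le> (1 / Im z) ^ k * (1 / d)"
      using cmod_inverse_shift_le[OF z, of x] z w(2)
      unfolding norm_mult power_one_over[symmetric] norm_power by (intro mult_mono power_mono) auto
  qed
qed simp

lemma stieltjes_tendsto:
  assumes "\<And>m. Im (w m) \<ge> d" "d > 0" "w \<longlonglongrightarrow> w0" "Im w0 > 0"
  shows "(\<lambda>m. stieltjes M (w m)) \<longlonglongrightarrow> stieltjes M w0"
  using integral_resolvent_tendsto[of \<i> d w w0 0] assms unfolding stieltjes_def by simp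

lemma stieltjes_holomorphic: "stieltjes M holomorphic_on {z. Im z > 0}"
proof (rule holomorphic_onI)
  fix z :: complex assume "z \<in> {z. Im z > 0}"
  then have z: "Im z > 0" by simp
  let ?D = "LINT x|M. 1 / (of_real x - z) ^ 1 * (1 / (of_real x - z))"
  have "((\<lambda>w. (stieltjes M w - stieltjes M z) / (w - z)) \<longlongrightarrow> ?D) (at z within {z. Im z > 0})"
    unfolding tendsto_at_iff_sequentially
  proof (intro allI impI)
    fix X assume X: "\<forall>i. X i \<in> {z. 0 < Im z} - {z}" "X \<longlonglongrightarrow> z"
    have "eventually (\<lambda>i. Im (X i) > Im z / 2) sequentially"
      using order_tendstoD(1)[OF tendsto_Im[OF X(2)], of "Im z / 2"] z by simp
    then obtain m0 where m0: "\<And>i. i \<ge> m0 \<Longrightarrow> Im (X i) > Im z / 2" by (auto simp: eventually_sequentially)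
    have "(\<lambda>m. (LINT x|M. 1 / (of_real x - z) ^ 1 * (1 / (of_real x - X (m + m0))))) \<longlonglongrightarrow> ?D"
      by (rule integral_resolvent_tendsto[OF z, of "Im z / 2"]) (use m0 X z LIMSEQ_ignore_initial_segment[OF X(2)] in \<open>auto intro!: less_imp_le\<close>)
    moreover have "(LINT x|M. 1 / (of_real x - z) ^ 1 * (1 / (of_real x - X m))) = (stieltjes M (X m) - stieltjes M z) / (X m - z)" for m
    proof -
      have Xm: "Im (X m) > 0" "X m \<noteq> z" using X by auto
      have i: "integrable M (\<lambda>x. 1 / (complex_of_real x - w))" if "Im w > 0" for w
        using integrable_resolvent_powers[OF that that, of 0] by simp
      have "(LINT x|M. 1 / (of_real x - z) ^ 1 * (1 / (of_real x - X m)))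
         = (LINT x|M. (1 / (of_real x - X m) - 1 / (of_real x - z)) / (X m - z))"
      proof (intro Bochner_Integration.integral_cong refl)
        fix x
        have gen: "1 / q ^ 1 * (1 / p) = (1 / p - 1 / q) / (q - p)" if "p \<noteq> 0" "q \<noteq> 0" "p \<noteq> q" for p q :: complex
        proof -
          have "1 / p - 1 / q = (q - p) / (p * q)" using that by (simp add: field_simps)
          then show ?thesis using that by simp
        qed
        show "1 / (complex_of_real x - z) ^ 1 * (1 / (complex_of_real x - X m)) = (1 / (complex_of_real x - X m) - 1 / (complex_of_real x - z)) / (X m - z)"
          using gen[OF shift_nonzero[OF Xm(1)] shift_nonzero[OF z], of x x] Xm by simp
      qed
      also have "\<dots> = (stieltjes M (X m) - stieltjes M z) / (X m - z)"
        unfolding stieltjes_def using i[OF z] i[OF Xm(1)] by simp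
      finally show ?thesis .
    qed
    ultimately have "(\<lambda>m. (stieltjes M (X (m + m0)) - stieltjes M z) / (X (m + m0) - z)) \<longlonglongrightarrow> ?D" by simp
    then have "(\<lambda>m. (stieltjes M (X m) - stieltjes M z) / (X m - z)) \<longlonglongrightarrow> ?D"
      by (rule LIMSEQ_offset)
    then show "((\<lambda>w. (stieltjes M w - stieltjes M z) / (w - z)) \<circ> X) \<longlonglongrightarrow> ?D" by (simp add: comp_def)
  qed
  then have "(stieltjes M has_field_derivative ?D) (at z within {z. Im z > 0})"
    by (simp add: has_field_derivative_iff)
  then show "stieltjes M field_differentiable at z within {z. 0 < Im z}"
    by (auto simp: field_differentiable_def)
qed

text \<open>The Post-Widder inversion (1 + i t x / n)^-n -> exp (- i t x): up to a constant factor, the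
  left-hand side is a power of 1 / (x - i n / t), evaluated on the imaginary axis at a height that tends to
  infinity. Hence knowing the Stieltjes transform high on the axis is enough.\<close>
lemma char_as_resolvent_limit:
  assumes t: "t > 0"
  shows "(\<lambda>n. (of_real (real (Suc n) / t) / \<i>) ^ Suc n * (LINT x|M. 1 / (of_real x - \<i> * of_real (real (Suc n) / t)) ^ n * (1 / (of_real x - \<i> * of_real (real (Suc n) / t))))) \<longlonglongrightarrow> char M (- t)"
proof -
  define g where "g n x = 1 / (1 + \<i> * of_real (t * x) / of_nat n) ^ n" for n and x :: real
  have nz: "1 + \<i> * complex_of_real (t * x) / of_nat n \<noteq> 0" for n x
    by (auto simp: complex_eq_iff)
  have le1: "cmod (g n x) \<le> 1" for n x
  proof -
    have "1 \<le> cmod (1 + \<i> * complex_of_real (t * x) / of_nat n)"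
      using abs_Re_le_cmod[of "1 + \<i> * complex_of_real (t * x) / of_nat n"] by simp
    then have "1 \<le> cmod (1 + \<i> * complex_of_real (t * x) / of_nat n) ^ n" by (rule one_le_power)
    from frac_le[OF _ order_refl _ this, of 1] show ?thesis unfolding g_def norm_divide norm_power by simp
  qed
  have lim: "(\<lambda>n. g n x) \<longlonglongrightarrow> iexp (- t * x)" for x
  proof -
    have "(\<lambda>n. 1 / (1 + \<i> * of_real (t * x) / of_nat n) ^ n) \<longlonglongrightarrow> 1 / exp (\<i> * of_real (t * x))"
      by (intro tendsto_divide tendsto_const complex_exp_limit) simp
    moreover have "1 / exp (\<i> * of_real (t * x)) = iexp (- t * x)" by (simp add: exp_minus divide_inverse)
    ultimately show ?thesis unfolding g_def by simp
  qed
  have "(\<lambda>n. LINT x|M. g (Suc n) x) \<longlonglongrightarrow> (LINT x|M. iexp (- t * x))"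
  proof (rule integral_dominated_convergence[where w = "\<lambda>_. 1"])
    show "(\<lambda>x. iexp (- t * x)) \<in> borel_measurable M"
      by (intro measurable_finite_borel borel_measurable_continuous_onI continuous_intros)
    show "g (Suc n) \<in> borel_measurable M" for n unfolding g_def
      by (intro measurable_finite_borel borel_measurable_continuous_onI continuous_intros) (use nz in \<open>auto simp del: of_nat_Suc of_real_mult\<close>)
    show "AE x in M. (\<lambda>n. g (Suc n) x) \<longlonglongrightarrow> iexp (- t * x)" using LIMSEQ_Suc[OF lim] by simp
    show "AE x in M. cmod (g (Suc n) x) \<le> 1" for n using le1 by simp
  qed simp
  moreover have "(LINT x|M. g (Suc n) x) = (of_real (real (Suc n) / t) / \<i>) ^ Suc n * (LINT x|M. 1 / (of_real x - \<i> * of_real (real (Suc n) / t)) ^ n * (1 / (of_real x - \<i> * of_real (real (Suc n) / t))))" for n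
  proof -
    let ?y = "complex_of_real (real (Suc n) / t)"
    have gen: "1 + \<i> * of_real x / Y = (of_real x - \<i> * Y) * \<i> / Y" if "Y \<noteq> 0" for Y :: complex and x
      using that by (simp add: field_simps)
    have gen2: "1 / (P * \<i> / Y) = (Y / \<i>) * (1 / P)" if "P \<noteq> 0" "Y \<noteq> 0" for P Y :: complex
      using that by (simp add: field_simps)
    have y: "?y \<noteq> 0" using t by (simp del: of_nat_Suc)
    have "g (Suc n) x = (?y / \<i>) ^ Suc n * (1 / (of_real x - \<i> * ?y) ^ n * (1 / (of_real x - \<i> * ?y)))" for x
    proof -
      have nz2: "complex_of_real x - \<i> * ?y \<noteq> 0" using t by (auto simp: complex_eq_iff)
      have ty: "\<i> * complex_of_real (t * x) / of_nat (Suc n) = \<i> * of_real x / ?y" using t by (simp del: of_nat_Suc)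
      have "1 + \<i> * complex_of_real (t * x) / of_nat (Suc n) = (of_real x - \<i> * ?y) * \<i> / ?y"
        unfolding ty by (rule gen[OF y])
      then have "g (Suc n) x = (1 / ((of_real x - \<i> * ?y) * \<i> / ?y)) ^ Suc n"
        unfolding g_def by (simp only: power_one_over)
      also have "1 / ((of_real x - \<i> * ?y) * \<i> / ?y) = (?y / \<i>) * (1 / (of_real x - \<i> * ?y))"
        by (rule gen2[OF nz2 y])
      finally show ?thesis by (simp only: power_mult_distrib power_Suc power_one_over[symmetric] mult_ac)
    qed
    then show ?thesis by (simp only: Bochner_Integration.integral_mult_right_zero)
  qed
  ultimately show ?thesis unfolding char_def by (simp add: mult.commute)
qed

end

text \<open>Induction on k by partial fractions, 1 / ((x - i y)(x - i w)) being a difference quotient of 1 /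
  (x - i y). The case w = y is the limit of the others.\<close>
lemma resolvent_moments_eq:
  assumes M: "real_distribution M" and N: "real_distribution N" and y0: "y0 \<ge> 0"
    and eq: "\<And>y. y > y0 \<Longrightarrow> stieltjes M (\<i> * of_real y) = stieltjes N (\<i> * of_real y)"
    and y: "y > y0" "y' > y0"
  shows "(LINT x|M. 1 / (of_real x - \<i> * of_real y) ^ k * (1 / (of_real x - \<i> * of_real y')))
       = (LINT x|N. 1 / (of_real x - \<i> * of_real y) ^ k * (1 / (of_real x - \<i> * of_real y')))"
  using y
proof (induction k arbitrary: y')
  case 0
  then show ?case using eq unfolding stieltjes_def by simp
next
  case (Suc k)
  let ?I = "\<lambda>M k y'. LINT x|M. 1 / (complex_of_real x - \<i> * of_real y) ^ k * (1 / (of_real x - \<i> * of_real y'))"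
  have ne: "?I M (Suc k) w = ?I N (Suc k) w" if w: "w > y0" "w \<noteq> y" for w
  proof -
    have "?I P (Suc k) w = (?I P k y - ?I P k w) / (\<i> * of_real (y - w))" if "real_distribution P" for P
    proof -
      interpret P: real_distribution P by fact
      have i: "integrable P (\<lambda>x. 1 / (complex_of_real x - \<i> * of_real y) ^ k * (1 / (of_real x - \<i> * of_real v)))" if "v > y0" for v
        by (rule P.integrable_resolvent_powers) (use that Suc.prems y0 in auto)
      have "1 / (complex_of_real x - \<i> * of_real y) ^ Suc k * (1 / (of_real x - \<i> * of_real w))
          = (1 / (complex_of_real x - \<i> * of_real y) ^ k * (1 / (of_real x - \<i> * of_real y))
           - 1 / (complex_of_real x - \<i> * of_real y) ^ k * (1 / (of_real x - \<i> * of_real w))) / (\<i> * of_real (y - w))" for x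
      proof -
        have gen: "1 / p ^ Suc k * (1 / q) = (1 / p ^ k * (1 / p) - 1 / p ^ k * (1 / q)) / (q - p)" if "p \<noteq> 0" "q \<noteq> 0" "p \<noteq> q" for p q :: complex
        proof -
          have "1 / p - 1 / q = (q - p) / (p * q)" using that by (simp add: field_simps)
          then have "(1 / p ^ k * (1 / p) - 1 / p ^ k * (1 / q)) = 1 / p ^ k * ((q - p) / (p * q))"
            by (simp only: right_diff_distrib[symmetric])
          then show ?thesis using that by simp
        qed
        have "complex_of_real x - \<i> * of_real y \<noteq> 0" "complex_of_real x - \<i> * of_real w \<noteq> 0"
          by (rule shift_nonzero; use w Suc.prems y0 in simp)+
        from gen[OF this] show ?thesis using w by (simp add: algebra_simps)
      qed
      then have "?I P (Suc k) w = (LINT x|P. (1 / (complex_of_real x - \<i> * of_real y) ^ k * (1 / (of_real x - \<i> * of_real y))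
           - 1 / (complex_of_real x - \<i> * of_real y) ^ k * (1 / (of_real x - \<i> * of_real w))) / (\<i> * of_real (y - w)))"
        by (simp only:)
      also have "\<dots> = (?I P k y - ?I P k w) / (\<i> * of_real (y - w))"
        using i[OF Suc.prems(1)] i[OF w(1)] by simp
      finally show ?thesis .
    qed
    then show ?thesis using M N Suc.IH[of y] Suc.IH[of w] Suc.prems w by (simp only:)
  qed
  show ?case
  proof (cases "y' = y")
    case True
    let ?w = "\<lambda>m. \<i> * complex_of_real (y + inverse (real (Suc m)))"
    have lim: "(\<lambda>m. ?I P (Suc k) (y + inverse (real (Suc m)))) \<longlonglongrightarrow> ?I P (Suc k) y" if "real_distribution P" for P
    proof -
      interpret P: real_distribution P by fact
      have "(\<lambda>m. y + inverse (real (Suc m))) \<longlonglongrightarrow> y + 0"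
        by (intro tendsto_add tendsto_const LIMSEQ_inverse_real_of_nat)
      then have "?w \<longlonglongrightarrow> \<i> * of_real y" by (intro tendsto_mult tendsto_const tendsto_of_real) simp
      then show ?thesis
        by (intro P.integral_resolvent_tendsto[where d = y]) (use Suc.prems y0 in auto)
    qed
    have "?I M (Suc k) (y + inverse (real (Suc m))) = ?I N (Suc k) (y + inverse (real (Suc m)))" for m
    proof (rule ne)
      have "inverse (real (Suc m)) > 0" by simp
      then show "y + inverse (real (Suc m)) > y0" "y + inverse (real (Suc m)) \<noteq> y" using Suc.prems(1) by linarith+
    qed
    then show ?thesis using LIMSEQ_unique[OF lim[OF M]] lim[OF N] True by simp
  qed (use ne Suc.prems in blast)
qed

lemma stieltjes_unique:
  assumes M: "real_distribution M" and N: "real_distribution N" and y0: "y0 \<ge> 0"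
    and eq: "\<And>y. y \<in> \<rat> \<Longrightarrow> y > y0 \<Longrightarrow> stieltjes M (\<i> * of_real y) = stieltjes N (\<i> * of_real y)"
  shows "M = N"
proof (rule Levy_uniqueness[OF M N])
  interpret M: real_distribution M by fact
  interpret N: real_distribution N by fact
  have eqr: "stieltjes M (\<i> * of_real y) = stieltjes N (\<i> * of_real y)" if y: "y > y0" for y
  proof -
    have "\<exists>q. q \<in> \<rat> \<and> y < q \<and> q < y + inverse (real (Suc m))" for m
      using Rats_dense_in_real[of y "y + inverse (real (Suc m))"] by auto
    then obtain q where q: "\<And>m. q m \<in> \<rat>" "\<And>m. y < q m" "\<And>m. q m < y + inverse (real (Suc m))" by metis
    have "(\<lambda>m. y + inverse (real (Suc m))) \<longlonglongrightarrow> y + 0"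
      by (intro tendsto_add tendsto_const LIMSEQ_inverse_real_of_nat)
    then have "q \<longlonglongrightarrow> y"
      by (intro tendsto_sandwich[of "\<lambda>_. y" q _ "\<lambda>m. y + inverse (real (Suc m))"]) (use q in \<open>auto intro!: always_eventually less_imp_le\<close>)
    then have w: "(\<lambda>m. \<i> * complex_of_real (q m)) \<longlonglongrightarrow> \<i> * of_real y" by (intro tendsto_mult tendsto_const tendsto_of_real)
    have "(\<lambda>m. stieltjes P (\<i> * complex_of_real (q m))) \<longlonglongrightarrow> stieltjes P (\<i> * of_real y)" if "real_distribution P" for P
      by (rule real_distribution.stieltjes_tendsto[OF that _ _ w, of y]) (use q y y0 in \<open>auto intro: less_imp_le\<close>)
    from this[OF M] this[OF N] show ?thesis
      using eq q(1) order.strict_trans[OF y q(2)] by (simp add: LIMSEQ_unique)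
  qed
  have neg: "char M (- t) = char N (- t)" if t: "t > 0" for t
  proof -
    have "eventually (\<lambda>n. real (Suc n) / t > y0) sequentially"
    proof -
      obtain n0 where "real n0 > y0 * t" using reals_Archimedean2 by blast
      then have "real (Suc n) / t > y0" if "n \<ge> n0" for n
        using that t by (simp add: field_simps)
      then show ?thesis by (auto simp: eventually_sequentially)
    qed
    then have ev: "eventually (\<lambda>n. (of_real (real (Suc n) / t) / \<i>) ^ Suc n * (LINT x|M. 1 / (of_real x - \<i> * of_real (real (Suc n) / t)) ^ n * (1 / (of_real x - \<i> * of_real (real (Suc n) / t))))
      = (of_real (real (Suc n) / t) / \<i>) ^ Suc n * (LINT x|N. 1 / (of_real x - \<i> * of_real (real (Suc n) / t)) ^ n * (1 / (of_real x - \<i> * of_real (real (Suc n) / t))))) sequentially"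
      by eventually_elim (subst resolvent_moments_eq[OF M N y0 eqr], auto)
    show ?thesis
      by (rule LIMSEQ_unique[OF Lim_transform_eventually[OF M.char_as_resolvent_limit[OF t] ev] N.char_as_resolvent_limit[OF t]])
  qed
  have cnj: "char P (- t) = cnj (char P t)" for P t
  proof -
    have "iexp (- t * x) = cnj (iexp (t * x))" for x by (simp add: exp_cnj)
    then have "char P (- t) = (LINT x|P. cnj (iexp (t * x)))" unfolding char_def by (simp only:)
    also have "\<dots> = cnj (char P t)" unfolding char_def by (rule Bochner_Integration.integral_cnj)
    finally show ?thesis .
  qed
  show "char M = char N"
  proof (rule ext)
    fix t :: real
    consider "t < 0" | "t = 0" | "t > 0" by linarith
    then show "char M t = char N t"
    proof cases
      case 1 then show ?thesis using neg[of "- t"] by simp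
    next
      case 2 then show ?thesis using M.char_zero N.char_zero by simp
    next
      case 3 then show ?thesis using neg[of t] by (simp add: cnj)
    qed
  qed
qed

text \<open>1 - y Im m(i y) is the integral of x^2 / (x^2 + y^2), and the integrand is at least 1 / 2 as soon
  as |x| >= y.\<close>
lemma (in real_distribution) stieltjes_tail:
  assumes y: "y > 0"
  shows "1 - measure M {- y<..y} \<le> 2 * (1 - y * Im (stieltjes M (\<i> * of_real y)))"
proof -
  have i: "integrable M (\<lambda>x. 1 / (complex_of_real x - \<i> * of_real y))"
    using integrable_resolvent_powers[of "\<i> * of_real y" "\<i> * of_real y" 0] y by simp
  have Im: "Im (1 / (complex_of_real x - \<i> * of_real y)) = y / (x\<^sup>2 + y\<^sup>2)" for x
    by (simp add: Im_divide power2_eq_square)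
  have ii: "integrable M (\<lambda>x. y / (x\<^sup>2 + y\<^sup>2))" using integrable_Im[OF i] unfolding Im .
  have "Im (stieltjes M (\<i> * of_real y)) = (LINT x|M. y / (x\<^sup>2 + y\<^sup>2))"
    unfolding stieltjes_def using integral_Im[OF i] unfolding Im by simp
  then have "2 * (1 - y * Im (stieltjes M (\<i> * of_real y))) = (LINT x|M. 2 * (1 - y * (y / (x\<^sup>2 + y\<^sup>2))))"
    using ii prob_space by (simp del: times_divide_eq_right)
  also have "\<dots> \<ge> (LINT x|M. indicator (- {- y<..y}) x)"
  proof (rule integral_mono)
    show "integrable M (\<lambda>x. 2 * (1 - y * (y / (x\<^sup>2 + y\<^sup>2))))" using ii by (simp del: times_divide_eq_right)
    show "integrable M (indicator (- {- y<..y}) :: real \<Rightarrow> real)" by (rule integrable_const_bound[of _ 1]) auto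
    fix x
    have p: "x\<^sup>2 + y\<^sup>2 > 0" using y by (simp add: add_nonneg_pos)
    show "indicator (- {- y<..y}) x \<le> 2 * (1 - y * (y / (x\<^sup>2 + y\<^sup>2)))"
    proof (cases "x \<in> - {- y<..y}")
      case True
      then have "\<bar>y\<bar> \<le> \<bar>x\<bar>" using y by auto
      then have "y\<^sup>2 \<le> x\<^sup>2" by (simp add: abs_le_square_iff)
      then show ?thesis using True p by (simp add: field_simps power2_eq_square)
    next
      case False
      have "y * y \<le> x\<^sup>2 + y\<^sup>2" by (simp add: power2_eq_square)
      then show ?thesis using False p by (simp add: field_simps)
    qed
  qed
  also have "(LINT x|M. indicator (- {- y<..y}) x) = measure M (- {- y<..y})" by (simp add: space_eq_univ)
  also have "\<dots> = 1 - measure M {- y<..y}" using prob_compl[of "{- y<..y}"] by (simp add: space_eq_univ Compl_eq_Diff_UNIV)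
  finally show ?thesis .
qed

lemma (in real_distribution) exists_interval:
  assumes "e > 0"
  shows "\<exists>b>0. measure M {- b<..b} > 1 - e"
proof -
  have "(\<lambda>n. measure M {- real n<..real n}) \<longlonglongrightarrow> measure M (\<Union>n. {- real n<..real n})"
    by (rule Lim_measure_incseq) (auto simp: incseq_def)
  also have "(\<Union>n. {- real n<..real n}) = UNIV"
  proof -
    have "\<exists>n. x \<in> {- real n<..real n}" for x
      using reals_Archimedean2[of "\<bar>x\<bar>"] by (auto simp: abs_less_iff intro: less_imp_le) (metis less_imp_le minus_less_iff)
    then show ?thesis by auto
  qed
  finally have "(\<lambda>n. measure M {- real n<..real n}) \<longlonglongrightarrow> 1" using prob_space by (simp add: space_eq_univ)
  then have "eventually (\<lambda>n. measure M {- real n<..real n} > 1 - e) sequentially"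
    by (rule order_tendstoD) (use assms in simp)
  then have "eventually (\<lambda>n. measure M {- real n<..real n} > 1 - e \<and> n > 0) sequentially"
    using eventually_gt_at_top[of 0] by eventually_elim auto
  then obtain n where "measure M {- real n<..real n} > 1 - e" "n > 0" by (auto simp: eventually_sequentially)
  then show ?thesis by (intro exI[of _ "real n"]) auto
qed

text \<open>The tail bound at one fixed height covers all but finitely many of the measures, and each of the
  remaining ones is tight by itself.\<close>
lemma tight_of_stieltjes:
  assumes D: "\<And>n. real_distribution (\<mu> n)" and y0: "y0 \<ge> 0"
    and lim: "\<And>y. y \<in> \<rat> \<Longrightarrow> y > y0 \<Longrightarrow> (\<lambda>n. stieltjes (\<mu> n) (\<i> * of_real y)) \<longlonglongrightarrow> s y"
    and tail: "\<And>e. e > 0 \<Longrightarrow> \<exists>y\<in>\<rat>. y > y0 \<and> 1 - y * Im (s y) < e"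
  shows "tight \<mu>"
  unfolding tight_def
proof (intro conjI allI impI D)
  fix e :: real assume e: "e > 0"
  obtain y where y: "y \<in> \<rat>" "y > y0" "1 - y * Im (s y) < e / 2" using tail[of "e / 2"] e by auto
  have "(\<lambda>n. 1 - y * Im (stieltjes (\<mu> n) (\<i> * of_real y))) \<longlonglongrightarrow> 1 - y * Im (s y)"
    by (intro tendsto_intros lim y)
  then have "eventually (\<lambda>n. 1 - y * Im (stieltjes (\<mu> n) (\<i> * of_real y)) < e / 2) sequentially"
    by (rule order_tendstoD) (use y in simp)
  then obtain n0 where n0: "\<And>n. n \<ge> n0 \<Longrightarrow> 1 - y * Im (stieltjes (\<mu> n) (\<i> * of_real y)) < e / 2"
    by (auto simp: eventually_sequentially)
  have big: "measure (\<mu> n) {- y<..y} > 1 - e" if "n \<ge> n0" for n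
  proof -
    define w where "w = 1 - y * Im (stieltjes (\<mu> n) (\<i> * of_real y))"
    have "1 - measure (\<mu> n) {- y<..y} \<le> 2 * w"
      unfolding w_def using y0 y by (intro real_distribution.stieltjes_tail[OF D]) simp
    moreover have "w < e / 2" unfolding w_def by (rule n0[OF that])
    ultimately show ?thesis by simp
  qed
  have "\<exists>b. \<forall>n. b n > 0 \<and> measure (\<mu> n) {- b n<..b n} > 1 - e"
    using real_distribution.exists_interval[OF D e] by metis
  then obtain b where b: "\<And>n. b n > 0" "\<And>n. measure (\<mu> n) {- b n<..b n} > 1 - e" by blast
  define B where "B = Max (insert y (b ` {..<n0}))"
  have yB: "y \<le> B" and bB: "b n \<le> B" if "n < n0" for n unfolding B_def using that by auto
  have yB: "y \<le> B" unfolding B_def by auto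
  have "measure (\<mu> n) {- B<..B} > 1 - e" for n
  proof -
    interpret real_distribution "\<mu> n" by (rule D)
    have mono: "measure (\<mu> n) {- a<..a} \<le> measure (\<mu> n) {- B<..B}" if "a \<le> B" for a
      using that by (intro finite_measure_mono) auto
    show ?thesis
    proof (cases "n < n0")
      case True then show ?thesis using b(2)[of n] mono[OF bB] by (meson less_le_trans)
    next
      case False then show ?thesis using big[of n] mono[OF yB] by simp
    qed
  qed
  moreover have "- B < B" using yB y y0 by simp
  ultimately show "\<exists>a b. a < b \<and> (\<forall>n. measure (\<mu> n) {a<..b} > 1 - e)" by blast
qed

lemma weak_limit_stieltjes:
  assumes "\<And>n. real_distribution (\<mu> n)" "real_distribution \<nu>" "weak_conv_m \<mu> \<nu>" "Im z > 0"
  shows "(\<lambda>n. stieltjes (\<mu> n) z) \<longlonglongrightarrow> stieltjes \<nu> z"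
  unfolding stieltjes_def
  by (rule weak_conv_imp_integral_bdd_continuous_conv[OF assms(1-3), of _ "1 / Im z"])
     (use shift_nonzero[OF assms(4)] cmod_inverse_shift_le[OF assms(4)] in \<open>auto intro!: continuous_intros\<close>)

text \<open>Tightness gives a limit point, and uniqueness of the Stieltjes transform shows that all limit
  points, also those of any other sequence with the same limits, agree. The limit depends on the numbers s y
  only: applied to random measures, it is the same measure for almost every realisation.\<close>
theorem stieltjes_continuity:
  fixes s :: "real \<Rightarrow> complex"
  assumes D: "\<And>n. real_distribution (\<mu>\<^sub>0 n)" and y0: "y0 \<ge> 0"
    and lim: "\<And>y. y \<in> \<rat> \<Longrightarrow> y > y0 \<Longrightarrow> (\<lambda>n. stieltjes (\<mu>\<^sub>0 n) (\<i> * of_real y)) \<longlonglongrightarrow> s y"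
    and tail: "\<And>e. e > 0 \<Longrightarrow> \<exists>y\<in>\<rat>. y > y0 \<and> 1 - y * Im (s y) < e"
  obtains \<mu> where "real_distribution \<mu>" "\<And>y. y \<in> \<rat> \<Longrightarrow> y > y0 \<Longrightarrow> stieltjes \<mu> (\<i> * of_real y) = s y"
    and "\<And>\<nu>. (\<And>n. real_distribution (\<nu> n)) \<Longrightarrow>
       (\<And>y. y \<in> \<rat> \<Longrightarrow> y > y0 \<Longrightarrow> (\<lambda>n. stieltjes (\<nu> n) (\<i> * of_real y)) \<longlonglongrightarrow> s y) \<Longrightarrow> weak_conv_m \<nu> \<mu>"
proof -
  have "tight \<mu>\<^sub>0" by (rule tight_of_stieltjes[OF D y0 lim tail])
  then obtain r \<mu> where r: "strict_mono r" "real_distribution \<mu>" "weak_conv_m (\<mu>\<^sub>0 \<circ> id \<circ> r) \<mu>"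
    using tight_imp_convergent_subsubsequence[of \<mu>\<^sub>0 id] by (auto simp: strict_mono_id)
  have lim_eq: "stieltjes \<nu>' (\<i> * of_real y) = s y"
    if "\<And>n. real_distribution (\<nu> n)" "strict_mono q" "real_distribution \<nu>'" "weak_conv_m (\<nu> \<circ> q) \<nu>'"
      "y \<in> \<rat>" "y > y0" "(\<lambda>n. stieltjes (\<nu> n) (\<i> * of_real y)) \<longlonglongrightarrow> s y" for \<nu> :: "nat \<Rightarrow> real measure" and q :: "nat \<Rightarrow> nat" and \<nu>' y
  proof -
    have "(\<lambda>n. stieltjes ((\<nu> \<circ> q) n) (\<i> * of_real y)) \<longlonglongrightarrow> stieltjes \<nu>' (\<i> * of_real y)"
      by (rule weak_limit_stieltjes[OF _ that(3,4)]) (use that y0 in auto)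
    moreover have "(\<lambda>n. stieltjes ((\<nu> \<circ> q) n) (\<i> * of_real y)) \<longlonglongrightarrow> s y"
      using LIMSEQ_subseq_LIMSEQ[OF that(7,2)] by (simp add: comp_def)
    ultimately show ?thesis by (rule LIMSEQ_unique)
  qed
  have mu: "stieltjes \<mu> (\<i> * of_real y) = s y" if "y \<in> \<rat>" "y > y0" for y
    using lim_eq[OF D r(1,2) _ that lim[OF that]] r(3) by (simp add: comp_def)
  show ?thesis
  proof (rule that[OF r(2) mu])
    fix \<nu> :: "nat \<Rightarrow> real measure"
    assume \<nu>: "\<And>n. real_distribution (\<nu> n)" "\<And>y. y \<in> \<rat> \<Longrightarrow> y > y0 \<Longrightarrow> (\<lambda>n. stieltjes (\<nu> n) (\<i> * of_real y)) \<longlonglongrightarrow> s y"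
    show "weak_conv_m \<nu> \<mu>"
    proof (rule tight_subseq_weak_converge[OF \<nu>(1) r(2) tight_of_stieltjes[OF \<nu>(1) y0 \<nu>(2) tail]])
      fix q \<nu>' assume q: "strict_mono q" "real_distribution \<nu>'" "weak_conv_m (\<nu> \<circ> q) \<nu>'"
      have "\<nu>' = \<mu>"
        by (rule stieltjes_unique[OF q(2) r(2) y0]) (simp add: lim_eq[OF \<nu>(1) q] \<nu>(2) mu)
      then show "weak_conv_m (\<nu> \<circ> q) \<mu>" using q by simp
    qed
  qed
qed

text \<open>Analytic continuation from a sequence of points of the imaginary axis.\<close>
lemma stieltjes_equation_extend:
  fixes c :: real
  assumes "real_distribution \<mu>" and y1: "y1 \<ge> 0"
    and eq: "\<And>y. y \<in> \<rat> \<Longrightarrow> y > y1 \<Longrightarrow> (1 - (of_real c)\<^sup>2 * (stieltjes \<mu> (\<i> * of_real y))\<^sup>2) *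
       (of_real c + of_real c * (\<i> * of_real y) * stieltjes \<mu> (\<i> * of_real y) - 1)\<^sup>2 = 1"
    and z: "Im z > 0"
  shows "(1 - (of_real c)\<^sup>2 * (stieltjes \<mu> z)\<^sup>2) * (of_real c + of_real c * z * stieltjes \<mu> z - 1)\<^sup>2 = 1"
proof -
  interpret real_distribution \<mu> by fact
  let ?F = "\<lambda>z. (1 - (of_real c)\<^sup>2 * (stieltjes \<mu> z)\<^sup>2) * (of_real c + of_real c * z * stieltjes \<mu> z - 1)\<^sup>2 - 1"
  obtain q where q: "q \<in> \<rat>" "y1 < q" using Rats_dense_in_real[of y1 "y1 + 1"] by auto
  define r where "r n = inverse (real (Suc n))" for n
  have rQ: "r n \<in> \<rat>" and pos: "r n > 0" for n unfolding r_def by (auto intro!: Rats_inverse simp del: of_nat_Suc)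
  have r0: "r \<longlonglongrightarrow> 0" unfolding r_def by (rule LIMSEQ_inverse_real_of_nat)
  define U where "U = (\<lambda>n. \<i> * complex_of_real (q + r n)) ` UNIV"
  have lim: "(\<lambda>n. \<i> * complex_of_real (q + r n)) \<longlonglongrightarrow> \<i> * of_real (q + 0)"
    by (intro tendsto_mult tendsto_of_real tendsto_add tendsto_const r0)
  have "?F z = 0"
  proof (rule analytic_continuation[of ?F "{z. Im z > 0}" U "\<i> * of_real q" z])
    show "?F holomorphic_on {z. Im z > 0}" by (intro holomorphic_intros stieltjes_holomorphic)
    show "open {z. Im z > 0}" by (rule open_halfspace_Im_gt)
    show "connected {z. Im z > 0}" by (intro convex_connected convex_halfspace_Im_gt)
    show "\<i> * complex_of_real q \<in> {z. Im z > 0}" using q y1 by simp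
    have pos': "q + r n > y1" for n using q pos[of n] by linarith
    show "U \<subseteq> {z. Im z > 0}" unfolding U_def
      by (rule image_subsetI) (simp only: mem_Collect_eq Im_i_times Re_complex_of_real le_less_trans[OF y1 pos'])
    show "\<i> * complex_of_real q islimpt U"
      unfolding islimpt_sequential
    proof (intro exI[of _ "\<lambda>n. \<i> * complex_of_real (q + r n)"] conjI allI)
      show "\<i> * complex_of_real (q + r n) \<in> U - {\<i> * complex_of_real q}" for n
        unfolding U_def using pos[of n] by auto
    qed (use lim in simp)
    show "?F w = 0" if "w \<in> U" for w
    proof -
      from that obtain n where w: "w = \<i> * complex_of_real (q + r n)" unfolding U_def image_def by blast
      have "q + r n \<in> \<rat>" using q rQ by (intro Rats_add)
      from eq[OF this pos'] show ?thesis unfolding w by (simp only: diff_self)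
    qed
  qed (use z in simp)
  then show ?thesis by simp
qed

section \<open>Quadratic forms in a row of the array\<close>

text \<open>A first moment estimated by a second one. The free parameter takes the place of an optimisation,
  and is sent to 0 only after the size of the matrix has been sent to infinity.\<close>
lemma le_add_square_div: "(x::real) \<le> \<theta> + x\<^sup>2 / \<theta>" if "\<theta> > 0"
proof (cases "x \<le> \<theta>")
  case True then show ?thesis using that by (simp add: add_increasing2)
next
  case False
  then have "x * \<theta> \<le> x * x" using that by (intro mult_left_mono) auto
  then have "x \<le> x\<^sup>2 / \<theta>" using that by (simp add: field_simps power2_eq_square)
  then show ?thesis using that by simp
qed

text \<open>The array after truncation and centring: bounded entries, of variance close to 1. The array
  vanishes outside its index range, so that rows can be handled as functions on all numbers.\<close>
locale row_model = prob_space +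
  fixes N n :: nat and T b :: real and X :: "nat \<Rightarrow> nat \<Rightarrow> 'a \<Rightarrow> complex" and s :: "nat \<Rightarrow> nat \<Rightarrow> real"
    and C :: "nat \<Rightarrow> nat \<Rightarrow> complex" and z :: complex
  assumes T: "T > 0" and N: "N > 0" and C: "hermitian_on n C" and CK: "row_bound n 1 C" and z: "Im z > 0"
    and indep: "indep_vars (\<lambda>_. borel) (\<lambda>(i, k). X i k) ({..<N} \<times> {..<n})"
    and outside: "\<And>i k \<omega>. \<not> (i < N \<and> k < n) \<Longrightarrow> X i k \<omega> = 0"
    and bound: "\<And>i k \<omega>. i < N \<Longrightarrow> k < n \<Longrightarrow> \<omega> \<in> space M \<Longrightarrow> cmod (X i k \<omega>) \<le> b"
    and mean: "\<And>i k. i < N \<Longrightarrow> k < n \<Longrightarrow> expectation (X i k) = 0"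
    and var: "\<And>i k. i < N \<Longrightarrow> k < n \<Longrightarrow> expectation (\<lambda>\<omega>. (cmod (X i k \<omega>))\<^sup>2) = s i k"
    and s_le: "\<And>i k. i < N \<Longrightarrow> k < n \<Longrightarrow> s i k \<le> 1"
begin

abbreviation "arr \<omega> \<equiv> (\<lambda>i k. X i k \<omega>)"

definition scaled :: "(nat \<Rightarrow> nat \<Rightarrow> complex) \<Rightarrow> nat \<Rightarrow> nat \<Rightarrow> complex" where
  "scaled W i k = of_real (1 / sqrt T) * W i k"

lemma scale_square: "(1 / sqrt T)\<^sup>2 = 1 / T"
  using T by (simp add: power_divide)

lemma scaled_zero_row: "scaled (zero_row i W) = zero_row i (scaled W)"
  by (auto simp: scaled_def zero_row_def fun_eq_iff)

lemma X_measurable [measurable]: "X i k \<in> borel_measurable M"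
proof (cases "i < N \<and> k < n")
  case True
  then show ?thesis using indep by (auto simp: indep_vars_def)
next
  case False
  then have "X i k = (\<lambda>_. 0)" using outside by auto
  then show ?thesis by simp
qed

lemma row_bounded_indep: "i < N \<Longrightarrow> bounded_indep M (X i) {..<n} b (s i)"
proof
  assume i: "i < N"
  have "indep_vars (\<lambda>k. PiM {(i, k)} (\<lambda>_. borel)) (\<lambda>k \<omega>. restrict (\<lambda>j. (case j of (i, k) \<Rightarrow> X i k) \<omega>) {(i, k)}) {..<n}"
    by (rule indep_vars_restrict[OF indep]) (use i in \<open>auto simp: disjoint_family_on_def\<close>)
  from indep_vars_compose2[OF this, of "\<lambda>k p. p (i, k)" "\<lambda>_. borel"]
  show "indep_vars (\<lambda>_. borel) (X i) {..<n}" by simp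
qed (use bound mean var s_le in auto)

text \<open>Coordinates on the product space: a row, and the array without that row. They express the
  independence of the two as a statement about one product measure.\<close>
definition row_of :: "nat \<Rightarrow> (nat \<times> nat \<Rightarrow> complex) \<Rightarrow> nat \<Rightarrow> complex" where
  "row_of i p k = (if k < n then p (i, k) else 0)"

definition rest_of :: "nat \<Rightarrow> (nat \<times> nat \<Rightarrow> complex) \<Rightarrow> nat \<Rightarrow> nat \<Rightarrow> complex" where
  "rest_of i p a k = (if a < N \<and> k < n \<and> a \<noteq> i then p (a, k) else 0)"

abbreviation "row_space i \<equiv> PiM ({i} \<times> {..<n}) (\<lambda>_. borel :: complex measure)"
abbreviation "rest_space i \<equiv> PiM (({..<N} - {i}) \<times> {..<n}) (\<lambda>_. borel :: complex measure)"

lemma row_of_measurable: "(\<lambda>p. row_of i p k) \<in> borel_measurable (row_space i)"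
  unfolding row_of_def by (cases "k < n") auto

lemma rest_of_measurable: "(\<lambda>p. rest_of i p a k) \<in> borel_measurable (rest_space i)"
  unfolding rest_of_def by (cases "a < N \<and> k < n \<and> a \<noteq> i") auto

text \<open>An estimate in the mean over row i, for a fixed array of the other rows, may be integrated over
  those rows.\<close>
lemma row_expectation_le:
  fixes F :: "(nat \<Rightarrow> complex) \<Rightarrow> (nat \<Rightarrow> nat \<Rightarrow> complex) \<Rightarrow> real"
  assumes i: "i < N"
    and meas: "(\<lambda>p. F (row_of i (fst p)) (rest_of i (snd p))) \<in> borel_measurable (row_space i \<Otimes>\<^sub>M rest_space i)"
    and F0: "\<And>u W. 0 \<le> F u W"
    and int: "\<And>W. integrable M (\<lambda>\<omega>. F (\<lambda>k. X i k \<omega>) W)"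
    and le: "\<And>W. expectation (\<lambda>\<omega>. F (\<lambda>k. X i k \<omega>) W) \<le> g W"
    and gmeas: "(\<lambda>p. g (rest_of i p)) \<in> borel_measurable (rest_space i)"
    and gint: "integrable M (\<lambda>\<omega>. g (zero_row i (arr \<omega>)))"
  shows "integrable M (\<lambda>\<omega>. F (\<lambda>k. X i k \<omega>) (zero_row i (arr \<omega>)))"
    and "expectation (\<lambda>\<omega>. F (\<lambda>k. X i k \<omega>) (zero_row i (arr \<omega>))) \<le> expectation (\<lambda>\<omega>. g (zero_row i (arr \<omega>)))"
proof -
  let ?x = "\<lambda>j. (\<lambda>(i, k). X i k) j"
  let ?U = "\<lambda>\<omega>. \<lambda>j\<in>{i} \<times> {..<n}. ?x j \<omega>" and ?V = "\<lambda>\<omega>. \<lambda>j\<in>({..<N} - {i}) \<times> {..<n}. ?x j \<omega>"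
  have ind: "indep_var (row_space i) ?U (rest_space i) ?V"
    using i by (intro indep_var_restrict[OF indep]) auto
  have U: "row_of i (?U \<omega>) = (\<lambda>k. X i k \<omega>)" for \<omega>
    using outside[of i] by (auto simp: row_of_def fun_eq_iff)
  have V: "rest_of i (?V \<omega>) = zero_row i (arr \<omega>)" for \<omega>
    using outside by (auto simp: rest_of_def zero_row_def fun_eq_iff)
  note * = indep_expectation_le[where f = "\<lambda>p. F (row_of i (fst p)) (rest_of i (snd p))" and g = "\<lambda>p. g (rest_of i p)" and X = ?U and Y = ?V,
      OF ind meas F0 _ _ gmeas, unfolded fst_conv snd_conv U V, OF int le gint]
  show "integrable M (\<lambda>\<omega>. F (\<lambda>k. X i k \<omega>) (zero_row i (arr \<omega>)))" by (rule *(1))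
  show "expectation (\<lambda>\<omega>. F (\<lambda>k. X i k \<omega>) (zero_row i (arr \<omega>))) \<le> expectation (\<lambda>\<omega>. g (zero_row i (arr \<omega>)))" by (rule *(2))
qed

lemma row_of_fst [measurable]: "(\<lambda>p. row_of i (fst p) k) \<in> borel_measurable (row_space i \<Otimes>\<^sub>M rest_space i)"
  by (rule measurable_compose[OF measurable_fst row_of_measurable])

lemma row_square:
  assumes "i < N" "k < n"
  shows "integrable M (\<lambda>\<omega>. (cmod (X i k \<omega>))\<^sup>2)" "expectation (\<lambda>\<omega>. (cmod (X i k \<omega>))\<^sup>2) \<le> 1"
proof -
  show "integrable M (\<lambda>\<omega>. (cmod (X i k \<omega>))\<^sup>2)"
    by (rule integrable_const_bound[of _ "b\<^sup>2"]) (use bound[OF assms] in \<open>auto intro!: power_mono AE_I2\<close>)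
  show "expectation (\<lambda>\<omega>. (cmod (X i k \<omega>))\<^sup>2) \<le> 1" using var[OF assms] s_le[OF assms] by simp
qed

lemma outer_gram_scaled: "outer_gram n (scaled W) a c = of_real (1 / T) * (\<Sum>k<n. W a k * cnj (W c k))"
proof -
  have "scaled W a k * cnj (scaled W c k) = of_real (1 / T) * (W a k * cnj (W c k))" for k
  proof -
    have "complex_of_real (1 / sqrt T) * of_real (1 / sqrt T) = of_real (1 / T)"
      unfolding of_real_mult[symmetric] scale_square[symmetric] power2_eq_square ..
    then show ?thesis unfolding scaled_def complex_cnj_mult complex_cnj_complex_of_real
      by (metis (no_types, opaque_lifting) mult.assoc mult.left_commute)
  qed
  then show ?thesis unfolding outer_gram_def by (simp only: sum_distrib_left)
qed

definition outer_const :: real where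
  "outer_const = (real N)\<^sup>2 * (3 * n / T\<^sup>2) + real N * (2 * (n\<^sup>2 + 2 * (9 + 3 * b\<^sup>2 + n) * n) / T\<^sup>2)"

text \<open>The inner product of two different rows is a linear form in one of them once the other is fixed,
  so its square has mean of order n before scaling; for the n times rarer diagonal entries the order n^2
  suffices.\<close>
lemma outer_entry_off:
  assumes ac: "a < N" "c < N" "a \<noteq> c"
  shows "integrable M (\<lambda>\<omega>. (cmod (outer_gram n (scaled (arr \<omega>)) a c))\<^sup>2)"
    and "expectation (\<lambda>\<omega>. (cmod (outer_gram n (scaled (arr \<omega>)) a c))\<^sup>2) \<le> 3 * n / T\<^sup>2"
proof -
  interpret R: bounded_indep M "X a" "{..<n}" b "s a" by (rule row_bounded_indep[OF ac(1)])
  let ?F = "\<lambda>u W. (cmod (\<Sum>k<n. cnj (W c k) * u k))\<^sup>2" and ?g = "\<lambda>W. 3 * (\<Sum>k<n. (cmod (W c k))\<^sup>2)"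
  have 0: "?F (\<lambda>k. X a k \<omega>) (zero_row a (arr \<omega>)) = (cmod (\<Sum>k<n. X a k \<omega> * cnj (X c k \<omega>)))\<^sup>2" for \<omega>
    using ac by (simp add: zero_row_def mult.commute)
  have g0: "?g (zero_row a (arr \<omega>)) = 3 * (\<Sum>k<n. (cmod (X c k \<omega>))\<^sup>2)" for \<omega>
    using ac by (simp add: zero_row_def)
  have lin: "integrable M (\<lambda>\<omega>. ?F (\<lambda>k. X a k \<omega>) W) \<and> expectation (\<lambda>\<omega>. ?F (\<lambda>k. X a k \<omega>) W) \<le> ?g W" for W
    using R.linear_form[of "{..<n}" "\<lambda>k. cnj (W c k)"] by simp
  have gi: "integrable M (\<lambda>\<omega>. ?g (zero_row a (arr \<omega>)))"
    unfolding g0 using row_square[OF ac(2)] by (intro integrable_mult_right Bochner_Integration.integrable_sum) auto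
  have "integrable M (\<lambda>\<omega>. ?F (\<lambda>k. X a k \<omega>) (zero_row a (arr \<omega>)))"
    "expectation (\<lambda>\<omega>. ?F (\<lambda>k. X a k \<omega>) (zero_row a (arr \<omega>))) \<le> expectation (\<lambda>\<omega>. ?g (zero_row a (arr \<omega>)))"
    by (rule row_expectation_le[where F = ?F and g = ?g, OF ac(1)];
        use lin gi rest_of_measurable in \<open>auto intro!: borel_measurable_sum borel_measurable_times borel_measurable_power\<close>)+
  note * = this[unfolded 0]
  have "expectation (\<lambda>\<omega>. ?g (zero_row a (arr \<omega>))) = 3 * (\<Sum>k<n. expectation (\<lambda>\<omega>. (cmod (X c k \<omega>))\<^sup>2))"
    unfolding g0 using row_square[OF ac(2)] by (simp add: Bochner_Integration.integral_sum)
  also have "\<dots> \<le> 3 * (\<Sum>k<n. 1)" using row_square[OF ac(2)] by (intro mult_left_mono sum_mono) auto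
  finally have g: "expectation (\<lambda>\<omega>. ?g (zero_row a (arr \<omega>))) \<le> 3 * n" by simp
  have eq: "(cmod (outer_gram n (scaled (arr \<omega>)) a c))\<^sup>2 = (1 / T)\<^sup>2 * (cmod (\<Sum>k<n. X a k \<omega> * cnj (X c k \<omega>)))\<^sup>2" for \<omega>
    unfolding outer_gram_scaled norm_mult power_mult_distrib by (simp only: norm_of_real power2_abs)
  show "integrable M (\<lambda>\<omega>. (cmod (outer_gram n (scaled (arr \<omega>)) a c))\<^sup>2)" unfolding eq using * by simp
  have "expectation (\<lambda>\<omega>. (cmod (outer_gram n (scaled (arr \<omega>)) a c))\<^sup>2) = (1 / T)\<^sup>2 * expectation (\<lambda>\<omega>. (cmod (\<Sum>k<n. X a k \<omega> * cnj (X c k \<omega>)))\<^sup>2)"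
    unfolding eq by simp
  also have "\<dots> \<le> (1 / T)\<^sup>2 * (3 * n)" using * g by (intro mult_left_mono) auto
  finally show "expectation (\<lambda>\<omega>. (cmod (outer_gram n (scaled (arr \<omega>)) a c))\<^sup>2) \<le> 3 * n / T\<^sup>2"
    by (simp add: power_divide)
qed

lemma outer_entry_diag:
  assumes a: "a < N"
  shows "integrable M (\<lambda>\<omega>. (cmod (outer_gram n (scaled (arr \<omega>)) a a))\<^sup>2)"
    and "expectation (\<lambda>\<omega>. (cmod (outer_gram n (scaled (arr \<omega>)) a a))\<^sup>2) \<le> 2 * (n\<^sup>2 + 2 * (9 + 3 * b\<^sup>2 + n) * n) / T\<^sup>2"
proof -
  interpret R: bounded_indep M "X a" "{..<n}" b "s a" by (rule row_bounded_indep[OF a])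
  define q where "q \<omega> = (\<Sum>k<n. X a k \<omega> * cnj (X a k \<omega>)) - of_nat n" for \<omega>
  let ?A = "\<lambda>k l::nat. if k = l then 1 else 0 :: complex"
  have sq: "(\<Sum>k<n. \<Sum>l<n. X a k \<omega> * ?A k l * cnj (X a l \<omega>)) - (\<Sum>k<n. ?A k k) = q \<omega>" for \<omega>
    unfolding q_def by (simp add: if_distrib[of "\<lambda>x. _ * x"] if_distrib[of "\<lambda>x. x * _"] cong: if_cong)
  have A: "(\<Sum>k<n. \<Sum>l<n. (cmod (?A k l))\<^sup>2) = n" using frob_id[of n] unfolding frob_def .
  note Q = R.quadratic_form[of ?A, unfolded sq A]
  have "(\<Sum>k<n. 1 - s a k) \<le> (\<Sum>k<n. 1)"
    using R.s_le R.var by (intro sum_mono) (metis (no_types, lifting) Bochner_Integration.integral_nonneg diff_le_eq le_add_same_cancel1 lessThan_iff zero_le_power2)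
  then have "2 * (9 + 3 * b\<^sup>2 + (\<Sum>k<n. 1 - s a k)) * n \<le> 2 * (9 + 3 * b\<^sup>2 + n) * n" by (intro mult_right_mono mult_left_mono) auto
  then have Eq: "expectation (\<lambda>\<omega>. (cmod (q \<omega>))\<^sup>2) \<le> 2 * (9 + 3 * b\<^sup>2 + n) * n" using Q(2) by simp
  have le: "(cmod (outer_gram n (scaled (arr \<omega>)) a a))\<^sup>2 \<le> (1 / T)\<^sup>2 * (2 * ((cmod (q \<omega>))\<^sup>2 + (real n)\<^sup>2))" for \<omega>
  proof -
    have "outer_gram n (scaled (arr \<omega>)) a a = of_real (1 / T) * (q \<omega> - (- of_nat n))"
      unfolding outer_gram_scaled q_def by simp
    then have "(cmod (outer_gram n (scaled (arr \<omega>)) a a))\<^sup>2 = (1 / T)\<^sup>2 * (cmod (q \<omega> - (- of_nat n)))\<^sup>2"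
      by (simp only: norm_mult power_mult_distrib norm_of_real power2_abs)
    also have "\<dots> \<le> (1 / T)\<^sup>2 * (2 * ((cmod (q \<omega>))\<^sup>2 + (cmod (- of_nat n))\<^sup>2))"
      by (intro mult_left_mono cmod_diff_square_le) auto
    finally show ?thesis by simp
  qed
  have m: "(\<lambda>\<omega>. outer_gram n (scaled (arr \<omega>)) a a) \<in> borel_measurable M"
    unfolding outer_gram_scaled by measurable
  have ri: "integrable M (\<lambda>\<omega>. (1 / T)\<^sup>2 * (2 * ((cmod (q \<omega>))\<^sup>2 + (real n)\<^sup>2)))" using Q(1) by simp
  show i: "integrable M (\<lambda>\<omega>. (cmod (outer_gram n (scaled (arr \<omega>)) a a))\<^sup>2)"
    by (rule Bochner_Integration.integrable_bound[OF ri]) (use m le in auto)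
  have "expectation (\<lambda>\<omega>. (cmod (outer_gram n (scaled (arr \<omega>)) a a))\<^sup>2) \<le> expectation (\<lambda>\<omega>. (1 / T)\<^sup>2 * (2 * ((cmod (q \<omega>))\<^sup>2 + (real n)\<^sup>2)))"
    by (rule integral_mono[OF i ri le])
  also have "\<dots> = (1 / T)\<^sup>2 * (2 * (expectation (\<lambda>\<omega>. (cmod (q \<omega>))\<^sup>2) + (real n)\<^sup>2))" using Q(1) by (simp add: prob_space)
  also have "\<dots> \<le> (1 / T)\<^sup>2 * (2 * (2 * (9 + 3 * b\<^sup>2 + n) * n + (real n)\<^sup>2))" using Eq by (intro mult_left_mono add_right_mono) auto
  finally show "expectation (\<lambda>\<omega>. (cmod (outer_gram n (scaled (arr \<omega>)) a a))\<^sup>2) \<le> 2 * (n\<^sup>2 + 2 * (9 + 3 * b\<^sup>2 + n) * n) / T\<^sup>2"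
    by (simp add: power_divide add.commute)
qed

lemma outer_frob:
  shows "integrable M (\<lambda>\<omega>. frob N N (outer_gram n (scaled (arr \<omega>))))"
    and "expectation (\<lambda>\<omega>. frob N N (outer_gram n (scaled (arr \<omega>)))) \<le> outer_const"
proof -
  have i: "integrable M (\<lambda>\<omega>. (cmod (outer_gram n (scaled (arr \<omega>)) a c))\<^sup>2)" if "a < N" "c < N" for a c
    using outer_entry_off(1)[OF that] outer_entry_diag(1)[OF that(1)] by (cases "a = c") auto
  show "integrable M (\<lambda>\<omega>. frob N N (outer_gram n (scaled (arr \<omega>))))"
    unfolding frob_def using i by (intro Bochner_Integration.integrable_sum) auto
  define d where "d = 2 * (n\<^sup>2 + 2 * (9 + 3 * b\<^sup>2 + n) * n) / T\<^sup>2"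
  have "expectation (\<lambda>\<omega>. frob N N (outer_gram n (scaled (arr \<omega>)))) = (\<Sum>a<N. \<Sum>c<N. expectation (\<lambda>\<omega>. (cmod (outer_gram n (scaled (arr \<omega>)) a c))\<^sup>2))"
    unfolding frob_def using i by (subst Bochner_Integration.integral_sum; (intro Bochner_Integration.integrable_sum)?; (intro sum.cong refl Bochner_Integration.integral_sum)?) auto
  also have "\<dots> \<le> (\<Sum>a<N. \<Sum>c<N. 3 * n / T\<^sup>2 + (if a = c then d else 0))"
  proof (intro sum_mono)
    fix a c assume ac: "a \<in> {..<N}" "c \<in> {..<N}"
    show "expectation (\<lambda>\<omega>. (cmod (outer_gram n (scaled (arr \<omega>)) a c))\<^sup>2) \<le> 3 * n / T\<^sup>2 + (if a = c then d else 0)"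
    proof (cases "a = c")
      case True
      have "expectation (\<lambda>\<omega>. (cmod (outer_gram n (scaled (arr \<omega>)) a c))\<^sup>2) \<le> d"
        unfolding d_def True using ac by (intro outer_entry_diag) simp
      then show ?thesis using True by (simp add: add_increasing)
    next
      case False
      then show ?thesis using outer_entry_off(2)[of a c] ac by simp
    qed
  qed
  also have "\<dots> = outer_const" unfolding outer_const_def d_def[symmetric] by (simp add: sum.distrib power2_eq_square distrib_left)
  finally show "expectation (\<lambda>\<omega>. frob N N (outer_gram n (scaled (arr \<omega>)))) \<le> outer_const" .
qed

abbreviation "Rc W \<equiv> coresolvent N n z C (scaled W)"
abbreviation "Gc W \<equiv> resolvent N z (gram n C (scaled W))"

lemma cavity_model: "cavity n z C"
  using C z by unfold_locales auto

definition frob_const :: real where "frob_const = 2 * (n + outer_const / (Im z)\<^sup>2)"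

lemma scaled_measurable [measurable]: "(\<lambda>\<omega>. scaled (arr \<omega>) i k) \<in> borel_measurable M"
  unfolding scaled_def by measurable

lemma zero_row_measurable [measurable]: "(\<lambda>\<omega>. scaled (zero_row i (arr \<omega>)) a k) \<in> borel_measurable M"
  unfolding scaled_def zero_row_def by measurable

lemma Gc_measurable [measurable]: "i < N \<Longrightarrow> j < N \<Longrightarrow> (\<lambda>\<omega>. Gc (arr \<omega>) i j) \<in> borel_measurable M"
  by (rule gram_resolvent_measurable[where Y = "\<lambda>\<omega>. scaled (arr \<omega>)"]) auto

lemma Rc_measurable [measurable]: "(\<lambda>\<omega>. Rc (arr \<omega>) k l) \<in> borel_measurable M"
  by (rule coresolvent_measurable[where Y = "\<lambda>\<omega>. scaled (arr \<omega>)"]) auto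

lemma Rc0_measurable [measurable]: "(\<lambda>\<omega>. Rc (zero_row i (arr \<omega>)) k l) \<in> borel_measurable M"
  by (rule coresolvent_measurable[where Y = "\<lambda>\<omega>. scaled (zero_row i (arr \<omega>))"]) auto

lemma Rc_frob:
  shows "integrable M (\<lambda>\<omega>. frob n n (Rc (arr \<omega>)))" and "expectation (\<lambda>\<omega>. frob n n (Rc (arr \<omega>))) \<le> frob_const"
    and "integrable M (\<lambda>\<omega>. frob n n (Rc (zero_row i (arr \<omega>))))" and "expectation (\<lambda>\<omega>. frob n n (Rc (zero_row i (arr \<omega>)))) \<le> frob_const"
proof -
  let ?B = "\<lambda>\<omega>. 2 * (n + frob N N (outer_gram n (scaled (arr \<omega>))) / (Im z)\<^sup>2)"
  have Bi: "integrable M ?B" using outer_frob(1) by simp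
  have BE: "expectation ?B \<le> frob_const"
    unfolding frob_const_def using outer_frob by (simp add: prob_space divide_right_mono)
  have le1: "frob n n (Rc (arr \<omega>)) \<le> ?B \<omega>" for \<omega> by (rule cavity.frob_coresolvent_le[OF cavity_model CK])
  have le2: "frob n n (Rc (zero_row i (arr \<omega>))) \<le> ?B \<omega>" for \<omega>
    unfolding scaled_zero_row by (rule cavity.frob_coresolvent_zeroed_le[OF cavity_model CK])
  show i1: "integrable M (\<lambda>\<omega>. frob n n (Rc (arr \<omega>)))"
    by (rule Bochner_Integration.integrable_bound[OF Bi]) (use le1 in \<open>auto simp: order_trans[OF _ abs_ge_self] intro!: AE_I2 frob_measurable\<close>)
  show i2: "integrable M (\<lambda>\<omega>. frob n n (Rc (zero_row i (arr \<omega>))))"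
    by (rule Bochner_Integration.integrable_bound[OF Bi]) (use le2 in \<open>auto simp: order_trans[OF _ abs_ge_self] intro!: AE_I2 frob_measurable\<close>)
  show "expectation (\<lambda>\<omega>. frob n n (Rc (arr \<omega>))) \<le> frob_const"
    using integral_mono[OF i1 Bi le1] BE by simp
  show "expectation (\<lambda>\<omega>. frob n n (Rc (zero_row i (arr \<omega>)))) \<le> frob_const"
    using integral_mono[OF i2 Bi le2] BE by simp
qed

end

context row_model begin

definition qform :: "nat \<Rightarrow> (nat \<Rightarrow> nat \<Rightarrow> complex) \<Rightarrow> 'a \<Rightarrow> complex" where
  "qform i D \<omega> = (\<Sum>l<n. (\<Sum>k<n. scaled (arr \<omega>) i k * (\<Sum>m<n. Rc (zero_row i (arr \<omega>)) k m * D m l)) * cnj (scaled (arr \<omega>) i l))"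

definition ntrace :: "(nat \<Rightarrow> nat \<Rightarrow> complex) \<Rightarrow> (nat \<Rightarrow> nat \<Rightarrow> complex) \<Rightarrow> complex" where
  "ntrace A D = of_real (1 / T) * (\<Sum>k<n. \<Sum>l<n. A k l * D l k)"

definition variance_defect :: "nat \<Rightarrow> real" where
  "variance_defect i = (\<Sum>k<n. 1 - s i k)"

lemma frob_const_nonneg: "0 \<le> frob_const"
  using Rc_frob(2) by (meson Bochner_Integration.integral_nonneg frob_nonneg order_trans)

lemma variance_defect_nonneg: "i < N \<Longrightarrow> 0 \<le> variance_defect i"
  unfolding variance_defect_def using s_le by (intro sum_nonneg) auto

lemma qform_expand: "qform i D \<omega> = (\<Sum>k<n. \<Sum>l<n. X i k \<omega> * (of_real (1 / T) * (\<Sum>m<n. Rc (zero_row i (arr \<omega>)) k m * D m l)) * cnj (X i l \<omega>))"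
proof -
  have sc: "complex_of_real (1 / sqrt T) * of_real (1 / sqrt T) = of_real (1 / T)"
    unfolding of_real_mult[symmetric] scale_square[symmetric] power2_eq_square ..
  define S where "S k l = (\<Sum>m<n. Rc (zero_row i (arr \<omega>)) k m * D m l)" for k l
  have gen: "(\<Sum>k<n. (c * X i k \<omega>) * S k l) * (c * cnj (X i l \<omega>)) = (\<Sum>k<n. X i k \<omega> * ((c * c) * S k l) * cnj (X i l \<omega>))" for c l
    by (simp add: sum_distrib_right sum_distrib_left mult_ac)
  have "qform i D \<omega> = (\<Sum>l<n. \<Sum>k<n. X i k \<omega> * ((of_real (1 / sqrt T) * of_real (1 / sqrt T)) * S k l) * cnj (X i l \<omega>))"
    unfolding qform_def scaled_def[of "arr \<omega>"] complex_cnj_mult complex_cnj_complex_of_real S_def[symmetric] gen ..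
  then show ?thesis unfolding sc S_def by (subst sum.swap) simp
qed

lemma ntrace_bound:
  assumes "row_bound n K D"
  shows "(cmod (ntrace A D))\<^sup>2 \<le> frob n n A * (K * n) / T\<^sup>2"
proof -
  have "(cmod (\<Sum>k<n. \<Sum>l<n. A k l * D l k))\<^sup>2 \<le> frob n n A * frob n n (\<lambda>k l. D l k)"
    by (rule cmod_frob_inner_square_le)
  also have "frob n n (\<lambda>k l. D l k) = frob n n D" unfolding frob_def by (rule sum.swap)
  also have "frob n n A * frob n n D \<le> frob n n A * (K * n)"
    by (intro mult_left_mono frob_le_of_row_bound assms) simp
  finally have "(cmod (\<Sum>k<n. \<Sum>l<n. A k l * D l k))\<^sup>2 \<le> frob n n A * (K * n)" .
  then have "(1 / T)\<^sup>2 * (cmod (\<Sum>k<n. \<Sum>l<n. A k l * D l k))\<^sup>2 \<le> (1 / T)\<^sup>2 * (frob n n A * (K * n))"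
    by (intro mult_left_mono) auto
  then show ?thesis unfolding ntrace_def norm_mult power_mult_distrib norm_of_real power2_abs
    by (simp add: power_divide)
qed

lemma ntrace_measurable:
  assumes "\<And>k l. (\<lambda>\<omega>. A \<omega> k l) \<in> borel_measurable M'"
  shows "(\<lambda>\<omega>. ntrace (A \<omega>) D) \<in> borel_measurable M'"
  unfolding ntrace_def using assms
  by (intro borel_measurable_times borel_measurable_sum borel_measurable_const) auto

lemma qform_measurable: "qform i D \<in> borel_measurable M"
proof -
  have "(\<lambda>\<omega>. qform i D \<omega>) \<in> borel_measurable M" unfolding qform_def
    by (intro borel_measurable_times borel_measurable_sum borel_measurable_cnj scaled_measurable Rc0_measurable borel_measurable_const)
  then show ?thesis by simp
qed

lemma rest_coresolvent_measurable:
  "(\<lambda>p. Rc (rest_of i p) k l) \<in> borel_measurable (rest_space i)"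
  "(\<lambda>p. Rc (rest_of i (snd p)) k l) \<in> borel_measurable (row_space i \<Otimes>\<^sub>M rest_space i)"
proof -
  show 1: "(\<lambda>p. Rc (rest_of i p) k l) \<in> borel_measurable (rest_space i)"
    by (rule coresolvent_measurable[where Y = "\<lambda>p. scaled (rest_of i p)"])
       (unfold scaled_def, intro borel_measurable_times borel_measurable_const rest_of_measurable)
  show "(\<lambda>p. Rc (rest_of i (snd p)) k l) \<in> borel_measurable (row_space i \<Otimes>\<^sub>M rest_space i)"
    by (rule measurable_compose[OF measurable_snd 1])
qed

lemma rest_frob_measurable: "(\<lambda>p. c * frob n n (Rc (rest_of i p))) \<in> borel_measurable (rest_space i)"
  by (intro borel_measurable_times borel_measurable_const frob_measurable rest_coresolvent_measurable)

text \<open>The matrix R_i D is independent of row i, so the bound for quadratic forms applies row by row with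
  R_i D frozen; its Frobenius norm is of the order sqrt n, so the bound is of the order (b^2 + defect) / T,
  which is small when b^2 is a small multiple of T.\<close>
lemma quadratic_concentration:
  assumes i: "i < N" and D: "row_bound n K D"
  defines "V \<equiv> (\<lambda>\<omega>. (cmod (qform i D \<omega> - ntrace (Rc (zero_row i (arr \<omega>))) D))\<^sup>2)"
  shows "integrable M V"
    and "expectation V \<le> 2 * (9 + 3 * b\<^sup>2 + variance_defect i) * K / T\<^sup>2 * frob_const"
proof -
  interpret R: bounded_indep M "X i" "{..<n}" b "s i" by (rule row_bounded_indep[OF i])
  define A where "A W k l = complex_of_real (1 / T) * (\<Sum>m<n. Rc W k m * D m l)" for W k l
  define c where "c = 2 * (9 + 3 * b\<^sup>2 + variance_defect i) * K / T\<^sup>2"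
  let ?F = "\<lambda>u W. (cmod ((\<Sum>k<n. \<Sum>l<n. u k * A W k l * cnj (u l)) - (\<Sum>k<n. A W k k)))\<^sup>2"
  let ?g = "\<lambda>W. c * frob n n (Rc W)"
  have V: "V \<omega> = ?F (\<lambda>k. X i k \<omega>) (zero_row i (arr \<omega>))" for \<omega>
    unfolding V_def qform_expand ntrace_def A_def sum_distrib_left ..
  have Am: "(\<lambda>p. A (rest_of i (snd p)) k l) \<in> borel_measurable (row_space i \<Otimes>\<^sub>M rest_space i)" for k l
    unfolding A_def by (intro borel_measurable_times borel_measurable_sum borel_measurable_const rest_coresolvent_measurable)
  have Fm: "(\<lambda>p. ?F (row_of i (fst p)) (rest_of i (snd p))) \<in> borel_measurable (row_space i \<Otimes>\<^sub>M rest_space i)"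
    by (intro borel_measurable_power measurable_compose[OF _ borel_measurable_norm] borel_measurable_diff borel_measurable_sum
        borel_measurable_times borel_measurable_cnj row_of_fst Am)
  have frobA: "(\<Sum>k<n. \<Sum>l<n. (cmod (A W k l))\<^sup>2) \<le> (1 / T)\<^sup>2 * (K * frob n n (Rc W))" for W
  proof -
    have "(\<Sum>k<n. \<Sum>l<n. (cmod (A W k l))\<^sup>2) = (1 / T)\<^sup>2 * frob n n (\<lambda>k l. \<Sum>m<n. Rc W k m * D m l)"
      unfolding A_def frob_def norm_mult power_mult_distrib norm_of_real power2_abs by (simp add: sum_distrib_left)
    also have "\<dots> \<le> (1 / T)\<^sup>2 * (K * frob n n (Rc W))" by (intro mult_left_mono frob_mult_row_bound D) simp
    finally show ?thesis .
  qed
  have int: "integrable M (\<lambda>\<omega>. ?F (\<lambda>k. X i k \<omega>) W)" for W by (rule R.quadratic_form(1))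
  have le: "expectation (\<lambda>\<omega>. ?F (\<lambda>k. X i k \<omega>) W) \<le> ?g W" for W
  proof -
    have "expectation (\<lambda>\<omega>. ?F (\<lambda>k. X i k \<omega>) W) \<le> 2 * (9 + 3 * b\<^sup>2 + variance_defect i) * (\<Sum>k<n. \<Sum>l<n. (cmod (A W k l))\<^sup>2)"
      unfolding variance_defect_def by (rule R.quadratic_form(2))
    also have "\<dots> \<le> 2 * (9 + 3 * b\<^sup>2 + variance_defect i) * ((1 / T)\<^sup>2 * (K * frob n n (Rc W)))"
      using frobA variance_defect_nonneg[OF i] by (intro mult_left_mono) auto
    finally show ?thesis unfolding c_def by (simp add: power_divide mult_ac)
  qed
  have gi: "integrable M (\<lambda>\<omega>. ?g (zero_row i (arr \<omega>)))" using Rc_frob(3) by simp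
  note * = row_expectation_le[where F = ?F and g = ?g, OF i Fm _ int le rest_frob_measurable gi, folded V]
  show "integrable M V" using *(1) by simp
  have "K \<ge> 0 \<or> n = 0"
  proof (rule disjCI)
    assume "n \<noteq> 0"
    moreover have "0 \<le> K * n" by (rule order_trans[OF frob_nonneg frob_le_of_row_bound[OF D]])
    ultimately show "0 \<le> K" by (simp add: zero_le_mult_iff)
  qed
  have "c * expectation (\<lambda>\<omega>. frob n n (Rc (zero_row i (arr \<omega>)))) \<le> c * frob_const"
  proof (cases "n = 0")
    case True
    then have "c * expectation (\<lambda>\<omega>. frob n n (Rc (zero_row i (arr \<omega>)))) = 0" by (simp add: frob_def)
    moreover have "frob_const = 0" unfolding frob_const_def outer_const_def using True by simp
    ultimately show ?thesis by (metis mult_zero_right order_refl)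
  next
    case False
    then have "c \<ge> 0" unfolding c_def using \<open>K \<ge> 0 \<or> n = 0\<close> variance_defect_nonneg[OF i] by auto
    then show ?thesis by (intro mult_left_mono Rc_frob)
  qed
  then show "expectation V \<le> 2 * (9 + 3 * b\<^sup>2 + variance_defect i) * K / T\<^sup>2 * frob_const"
    using *(2) unfolding c_def[symmetric] by simp
qed

text \<open>Both vectors are linear in row i for fixed R_i; their second moments bound the rank one difference
  between R and R_i.\<close>
lemma row_times_coresolvent:
  assumes i: "i < N"
  defines "r \<equiv> (\<lambda>\<omega>. \<Sum>m<n. (cmod (\<Sum>p<n. scaled (arr \<omega>) i p * Rc (zero_row i (arr \<omega>)) p m))\<^sup>2)"
    and "c \<equiv> (\<lambda>\<omega>. \<Sum>k<n. (cmod (\<Sum>p<n. Rc (zero_row i (arr \<omega>)) k p * cnj (scaled (arr \<omega>) i p)))\<^sup>2)"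
  shows "integrable M r" "expectation r \<le> 3 / T * frob_const" "integrable M c" "expectation c \<le> 3 / T * frob_const"
proof -
  interpret R: bounded_indep M "X i" "{..<n}" b "s i" by (rule row_bounded_indep[OF i])
  let ?g = "\<lambda>W. 3 / T * frob n n (Rc W)"
  let ?F1 = "\<lambda>u W. \<Sum>m<n. (cmod (\<Sum>p<n. (of_real (1 / sqrt T) * Rc W p m) * u p))\<^sup>2"
  let ?F2 = "\<lambda>u W. \<Sum>k<n. (cmod (\<Sum>p<n. (of_real (1 / sqrt T) * cnj (Rc W k p)) * u p))\<^sup>2"
  have r: "r \<omega> = ?F1 (\<lambda>k. X i k \<omega>) (zero_row i (arr \<omega>))" for \<omega>
    unfolding r_def scaled_def[of "arr \<omega>"]
    by (intro sum.cong refl arg_cong[where f = "\<lambda>x. (cmod x)\<^sup>2"]) (simp only: mult_ac)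
  have c: "c \<omega> = ?F2 (\<lambda>k. X i k \<omega>) (zero_row i (arr \<omega>))" for \<omega>
    unfolding c_def
  proof (intro sum.cong refl arg_cong[where f = "\<lambda>x. x\<^sup>2"])
    fix k
    have e: "cnj (\<Sum>p<n. Rc (zero_row i (arr \<omega>)) k p * cnj (scaled (arr \<omega>) i p)) = (\<Sum>p<n. of_real (1 / sqrt T) * cnj (Rc (zero_row i (arr \<omega>)) k p) * X i p \<omega>)"
      unfolding scaled_def[of "arr \<omega>"] cnj_sum by (intro sum.cong refl) (simp add: mult_ac)
    show "cmod (\<Sum>p<n. Rc (zero_row i (arr \<omega>)) k p * cnj (scaled (arr \<omega>) i p)) = cmod (\<Sum>p<n. of_real (1 / sqrt T) * cnj (Rc (zero_row i (arr \<omega>)) k p) * X i p \<omega>)"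
      unfolding e[symmetric] complex_mod_cnj ..
  qed
  have F1m: "(\<lambda>p. ?F1 (row_of i (fst p)) (rest_of i (snd p))) \<in> borel_measurable (row_space i \<Otimes>\<^sub>M rest_space i)"
    by (intro borel_measurable_power measurable_compose[OF _ borel_measurable_norm] borel_measurable_sum
        borel_measurable_times row_of_fst rest_coresolvent_measurable borel_measurable_const)
  have F2m: "(\<lambda>p. ?F2 (row_of i (fst p)) (rest_of i (snd p))) \<in> borel_measurable (row_space i \<Otimes>\<^sub>M rest_space i)"
    by (intro borel_measurable_power measurable_compose[OF _ borel_measurable_norm] borel_measurable_sum
        borel_measurable_times borel_measurable_cnj row_of_fst rest_coresolvent_measurable borel_measurable_const)
  have sc: "(cmod (of_real (1 / sqrt T) * x))\<^sup>2 = 1 / T * (cmod x)\<^sup>2" for x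
    unfolding norm_mult power_mult_distrib norm_of_real power2_abs scale_square ..
  have 1: "integrable M (\<lambda>\<omega>. ?F1 (\<lambda>k. X i k \<omega>) W)" "expectation (\<lambda>\<omega>. ?F1 (\<lambda>k. X i k \<omega>) W) \<le> ?g W" for W
  proof -
    note L = R.linear_form[of "{..<n}" "\<lambda>p. of_real (1 / sqrt T) * Rc W p m" for m, unfolded sc]
    show "integrable M (\<lambda>\<omega>. ?F1 (\<lambda>k. X i k \<omega>) W)" using L by (intro Bochner_Integration.integrable_sum) auto
    have "expectation (\<lambda>\<omega>. ?F1 (\<lambda>k. X i k \<omega>) W) = (\<Sum>m<n. expectation (\<lambda>\<omega>. (cmod (\<Sum>p<n. (of_real (1 / sqrt T) * Rc W p m) * X i p \<omega>))\<^sup>2))"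
      using L by (intro Bochner_Integration.integral_sum) auto
    also have "\<dots> \<le> (\<Sum>m<n. 3 * (\<Sum>p<n. 1 / T * (cmod (Rc W p m))\<^sup>2))" using L by (intro sum_mono) auto
    also have "\<dots> = ?g W" unfolding frob_swap[of n n "Rc W"] by (simp add: sum_distrib_left)
    finally show "expectation (\<lambda>\<omega>. ?F1 (\<lambda>k. X i k \<omega>) W) \<le> ?g W" .
  qed
  have 2: "integrable M (\<lambda>\<omega>. ?F2 (\<lambda>k. X i k \<omega>) W)" "expectation (\<lambda>\<omega>. ?F2 (\<lambda>k. X i k \<omega>) W) \<le> ?g W" for W
  proof -
    note L = R.linear_form[of "{..<n}" "\<lambda>p. of_real (1 / sqrt T) * cnj (Rc W m p)" for m, unfolded sc]
    show "integrable M (\<lambda>\<omega>. ?F2 (\<lambda>k. X i k \<omega>) W)" using L by (intro Bochner_Integration.integrable_sum) auto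
    have "expectation (\<lambda>\<omega>. ?F2 (\<lambda>k. X i k \<omega>) W) = (\<Sum>m<n. expectation (\<lambda>\<omega>. (cmod (\<Sum>p<n. (of_real (1 / sqrt T) * cnj (Rc W m p)) * X i p \<omega>))\<^sup>2))"
      using L by (intro Bochner_Integration.integral_sum) auto
    also have "\<dots> \<le> (\<Sum>m<n. 3 * (\<Sum>p<n. 1 / T * (cmod (cnj (Rc W m p)))\<^sup>2))" using L by (intro sum_mono) auto
    also have "\<dots> = ?g W" unfolding frob_def by (simp add: sum_distrib_left)
    finally show "expectation (\<lambda>\<omega>. ?F2 (\<lambda>k. X i k \<omega>) W) \<le> ?g W" .
  qed
  have gi: "integrable M (\<lambda>\<omega>. ?g (zero_row i (arr \<omega>)))" using Rc_frob(3) by simp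
  have gE: "expectation (\<lambda>\<omega>. ?g (zero_row i (arr \<omega>))) \<le> 3 / T * frob_const"
  proof -
    have "3 / T * expectation (\<lambda>\<omega>. frob n n (Rc (zero_row i (arr \<omega>)))) \<le> 3 / T * frob_const"
      using T by (intro mult_left_mono Rc_frob) auto
    then show ?thesis by simp
  qed
  have nn: "0 \<le> ?F1 u W" "0 \<le> ?F2 u W" for u W by (auto intro: sum_nonneg)
  note r1 = row_expectation_le[where F = ?F1 and g = ?g, OF i F1m nn(1) 1 rest_frob_measurable gi, folded r]
  note r2 = row_expectation_le[where F = ?F2 and g = ?g, OF i F2m nn(2) 2 rest_frob_measurable gi, folded c]
  show "integrable M r" "integrable M c" using r1(1) r2(1) by simp_all
  show "expectation r \<le> 3 / T * frob_const" "expectation c \<le> 3 / T * frob_const" using r1(2) r2(2) gE by linarith+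
qed

definition conc_const :: "real \<Rightarrow> real \<Rightarrow> nat \<Rightarrow> real" where
  "conc_const K \<theta> i = \<theta> + 2 * (9 + 3 * b\<^sup>2 + variance_defect i) * K / T\<^sup>2 * frob_const / \<theta>
     + 3 * (1 + K) * frob_const / (2 * Im z * T\<^sup>2)"

text \<open>The quadratic form concentrates at the trace of R_i D, and the rank one formula exchanges R_i for
  R.\<close>
lemma trace_concentration:
  assumes i: "i < N" and D: "row_bound n K D" and \<theta>: "\<theta> > 0" and K: "K \<ge> 0"
  shows "integrable M (\<lambda>\<omega>. cmod (qform i D \<omega> - ntrace (Rc (arr \<omega>)) D))"
    and "expectation (\<lambda>\<omega>. cmod (qform i D \<omega> - ntrace (Rc (arr \<omega>)) D)) \<le> conc_const K \<theta> i"
proof -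
  define V where "V \<omega> = (cmod (qform i D \<omega> - ntrace (Rc (zero_row i (arr \<omega>))) D))\<^sup>2" for \<omega>
  define r where "r \<omega> = (\<Sum>m<n. (cmod (\<Sum>p<n. scaled (arr \<omega>) i p * Rc (zero_row i (arr \<omega>)) p m))\<^sup>2)" for \<omega>
  define c where "c \<omega> = (\<Sum>k<n. (cmod (\<Sum>p<n. Rc (zero_row i (arr \<omega>)) k p * cnj (scaled (arr \<omega>) i p)))\<^sup>2)" for \<omega>
  have V: "integrable M V" "expectation V \<le> 2 * (9 + 3 * b\<^sup>2 + variance_defect i) * K / T\<^sup>2 * frob_const"
    using quadratic_concentration[OF i D] unfolding V_def by auto
  have rc: "integrable M r" "expectation r \<le> 3 / T * frob_const" "integrable M c" "expectation c \<le> 3 / T * frob_const"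
    using row_times_coresolvent[OF i] unfolding r_def c_def by auto
  let ?c = "1 / (2 * Im z * T)"
  have le: "cmod (qform i D \<omega> - ntrace (Rc (arr \<omega>)) D) \<le> \<theta> + V \<omega> / \<theta> + ?c * (c \<omega> + K * r \<omega>)" for \<omega>
  proof -
    note zpos = z
    interpret cavity N n z C "scaled (arr \<omega>)" by (rule cavity_model)
    define R0 where "R0 = Rc (zero_row i (arr \<omega>))"
    have R0: "coresolvent N n z C (zero_row i (scaled (arr \<omega>))) = R0" unfolding R0_def scaled_zero_row ..
    define c' where "c' k = (\<Sum>p<n. R0 k p * cnj (scaled (arr \<omega>) i p))" for k
    define r' where "r' m = (\<Sum>p<n. scaled (arr \<omega>) i p * R0 p m)" for m
    have d: "R0 k l - Rc (arr \<omega>) k l = Gc (arr \<omega>) i i * c' k * r' l" if "k < n" for k l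
      using coresolvent_diff[OF i that, of l] unfolding R0 c'_def r'_def .
    have "ntrace R0 D - ntrace (Rc (arr \<omega>)) D = of_real (1 / T) * (\<Sum>k<n. \<Sum>l<n. (R0 k l - Rc (arr \<omega>) k l) * D l k)"
      unfolding ntrace_def by (simp add: right_diff_distrib left_diff_distrib sum_subtractf)
    also have "(\<Sum>k<n. \<Sum>l<n. (R0 k l - Rc (arr \<omega>) k l) * D l k) = (\<Sum>k<n. \<Sum>l<n. Gc (arr \<omega>) i i * (c' k * (r' l * D l k)))"
      by (rule sum.cong[OF refl], rule sum.cong[OF refl]) (simp add: d mult_ac)
    also have "of_real (1 / T) * \<dots> = of_real (1 / T) * Gc (arr \<omega>) i i * (\<Sum>k<n. c' k * (\<Sum>l<n. r' l * D l k))"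
      by (simp add: sum_distrib_left mult.assoc)
    finally have "cmod (ntrace R0 D - ntrace (Rc (arr \<omega>)) D) = 1 / T * cmod (Gc (arr \<omega>) i i) * cmod (\<Sum>k<n. c' k * (\<Sum>l<n. r' l * D l k))"
      using T by (simp add: norm_mult norm_divide)
    also have "\<dots> \<le> 1 / T * (1 / Im z) * ((c \<omega> + K * r \<omega>) / 2)"
    proof (intro mult_mono)
      show "cmod (Gc (arr \<omega>) i i) \<le> 1 / Im z" using resolvent_diag_bound[OF hermitian_gram z i] zpos by simp
      have "(cmod (\<Sum>k<n. c' k * (\<Sum>l<n. r' l * D l k)))\<^sup>2 \<le> (\<Sum>k<n. (cmod (c' k))\<^sup>2) * (\<Sum>k<n. (cmod (\<Sum>l<n. r' l * D l k))\<^sup>2)"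
        by (rule cmod_sum_mult_square_le)
      also have "\<dots> \<le> c \<omega> * (K * r \<omega>)"
        using row_boundD[OF D, of r'] unfolding c_def r_def c'_def r'_def R0_def by (intro mult_mono) (auto intro: sum_nonneg)
      also have "\<dots> \<le> ((c \<omega> + K * r \<omega>) / 2)\<^sup>2"
        using sum_squares_bound[of "c \<omega>" "K * r \<omega>"] by (simp add: power_divide power2_sum mult_ac)
      finally show "cmod (\<Sum>k<n. c' k * (\<Sum>l<n. r' l * D l k)) \<le> (c \<omega> + K * r \<omega>) / 2"
        by (rule power2_le_imp_le) (use K in \<open>auto simp: c_def r_def intro!: add_nonneg_nonneg sum_nonneg mult_nonneg_nonneg\<close>)
    qed (use T zpos in auto)
    finally have 1: "cmod (ntrace R0 D - ntrace (Rc (arr \<omega>)) D) \<le> ?c * (c \<omega> + K * r \<omega>)" by (simp add: mult_ac)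
    have "cmod (qform i D \<omega> - ntrace R0 D) \<le> \<theta> + V \<omega> / \<theta>"
      unfolding V_def R0_def by (rule le_add_square_div[OF \<theta>])
    then show ?thesis using 1 norm_triangle_ineq[of "qform i D \<omega> - ntrace R0 D" "ntrace R0 D - ntrace (Rc (arr \<omega>)) D"] by simp
  qed
  have bi: "integrable M (\<lambda>\<omega>. \<theta> + V \<omega> / \<theta> + ?c * (c \<omega> + K * r \<omega>))" using V rc by simp
  have m: "(\<lambda>\<omega>. cmod (qform i D \<omega> - ntrace (Rc (arr \<omega>)) D)) \<in> borel_measurable M"
    by (intro measurable_compose[OF _ borel_measurable_norm] borel_measurable_diff qform_measurable ntrace_measurable Rc_measurable)
  show i: "integrable M (\<lambda>\<omega>. cmod (qform i D \<omega> - ntrace (Rc (arr \<omega>)) D))"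
    by (rule Bochner_Integration.integrable_bound[OF bi m]) (use le in \<open>auto intro!: AE_I2 order_trans[OF _ abs_ge_self]\<close>)
  have "expectation (\<lambda>\<omega>. cmod (qform i D \<omega> - ntrace (Rc (arr \<omega>)) D)) \<le> expectation (\<lambda>\<omega>. \<theta> + V \<omega> / \<theta> + ?c * (c \<omega> + K * r \<omega>))"
    by (rule integral_mono[OF i bi le])
  also have "\<dots> = \<theta> + expectation V / \<theta> + ?c * (expectation c + K * expectation r)"
    using V rc by (simp add: prob_space)
  also have "\<dots> \<le> \<theta> + (2 * (9 + 3 * b\<^sup>2 + variance_defect i) * K / T\<^sup>2 * frob_const) / \<theta> + ?c * (3 / T * frob_const + K * (3 / T * frob_const))"
    using V rc \<theta> T z K by (intro add_mono mult_left_mono divide_right_mono order_refl) auto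
  also have "\<dots> = conc_const K \<theta> i" unfolding conc_const_def using T z by (simp add: field_simps power2_eq_square)
  finally show "expectation (\<lambda>\<omega>. cmod (qform i D \<omega> - ntrace (Rc (arr \<omega>)) D)) \<le> conc_const K \<theta> i" .
qed

section \<open>The self-consistent equation for the mean trace\<close>

definition mtrace :: "'a \<Rightarrow> complex" where
  "mtrace \<omega> = (\<Sum>i<N. Gc (arr \<omega>) i i) / of_nat N"

lemma mtrace_measurable [measurable]: "mtrace \<in> borel_measurable M"
  unfolding mtrace_def[abs_def] by measurable

lemma resolvent_diag_le: "i < N \<Longrightarrow> cmod (Gc W i i) \<le> 1 / Im z"
  using resolvent_diag_bound[OF cavity.hermitian_gram[OF cavity_model] cavity.z[OF cavity_model]] z by simp

lemma mtrace_bound: "cmod (mtrace \<omega>) \<le> 1 / Im z"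
proof -
  have "cmod (\<Sum>i<N. Gc (arr \<omega>) i i) \<le> (\<Sum>i<N. 1 / Im z)" by (rule sum_norm_le) (simp add: resolvent_diag_le)
  then show ?thesis unfolding mtrace_def norm_divide using N by (simp add: field_simps)
qed

lemma mtrace_integrable: "integrable M mtrace"
  by (rule integrable_const_bound[of _ "1 / Im z"]) (use mtrace_bound in auto)

lemma ntrace_add: "ntrace A (\<lambda>k l. D k l + D' k l) = ntrace A D + ntrace A D'"
  and ntrace_cmult: "ntrace A (\<lambda>k l. a * D k l) = a * ntrace A D"
  unfolding ntrace_def by (simp_all add: distrib_left sum.distrib sum_distrib_left mult_ac)

text \<open>The row expansion of the trace of R B, rescaled.\<close>
lemma weighted_qform_sum:
  assumes w: "w = (\<lambda>k l. \<Sum>p<n. B k p * C p l)"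
  shows "ntrace (Rc (arr \<omega>)) B = ntrace C B - of_real (1 / T) * (\<Sum>i<N. Gc (arr \<omega>) i i * qform i w \<omega>)"
  unfolding ntrace_def right_diff_distrib[symmetric] w qform_def scaled_zero_row
  by (intro arg_cong2[of _ _ _ _ "(*)"] refl cavity.trace_coresolvent_mult[OF cavity_model])

lemma cmod_mult_le: "x * y \<le> x\<^sup>2 / \<theta> + \<theta> * y\<^sup>2" if "\<theta> > 0" for x y :: real
proof -
  have "0 \<le> (x - \<theta> * y)\<^sup>2 + x\<^sup>2 + (\<theta> * y)\<^sup>2" by simp
  then have "\<theta> * (x * y) \<le> x\<^sup>2 + \<theta>\<^sup>2 * y\<^sup>2" by (simp add: power2_eq_square algebra_simps)
  then show ?thesis using that by (simp add: field_simps power2_eq_square)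
qed

text \<open>With m the trace of G over N, t_J the trace of R J over T and rho that of C B, the cavity formula
  summed over i reads 1 - m (rho - z) = m (t_I - rho) up to concentration errors, where I is the identity. As B
  + (N / T) w D, with D = B C, is I up to a matrix of small Frobenius norm, t_I is the trace of R B plus (N / T)
  w t_D; the row expansion gives the former as rho - (N / T) m t_D, and the two terms in t_D cancel as m is
  close to its mean w.\<close>
lemma mean_equation_estimate:
  fixes B :: "nat \<Rightarrow> nat \<Rightarrow> complex" and K e\<^sub>0 \<theta> :: real
  defines "D \<equiv> (\<lambda>k l. \<Sum>p<n. B k p * C p l)" and "w \<equiv> expectation mtrace"
  assumes D: "row_bound n K D" and K: "K \<ge> 1" and \<theta>: "\<theta> > 0"
    and e0: "frob n n (\<lambda>k l. B k l + of_real (N / T) * w * D k l - (if k = l then 1 else 0)) \<le> e\<^sub>0"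
  shows "cmod (1 - w * (ntrace C B - z)) \<le>
    1 / Im z * ((1 + N / (T * Im z)) * ((\<Sum>i<N. conc_const K \<theta> i) / N)
      + N / T * (expectation (\<lambda>\<omega>. (cmod (mtrace \<omega> - w))\<^sup>2) / \<theta> + \<theta> * (frob_const * (K * n) / T\<^sup>2))
      + (\<theta> * frob_const + e\<^sub>0 / \<theta>) / T)"
proof -
  define I where "I = (\<lambda>k l::nat. if k = l then 1 else 0 :: complex)"
  define Er where "Er = (\<lambda>k l. B k l + of_real (N / T) * w * D k l - I k l)"
  define R where "R \<omega> = Rc (arr \<omega>)" for \<omega>
  define p where "p J i \<omega> = cmod (qform i J \<omega> - ntrace (R \<omega>) J)" for J i \<omega>
  have rI: "row_bound n K I"
    unfolding row_bound_def
  proof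
    fix u :: "nat \<Rightarrow> complex"
    have "(\<Sum>l<n. (cmod (\<Sum>k<n. u k * I k l))\<^sup>2) \<le> 1 * (\<Sum>k<n. (cmod (u k))\<^sup>2)"
      unfolding I_def by (rule row_boundD[OF row_bound_id])
    also have "\<dots> \<le> K * (\<Sum>k<n. (cmod (u k))\<^sup>2)" using K by (intro mult_right_mono sum_nonneg) auto
    finally show "(\<Sum>l<n. (cmod (\<Sum>k<n. u k * I k l))\<^sup>2) \<le> K * (\<Sum>k<n. (cmod (u k))\<^sup>2)" .
  qed
  have v: "Im z > 0" by (rule z)
  have N0: "real N > 0" using N by simp
  let ?bound = "\<lambda>\<omega>. 1 / Im z * ((\<Sum>i<N. p I i \<omega>) / N + N / (T * Im z) * ((\<Sum>i<N. p D i \<omega>) / N)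
      + N / T * ((cmod (mtrace \<omega> - w))\<^sup>2 / \<theta> + \<theta> * (frob n n (R \<omega>) * (K * n) / T\<^sup>2))
      + (\<theta> * frob n n (R \<omega>) + e\<^sub>0 / \<theta>) / T)"
  have le: "cmod (1 - mtrace \<omega> * (ntrace C B - z)) \<le> ?bound \<omega>" for \<omega>
  proof -
    define g where "g i = Gc (arr \<omega>) i i" for i
    define m where "m = mtrace \<omega>"
    define tI where "tI = ntrace (R \<omega>) I"
    define tD where "tD = ntrace (R \<omega>) D"
    define tE where "tE = ntrace (R \<omega>) Er"
    define \<rho> where "\<rho> = ntrace C B"
    have g: "cmod (g i) \<le> 1 / Im z" if "i < N" for i unfolding g_def by (rule resolvent_diag_le[OF that])
    have m: "m * of_nat N = (\<Sum>i<N. g i)" unfolding m_def mtrace_def g_def using N by simp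
    \<comment> \<open>the cavity formula for the diagonal of the resolvent\<close>
    have qI: "g i * qform i I \<omega> = 1 + z * g i" if "i < N" for i
    proof -
      have "qform i I \<omega> = (\<Sum>l<n. (\<Sum>k<n. scaled (arr \<omega>) i k * Rc (zero_row i (arr \<omega>)) k l) * cnj (scaled (arr \<omega>) i l))"
        unfolding qform_def I_def
        by (intro sum.cong refl arg_cong2[of _ _ _ _ "(*)"]) (simp add: sum_delta_mult)
      then show ?thesis
        using cavity.resolvent_diag_cavity[OF cavity_model that, of "scaled (arr \<omega>)"] unfolding g_def scaled_zero_row
        by (simp add: algebra_simps)
    qed
    have 1: "(1 - m * (\<rho> - z)) * of_nat N = (\<Sum>i<N. g i * (qform i I \<omega> - tI)) + m * of_nat N * (tI - \<rho>)"
    proof -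
      have "(\<Sum>i<N. g i * (qform i I \<omega> - tI)) = (\<Sum>i<N. 1 + z * g i - g i * tI)"
        by (intro sum.cong refl) (simp add: qI right_diff_distrib)
      also have "\<dots> = of_nat N + z * (\<Sum>i<N. g i) - (\<Sum>i<N. g i) * tI"
        by (simp add: sum_subtractf sum.distrib sum_distrib_left sum_distrib_right)
      finally show ?thesis unfolding m[symmetric] by (simp add: algebra_simps)
    qed
    \<comment> \<open>the same trace of R B is evaluated twice: here by the row expansion, and below through the
      approximate inverse\<close>
    have tB: "ntrace (R \<omega>) B = \<rho> - of_real (1 / T) * (\<Sum>i<N. g i * qform i D \<omega>)"
      unfolding R_def \<rho>_def g_def by (rule weighted_qform_sum) (simp add: D_def)
    have "ntrace (R \<omega>) B + of_real (N / T) * w * tD = ntrace (R \<omega>) (\<lambda>k l. Er k l + I k l)"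
      unfolding tD_def ntrace_cmult[symmetric] ntrace_add[symmetric] by (simp add: Er_def)
    then have 2: "tI = ntrace (R \<omega>) B + of_real (N / T) * w * tD - tE"
      unfolding ntrace_add tI_def tE_def by (simp add: algebra_simps)
    have 3: "(\<Sum>i<N. g i * qform i D \<omega>) = (\<Sum>i<N. g i * (qform i D \<omega> - tD)) + m * of_nat N * tD"
      unfolding m by (simp add: sum_subtractf right_diff_distrib sum_distrib_right)
    have NT: "complex_of_real (N / T) = of_real (1 / T) * of_nat N" by simp
    have 4: "tI - \<rho> = of_real (N / T) * (w - m) * tD - tE - of_real (1 / T) * (\<Sum>i<N. g i * (qform i D \<omega> - tD))"
      unfolding 2 tB 3 NT by (simp add: algebra_simps diff_divide_distrib)
    have gs: "cmod (\<Sum>i<N. g i * (qform i J \<omega> - ntrace (R \<omega>) J)) \<le> 1 / Im z * (\<Sum>i<N. p J i \<omega>)" for J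
      unfolding p_def sum_distrib_left by (rule sum_norm_le) (unfold norm_mult, intro mult_right_mono g, auto)
    have ND: "(cmod tD)\<^sup>2 \<le> frob n n (R \<omega>) * (K * n) / T\<^sup>2" unfolding tD_def by (rule ntrace_bound[OF D])
    have c5: "cmod (w - m) * cmod tD \<le> (cmod (m - w))\<^sup>2 / \<theta> + \<theta> * (frob n n (R \<omega>) * (K * n) / T\<^sup>2)"
      using cmod_mult_le[OF \<theta>, of "cmod (w - m)" "cmod tD"] mult_left_mono[OF ND, of \<theta>] \<theta>
      by (simp add: norm_minus_commute)
    have c6: "cmod tE \<le> (\<theta> * frob n n (R \<omega>) + e\<^sub>0 / \<theta>) / T"
    proof -
      have "(cmod (\<Sum>k<n. \<Sum>l<n. R \<omega> k l * Er l k))\<^sup>2 \<le> frob n n (R \<omega>) * frob n n (\<lambda>k l. Er l k)"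
        by (rule cmod_frob_inner_square_le)
      also have "frob n n (\<lambda>k l. Er l k) = frob n n Er" unfolding frob_def by (rule sum.swap)
      also have "frob n n (R \<omega>) * frob n n Er \<le> frob n n (R \<omega>) * e\<^sub>0"
        using e0 unfolding Er_def I_def by (intro mult_left_mono) auto
      also have "\<dots> \<le> (\<theta> * frob n n (R \<omega>) + e\<^sub>0 / \<theta>)\<^sup>2"
      proof -
        have "0 \<le> frob n n (R \<omega>) * e\<^sub>0" using order_trans[OF frob_nonneg e0] by simp
        moreover have "(\<theta> * frob n n (R \<omega>) + e\<^sub>0 / \<theta>)\<^sup>2
            = (\<theta> * frob n n (R \<omega>))\<^sup>2 + (e\<^sub>0 / \<theta>)\<^sup>2 + 2 * (frob n n (R \<omega>) * e\<^sub>0)"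
          using \<theta> by (simp add: power2_sum)
        moreover have "0 \<le> (\<theta> * frob n n (R \<omega>))\<^sup>2" "0 \<le> (e\<^sub>0 / \<theta>)\<^sup>2" by simp_all
        ultimately show ?thesis by linarith
      qed
      finally have "cmod (\<Sum>k<n. \<Sum>l<n. R \<omega> k l * Er l k) \<le> \<theta> * frob n n (R \<omega>) + e\<^sub>0 / \<theta>"
        by (rule power2_le_imp_le) (use \<theta> order_trans[OF frob_nonneg e0] in simp)
      then show ?thesis unfolding tE_def ntrace_def using T by (simp add: norm_mult norm_divide divide_right_mono)
    qed
    have c4: "cmod (tI - \<rho>) \<le> N / T * ((cmod (m - w))\<^sup>2 / \<theta> + \<theta> * (frob n n (R \<omega>) * (K * n) / T\<^sup>2))
        + (\<theta> * frob n n (R \<omega>) + e\<^sub>0 / \<theta>) / T + 1 / T * (1 / Im z * (\<Sum>i<N. p D i \<omega>))"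
    proof -
      have "cmod (tI - \<rho>) \<le> cmod (of_real (N / T) * (w - m) * tD) + cmod tE + cmod (of_real (1 / T) * (\<Sum>i<N. g i * (qform i D \<omega> - tD)))"
        unfolding 4 by (intro order_trans[OF norm_triangle_ineq4] add_mono norm_triangle_ineq4 order_refl)
      also have "cmod (of_real (N / T) * (w - m) * tD) = N / T * (cmod (w - m) * cmod tD)"
        unfolding norm_mult norm_of_real using T by simp
      also have "cmod (of_real (1 / T) * (\<Sum>i<N. g i * (qform i D \<omega> - tD))) = 1 / T * cmod (\<Sum>i<N. g i * (qform i D \<omega> - tD))"
        unfolding norm_mult norm_of_real using T by simp
      also have "N / T * (cmod (w - m) * cmod tD) + cmod tE + 1 / T * cmod (\<Sum>i<N. g i * (qform i D \<omega> - tD))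
        \<le> N / T * ((cmod (m - w))\<^sup>2 / \<theta> + \<theta> * (frob n n (R \<omega>) * (K * n) / T\<^sup>2))
        + (\<theta> * frob n n (R \<omega>) + e\<^sub>0 / \<theta>) / T + 1 / T * (1 / Im z * (\<Sum>i<N. p D i \<omega>))"
        using c5 c6 gs[of D] T unfolding tD_def by (intro add_mono mult_left_mono) auto
      finally show ?thesis .
    qed
    have mle: "cmod m \<le> 1 / Im z" unfolding m_def by (rule mtrace_bound)
    have "cmod (1 - m * (\<rho> - z)) * N = cmod ((1 - m * (\<rho> - z)) * of_nat N)" by (simp add: norm_mult)
    also have "\<dots> \<le> cmod (\<Sum>i<N. g i * (qform i I \<omega> - tI)) + cmod m * N * cmod (tI - \<rho>)"
      unfolding 1 by (rule order_trans[OF norm_triangle_ineq]) (simp add: norm_mult)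
    also have "\<dots> \<le> 1 / Im z * (\<Sum>i<N. p I i \<omega>) + 1 / Im z * N * cmod (tI - \<rho>)"
      using gs[of I] mle unfolding tI_def by (intro add_mono mult_right_mono) auto
    finally have "cmod (1 - m * (\<rho> - z)) \<le> 1 / Im z * ((\<Sum>i<N. p I i \<omega>) / N + cmod (tI - \<rho>))"
      using N0 v by (simp add: field_simps)
    also have "\<dots> \<le> 1 / Im z * ((\<Sum>i<N. p I i \<omega>) / N + (N / T * ((cmod (m - w))\<^sup>2 / \<theta> + \<theta> * (frob n n (R \<omega>) * (K * n) / T\<^sup>2))
        + (\<theta> * frob n n (R \<omega>) + e\<^sub>0 / \<theta>) / T + 1 / T * (1 / Im z * (\<Sum>i<N. p D i \<omega>))))"
      using c4 v by (intro mult_left_mono add_left_mono) auto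
    also have "\<dots> = ?bound \<omega>"
    proof -
      have "1 / T * (1 / Im z * (\<Sum>i<N. p D i \<omega>)) = N / (T * Im z) * ((\<Sum>i<N. p D i \<omega>) / N)"
        using N0 by (simp add: field_simps)
      then show ?thesis unfolding m_def by (simp add: add_ac)
    qed
    finally show ?thesis unfolding m_def \<rho>_def .
  qed
  have pi: "integrable M (p J i)" "expectation (p J i) \<le> conc_const K \<theta> i" if "i < N" "row_bound n K J" for i J
    using trace_concentration[OF that \<theta>] K unfolding p_def[abs_def] R_def by auto
  have mi: "integrable M (\<lambda>\<omega>. (cmod (mtrace \<omega> - w))\<^sup>2)"
  proof (rule integrable_const_bound[of _ "(1 / Im z + cmod w)\<^sup>2"])
    show "AE \<omega> in M. norm ((cmod (mtrace \<omega> - w))\<^sup>2) \<le> (1 / Im z + cmod w)\<^sup>2"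
      using mtrace_bound by (intro AE_I2) (auto intro!: power_mono order_trans[OF norm_triangle_ineq4])
  qed measurable
  have Ri: "integrable M (\<lambda>\<omega>. frob n n (R \<omega>))" "expectation (\<lambda>\<omega>. frob n n (R \<omega>)) \<le> frob_const"
    unfolding R_def using Rc_frob by auto
  have bi: "integrable M ?bound"
    using pi(1)[OF _ rI] pi(1)[OF _ D] mi Ri(1)
    by (intro integrable_mult_right Bochner_Integration.integrable_add integrable_divide Bochner_Integration.integrable_sum
        integrable_const integrable_mult_left) auto
  have "1 - w * (ntrace C B - z) = expectation (\<lambda>\<omega>. 1 - mtrace \<omega> * (ntrace C B - z))"
    unfolding w_def using mtrace_integrable by (simp add: prob_space)
  then have "cmod (1 - w * (ntrace C B - z)) \<le> expectation (\<lambda>\<omega>. cmod (1 - mtrace \<omega> * (ntrace C B - z)))"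
    by (simp only: integral_norm_bound)
  also have "\<dots> \<le> expectation ?bound"
    using mtrace_integrable by (intro integral_mono bi le) auto
  also have "\<dots> = 1 / Im z * ((\<Sum>i<N. expectation (p I i)) / N + N / (T * Im z) * ((\<Sum>i<N. expectation (p D i)) / N)
      + N / T * (expectation (\<lambda>\<omega>. (cmod (mtrace \<omega> - w))\<^sup>2) / \<theta> + \<theta> * (expectation (\<lambda>\<omega>. frob n n (R \<omega>)) * (K * n) / T\<^sup>2))
      + (\<theta> * expectation (\<lambda>\<omega>. frob n n (R \<omega>)) + e\<^sub>0 / \<theta>) / T)"
  proof -
    have si: "integrable M (\<lambda>\<omega>. \<Sum>i<N. p J i \<omega>)" "expectation (\<lambda>\<omega>. \<Sum>i<N. p J i \<omega>) = (\<Sum>i<N. expectation (p J i))"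
      if "row_bound n K J" for J
      using pi(1)[OF _ that] by (auto intro!: Bochner_Integration.integrable_sum Bochner_Integration.integral_sum)
    have lin: "expectation (\<lambda>\<omega>. c1 * (f1 \<omega> / c2 + c3 * (f2 \<omega> / c2) + c4 * (f3 \<omega> / \<theta> + \<theta> * (f4 \<omega> * c5 / c6)) + (\<theta> * f4 \<omega> + c7) / c8))
        = c1 * (expectation f1 / c2 + c3 * (expectation f2 / c2) + c4 * (expectation f3 / \<theta> + \<theta> * (expectation f4 * c5 / c6)) + (\<theta> * expectation f4 + c7) / c8)"
      if "integrable M f1" "integrable M f2" "integrable M f3" "integrable M f4" for f1 f2 f3 f4 :: "'a \<Rightarrow> real" and c1 c2 c3 c4 c5 c6 c7 c8
      using that by (simp add: prob_space)
    show ?thesis unfolding lin[OF si(1)[OF rI] si(1)[OF D] mi Ri(1)] si(2)[OF rI] si(2)[OF D] ..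
  qed
  also have "\<dots> \<le> 1 / Im z * ((\<Sum>i<N. conc_const K \<theta> i) / N + N / (T * Im z) * ((\<Sum>i<N. conc_const K \<theta> i) / N)
      + N / T * (expectation (\<lambda>\<omega>. (cmod (mtrace \<omega> - w))\<^sup>2) / \<theta> + \<theta> * (frob_const * (K * n) / T\<^sup>2))
      + (\<theta> * frob_const + e\<^sub>0 / \<theta>) / T)"
    using pi(2)[OF _ rI] pi(2)[OF _ D] Ri(2) v T \<theta> K
    by (intro mult_left_mono add_mono divide_right_mono mult_right_mono sum_mono order_refl) auto
  finally show ?thesis by (simp only: distrib_right mult_1_left)
qed

end

section \<open>The lag matrix and its inverse symbol\<close>

text \<open>Schur's test.\<close>
lemma row_bound_schur:
  assumes row: "\<And>k. k < n \<Longrightarrow> (\<Sum>l<n. cmod (D k l)) \<le> \<alpha>" and col: "\<And>l. l < n \<Longrightarrow> (\<Sum>k<n. cmod (D k l)) \<le> \<beta>"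
    and \<beta>: "\<beta> \<ge> 0"
  shows "row_bound n (\<alpha> * \<beta>) D"
  unfolding row_bound_def
proof
  fix u :: "nat \<Rightarrow> complex"
  have "(\<Sum>l<n. (cmod (\<Sum>k<n. u k * D k l))\<^sup>2) \<le> (\<Sum>l<n. \<beta> * (\<Sum>k<n. (cmod (u k))\<^sup>2 * cmod (D k l)))"
  proof (rule sum_mono)
    fix l assume l: "l \<in> {..<n}"
    have "(cmod (\<Sum>k<n. u k * D k l))\<^sup>2 \<le> (\<Sum>k<n. sqrt (cmod (D k l)) * (sqrt (cmod (D k l)) * cmod (u k)))\<^sup>2"
    proof (intro power_mono)
      show "cmod (\<Sum>k<n. u k * D k l) \<le> (\<Sum>k<n. sqrt (cmod (D k l)) * (sqrt (cmod (D k l)) * cmod (u k)))"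
        by (rule sum_norm_le) (simp add: norm_mult mult.assoc[symmetric])
    qed simp
    also have "\<dots> \<le> (\<Sum>k<n. (sqrt (cmod (D k l)))\<^sup>2) * (\<Sum>k<n. (sqrt (cmod (D k l)) * cmod (u k))\<^sup>2)"
      by (rule Cauchy_Schwarz_ineq_sum)
    also have "\<dots> = (\<Sum>k<n. cmod (D k l)) * (\<Sum>k<n. (cmod (u k))\<^sup>2 * cmod (D k l))"
      by (simp add: power_mult_distrib mult.commute)
    also have "\<dots> \<le> \<beta> * (\<Sum>k<n. (cmod (u k))\<^sup>2 * cmod (D k l))"
      using col l by (intro mult_right_mono sum_nonneg) auto
    finally show "(cmod (\<Sum>k<n. u k * D k l))\<^sup>2 \<le> \<beta> * (\<Sum>k<n. (cmod (u k))\<^sup>2 * cmod (D k l))" .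
  qed
  also have "\<dots> = \<beta> * (\<Sum>k<n. (cmod (u k))\<^sup>2 * (\<Sum>l<n. cmod (D k l)))"
    unfolding sum_distrib_left[symmetric] by (subst sum.swap) (simp add: sum_distrib_left)
  also have "\<dots> \<le> \<beta> * (\<Sum>k<n. (cmod (u k))\<^sup>2 * \<alpha>)"
    using row \<beta> by (intro mult_left_mono sum_mono) auto
  finally show "(\<Sum>l<n. (cmod (\<Sum>k<n. u k * D k l))\<^sup>2) \<le> \<alpha> * \<beta> * (\<Sum>k<n. (cmod (u k))\<^sup>2)"
    by (simp add: sum_distrib_left mult_ac)
qed

lemma row_bound_mult:
  assumes "row_bound n K B" "row_bound n L C" "L \<ge> 0"
  shows "row_bound n (K * L) (\<lambda>k l. \<Sum>p<n. B k p * C p l)"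
  unfolding row_bound_def
proof
  fix u :: "nat \<Rightarrow> complex"
  have "(\<Sum>l<n. (cmod (\<Sum>k<n. u k * (\<Sum>p<n. B k p * C p l)))\<^sup>2) = (\<Sum>l<n. (cmod (\<Sum>p<n. (\<Sum>k<n. u k * B k p) * C p l))\<^sup>2)"
    by (simp only: sum_mult_assoc)
  also have "\<dots> \<le> L * (\<Sum>p<n. (cmod (\<Sum>k<n. u k * B k p))\<^sup>2)" by (rule row_boundD[OF assms(2)])
  also have "\<dots> \<le> L * (K * (\<Sum>k<n. (cmod (u k))\<^sup>2))" using assms by (intro mult_left_mono row_boundD)
  finally show "(\<Sum>l<n. (cmod (\<Sum>k<n. u k * (\<Sum>p<n. B k p * C p l)))\<^sup>2) \<le> K * L * (\<Sum>k<n. (cmod (u k))\<^sup>2)"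
    by (simp add: mult_ac)
qed

text \<open>With this Toeplitz matrix, whose symbol is x -> cos (tau x), the symmetrised sum of the products
  of the columns k and k + tau becomes Y C Y*.\<close>
definition lag_mat :: "nat \<Rightarrow> nat \<Rightarrow> nat \<Rightarrow> complex" where
  "lag_mat \<tau> k l = (if l = k + \<tau> \<or> k = l + \<tau> then 1 / 2 else 0)"

lemma hermitian_lag_mat: "hermitian_on n (lag_mat \<tau>)"
  by (auto simp: hermitian_on_def lag_mat_def)

lemma lag_mat_sym: "lag_mat \<tau> k l = lag_mat \<tau> l k"
  by (auto simp: lag_mat_def)

lemma sum_lag_mat:
  fixes f :: "nat \<Rightarrow> complex"
  assumes "\<tau> \<ge> 1"
  shows "(\<Sum>p<n. f p * lag_mat \<tau> p l) = (if l \<ge> \<tau> \<and> l - \<tau> < n then f (l - \<tau>) / 2 else 0) + (if l + \<tau> < n then f (l + \<tau>) / 2 else 0)"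
proof -
  have "(\<Sum>p<n. f p * lag_mat \<tau> p l) = (\<Sum>p<n. (if p = l - \<tau> then (if l \<ge> \<tau> then f p / 2 else 0) else 0) + (if p = l + \<tau> then f p / 2 else 0))"
    using assms by (intro sum.cong) (auto simp: lag_mat_def)
  also have "\<dots> = (if l \<ge> \<tau> \<and> l - \<tau> < n then f (l - \<tau>) / 2 else 0) + (if l + \<tau> < n then f (l + \<tau>) / 2 else 0)"
    by (auto simp: sum.distrib)
  finally show ?thesis .
qed

lemma row_bound_lag_mat:
  assumes "\<tau> \<ge> 1"
  shows "row_bound n 1 (lag_mat \<tau>)"
proof -
  have "(\<Sum>p<n. cmod (lag_mat \<tau> p l)) \<le> 1" for l
  proof -
    have "complex_of_real (\<Sum>p<n. cmod (lag_mat \<tau> p l)) = (\<Sum>p<n. 1 * lag_mat \<tau> p l)"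
      unfolding of_real_sum by (intro sum.cong) (auto simp: lag_mat_def)
    also have "\<dots> = of_real ((if l \<ge> \<tau> \<and> l - \<tau> < n then 1 / 2 else 0) + (if l + \<tau> < n then 1 / 2 else 0))"
      unfolding sum_lag_mat[OF assms] by simp
    finally have "(\<Sum>p<n. cmod (lag_mat \<tau> p l)) = (if l \<ge> \<tau> \<and> l - \<tau> < n then 1 / 2 else 0) + (if l + \<tau> < n then 1 / 2 else 0)"
      by (simp only: of_real_eq_iff)
    then show ?thesis by auto
  qed
  then show ?thesis using row_bound_schur[of n "lag_mat \<tau>" 1 1] by (simp add: lag_mat_sym[of \<tau> _ l for l])
qed

text \<open>The Fourier coefficients of x -> sum over j of q^|j| exp (i j tau x), the Poisson kernel in the
  variable tau x.\<close>
definition lag_power :: "nat \<Rightarrow> complex \<Rightarrow> int \<Rightarrow> complex" where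
  "lag_power \<tau> q d = (if int \<tau> dvd d then q ^ (nat \<bar>d\<bar> div \<tau>) else 0)"

definition symbol_const :: "complex \<Rightarrow> complex" where
  "symbol_const q = (1 + q\<^sup>2) / (1 - q\<^sup>2)"

text \<open>For a = - 2 q / (1 + q^2) the function 1 / (1 + a cos x) is a multiple of the Poisson kernel with
  parameter q. The Toeplitz matrix with this symbol inverts 1 + a C away from the corners.\<close>
definition inv_lag :: "nat \<Rightarrow> complex \<Rightarrow> nat \<Rightarrow> nat \<Rightarrow> complex" where
  "inv_lag \<tau> q k l = symbol_const q * lag_power \<tau> q (int k - int l)"

lemma lag_power_minus [simp]: "lag_power \<tau> q (- d) = lag_power \<tau> q d"
  by (simp add: lag_power_def)

lemma lag_power_multiple: "\<tau> \<ge> 1 \<Longrightarrow> lag_power \<tau> q (int \<tau> * j) = q ^ nat \<bar>j\<bar>"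
  by (simp add: lag_power_def abs_mult nat_mult_distrib)

text \<open>The identity (1 + a cos (tau x)) * symbol = 1 in Fourier coefficients.\<close>
lemma inverse_symbol_recurrence:
  assumes \<tau>: "\<tau> \<ge> 1" and q: "1 + q\<^sup>2 \<noteq> 0" "1 - q\<^sup>2 \<noteq> 0"
  shows "symbol_const q * lag_power \<tau> q d + (- 2 * q / (1 + q\<^sup>2)) * ((symbol_const q * lag_power \<tau> q (d + \<tau>) + symbol_const q * lag_power \<tau> q (d - \<tau>)) / 2)
     = (if d = 0 then 1 else 0)"
proof (cases "int \<tau> dvd d")
  case False
  then have "\<not> int \<tau> dvd d + \<tau>" "\<not> int \<tau> dvd d - \<tau>"
    using dvd_add_left_iff[of "int \<tau>" "int \<tau>" d] dvd_add_left_iff[of "int \<tau>" "- int \<tau>" d] by simp_all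
  then show ?thesis using False by (auto simp: lag_power_def)
next
  case True
  then obtain j where d: "d = int \<tau> * j" by auto
  have g: "lag_power \<tau> q d = q ^ nat \<bar>j\<bar>" "lag_power \<tau> q (d + \<tau>) = q ^ nat \<bar>j + 1\<bar>" "lag_power \<tau> q (d - \<tau>) = q ^ nat \<bar>j - 1\<bar>"
    using lag_power_multiple[OF \<tau>, of q j] lag_power_multiple[OF \<tau>, of q "j + 1"] lag_power_multiple[OF \<tau>, of q "j - 1"]
    unfolding d by (simp_all add: distrib_left right_diff_distrib)
  have d0: "d = 0 \<longleftrightarrow> j = 0" using \<tau> d by simp
  have gen: "w * (Q + (- 2 * q / w) * (S / 2)) = w * Q - q * S" if "w \<noteq> 0" for w Q S :: complex
    using that by (simp add: field_simps)
  have step: "q ^ Suc i + (- 2 * q / (1 + q\<^sup>2)) * ((q ^ Suc (Suc i) + q ^ i) / 2) = 0" for i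
  proof -
    have "(1 + q\<^sup>2) * (q ^ Suc i + (- 2 * q / (1 + q\<^sup>2)) * ((q ^ Suc (Suc i) + q ^ i) / 2)) = (1 + q\<^sup>2) * q ^ Suc i - q * (q ^ Suc (Suc i) + q ^ i)"
      by (rule gen[OF q(1)])
    also have "\<dots> = 0" by (simp add: power2_eq_square algebra_simps)
    finally show ?thesis using q by (metis mult_eq_0_iff)
  qed
  show ?thesis
  proof (cases "j = 0")
    case True
    have "symbol_const q * 1 + (- 2 * q / (1 + q\<^sup>2)) * ((symbol_const q * q + symbol_const q * q) / 2) = symbol_const q * (1 - 2 * q\<^sup>2 / (1 + q\<^sup>2))"
      by (simp add: algebra_simps power2_eq_square)
    also have "1 - 2 * q\<^sup>2 / (1 + q\<^sup>2) = (1 - q\<^sup>2) / (1 + q\<^sup>2)" using q by (simp add: field_simps)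
    also have "symbol_const q * \<dots> = 1" unfolding symbol_const_def using q by simp
    finally show ?thesis unfolding g d0 using True by simp
  next
    case False
    define i where "i = nat (\<bar>j\<bar> - 1)"
    have "q ^ nat \<bar>j\<bar> + (- 2 * q / (1 + q\<^sup>2)) * ((q ^ nat \<bar>j + 1\<bar> + q ^ nat \<bar>j - 1\<bar>) / 2) = 0"
    proof (cases "j > 0")
      case True
      then have "nat \<bar>j\<bar> = Suc i" "nat \<bar>j + 1\<bar> = Suc (Suc i)" "nat \<bar>j - 1\<bar> = i" unfolding i_def by auto
      then show ?thesis using step[of i] by simp
    next
      case F: False
      then have "nat \<bar>j\<bar> = Suc i" "nat \<bar>j - 1\<bar> = Suc (Suc i)" "nat \<bar>j + 1\<bar> = i" using False unfolding i_def by auto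
      then show ?thesis using step[of i] by (simp add: add.commute)
    qed
    then have "symbol_const q * (q ^ nat \<bar>j\<bar> + (- 2 * q / (1 + q\<^sup>2)) * ((q ^ nat \<bar>j + 1\<bar> + q ^ nat \<bar>j - 1\<bar>) / 2)) = 0" by simp
    then show ?thesis unfolding g d0 using False by (simp add: algebra_simps)
  qed
qed

lemma sum_lag_power_le:
  assumes \<tau>: "\<tau> \<ge> 1" and q: "cmod q \<le> 1 / 2" and K: "finite K" and f: "inj_on f K"
  shows "(\<Sum>k\<in>K. cmod (lag_power \<tau> q (f k))) \<le> 4"
proof -
  let ?r = "cmod q"
  have "(\<Sum>k\<in>K. cmod (lag_power \<tau> q (f k))) = (\<Sum>d\<in>f ` K. cmod (lag_power \<tau> q d))" using f by (simp add: sum.reindex)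
  also have "\<dots> = (\<Sum>d\<in>{d \<in> f ` K. int \<tau> dvd d}. cmod (lag_power \<tau> q d))"
    using K by (intro sum.mono_neutral_right) (auto simp: lag_power_def)
  also have "\<dots> = (\<Sum>j\<in>{j. int \<tau> * j \<in> f ` K}. cmod (lag_power \<tau> q (int \<tau> * j)))"
  proof (rule sum.reindex_bij_betw[symmetric])
    have "(\<lambda>j. int \<tau> * j) ` {j. int \<tau> * j \<in> f ` K} = {d \<in> f ` K. int \<tau> dvd d}"
      by (force simp: dvd_def image_def)
    then show "bij_betw (\<lambda>j. int \<tau> * j) {j. int \<tau> * j \<in> f ` K} {d \<in> f ` K. int \<tau> dvd d}"
      using \<tau> by (auto simp: bij_betw_def inj_on_def)
  qed
  also have "\<dots> = (\<Sum>j\<in>{j. int \<tau> * j \<in> f ` K}. ?r ^ nat \<bar>j\<bar>)" by (simp add: lag_power_multiple[OF \<tau>] norm_power)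
  also have "\<dots> \<le> (\<Sum>j\<in>int ` {..m} \<union> (\<lambda>j. - int j) ` {..m}. ?r ^ nat \<bar>j\<bar>)"
    if m: "{j. int \<tau> * j \<in> f ` K} \<subseteq> {- int m..int m}" for m
  proof (rule sum_mono2)
    have "{- int m..int m} \<subseteq> int ` {..m} \<union> (\<lambda>j. - int j) ` {..m}"
    proof
      fix j assume "j \<in> {- int m..int m}"
      then have "(j = int (nat j) \<and> nat j \<le> m) \<or> (j = - int (nat (- j)) \<and> nat (- j) \<le> m)" by auto
      then show "j \<in> int ` {..m} \<union> (\<lambda>j. - int j) ` {..m}" by blast
    qed
    then show "{j. int \<tau> * j \<in> f ` K} \<subseteq> int ` {..m} \<union> (\<lambda>j. - int j) ` {..m}" using m by blast
  qed auto
  also have "(\<Sum>j\<in>int ` {..m} \<union> (\<lambda>j. - int j) ` {..m}. ?r ^ nat \<bar>j\<bar>) \<le> 4" for m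
  proof -
    have g: "(\<Sum>j\<le>m. ?r ^ j) \<le> 2"
    proof -
      have "(\<Sum>j\<le>m. ?r ^ j) \<le> (\<Sum>j\<le>m. (1 / 2) ^ j)" using q by (intro sum_mono power_mono) auto
      also have "\<dots> = 2 - (1 / 2) ^ m" by (induction m) auto
      finally show ?thesis by (smt (verit) zero_le_power divide_nonneg_nonneg)
    qed
    have "(\<Sum>j\<in>int ` {..m} \<union> (\<lambda>j. - int j) ` {..m}. ?r ^ nat \<bar>j\<bar>) \<le> (\<Sum>j\<in>int ` {..m}. ?r ^ nat \<bar>j\<bar>) + (\<Sum>j\<in>(\<lambda>j. - int j) ` {..m}. ?r ^ nat \<bar>j\<bar>)"
      by (subst sum.union_inter[symmetric]) (auto intro!: sum_nonneg)
    also have "(\<Sum>j\<in>int ` {..m}. ?r ^ nat \<bar>j\<bar>) = (\<Sum>j\<le>m. ?r ^ j)" by (subst sum.reindex) auto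
    also have "(\<Sum>j\<in>(\<lambda>j. - int j) ` {..m}. ?r ^ nat \<bar>j\<bar>) = (\<Sum>j\<le>m. ?r ^ j)" by (subst sum.reindex) (auto simp: inj_on_def)
    finally show ?thesis using g by simp
  qed
  finally have *: "(\<Sum>k\<in>K. cmod (lag_power \<tau> q (f k))) \<le> 4" if "{j. int \<tau> * j \<in> f ` K} \<subseteq> {- int m..int m}" for m
    using that by blast
  have fin: "finite {j. int \<tau> * j \<in> f ` K}"
    using \<tau> K by (intro finite_inverse_image[of "f ` K" "\<lambda>j. int \<tau> * j", unfolded vimage_def, simplified]) (auto simp: inj_on_def)
  define m where "m = (\<Sum>j\<in>{j. int \<tau> * j \<in> f ` K}. nat \<bar>j\<bar>)"
  have "nat \<bar>j\<bar> \<le> m" if "int \<tau> * j \<in> f ` K" for j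
    unfolding m_def using fin that by (intro member_le_sum) auto
  then show ?thesis by (intro *[of m]) force
qed

context
  fixes q :: complex
  assumes q: "cmod q \<le> 1 / 2"
begin

lemma norm_square_le_quarter: "cmod (q\<^sup>2) \<le> 1 / 4"
  using power_mono[OF q, of 2] by (simp add: norm_power power_divide)

lemma one_pm_square_nonzero: "1 + q\<^sup>2 \<noteq> 0" "1 - q\<^sup>2 \<noteq> 0"
  and one_pm_square_lower: "cmod (1 + q\<^sup>2) \<ge> 3 / 4" "cmod (1 - q\<^sup>2) \<ge> 3 / 4"
proof -
  show 1: "cmod (1 + q\<^sup>2) \<ge> 3 / 4" using norm_diff_ineq[of 1 "q\<^sup>2"] norm_square_le_quarter by simp
  show 2: "cmod (1 - q\<^sup>2) \<ge> 3 / 4" using norm_triangle_ineq2[of 1 "q\<^sup>2"] norm_square_le_quarter by simp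
  show "1 + q\<^sup>2 \<noteq> 0" "1 - q\<^sup>2 \<noteq> 0" using 1 2 by auto
qed

lemma symbol_const_le: "cmod (symbol_const q) \<le> 5 / 3"
proof -
  have "cmod (1 + q\<^sup>2) \<le> 5 / 4" using norm_triangle_ineq[of 1 "q\<^sup>2"] norm_square_le_quarter by simp
  then have "cmod (1 + q\<^sup>2) / cmod (1 - q\<^sup>2) \<le> (5 / 4) / (3 / 4)"
    using one_pm_square_lower by (intro frac_le) auto
  then show ?thesis unfolding symbol_const_def by (simp add: norm_divide)
qed

end

context
  fixes \<tau> n :: nat and q :: complex
  assumes \<tau>: "\<tau> \<ge> 1" and q: "cmod q \<le> 1 / 2"
begin

lemma row_bound_inv_lag: "row_bound n 49 (inv_lag \<tau> q)"
proof -
  have row: "(\<Sum>l<n. cmod (inv_lag \<tau> q k l)) \<le> 7" for k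
  proof -
    have "(\<Sum>l<n. cmod (lag_power \<tau> q (int k - int l))) \<le> 4" by (rule sum_lag_power_le[OF \<tau> q]) (auto simp: inj_on_def)
    then have "(\<Sum>l<n. cmod (inv_lag \<tau> q k l)) \<le> 5 / 3 * 4"
      unfolding inv_lag_def norm_mult sum_distrib_left[symmetric] using symbol_const_le[OF q]
      by (intro mult_mono sum_nonneg) auto
    then show ?thesis by simp
  qed
  have sym: "inv_lag \<tau> q k l = inv_lag \<tau> q l k" for k l
    unfolding inv_lag_def using lag_power_minus[of \<tau> q "int k - int l"] by simp
  have "row_bound n (7 * 7) (inv_lag \<tau> q)"
    by (rule row_bound_schur) (use row sym in auto)
  then show ?thesis by simp
qed

lemma row_bound_inv_lag_mult: "row_bound n 49 (\<lambda>k l. \<Sum>p<n. inv_lag \<tau> q k p * lag_mat \<tau> p l)"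
  using row_bound_mult[OF row_bound_inv_lag row_bound_lag_mat[OF \<tau>]] by simp

text \<open>The truncation of the Toeplitz matrix to n rows is felt only in the first and the last tau
  columns, and each column of the inverse symbol has a bounded norm because its entries decay
  geometrically.\<close>
lemma inv_lag_error:
  defines "a \<equiv> - 2 * q / (1 + q\<^sup>2)"
  shows "frob n n (\<lambda>k l. inv_lag \<tau> q k l + a * (\<Sum>p<n. inv_lag \<tau> q k p * lag_mat \<tau> p l) - (if k = l then 1 else 0)) \<le> 200 * \<tau>"
proof -
  let ?c = "symbol_const q"
  define Er where "Er k l = inv_lag \<tau> q k l + a * (\<Sum>p<n. inv_lag \<tau> q k p * lag_mat \<tau> p l) - (if k = l then 1 else 0)" for k l
  \<comment> \<open>the neighbours of column l outside the index range, below 0 in u and above n in v\<close>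
  define u where "u k l = (if l < \<tau> then ?c * lag_power \<tau> q (int k - int l + \<tau>) else 0)" for k l
  define v where "v k l = (if n \<le> l + \<tau> then ?c * lag_power \<tau> q (int k - int l - \<tau>) else 0)" for k l
  have a: "cmod a \<le> 4 / 3"
  proof -
    have "2 * cmod q / cmod (1 + q\<^sup>2) \<le> (2 * (1 / 2)) / (3 / 4)" using q one_pm_square_lower[OF q] by (intro frac_le) auto
    then show ?thesis unfolding a_def by (simp add: norm_divide norm_mult)
  qed
  have gen: "I + a * S - \<delta> = - a / 2 * (u + v)"
    if "S = (x - u + (y - v)) / 2" "I + a * ((x + y) / 2) = \<delta>" for S x y u v I \<delta> :: complex
    unfolding that(1) that(2)[symmetric] by (simp add: field_simps)
  have Er: "Er k l = - a / 2 * (u k l + v k l)" if kl: "k < n" "l < n" for k l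
  proof -
    have "(\<Sum>p<n. inv_lag \<tau> q k p * lag_mat \<tau> p l) = (?c * lag_power \<tau> q (int k - int l + \<tau>) - u k l + (?c * lag_power \<tau> q (int k - int l - \<tau>) - v k l)) / 2"
      unfolding sum_lag_mat[OF \<tau>] u_def v_def inv_lag_def using kl
      by (auto simp: of_nat_diff algebra_simps)
    moreover have "?c * lag_power \<tau> q (int k - int l) + a * ((?c * lag_power \<tau> q (int k - int l + \<tau>) + ?c * lag_power \<tau> q (int k - int l - \<tau>)) / 2) = (if k = l then 1 else 0)"
      unfolding a_def using inverse_symbol_recurrence[OF \<tau> one_pm_square_nonzero[OF q], of "int k - int l"] by simp
    ultimately show ?thesis unfolding Er_def inv_lag_def[of \<tau> q k l] by (rule gen)
  qed
  have geo_sq: "(cmod (lag_power \<tau> q d))\<^sup>2 \<le> cmod (lag_power \<tau> q d)" for d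
  proof -
    have "cmod (lag_power \<tau> q d) \<le> 1" unfolding lag_power_def using q by (auto simp: norm_power intro!: power_le_one)
    then show ?thesis by (simp add: power2_eq_square mult_left_le)
  qed
  have c2: "(cmod ?c)\<^sup>2 \<le> 3"
    using power_mono[OF symbol_const_le[OF q], of 2] by (simp add: power2_eq_square)
  have col: "(\<Sum>k<n. (cmod (?c * lag_power \<tau> q (int k - int l + x)))\<^sup>2) \<le> 12" for l :: nat and x :: int
  proof -
    have "(\<Sum>k<n. (cmod (lag_power \<tau> q (int k - int l + x)))\<^sup>2) \<le> (\<Sum>k<n. cmod (lag_power \<tau> q (int k - int l + x)))"
      by (intro sum_mono geo_sq)
    also have "\<dots> \<le> 4" by (rule sum_lag_power_le[OF \<tau> q]) (auto simp: inj_on_def)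
    finally have "(cmod ?c)\<^sup>2 * (\<Sum>k<n. (cmod (lag_power \<tau> q (int k - int l + x)))\<^sup>2) \<le> 3 * 4"
      using c2 by (intro mult_mono sum_nonneg) auto
    then show ?thesis by (simp add: norm_mult power_mult_distrib sum_distrib_left)
  qed
  have cu: "(\<Sum>k<n. (cmod (u k l))\<^sup>2) \<le> (if l < \<tau> then 12 else 0)" for l
    using col[of l "int \<tau>"] unfolding u_def by auto
  have cv: "(\<Sum>k<n. (cmod (v k l))\<^sup>2) \<le> (if n \<le> l + \<tau> then 12 else 0)" for l
    using col[of l "- int \<tau>"] unfolding v_def by auto
  have "frob n n Er = (\<Sum>l<n. \<Sum>k<n. (cmod (Er k l))\<^sup>2)" by (rule frob_swap)
  also have "\<dots> \<le> (\<Sum>l<n. \<Sum>k<n. 2 * ((cmod (u k l))\<^sup>2 + (cmod (v k l))\<^sup>2))"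
  proof (intro sum_mono)
    fix l k assume kl: "l \<in> {..<n}" "k \<in> {..<n}"
    have "cmod (- a / 2) \<le> 1" using a by (simp add: norm_divide)
    then have "cmod (- a / 2) * cmod (u k l + v k l) \<le> 1 * cmod (u k l + v k l)" by (intro mult_right_mono) auto
    moreover have "cmod (Er k l) = cmod (- a / 2) * cmod (u k l + v k l)"
      using Er[of k l] kl by (simp only: norm_mult lessThan_iff)
    ultimately have "cmod (Er k l) \<le> cmod (u k l - (- v k l))" by simp
    then have "(cmod (Er k l))\<^sup>2 \<le> (cmod (u k l - (- v k l)))\<^sup>2" by (intro power_mono) auto
    also have "\<dots> \<le> 2 * ((cmod (u k l))\<^sup>2 + (cmod (v k l))\<^sup>2)" using cmod_diff_square_le[of "u k l" "- v k l"] by simp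
    finally show "(cmod (Er k l))\<^sup>2 \<le> 2 * ((cmod (u k l))\<^sup>2 + (cmod (v k l))\<^sup>2)" .
  qed
  also have "\<dots> \<le> (\<Sum>l<n. 2 * ((if l < \<tau> then 12 else 0) + (if n \<le> l + \<tau> then 12 else 0)))"
    unfolding sum_distrib_left[symmetric] sum.distrib by (intro mult_left_mono add_mono sum_mono cu cv) auto
  also have "\<dots> = 24 * card {l. l < n \<and> l < \<tau>} + 24 * card {l. l < n \<and> n \<le> l + \<tau>}"
    by (simp add: distrib_left sum.distrib sum.If_cases Int_def if_distrib[of "\<lambda>x. 2 * x"] cong: if_cong)
  also have "\<dots> \<le> 24 * \<tau> + 24 * \<tau>"
  proof -
    have "card {l. l < n \<and> l < \<tau>} \<le> card {..<\<tau>}" by (intro card_mono) auto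
    moreover have "card {l. l < n \<and> n \<le> l + \<tau>} \<le> card {n - \<tau>..<n}" by (intro card_mono) auto
    moreover have "card {n - \<tau>..<n} \<le> \<tau>" by simp
    ultimately show ?thesis by simp
  qed
  finally show ?thesis unfolding Er_def by simp
qed

text \<open>C has 2 t nonzero entries, and at each of them the inverse symbol contributes its coefficient at
  distance tau.\<close>
lemma trace_lag_inv_lag:
  assumes n: "n = t + \<tau>"
  shows "(\<Sum>k<n. \<Sum>l<n. lag_mat \<tau> k l * inv_lag \<tau> q l k) = of_nat t * (symbol_const q * q)"
proof -
  have g: "lag_power \<tau> q (int \<tau>) = q" using lag_power_multiple[OF \<tau>, of q 1] by simp
  have "(\<Sum>l<n. lag_mat \<tau> k l * inv_lag \<tau> q l k) = (if \<tau> \<le> k then symbol_const q * q / 2 else 0) + (if k < t then symbol_const q * q / 2 else 0)" if "k < n" for k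
  proof -
    have "(\<Sum>l<n. lag_mat \<tau> k l * inv_lag \<tau> q l k) = (\<Sum>l<n. inv_lag \<tau> q l k * lag_mat \<tau> l k)"
      by (intro sum.cong refl) (simp add: lag_mat_sym[of \<tau> k])
    also have "\<dots> = (if \<tau> \<le> k then symbol_const q * q / 2 else 0) + (if k < t then symbol_const q * q / 2 else 0)"
      unfolding sum_lag_mat[OF \<tau>] inv_lag_def using that n g lag_power_minus[of \<tau> q "int \<tau>"] by (auto simp: of_nat_diff)
    finally show ?thesis .
  qed
  then have "(\<Sum>k<n. \<Sum>l<n. lag_mat \<tau> k l * inv_lag \<tau> q l k) = (\<Sum>k<n. (if \<tau> \<le> k then symbol_const q * q / 2 else 0) + (if k < t then symbol_const q * q / 2 else 0))" by simp
  also have "\<dots> = of_nat (card {k. k < n \<and> \<tau> \<le> k}) * (symbol_const q * q / 2) + of_nat (card {k. k < n \<and> k < t}) * (symbol_const q * q / 2)"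
    by (simp add: sum.distrib sum.If_cases Int_def)
  also have "{k. k < n \<and> \<tau> \<le> k} = {\<tau>..<n}" by auto
  also have "{k. k < n \<and> k < t} = {..<t}" using n by auto
  finally show ?thesis using n by simp
qed

end

section \<open>Concentration of the normalized trace\<close>

definition norm_trace :: "nat \<Rightarrow> nat \<Rightarrow> complex \<Rightarrow> (nat \<Rightarrow> nat \<Rightarrow> complex) \<Rightarrow> (nat \<Rightarrow> nat \<Rightarrow> complex) \<Rightarrow> complex" where
  "norm_trace N n z C Y = (\<Sum>i<N. resolvent N z (gram n C Y) i i) / of_nat N"

lemma norm_trace_cong:
  assumes "\<And>i k. i < N \<Longrightarrow> k < n \<Longrightarrow> Y i k = Y' i k"
  shows "norm_trace N n z C Y = norm_trace N n z C Y'"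
proof -
  have "gram n C Y i j = gram n C Y' i j" if "i < N" "j < N" for i j
    unfolding gram_def using assms that by (intro sum.cong refl) auto
  then have "shifted_mat N z (gram n C Y) = shifted_mat N z (gram n C Y')"
    unfolding shifted_mat_def by (intro eq_matI) auto
  then show ?thesis unfolding norm_trace_def resolvent_def by simp
qed

lemma norm_trace_bound:
  assumes "hermitian_on n C" "Im z > 0"
  shows "cmod (norm_trace N n z C Y) \<le> 1 / Im z"
proof (cases "N = 0")
  case True then show ?thesis using assms by (simp add: norm_trace_def)
next
  case False
  interpret cavity N n z C Y using assms by unfold_locales auto
  have "cmod (\<Sum>i<N. G i i) \<le> (\<Sum>i<N. 1 / \<bar>Im z\<bar>)"
    by (rule sum_norm_le) (use resolvent_diag_bound[OF hermitian_gram z] in auto)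
  then show ?thesis unfolding norm_trace_def norm_divide using False assms by (simp add: field_simps)
qed

lemma norm_trace_measurable:
  assumes "\<And>i k. i < N \<Longrightarrow> k < n \<Longrightarrow> (\<lambda>\<omega>. Y \<omega> i k) \<in> borel_measurable M"
  shows "(\<lambda>\<omega>. norm_trace N n z C (Y \<omega>)) \<in> borel_measurable M"
  unfolding norm_trace_def
  by (intro borel_measurable_divide borel_measurable_sum borel_measurable_const gram_resolvent_measurable assms) auto

text \<open>Both traces are compared with the trace after zeroing the row in question.\<close>
lemma norm_trace_change_row:
  assumes C: "hermitian_on n C" and z: "Im z > 0" and i: "i < N"
    and Y: "\<And>a k. a \<noteq> i \<Longrightarrow> Y a k = Y' a k"
  shows "cmod (norm_trace N n z C Y - norm_trace N n z C Y') \<le> 4 / (Im z * N)"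
proof -
  interpret Y: cavity N n z C Y using C z by unfold_locales auto
  interpret Y': cavity N n z C Y' using C z by unfold_locales auto
  have eq: "zero_row i Y = zero_row i Y'" using Y by (auto simp: zero_row_def fun_eq_iff)
  define t where "t = (\<Sum>a<N. resolvent N z (gram n C (zero_row i Y)) a a)"
  have 1: "cmod (t - (\<Sum>a<N. Y.G a a)) \<le> 2 / \<bar>Im z\<bar>" unfolding t_def by (rule Y.trace_resolvent_zeroed_row[OF i])
  have 2: "cmod (t - (\<Sum>a<N. Y'.G a a)) \<le> 2 / \<bar>Im z\<bar>" unfolding t_def eq by (rule Y'.trace_resolvent_zeroed_row[OF i])
  have "cmod ((\<Sum>a<N. Y.G a a) - (\<Sum>a<N. Y'.G a a)) = cmod ((t - (\<Sum>a<N. Y'.G a a)) - (t - (\<Sum>a<N. Y.G a a)))" by simp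
  also have "\<dots> \<le> 2 / \<bar>Im z\<bar> + 2 / \<bar>Im z\<bar>" by (rule order_trans[OF norm_triangle_ineq4 add_mono[OF 2 1]])
  finally have "cmod ((\<Sum>a<N. Y.G a a) - (\<Sum>a<N. Y'.G a a)) \<le> 4 / Im z" using z by simp
  then have "cmod ((\<Sum>a<N. Y.G a a) - (\<Sum>a<N. Y'.G a a)) / N \<le> 4 / Im z / N" by (rule divide_right_mono) simp
  then show ?thesis unfolding norm_trace_def diff_divide_distrib[symmetric] norm_divide by simp
qed

context prob_space begin

text \<open>The rows are the independent coordinates: there are N of them, and each moves the trace by at most
  4 / (N Im z), so the exponent is proportional to N. Real and imaginary part are both instances of the function
  part.\<close>
lemma norm_trace_part_tail:
  fixes X :: "nat \<Rightarrow> nat \<Rightarrow> 'a \<Rightarrow> complex" and c :: complex and part :: "complex \<Rightarrow> real"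
  assumes ind: "indep_vars (\<lambda>_. borel) (\<lambda>(i, k). X i k) ({..<N} \<times> {..<n})" and N: "N > 0"
    and C: "hermitian_on n C" and z: "Im z > 0" and d: "d > 0"
    and part: "\<And>x. \<bar>part x\<bar> \<le> cmod x" "\<And>x y. part (x - y) = part x - part y" "part \<in> borel_measurable borel"
  defines "m \<equiv> (\<lambda>\<omega>. norm_trace N n z C (\<lambda>i k. c * X i k \<omega>))"
  shows "prob {\<omega> \<in> space M. d \<le> \<bar>part (m \<omega>) - expectation (\<lambda>\<omega>. part (m \<omega>))\<bar>} \<le> 2 * exp (- (d\<^sup>2 * (Im z)\<^sup>2 / 32 * N))"
proof -
  let ?S = "\<lambda>i. PiM ({i} \<times> {..<n}) (\<lambda>_. borel :: complex measure)"
  let ?R = "\<lambda>i \<omega>. \<lambda>j\<in>{i} \<times> {..<n}. (case j of (i, k) \<Rightarrow> X i k) \<omega>"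
  have rows: "indep_vars ?S ?R {..<N}"
    by (rule indep_vars_restrict[OF ind]) (auto simp: disjoint_family_on_def)
  define A where "A x i k = c * x i (i, k)" for x :: "nat \<Rightarrow> nat \<times> nat \<Rightarrow> complex" and i k
  define f where "f x = part (norm_trace N n z C (A x))" for x
  have Am: "(\<lambda>x. A x i k) \<in> borel_measurable (PiM {..<N} ?S)" if "i < N" "k < n" for i k
  proof -
    have "(\<lambda>x. x i) \<in> measurable (PiM {..<N} ?S) (?S i)" using that by (intro measurable_component_singleton) auto
    moreover have "(\<lambda>y. y (i, k)) \<in> borel_measurable (?S i)" using that by (intro measurable_component_singleton) auto
    ultimately have "(\<lambda>x. x i (i, k)) \<in> borel_measurable (PiM {..<N} ?S)" by (rule measurable_compose)
    then show ?thesis unfolding A_def by simp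
  qed
  have fm: "f \<in> borel_measurable (PiM {..<N} ?S)"
    unfolding f_def[abs_def] by (rule measurable_compose[OF norm_trace_measurable[OF Am] part(3)])
  have fB: "\<bar>f x\<bar> \<le> 1 / Im z" for x
    unfolding f_def using part(1) norm_trace_bound[OF C z] by (rule order_trans)
  have fd: "\<bar>f (x(i := y)) - f x\<bar> \<le> 4 / (Im z * N)" if "i < N" for x i y
    unfolding f_def part(2)[symmetric]
    by (rule order_trans[OF part(1) norm_trace_change_row[OF C z that]]) (simp add: A_def)
  have F: "f (\<lambda>i\<in>{..<N}. ?R i \<omega>) = part (m \<omega>)" for \<omega>
    unfolding f_def m_def by (intro arg_cong[where f = part] norm_trace_cong) (simp add: A_def)
  have "prob {\<omega> \<in> space M. d \<le> \<bar>f (\<lambda>i\<in>{..<N}. ?R i \<omega>) - expectation (\<lambda>\<omega>. f (\<lambda>i\<in>{..<N}. ?R i \<omega>))\<bar>}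
     \<le> 2 * exp (- (d\<^sup>2 / (2 * (4 / (Im z * N))\<^sup>2 * card {..<N})))"
    by (rule bounded_differences_tail[where f = f and c = "4 / (Im z * N)" and B = "1 / Im z", OF _ _ rows _ _ fm])
       (use N z d fB fd in auto)
  also have "d\<^sup>2 / (2 * (4 / (Im z * N))\<^sup>2 * card {..<N}) = d\<^sup>2 * (Im z)\<^sup>2 / 32 * N"
    using N z by (simp add: field_simps power2_eq_square)
  finally show ?thesis unfolding F .
qed

lemma
  fixes X :: "nat \<Rightarrow> nat \<Rightarrow> 'a \<Rightarrow> complex" and c :: complex
  assumes ind: "indep_vars (\<lambda>_. borel) (\<lambda>(i, k). X i k) ({..<N} \<times> {..<n})" and N: "N > 0"
    and C: "hermitian_on n C" and z: "Im z > 0" and d: "d > 0"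
  defines "m \<equiv> (\<lambda>\<omega>. norm_trace N n z C (\<lambda>i k. c * X i k \<omega>))"
  shows norm_trace_tail: "prob {\<omega> \<in> space M. d \<le> cmod (m \<omega> - expectation m)} \<le> 4 * exp (- (d\<^sup>2 * (Im z)\<^sup>2 / 128 * N))"
    and norm_trace_variance: "expectation (\<lambda>\<omega>. (cmod (m \<omega> - expectation m))\<^sup>2) \<le> d\<^sup>2 + 16 / (Im z)\<^sup>2 * exp (- (d\<^sup>2 * (Im z)\<^sup>2 / 128 * N))"
proof -
  have X: "X i k \<in> borel_measurable M" if "i < N" "k < n" for i k
    using ind that by (auto simp: indep_vars_def)
  have m [measurable]: "m \<in> borel_measurable M"
    unfolding m_def by (rule norm_trace_measurable) (use X in measurable)
  have mb: "cmod (m \<omega>) \<le> 1 / Im z" for \<omega> unfolding m_def by (rule norm_trace_bound[OF C z])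
  have mi: "integrable M m" by (rule integrable_const_bound[of _ "1 / Im z"]) (use mb in auto)
  have Eb: "cmod (expectation m) \<le> 1 / Im z"
  proof -
    have "cmod (expectation m) \<le> expectation (\<lambda>\<omega>. cmod (m \<omega>))" by (rule integral_norm_bound)
    also have "\<dots> \<le> expectation (\<lambda>\<omega>. 1 / Im z)" using mi mb by (intro integral_mono) auto
    finally show ?thesis by (simp add: prob_space)
  qed
  let ?e = "exp (- (d\<^sup>2 * (Im z)\<^sup>2 / 128 * N))"
  have ex: "2 * exp (- ((d / 2)\<^sup>2 * (Im z)\<^sup>2 / 32 * N)) = 2 * ?e" by (simp add: power_divide)
  have mw: "norm_trace N n z C (\<lambda>i k. c * X i k \<omega>) = m \<omega>" for \<omega> by (simp add: m_def)
  have re: "prob {\<omega> \<in> space M. d / 2 \<le> \<bar>Re (m \<omega>) - Re (expectation m)\<bar>} \<le> 2 * ?e"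
    using norm_trace_part_tail[OF ind N C z, of "d / 2" Re c, unfolded mw ex integral_Re[OF mi]] d
    by (simp add: abs_Re_le_cmod)
  have im: "prob {\<omega> \<in> space M. d / 2 \<le> \<bar>Im (m \<omega>) - Im (expectation m)\<bar>} \<le> 2 * ?e"
    using norm_trace_part_tail[OF ind N C z, of "d / 2" Im c, unfolded mw ex integral_Im[OF mi]] d
    by (simp add: abs_Im_le_cmod)
  have "prob {\<omega> \<in> space M. d \<le> cmod (m \<omega> - expectation m)} \<le>
     prob ({\<omega> \<in> space M. d / 2 \<le> \<bar>Re (m \<omega>) - Re (expectation m)\<bar>} \<union> {\<omega> \<in> space M. d / 2 \<le> \<bar>Im (m \<omega>) - Im (expectation m)\<bar>})"
  proof (rule finite_measure_mono)
    show "{\<omega> \<in> space M. d \<le> cmod (m \<omega> - expectation m)} \<subseteq> {\<omega> \<in> space M. d / 2 \<le> \<bar>Re (m \<omega>) - Re (expectation m)\<bar>} \<union> {\<omega> \<in> space M. d / 2 \<le> \<bar>Im (m \<omega>) - Im (expectation m)\<bar>}"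
    proof
      fix \<omega> assume w: "\<omega> \<in> {\<omega> \<in> space M. d \<le> cmod (m \<omega> - expectation m)}"
      have "cmod (m \<omega> - expectation m) \<le> \<bar>Re (m \<omega>) - Re (expectation m)\<bar> + \<bar>Im (m \<omega>) - Im (expectation m)\<bar>"
        using cmod_le[of "m \<omega> - expectation m"] by simp
      then have "d / 2 \<le> \<bar>Re (m \<omega>) - Re (expectation m)\<bar> \<or> d / 2 \<le> \<bar>Im (m \<omega>) - Im (expectation m)\<bar>"
        using w by (auto simp: not_le)
      then show "\<omega> \<in> {\<omega> \<in> space M. d / 2 \<le> \<bar>Re (m \<omega>) - Re (expectation m)\<bar>} \<union> {\<omega> \<in> space M. d / 2 \<le> \<bar>Im (m \<omega>) - Im (expectation m)\<bar>}"
        using w by blast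
    qed
  qed measurable
  also have "\<dots> \<le> 2 * ?e + 2 * ?e"
    by (rule order_trans[OF measure_Un_le add_mono[OF re im]]) measurable
  finally show tail: "prob {\<omega> \<in> space M. d \<le> cmod (m \<omega> - expectation m)} \<le> 4 * ?e" by simp
  let ?A = "{\<omega> \<in> space M. d \<le> cmod (m \<omega> - expectation m)}"
  have le: "(cmod (m \<omega> - expectation m))\<^sup>2 \<le> d\<^sup>2 + (2 / Im z)\<^sup>2 * indicator ?A \<omega>" if "\<omega> \<in> space M" for \<omega>
  proof (cases "d \<le> cmod (m \<omega> - expectation m)")
    case True
    have "cmod (m \<omega> - expectation m) \<le> 2 / Im z"
      using norm_triangle_ineq4[of "m \<omega>" "expectation m"] mb[of \<omega>] Eb by simp
    then have "(cmod (m \<omega> - expectation m))\<^sup>2 \<le> (2 / Im z)\<^sup>2" by (intro power_mono) auto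
    then show ?thesis using True that by (simp add: add_increasing)
  next
    case False
    then have "(cmod (m \<omega> - expectation m))\<^sup>2 \<le> d\<^sup>2" by (intro power_mono) auto
    then show ?thesis using False by simp
  qed
  have A: "?A \<in> events" by measurable
  then have Ai: "integrable M (indicator ?A :: 'a \<Rightarrow> real)" by (intro integrable_real_indicator) (auto simp: less_top[symmetric])
  then have ii: "integrable M (\<lambda>\<omega>. d\<^sup>2 + (2 / Im z)\<^sup>2 * indicator ?A \<omega>)"
    by (intro Bochner_Integration.integrable_add integrable_mult_right integrable_const)
  have "expectation (\<lambda>\<omega>. (cmod (m \<omega> - expectation m))\<^sup>2) \<le> expectation (\<lambda>\<omega>. d\<^sup>2 + (2 / Im z)\<^sup>2 * indicator ?A \<omega>)"
  proof (rule integral_mono)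
    show "integrable M (\<lambda>\<omega>. d\<^sup>2 + (2 / Im z)\<^sup>2 * indicator ?A \<omega>)" by (rule ii)
    show "integrable M (\<lambda>\<omega>. (cmod (m \<omega> - expectation m))\<^sup>2)"
      by (rule integrable_const_bound[of _ "d\<^sup>2 + (2 / Im z)\<^sup>2"])
         (use le in \<open>auto intro!: AE_I2 order_trans[OF le] simp: indicator_def\<close>)
  qed (rule le)
  also have "\<dots> = d\<^sup>2 + (2 / Im z)\<^sup>2 * prob ?A"
    using Bochner_Integration.integral_add[OF integrable_const integrable_mult_right[OF Ai], of "d\<^sup>2" "(2 / Im z)\<^sup>2"] A
    by (simp add: prob_space Int_absorb2 sets.sets_into_space)
  also have "\<dots> \<le> d\<^sup>2 + (2 / Im z)\<^sup>2 * (4 * ?e)" using tail by (intro add_left_mono mult_left_mono) auto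
  finally show "expectation (\<lambda>\<omega>. (cmod (m \<omega> - expectation m))\<^sup>2) \<le> d\<^sup>2 + 16 / (Im z)\<^sup>2 * ?e"
    by (simp add: power_divide)
qed

end

section \<open>Truncation\<close>

lemma (in prob_space) complex_variance:
  fixes Z :: "'a \<Rightarrow> complex"
  assumes Z [measurable]: "Z \<in> borel_measurable M" and sq: "integrable M (\<lambda>\<omega>. (cmod (Z \<omega>))\<^sup>2)"
  shows "integrable M Z" and "integrable M (\<lambda>\<omega>. (cmod (Z \<omega> - expectation Z))\<^sup>2)"
    and "expectation (\<lambda>\<omega>. (cmod (Z \<omega> - expectation Z))\<^sup>2) = expectation (\<lambda>\<omega>. (cmod (Z \<omega>))\<^sup>2) - (cmod (expectation Z))\<^sup>2"
proof -
  show i: "integrable M Z"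
  proof (rule Bochner_Integration.integrable_bound[of _ "\<lambda>\<omega>. 1 + (cmod (Z \<omega>))\<^sup>2"])
    show "AE \<omega> in M. norm (Z \<omega>) \<le> norm (1 + (cmod (Z \<omega>))\<^sup>2)"
    proof (rule AE_I2)
      fix \<omega>
      have "norm (Z \<omega>) \<le> 1 + (norm (Z \<omega>))\<^sup>2 / 1" by (rule le_add_square_div) simp
      then show "norm (Z \<omega>) \<le> norm (1 + (cmod (Z \<omega>))\<^sup>2)" by simp
    qed
  qed (use sq in auto)
  let ?E = "expectation Z"
  define r where "r \<omega> = Re (cnj (- ?E) * Z \<omega>)" for \<omega>
  have eq: "(cmod (Z \<omega> - ?E))\<^sup>2 = (cmod ?E)\<^sup>2 + 2 * r \<omega> + (cmod (Z \<omega>))\<^sup>2" for \<omega>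
    using cmod_add_square[of "- ?E" "Z \<omega>"] unfolding r_def by (simp add: add.commute)
  have ri: "integrable M r" unfolding r_def using i by (intro integrable_Re) simp
  have "expectation r = Re (expectation (\<lambda>\<omega>. cnj (- ?E) * Z \<omega>))"
    unfolding r_def using i by (intro integral_Re) simp
  also have "\<dots> = Re (cnj (- ?E) * ?E)" by simp
  also have "\<dots> = - (cmod ?E)\<^sup>2" unfolding cmod_power2 by (simp add: power2_eq_square)
  finally have rE: "expectation r = - (cmod ?E)\<^sup>2" .
  show "integrable M (\<lambda>\<omega>. (cmod (Z \<omega> - ?E))\<^sup>2)" unfolding eq using ri sq by simp
  show "expectation (\<lambda>\<omega>. (cmod (Z \<omega> - ?E))\<^sup>2) = expectation (\<lambda>\<omega>. (cmod (Z \<omega>))\<^sup>2) - (cmod ?E)\<^sup>2"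
    unfolding eq using ri sq rE by (simp add: prob_space)
qed

text \<open>The entries of the theorem for one pair of dimensions, with rows and columns counted from
  0.\<close>
locale entries = prob_space +
  fixes N t \<tau> :: nat and e :: "nat \<Rightarrow> nat \<Rightarrow> 'a \<Rightarrow> complex"
  assumes N: "N > 0" and t: "t > 0" and \<tau>: "\<tau> \<ge> 1"
    and indep: "indep_vars (\<lambda>_. borel) (\<lambda>(i, k). e i k) ({..<N} \<times> {..<t + \<tau>})"
    and mean: "\<And>i k. i < N \<Longrightarrow> k < t + \<tau> \<Longrightarrow> expectation (e i k) = 0"
    and var: "\<And>i k. i < N \<Longrightarrow> k < t + \<tau> \<Longrightarrow> expectation (\<lambda>\<omega>. (cmod (e i k \<omega>))\<^sup>2) = 1"
begin

abbreviation "n \<equiv> t + \<tau>"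

lemma e_measurable: "i < N \<Longrightarrow> k < n \<Longrightarrow> e i k \<in> borel_measurable M"
  using indep by (auto simp: indep_vars_def)

lemma e_square: "i < N \<Longrightarrow> k < n \<Longrightarrow> integrable M (\<lambda>\<omega>. (cmod (e i k \<omega>))\<^sup>2)"
  using var by (metis not_integrable_integral_eq zero_neq_one)

definition level :: "real \<Rightarrow> real" where
  "level \<eta> = \<eta> * sqrt n"

definition small :: "real \<Rightarrow> nat \<Rightarrow> nat \<Rightarrow> 'a \<Rightarrow> complex" where
  "small \<eta> i k \<omega> = (if cmod (e i k \<omega>) < level \<eta> then e i k \<omega> else 0)"

definition large :: "real \<Rightarrow> nat \<Rightarrow> nat \<Rightarrow> 'a \<Rightarrow> complex" where
  "large \<eta> i k \<omega> = (if cmod (e i k \<omega>) < level \<eta> then 0 else e i k \<omega>)"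

text \<open>Truncation at the level eta sqrt n destroys the zero mean, hence the recentring.\<close>
definition trunc :: "real \<Rightarrow> nat \<Rightarrow> nat \<Rightarrow> 'a \<Rightarrow> complex" where
  "trunc \<eta> i k \<omega> = (if i < N \<and> k < n then small \<eta> i k \<omega> - expectation (small \<eta> i k) else 0)"

definition tail_var :: "real \<Rightarrow> nat \<Rightarrow> nat \<Rightarrow> real" where
  "tail_var \<eta> i k = expectation (\<lambda>\<omega>. (cmod (large \<eta> i k \<omega>))\<^sup>2)"

definition trunc_var :: "real \<Rightarrow> nat \<Rightarrow> nat \<Rightarrow> real" where
  "trunc_var \<eta> i k = expectation (\<lambda>\<omega>. (cmod (trunc \<eta> i k \<omega>))\<^sup>2)"

text \<open>The Lindeberg sum, normalised by N t instead of eta^2 N n; the two differ by a factor that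
  converges for fixed eta.\<close>
definition lindeberg :: "real \<Rightarrow> real" where
  "lindeberg \<eta> = (\<Sum>i<N. \<Sum>k<n. tail_var \<eta> i k) / (N * t)"

lemma truncation_facts:
  assumes ik: "i < N" "k < n" and \<eta>: "\<eta> > 0"
  shows "\<And>\<omega>. \<omega> \<in> space M \<Longrightarrow> cmod (trunc \<eta> i k \<omega>) \<le> 2 * level \<eta>"
    and "expectation (trunc \<eta> i k) = 0"
    and "integrable M (\<lambda>\<omega>. (cmod (trunc \<eta> i k \<omega>))\<^sup>2)"
    and "trunc_var \<eta> i k \<le> 1" and "1 - trunc_var \<eta> i k \<le> 2 * tail_var \<eta> i k"
    and "integrable M (\<lambda>\<omega>. (cmod (e i k \<omega> - trunc \<eta> i k \<omega>))\<^sup>2)"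
    and "expectation (\<lambda>\<omega>. (cmod (e i k \<omega> - trunc \<eta> i k \<omega>))\<^sup>2) \<le> tail_var \<eta> i k"
proof -
  note e_measurable[OF ik, measurable] and e_sq = e_square[OF ik]
  have lev: "level \<eta> \<ge> 0" using \<eta> by (simp add: level_def)
  have small_m [measurable]: "small \<eta> i k \<in> borel_measurable M" unfolding small_def[abs_def] by measurable
  have large_m [measurable]: "large \<eta> i k \<in> borel_measurable M" unfolding large_def[abs_def] by measurable
  have sq: "(cmod (e i k \<omega>))\<^sup>2 = (cmod (small \<eta> i k \<omega>))\<^sup>2 + (cmod (large \<eta> i k \<omega>))\<^sup>2" for \<omega>
    by (simp add: small_def large_def)
  have sum: "e i k \<omega> = small \<eta> i k \<omega> + large \<eta> i k \<omega>" for \<omega> by (simp add: small_def large_def)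
  have si: "integrable M (\<lambda>\<omega>. (cmod (small \<eta> i k \<omega>))\<^sup>2)" and li: "integrable M (\<lambda>\<omega>. (cmod (large \<eta> i k \<omega>))\<^sup>2)"
    by (rule Bochner_Integration.integrable_bound[OF e_sq]; use sq in \<open>auto intro!: AE_I2\<close>)+
  note sv = complex_variance[OF small_m si] and lv = complex_variance[OF large_m li]
  have one: "expectation (\<lambda>\<omega>. (cmod (small \<eta> i k \<omega>))\<^sup>2) + tail_var \<eta> i k = 1"
    using var[OF ik] si li unfolding sq tail_var_def by simp
  have zero: "expectation (small \<eta> i k) + expectation (large \<eta> i k) = 0"
    using mean[OF ik] sv(1) lv(1) unfolding sum[abs_def] by simp
  then have neg: "expectation (small \<eta> i k) = - expectation (large \<eta> i k)" by (simp add: eq_neg_iff_add_eq_0)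
  have lE: "(cmod (expectation (large \<eta> i k)))\<^sup>2 \<le> tail_var \<eta> i k"
  proof -
    have "0 \<le> expectation (\<lambda>\<omega>. (cmod (large \<eta> i k \<omega> - expectation (large \<eta> i k)))\<^sup>2)" by simp
    then show ?thesis unfolding lv(3) tail_var_def by simp
  qed
  have tr: "trunc \<eta> i k = (\<lambda>\<omega>. small \<eta> i k \<omega> - expectation (small \<eta> i k))" using ik by (auto simp: trunc_def)
  have sb: "cmod (small \<eta> i k \<omega>) \<le> level \<eta>" for \<omega> using lev by (auto simp: small_def)
  show "cmod (trunc \<eta> i k \<omega>) \<le> 2 * level \<eta>" for \<omega>
  proof -
    have "cmod (expectation (small \<eta> i k)) \<le> expectation (\<lambda>\<omega>. cmod (small \<eta> i k \<omega>))" by (rule integral_norm_bound)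
    also have "\<dots> \<le> expectation (\<lambda>\<omega>. level \<eta>)" using sv(1) sb by (intro integral_mono) auto
    finally have "cmod (expectation (small \<eta> i k)) \<le> level \<eta>" by (simp add: prob_space)
    then show ?thesis unfolding tr using norm_triangle_ineq4[of "small \<eta> i k \<omega>" "expectation (small \<eta> i k)"] sb[of \<omega>] by linarith
  qed
  show "expectation (trunc \<eta> i k) = 0" unfolding tr using sv(1) by (simp add: prob_space)
  show "integrable M (\<lambda>\<omega>. (cmod (trunc \<eta> i k \<omega>))\<^sup>2)" unfolding tr by (rule sv(2))
  have tv: "trunc_var \<eta> i k = 1 - tail_var \<eta> i k - (cmod (expectation (large \<eta> i k)))\<^sup>2"
    unfolding trunc_var_def tr sv(3) using one neg by simp
  have "0 \<le> tail_var \<eta> i k" unfolding tail_var_def by simp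
  moreover have "0 \<le> (cmod (expectation (large \<eta> i k)))\<^sup>2" by simp
  ultimately show "trunc_var \<eta> i k \<le> 1" unfolding tv by linarith
  show "1 - trunc_var \<eta> i k \<le> 2 * tail_var \<eta> i k" unfolding tv using lE by simp
  have diff: "e i k \<omega> - trunc \<eta> i k \<omega> = large \<eta> i k \<omega> - expectation (large \<eta> i k)" for \<omega>
    unfolding tr sum using neg by simp
  show "integrable M (\<lambda>\<omega>. (cmod (e i k \<omega> - trunc \<eta> i k \<omega>))\<^sup>2)" unfolding diff by (rule lv(2))
  show "expectation (\<lambda>\<omega>. (cmod (e i k \<omega> - trunc \<eta> i k \<omega>))\<^sup>2) \<le> tail_var \<eta> i k"
    unfolding diff lv(3) tail_var_def by simp
qed

lemma trunc_indep: "indep_vars (\<lambda>_. borel) (\<lambda>(i, k). trunc \<eta> i k) ({..<N} \<times> {..<n})"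
proof -
  define f where "f p x = (if cmod x < level \<eta> then x else 0) - expectation (small \<eta> (fst p) (snd p))" for p :: "nat \<times> nat" and x
  have "f p \<in> borel_measurable borel" for p unfolding f_def by measurable
  then have "indep_vars (\<lambda>_. borel) (\<lambda>p \<omega>. f p ((case p of (i, k) \<Rightarrow> e i k) \<omega>)) ({..<N} \<times> {..<n})"
    by (intro indep_vars_compose2[OF indep]) auto
  then show ?thesis
    by (rule subst[OF indep_vars_cong, THEN iffD1, rotated -1]) (auto simp: f_def trunc_def small_def fun_eq_iff)
qed

lemma row_model_trunc:
  assumes \<eta>: "\<eta> > 0" and z: "Im z > 0"
  shows "row_model M N n (real t) (2 * level \<eta>) (trunc \<eta>) (trunc_var \<eta>) (lag_mat \<tau>) z"
proof
  show "real t > 0" "N > 0" using t N by auto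
  show "hermitian_on n (lag_mat \<tau>)" by (rule hermitian_lag_mat)
  show "row_bound n 1 (lag_mat \<tau>)" by (rule row_bound_lag_mat[OF \<tau>])
  show "indep_vars (\<lambda>_. borel) (\<lambda>(i, k). trunc \<eta> i k) ({..<N} \<times> {..<n})" by (rule trunc_indep)
  show "trunc \<eta> i k \<omega> = 0" if "\<not> (i < N \<and> k < n)" for i k \<omega> using that unfolding trunc_def by auto
qed (use z truncation_facts[OF _ _ \<eta>] in \<open>auto simp: trunc_var_def\<close>)

definition trunc_trace :: "real \<Rightarrow> complex \<Rightarrow> 'a \<Rightarrow> complex" where
  "trunc_trace \<eta> z \<omega> = norm_trace N n z (lag_mat \<tau>) (\<lambda>i k. of_real (1 / sqrt t) * trunc \<eta> i k \<omega>)"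

definition raw_trace :: "complex \<Rightarrow> 'a \<Rightarrow> complex" where
  "raw_trace z \<omega> = norm_trace N n z (lag_mat \<tau>) (\<lambda>i k. of_real (1 / sqrt t) * e i k \<omega>)"

lemma raw_trace_integrable: "Im z > 0 \<Longrightarrow> integrable M (raw_trace z)"
proof (rule integrable_const_bound[of _ "1 / Im z"])
  assume z: "Im z > 0"
  show "AE \<omega> in M. norm (raw_trace z \<omega>) \<le> 1 / Im z" unfolding raw_trace_def using norm_trace_bound[OF hermitian_lag_mat z] by simp
  show "raw_trace z \<in> borel_measurable M" unfolding raw_trace_def[abs_def]
    by (rule norm_trace_measurable) (use e_measurable in measurable)
qed

text \<open>Truncation changes the array by a matrix whose mean squared Frobenius norm is at most N times the
  Lindeberg quantity, whereas the arrays themselves have mean squared Frobenius norm of order N.\<close>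
lemma raw_trunc_trace_diff:
  assumes \<eta>: "\<eta> > 0" and z: "Im z > 0" and \<theta>: "\<theta> > 0"
  shows "cmod (expectation (raw_trace z) - expectation (trunc_trace \<eta> z)) \<le> 1 / (Im z)\<^sup>2 * (2 * lindeberg \<eta> / \<theta> + 2 * \<theta> * n / t)"
proof -
  interpret R: row_model M N n "real t" "2 * level \<eta>" "trunc \<eta>" "trunc_var \<eta>" "lag_mat \<tau>" z
    by (rule row_model_trunc[OF \<eta> z])
  let ?c = "complex_of_real (1 / sqrt t)"
  define Y where "Y \<omega> i k = ?c * e i k \<omega>" for \<omega> i k
  define V where "V \<omega> i k = ?c * trunc \<eta> i k \<omega>" for \<omega> i k
  have c2: "(cmod (?c * x))\<^sup>2 = 1 / t * (cmod x)\<^sup>2" for x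
    unfolding norm_mult power_mult_distrib norm_of_real power2_abs by (simp add: power_divide)
  have hi: "integrable M (trunc_trace \<eta> z)"
  proof (rule integrable_const_bound[of _ "1 / Im z"])
    show "AE \<omega> in M. norm (trunc_trace \<eta> z \<omega>) \<le> 1 / Im z" unfolding trunc_trace_def using norm_trace_bound[OF hermitian_lag_mat z] by simp
    show "trunc_trace \<eta> z \<in> borel_measurable M" unfolding trunc_trace_def[abs_def] by (rule norm_trace_measurable) measurable
  qed
  note ri = raw_trace_integrable[OF z]
  have frobE: "integrable M (\<lambda>\<omega>. frob N n (\<lambda>i k. ?c * f i k \<omega>)) \<and> expectation (\<lambda>\<omega>. frob N n (\<lambda>i k. ?c * f i k \<omega>)) \<le> (\<Sum>i<N. \<Sum>k<n. B i k) / t"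
    if "\<And>i k. i < N \<Longrightarrow> k < n \<Longrightarrow> integrable M (\<lambda>\<omega>. (cmod (f i k \<omega>))\<^sup>2)"
      "\<And>i k. i < N \<Longrightarrow> k < n \<Longrightarrow> expectation (\<lambda>\<omega>. (cmod (f i k \<omega>))\<^sup>2) \<le> B i k" for f :: "nat \<Rightarrow> nat \<Rightarrow> 'a \<Rightarrow> complex" and B
  proof
    show "integrable M (\<lambda>\<omega>. frob N n (\<lambda>i k. ?c * f i k \<omega>))"
      unfolding frob_def c2 using that(1) by (intro Bochner_Integration.integrable_sum integrable_mult_right) auto
    have "expectation (\<lambda>\<omega>. frob N n (\<lambda>i k. ?c * f i k \<omega>)) = (\<Sum>i<N. \<Sum>k<n. 1 / t * expectation (\<lambda>\<omega>. (cmod (f i k \<omega>))\<^sup>2))"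
      unfolding frob_def c2 using that(1)
      by (subst Bochner_Integration.integral_sum; (intro Bochner_Integration.integrable_sum integrable_mult_right)?; (intro sum.cong refl)?; (subst Bochner_Integration.integral_sum)?) auto
    also have "\<dots> \<le> (\<Sum>i<N. \<Sum>k<n. 1 / t * B i k)" using that(2) by (intro sum_mono mult_left_mono) auto
    also have "\<dots> = (\<Sum>i<N. \<Sum>k<n. B i k) / t" by (simp add: sum_divide_distrib)
    finally show "expectation (\<lambda>\<omega>. frob N n (\<lambda>i k. ?c * f i k \<omega>)) \<le> (\<Sum>i<N. \<Sum>k<n. B i k) / t" .
  qed
  have fY: "integrable M (\<lambda>\<omega>. frob N n (Y \<omega>))" "expectation (\<lambda>\<omega>. frob N n (Y \<omega>)) \<le> N * n / t"
    using frobE[of e "\<lambda>_ _. 1"] e_square var unfolding Y_def by auto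
  have fV: "integrable M (\<lambda>\<omega>. frob N n (V \<omega>))" "expectation (\<lambda>\<omega>. frob N n (V \<omega>)) \<le> N * n / t"
    using frobE[of "trunc \<eta>" "\<lambda>_ _. 1"] truncation_facts(3,4)[OF _ _ \<eta>] unfolding V_def trunc_var_def by auto
  have D: "(\<lambda>i k. Y \<omega> i k - V \<omega> i k) = (\<lambda>i k. ?c * (e i k \<omega> - trunc \<eta> i k \<omega>))" for \<omega>
    unfolding Y_def V_def by (simp add: right_diff_distrib)
  have fD: "integrable M (\<lambda>\<omega>. frob N n (\<lambda>i k. Y \<omega> i k - V \<omega> i k))" "expectation (\<lambda>\<omega>. frob N n (\<lambda>i k. Y \<omega> i k - V \<omega> i k)) \<le> N * lindeberg \<eta>"
    using frobE[of "\<lambda>i k \<omega>. e i k \<omega> - trunc \<eta> i k \<omega>" "tail_var \<eta>"] truncation_facts(6,7)[OF _ _ \<eta>] N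
    unfolding D lindeberg_def by auto
  let ?b = "\<lambda>\<omega>. 1 / (Im z)\<^sup>2 * ((2 / \<theta> * frob N n (\<lambda>i k. Y \<omega> i k - V \<omega> i k) + \<theta> * (frob N n (Y \<omega>) + frob N n (V \<omega>))) / N)"
  have le: "cmod (raw_trace z \<omega> - trunc_trace \<eta> z \<omega>) \<le> ?b \<omega>" for \<omega>
  proof -
    define g where "g = (\<Sum>i<N. resolvent N z (gram n (lag_mat \<tau>) (Y \<omega>)) i i)"
    define h where "h = (\<Sum>i<N. resolvent N z (gram n (lag_mat \<tau>) (V \<omega>)) i i)"
    have "(Im z)\<^sup>2 * cmod (g - h) \<le> sqrt (frob N n (\<lambda>i k. Y \<omega> i k - V \<omega> i k)) * (sqrt (frob N n (Y \<omega>)) + sqrt (frob N n (V \<omega>)))"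
      unfolding g_def h_def using z by (intro trace_resolvent_diff_le hermitian_lag_mat row_bound_lag_mat \<tau>) auto
    also have "\<dots> \<le> (frob N n (\<lambda>i k. Y \<omega> i k - V \<omega> i k) / \<theta> + \<theta> * frob N n (Y \<omega>)) + (frob N n (\<lambda>i k. Y \<omega> i k - V \<omega> i k) / \<theta> + \<theta> * frob N n (V \<omega>))"
      unfolding distrib_left
      using R.cmod_mult_le[OF \<theta>, of "sqrt (frob N n (\<lambda>i k. Y \<omega> i k - V \<omega> i k))" "sqrt (frob N n (Y \<omega>))"]
        R.cmod_mult_le[OF \<theta>, of "sqrt (frob N n (\<lambda>i k. Y \<omega> i k - V \<omega> i k))" "sqrt (frob N n (V \<omega>))"]
      by (intro add_mono) auto
    finally have "(Im z)\<^sup>2 * cmod (g - h) \<le> 2 / \<theta> * frob N n (\<lambda>i k. Y \<omega> i k - V \<omega> i k) + \<theta> * (frob N n (Y \<omega>) + frob N n (V \<omega>))"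
      by (simp add: distrib_left)
    then have "cmod (g - h) \<le> 1 / (Im z)\<^sup>2 * (2 / \<theta> * frob N n (\<lambda>i k. Y \<omega> i k - V \<omega> i k) + \<theta> * (frob N n (Y \<omega>) + frob N n (V \<omega>)))"
      using z by (simp add: pos_le_divide_eq mult.commute)
    then have "cmod (g - h) / N \<le> 1 / (Im z)\<^sup>2 * (2 / \<theta> * frob N n (\<lambda>i k. Y \<omega> i k - V \<omega> i k) + \<theta> * (frob N n (Y \<omega>) + frob N n (V \<omega>))) / N"
      by (rule divide_right_mono) simp
    moreover have "raw_trace z \<omega> - trunc_trace \<eta> z \<omega> = (g - h) / of_nat N"
      unfolding raw_trace_def trunc_trace_def norm_trace_def g_def h_def Y_def V_def by (simp add: diff_divide_distrib)
    ultimately show ?thesis by (simp add: norm_divide)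
  qed
  have bi: "integrable M ?b" using fD(1) fY(1) fV(1) by simp
  have "cmod (expectation (raw_trace z) - expectation (trunc_trace \<eta> z)) = cmod (expectation (\<lambda>\<omega>. raw_trace z \<omega> - trunc_trace \<eta> z \<omega>))"
    using ri hi by simp
  also have "\<dots> \<le> expectation (\<lambda>\<omega>. cmod (raw_trace z \<omega> - trunc_trace \<eta> z \<omega>))" by (rule integral_norm_bound)
  also have "\<dots> \<le> expectation ?b" using ri hi by (intro integral_mono bi le) auto
  also have "\<dots> = 1 / (Im z)\<^sup>2 * ((2 / \<theta> * expectation (\<lambda>\<omega>. frob N n (\<lambda>i k. Y \<omega> i k - V \<omega> i k)) + \<theta> * (expectation (\<lambda>\<omega>. frob N n (Y \<omega>)) + expectation (\<lambda>\<omega>. frob N n (V \<omega>)))) / N)"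
    using fD(1) fY(1) fV(1) by simp
  also have "\<dots> \<le> 1 / (Im z)\<^sup>2 * ((2 / \<theta> * (N * lindeberg \<eta>) + \<theta> * (N * n / t + N * n / t)) / N)"
    using fD(2) fY(2) fV(2) \<theta> by (intro mult_left_mono divide_right_mono add_mono) auto
  also have "\<dots> = 1 / (Im z)\<^sup>2 * (2 * lindeberg \<eta> / \<theta> + 2 * \<theta> * n / t)"
  proof -
    have "2 / \<theta> * (N * l) + \<theta> * (N * n / t + N * n / t) = N * (2 * l / \<theta> + 2 * \<theta> * n / t)" for l :: real
      by (simp add: algebra_simps add_divide_distrib)
    then show ?thesis using N by (simp only:) simp
  qed
  finally show ?thesis .
qed

end

text \<open>The error bounds as continuous functions of the ratios rho = N / t, nu = n / t, iota = 1 / t, of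
  the Lindeberg quantity and of the exponentially small term, so that passing to the limit in the dimensions is
  a substitution.\<close>
definition err_frob :: "real \<Rightarrow> real \<Rightarrow> real \<Rightarrow> real \<Rightarrow> real \<Rightarrow> real" where
  "err_frob v \<rho> \<nu> \<iota> \<eta> = 2 * (\<nu> + (3 * \<rho>\<^sup>2 * \<nu> + 2 * \<rho> * (\<nu>\<^sup>2 + 2 * (9 * \<iota> + 12 * \<eta>\<^sup>2 * \<nu> + \<nu>) * \<nu>)) / v\<^sup>2)"

definition err_bound :: "real \<Rightarrow> real \<Rightarrow> real \<Rightarrow> real \<Rightarrow> real \<Rightarrow> real \<Rightarrow> real \<Rightarrow> real \<Rightarrow> real \<Rightarrow> real" where
  "err_bound v \<tau> \<eta> \<theta> \<rho> \<nu> \<iota> \<Lambda> \<epsilon> = 1 / v * ((1 + \<rho> / v) *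
      (\<theta> + 98 * (9 * \<iota> + 12 * \<eta>\<^sup>2 * \<nu> + 2 * \<Lambda>) * err_frob v \<rho> \<nu> \<iota> \<eta> / \<theta> + 75 * err_frob v \<rho> \<nu> \<iota> \<eta> * \<iota> / v)
    + \<rho> * ((\<theta>\<^sup>2 + 16 / v\<^sup>2 * \<epsilon>) / \<theta> + \<theta> * (err_frob v \<rho> \<nu> \<iota> \<eta> * 49 * \<nu>))
    + \<theta> * err_frob v \<rho> \<nu> \<iota> \<eta> + 200 * \<tau> * \<iota> / \<theta>)"

text \<open>The estimate of the mean equation for the lag matrix, with the inverse symbol in the place of
  B.\<close>
lemma (in entries) trunc_trace_equation:
  assumes \<eta>: "\<eta> > 0" and z: "Im z > 0" and \<theta>: "\<theta> > 0" and q: "cmod q \<le> 1 / 2"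
    and a: "of_real (N / t) * expectation (trunc_trace \<eta> z) = - 2 * q / (1 + q\<^sup>2)"
  shows "cmod (1 - expectation (trunc_trace \<eta> z) * (symbol_const q * q - z))
    \<le> err_bound (Im z) \<tau> \<eta> \<theta> (N / t) (n / t) (1 / t) (lindeberg \<eta>) (exp (- (\<theta>\<^sup>2 * (Im z)\<^sup>2 / 128 * N)))"
proof -
  interpret R: row_model M N n "real t" "2 * level \<eta>" "trunc \<eta>" "trunc_var \<eta>" "lag_mat \<tau>" z
    by (rule row_model_trunc[OF \<eta> z])
  let ?v = "Im z"
  have mh: "R.mtrace = trunc_trace \<eta> z"
    unfolding R.mtrace_def[abs_def] trunc_trace_def[abs_def] norm_trace_def R.scaled_def[abs_def] ..
  define w where "w = expectation (trunc_trace \<eta> z)"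
  have tr: "R.ntrace (lag_mat \<tau>) (inv_lag \<tau> q) = symbol_const q * q"
    unfolding R.ntrace_def trace_lag_inv_lag[OF \<tau> q refl] using t by simp
  define fr where "fr = err_frob ?v (N / t) (n / t) (1 / t) \<eta>"
  have t0: "real t > 0" using t by simp
  have lev: "(2 * level \<eta>)\<^sup>2 = 4 * \<eta>\<^sup>2 * n" unfolding level_def by (simp add: power_mult_distrib)
  have fc: "R.frob_const = t * fr"
  proof -
    define Q where "Q = 3 * (N / t)\<^sup>2 * (n / t) + 2 * (N / t) * ((n / t)\<^sup>2 + 2 * (9 * (1 / t) + 12 * \<eta>\<^sup>2 * (n / t) + n / t) * (n / t))"
    have oc: "R.outer_const = t * Q"
      unfolding R.outer_const_def lev Q_def using t0 by (simp add: field_simps power2_eq_square)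
    have "2 * (x + s * Q / w) = s * (2 * (x / s + Q / w))" if "s \<noteq> 0" for x s w :: real
      using that by (simp add: distrib_left)
    note this[of "real t" "real n" "?v\<^sup>2"]
    moreover have "real t \<noteq> 0" using t by simp
    ultimately have "2 * (real n + t * Q / ?v\<^sup>2) = t * (2 * (real n / t + Q / ?v\<^sup>2))"
      by (rule meta_mp)
    then show ?thesis unfolding R.frob_const_def fr_def err_frob_def oc Q_def[symmetric] .
  qed
  have fr0: "0 \<le> fr" using R.frob_const_nonneg t0 unfolding fc by (simp add: zero_le_mult_iff)
  define A where "A = \<theta> + 98 * (9 * (1 / t) + 12 * \<eta>\<^sup>2 * (n / t) + 2 * lindeberg \<eta>) * fr / \<theta> + 75 * fr * (1 / t) / ?v"
  have avg: "(\<Sum>i<N. R.conc_const 49 \<theta> i) / N \<le> A"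
  proof -
    have vd: "(\<Sum>i<N. R.variance_defect i) \<le> 2 * (N * t * lindeberg \<eta>)"
    proof -
      have "(\<Sum>i<N. R.variance_defect i) \<le> (\<Sum>i<N. \<Sum>k<n. 2 * tail_var \<eta> i k)"
        unfolding R.variance_defect_def using truncation_facts(5)[OF _ _ \<eta>] by (intro sum_mono) auto
      then have "(\<Sum>i<N. R.variance_defect i) \<le> 2 * (\<Sum>i<N. \<Sum>k<n. tail_var \<eta> i k)"
        unfolding sum_distrib_left .
      moreover have "real (N * t) * (S / real (N * t)) = S" for S :: real using N t by simp
      ultimately show ?thesis unfolding lindeberg_def by (simp only:)
    qed
    have cc: "R.conc_const 49 \<theta> i = (\<theta> + 98 * (9 + 12 * \<eta>\<^sup>2 * n) / t * fr / \<theta> + 75 * fr * (1 / t) / ?v) + 98 / t * fr / \<theta> * R.variance_defect i" for i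
      unfolding R.conc_const_def lev fc using t0 \<theta> z by (simp add: field_simps power2_eq_square)
    have lin: "(\<Sum>i<N. a + b * f i) = N * a + b * (\<Sum>i<N. f i)" for a b :: real and f
      by (simp add: sum.distrib sum_distrib_left)
    have "(\<Sum>i<N. R.conc_const 49 \<theta> i) = N * (\<theta> + 98 * (9 + 12 * \<eta>\<^sup>2 * n) / t * fr / \<theta> + 75 * fr * (1 / t) / ?v) + 98 / t * fr / \<theta> * (\<Sum>i<N. R.variance_defect i)"
      unfolding cc by (rule lin)
    also have "\<dots> \<le> N * (\<theta> + 98 * (9 + 12 * \<eta>\<^sup>2 * n) / t * fr / \<theta> + 75 * fr * (1 / t) / ?v) + 98 / t * fr / \<theta> * (2 * (N * t * lindeberg \<eta>))"
      using vd fr0 \<theta> t0 by (intro add_left_mono mult_left_mono) auto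
    also have "\<dots> = N * A"
    proof -
      have "98 / t * fr / \<theta> * (2 * (N * t * lindeberg \<eta>)) = N * (98 * (2 * lindeberg \<eta>) * fr / \<theta>)"
        using t0 \<theta> by (simp add: field_simps)
      moreover have "98 * (9 + 12 * \<eta>\<^sup>2 * n) / t * fr / \<theta> = 98 * (9 * (1 / t) + 12 * \<eta>\<^sup>2 * (n / t)) * fr / \<theta>"
        using t0 \<theta> by (simp add: field_simps)
      ultimately show ?thesis unfolding A_def by (simp add: algebra_simps add_divide_distrib)
    qed
    finally show ?thesis using N by (simp add: field_simps)
  qed
  have var: "expectation (\<lambda>\<omega>. (cmod (trunc_trace \<eta> z \<omega> - w))\<^sup>2) \<le> \<theta>\<^sup>2 + 16 / ?v\<^sup>2 * exp (- (\<theta>\<^sup>2 * ?v\<^sup>2 / 128 * N))"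
    unfolding w_def trunc_trace_def by (rule norm_trace_variance[OF trunc_indep N hermitian_lag_mat z \<theta>])
  have "cmod (1 - w * (R.ntrace (lag_mat \<tau>) (inv_lag \<tau> q) - z)) \<le>
    1 / ?v * ((1 + N / (t * ?v)) * ((\<Sum>i<N. R.conc_const 49 \<theta> i) / N)
      + N / t * (expectation (\<lambda>\<omega>. (cmod (trunc_trace \<eta> z \<omega> - w))\<^sup>2) / \<theta> + \<theta> * (R.frob_const * (49 * real n) / (real t)\<^sup>2))
      + (\<theta> * R.frob_const + 200 * real \<tau> / \<theta>) / t)"
    unfolding w_def mh[symmetric]
  proof (rule R.mean_equation_estimate[OF row_bound_inv_lag_mult[OF \<tau> q] _ \<theta>])
    show "frob n n (\<lambda>k l. inv_lag \<tau> q k l + of_real (N / t) * expectation R.mtrace * (\<Sum>p<n. inv_lag \<tau> q k p * lag_mat \<tau> p l) - (if k = l then 1 else 0)) \<le> 200 * real \<tau>"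
      unfolding mh a by (rule order_trans[OF inv_lag_error[OF \<tau> q]]) simp
  qed simp
  also have "\<dots> \<le> 1 / ?v * ((1 + N / (t * ?v)) * A
      + N / t * ((\<theta>\<^sup>2 + 16 / ?v\<^sup>2 * exp (- (\<theta>\<^sup>2 * ?v\<^sup>2 / 128 * N))) / \<theta> + \<theta> * (R.frob_const * (49 * real n) / (real t)\<^sup>2))
      + (\<theta> * R.frob_const + 200 * real \<tau> / \<theta>) / t)"
    using avg var z \<theta> t0 by (intro mult_left_mono add_mono divide_right_mono order_refl) auto
  also have "\<dots> = err_bound ?v \<tau> \<eta> \<theta> (N / t) (n / t) (1 / t) (lindeberg \<eta>) (exp (- (\<theta>\<^sup>2 * ?v\<^sup>2 / 128 * N)))"
  proof -
    have 1: "real N / (t * ?v) = N / t / ?v" by simp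
    have 2: "R.frob_const * (49 * real n) / (real t)\<^sup>2 = fr * 49 * (n / t)"
      unfolding fc using t0 by (simp add: field_simps power2_eq_square)
    have 3: "(\<theta> * R.frob_const + 200 * real \<tau> / \<theta>) / t = \<theta> * fr + 200 * real \<tau> * (1 / t) / \<theta>"
      unfolding fc using t0 \<theta> by (simp add: field_simps)
    show ?thesis unfolding 1 2 3 A_def err_bound_def fr_def by (simp only: add.assoc)
  qed
  finally show ?thesis unfolding tr w_def .
qed

section \<open>The limit of the mean trace\<close>

text \<open>The root of a = - 2 q / (1 + q^2) inside the unit disc; this form has no singularity at a =
  0.\<close>
definition small_root :: "complex \<Rightarrow> complex" where
  "small_root a = - a / (1 + csqrt (1 - a\<^sup>2))"

lemma one_plus_csqrt: "1 \<le> cmod (1 + csqrt x)" "1 + csqrt x \<noteq> 0"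
proof -
  have "1 \<le> Re (1 + csqrt x)" using csqrt_principal[of x] by (auto simp: less_imp_le)
  then show 1: "1 \<le> cmod (1 + csqrt x)" using complex_Re_le_cmod order_trans by blast
  then show "1 + csqrt x \<noteq> 0" by auto
qed

lemma small_root_le: "cmod (small_root a) \<le> cmod a"
proof -
  have "cmod a / cmod (1 + csqrt (1 - a\<^sup>2)) \<le> cmod a / 1"
    using one_plus_csqrt(1)[of "1 - a\<^sup>2"] by (intro divide_left_mono) auto
  then show ?thesis unfolding small_root_def norm_divide norm_minus_cancel by simp
qed

lemma small_root_eq:
  assumes "cmod a \<le> 1 / 2"
  shows "a = - 2 * small_root a / (1 + (small_root a)\<^sup>2)"
proof -
  define r where "r = csqrt (1 - a\<^sup>2)"
  have r2: "r\<^sup>2 = 1 - a\<^sup>2" unfolding r_def by simp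
  have r1: "1 + r \<noteq> 0" unfolding r_def by (rule one_plus_csqrt)
  have "1 + (small_root a)\<^sup>2 \<noteq> 0" by (rule one_pm_square_nonzero) (rule order_trans[OF small_root_le assms])
  moreover have "a * (1 + (small_root a)\<^sup>2) = - 2 * small_root a"
  proof -
    have "(1 + r)\<^sup>2 * (a * (1 + (small_root a)\<^sup>2)) = a * ((1 + r)\<^sup>2 + a\<^sup>2)"
      unfolding small_root_def r_def[symmetric] using r1 by (simp add: power_divide distrib_left)
    also have "(1 + r)\<^sup>2 + a\<^sup>2 = 2 * (1 + r)" using r2 by (simp add: power2_eq_square algebra_simps)
    also have "a * (2 * (1 + r)) = (1 + r)\<^sup>2 * (- 2 * small_root a)"
      unfolding small_root_def r_def[symmetric] using r1 by (simp add: power2_eq_square)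
    finally have "(1 + r)\<^sup>2 * (a * (1 + (small_root a)\<^sup>2)) = (1 + r)\<^sup>2 * (- 2 * small_root a)" .
    then show ?thesis using r1 by (subst (asm) mult_cancel_left) simp
  qed
  ultimately show ?thesis by (subst nonzero_eq_divide_eq)
qed

lemma isCont_small_root:
  assumes "cmod a \<le> 1 / 2"
  shows "isCont small_root a"
proof -
  have "cmod (a\<^sup>2) \<le> 1 / 4" using power_mono[OF assms, of 2] by (simp add: norm_power power_divide)
  then have "Re (1 - a\<^sup>2) > 0" using abs_Re_le_cmod[of "a\<^sup>2"] by simp
  then have "1 - a\<^sup>2 \<notin> \<real>\<^sub>\<le>\<^sub>0" by (auto simp: complex_nonpos_Reals_iff)
  then have "isCont (\<lambda>a. csqrt (1 - a\<^sup>2)) a"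
    by (intro isCont_o2[OF _ continuous_at_csqrt] continuous_intros)
  then show ?thesis unfolding small_root_def[abs_def]
    by (intro continuous_intros) (use one_plus_csqrt(2) in auto)
qed

text \<open>Subtracting the equations and dividing by q1 - q2 leaves z times a factor bounded below equal to a
  bounded quantity, which is impossible for |z| >= 4.\<close>
lemma fixed_point_unique:
  fixes q1 q2 z :: complex and c :: real
  assumes q: "cmod q1 \<le> 1 / 2" "cmod q2 \<le> 1 / 2" and z: "cmod z \<ge> 4"
    and eq1: "- 2 * q1\<^sup>2 / (1 - q1\<^sup>2) + 2 * q1 * z / (1 + q1\<^sup>2) = of_real c"
    and eq2: "- 2 * q2\<^sup>2 / (1 - q2\<^sup>2) + 2 * q2 * z / (1 + q2\<^sup>2) = of_real c"
  shows "q1 = q2"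
proof (rule ccontr)
  assume ne: "q1 \<noteq> q2"
  note n1 = one_pm_square_nonzero[OF q(1)] and n2 = one_pm_square_nonzero[OF q(2)]
  have "2 * q1 * z / (1 + q1\<^sup>2) - 2 * q2 * z / (1 + q2\<^sup>2) = 2 * q1\<^sup>2 / (1 - q1\<^sup>2) - 2 * q2\<^sup>2 / (1 - q2\<^sup>2)"
    using eq1 eq2 by (simp add: algebra_simps)
  also have "2 * q1 * z / (1 + q1\<^sup>2) - 2 * q2 * z / (1 + q2\<^sup>2) = 2 * z * (q1 - q2) * (1 - q1 * q2) / ((1 + q1\<^sup>2) * (1 + q2\<^sup>2))"
    using n1 n2 by (simp add: diff_frac_eq) (simp add: power2_eq_square algebra_simps)
  also have "2 * q1\<^sup>2 / (1 - q1\<^sup>2) - 2 * q2\<^sup>2 / (1 - q2\<^sup>2) = 2 * (q1 - q2) * (q1 + q2) / ((1 - q1\<^sup>2) * (1 - q2\<^sup>2))"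
    using n1 n2 by (simp add: diff_frac_eq) (simp add: power2_eq_square algebra_simps)
  finally have "2 * z * (q1 - q2) * (1 - q1 * q2) * ((1 - q1\<^sup>2) * (1 - q2\<^sup>2)) = 2 * (q1 - q2) * (q1 + q2) * ((1 + q1\<^sup>2) * (1 + q2\<^sup>2))"
    using n1 n2 by (simp add: frac_eq_eq)
  then have "(2 * (q1 - q2)) * (z * (1 - q1 * q2) * ((1 - q1\<^sup>2) * (1 - q2\<^sup>2))) = (2 * (q1 - q2)) * ((q1 + q2) * ((1 + q1\<^sup>2) * (1 + q2\<^sup>2)))"
    by (simp only: mult_ac)
  then have eq: "z * (1 - q1 * q2) * ((1 - q1\<^sup>2) * (1 - q2\<^sup>2)) = (q1 + q2) * ((1 + q1\<^sup>2) * (1 + q2\<^sup>2))"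
    using ne by simp
  have "cmod (q1 * q2) \<le> 1 / 2 * (1 / 2)" unfolding norm_mult using q by (intro mult_mono) auto
  then have l: "3 / 4 \<le> cmod (1 - q1 * q2)" using norm_triangle_ineq2[of 1 "q1 * q2"] by simp
  have u: "cmod (1 + q1\<^sup>2) \<le> 5 / 4" "cmod (1 + q2\<^sup>2) \<le> 5 / 4"
    using norm_triangle_ineq[of 1 "q1\<^sup>2"] norm_triangle_ineq[of 1 "q2\<^sup>2"] norm_square_le_quarter[OF q(1)] norm_square_le_quarter[OF q(2)] by simp_all
  have "4 * (3 / 4) * (3 / 4 * (3 / 4)) \<le> cmod z * cmod (1 - q1 * q2) * (cmod (1 - q1\<^sup>2) * cmod (1 - q2\<^sup>2))"
    using z l one_pm_square_lower(2)[OF q(1)] one_pm_square_lower(2)[OF q(2)] by (intro mult_mono) auto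
  also have "\<dots> = cmod (q1 + q2) * (cmod (1 + q1\<^sup>2) * cmod (1 + q2\<^sup>2))"
    using arg_cong[OF eq, of cmod] by (simp only: norm_mult)
  also have "\<dots> \<le> 1 * (5 / 4 * (5 / 4))"
  proof (intro mult_mono u)
    show "cmod (q1 + q2) \<le> 1" using norm_triangle_ineq[of q1 q2] q by linarith
  qed simp_all
  finally show False by simp
qed

text \<open>In the variable q one has c + c z m - 1 = - (1 + q^2) / (1 - q^2) and 1 - c^2 m^2 = ((1 - q^2) /
  (1 + q^2))^2, so the polynomial equation of the limit is a cancellation.\<close>
lemma solution_identity:
  fixes q z m :: complex and c :: real
  assumes q: "cmod q \<le> 1 / 2" and a: "of_real c * m = - 2 * q / (1 + q\<^sup>2)" and m: "m * (symbol_const q * q - z) = 1"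
  shows "(1 - (of_real c)\<^sup>2 * m\<^sup>2) * (of_real c + of_real c * z * m - 1)\<^sup>2 = 1"
    and "- 2 * q\<^sup>2 / (1 - q\<^sup>2) + 2 * q * z / (1 + q\<^sup>2) = of_real c"
proof -
  note n = one_pm_square_nonzero[OF q]
  have aq: "of_real c * m * (symbol_const q * q) = - 2 * q\<^sup>2 / (1 - q\<^sup>2)"
    unfolding a symbol_const_def using n by (simp add: power2_eq_square)
  have "of_real c * (m * (symbol_const q * q - z)) = of_real c" using m by simp
  then have c: "of_real c * m * (symbol_const q * q) - of_real c * m * z = of_real c" by (simp add: algebra_simps)
  have "of_real c + of_real c * z * m = of_real c * m * (symbol_const q * q)" using c by (simp add: algebra_simps)
  then have "of_real c + of_real c * z * m - 1 = - 2 * q\<^sup>2 / (1 - q\<^sup>2) - 1" unfolding aq by simp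
  also have "\<dots> = - ((1 + q\<^sup>2) / (1 - q\<^sup>2))" using n by (simp add: field_simps)
  finally have 1: "of_real c + of_real c * z * m - 1 = - ((1 + q\<^sup>2) / (1 - q\<^sup>2))" .
  have "1 - (of_real c)\<^sup>2 * m\<^sup>2 = 1 - (- 2 * q / (1 + q\<^sup>2))\<^sup>2" unfolding power_mult_distrib[symmetric] a ..
  also have "\<dots> = ((1 - q\<^sup>2) / (1 + q\<^sup>2))\<^sup>2"
  proof -
    have "(1 + q\<^sup>2)\<^sup>2 - (2 * q)\<^sup>2 = (1 - q\<^sup>2)\<^sup>2" by (simp add: power2_eq_square algebra_simps)
    moreover have "1 - (- 2 * q / (1 + q\<^sup>2))\<^sup>2 = ((1 + q\<^sup>2)\<^sup>2 - (2 * q)\<^sup>2) / (1 + q\<^sup>2)\<^sup>2"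
      using n(1) by (simp add: power_divide diff_divide_distrib)
    ultimately show ?thesis by (simp only: power_divide)
  qed
  finally have 2: "1 - (of_real c)\<^sup>2 * m\<^sup>2 = ((1 - q\<^sup>2) / (1 + q\<^sup>2))\<^sup>2" .
  show "(1 - (of_real c)\<^sup>2 * m\<^sup>2) * (of_real c + of_real c * z * m - 1)\<^sup>2 = 1"
    unfolding 1 2 using n by (simp add: power_divide)
  show "- 2 * q\<^sup>2 / (1 - q\<^sup>2) + 2 * q * z / (1 + q\<^sup>2) = of_real c"
  proof -
    have mz: "- (of_real c * m * z) = 2 * q * z / (1 + q\<^sup>2)" unfolding a by simp
    have "- 2 * q\<^sup>2 / (1 - q\<^sup>2) + - (of_real c * m * z) = of_real c" using c unfolding aq by simp
    then show ?thesis unfolding mz .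
  qed
qed

text \<open>What is left of the error after the dimensions have gone to infinity, with both free parameters
  equal to eta.\<close>
lemma err_bound_vanishes:
  assumes v: "v > 0"
  shows "((\<lambda>\<eta>. err_bound v \<tau> \<eta> \<eta> c 1 0 0 0) \<longlongrightarrow> 0) (at_right 0)"
proof -
  define f where "f \<eta> = 1 / v * ((1 + c / v) * (\<eta> + 1176 * \<eta> * err_frob v c 1 0 \<eta>)
     + c * (\<eta> + \<eta> * (err_frob v c 1 0 \<eta> * 49)) + \<eta> * err_frob v c 1 0 \<eta>)" for \<eta> :: real
  have "isCont f 0" unfolding f_def err_frob_def using v by (intro continuous_intros) auto
  moreover have "f 0 = 0" unfolding f_def by simp
  ultimately have "(f \<longlongrightarrow> 0) (at 0)" unfolding isCont_def by simp
  then have "(f \<longlongrightarrow> 0) (at_right 0)" by (rule filterlim_mono) (auto simp: at_le)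
  moreover have "eventually (\<lambda>\<eta>. f \<eta> = err_bound v \<tau> \<eta> \<eta> c 1 0 0 0) (at_right 0)"
    unfolding eventually_at_right_field
    by (intro exI[of _ 1]) (simp add: f_def err_bound_def power2_eq_square)
  ultimately show ?thesis by (rule Lim_transform_eventually)
qed

lemma bounded_unique_limit_point:
  fixes w :: "nat \<Rightarrow> complex"
  assumes bdd: "\<And>j. cmod (w j) \<le> B"
    and P: "\<And>r l. strict_mono r \<Longrightarrow> (w \<circ> r) \<longlonglongrightarrow> l \<Longrightarrow> P l" and uniq: "\<And>l l'. P l \<Longrightarrow> P l' \<Longrightarrow> l = l'"
  obtains l where "w \<longlonglongrightarrow> l" "P l"
proof -
  have sub: "\<exists>l r'. strict_mono r' \<and> (w \<circ> (r \<circ> r')) \<longlonglongrightarrow> l" for r :: "nat \<Rightarrow> nat"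
  proof -
    have "bounded (range (w \<circ> r))" using bdd by (auto simp: bounded_iff)
    then obtain l r' where "strict_mono r'" "((w \<circ> r) \<circ> r') \<longlonglongrightarrow> l"
      using bounded_imp_convergent_subsequence by blast
    then show ?thesis unfolding comp_assoc by blast
  qed
  from sub[of id] obtain l r where r: "strict_mono r" "(w \<circ> r) \<longlonglongrightarrow> l" by auto
  have Pl: "P l" by (rule P[OF r])
  have "w \<longlonglongrightarrow> l"
  proof (rule ccontr)
    assume "\<not> w \<longlonglongrightarrow> l"
    then obtain e where e: "e > 0" "\<not> eventually (\<lambda>j. dist (w j) l < e) sequentially" by (auto simp: tendsto_iff)
    then have "infinite {j. \<not> dist (w j) l < e}" by (simp add: eventually_sequentially infinite_nat_iff_unbounded_le)
    from infinite_enumerate[OF this] obtain s :: "nat \<Rightarrow> nat"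
      where s: "strict_mono s" "\<And>j. s j \<in> {j. \<not> dist (w j) l < e}" by blast
    from sub[of s] obtain l' r' where r': "strict_mono r'" "(w \<circ> (s \<circ> r')) \<longlonglongrightarrow> l'" by auto
    have "P l'" by (rule P[OF _ r'(2)]) (intro strict_mono_o s r')
    then have "l' = l" using uniq Pl by blast
    then have "eventually (\<lambda>j. dist ((w \<circ> (s \<circ> r')) j) l < e) sequentially" using r'(2) e(1) by (auto simp: tendsto_iff)
    then obtain j where "dist (w (s (r' j))) l < e" by (auto simp: eventually_sequentially)
    then show False using s(2)[of "r' j"] by simp
  qed
  then show ?thesis using that Pl by blast
qed

lemma (in entries) raw_trace_mean_bound: "Im z > 0 \<Longrightarrow> cmod (expectation (raw_trace z)) \<le> 1 / Im z"
proof -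
  assume z: "Im z > 0"
  have "cmod (expectation (raw_trace z)) \<le> expectation (\<lambda>\<omega>. cmod (raw_trace z \<omega>))" by (rule integral_norm_bound)
  also have "\<dots> \<le> expectation (\<lambda>\<omega>. 1 / Im z)"
    by (intro integral_mono integrable_norm raw_trace_integrable[OF z]) (auto simp: raw_trace_def norm_trace_bound[OF hermitian_lag_mat z])
  finally show ?thesis by (simp add: prob_space)
qed

lemma shift_ratio_tendsto_1:
  fixes t :: "nat \<Rightarrow> nat"
  assumes "filterlim t at_top sequentially"
  shows "(\<lambda>j. real (t j + \<tau>) / real (t j)) \<longlonglongrightarrow> 1"
proof -
  have "((\<lambda>x::real. (x + a) / x) \<longlongrightarrow> 1) at_top" for a :: real by real_asymp
  from filterlim_compose[OF this[of "real \<tau>"] filterlim_compose[OF filterlim_real_sequentially assms]]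
  show ?thesis by simp
qed

text \<open>Every limit point of the bounded sequence of means solves the fixed point equation, for which the
  solution with |q| <= 1/2 is unique. High on the imaginary axis, c |m| <= c / v <= 1/4 guarantees that this
  solution is the relevant one. The last conclusion is the tightness condition.\<close>
lemma mean_limit:
  fixes M :: "'w measure" and N t :: "nat \<Rightarrow> nat" and \<tau> :: nat and e :: "nat \<Rightarrow> nat \<Rightarrow> nat \<Rightarrow> 'w \<Rightarrow> complex" and c v :: real
  defines "z \<equiv> \<i> * of_real v" and "E \<equiv> (\<lambda>j. LINT \<omega>|M. entries.raw_trace (N j) (t j) \<tau> (e j) (\<i> * of_real v) \<omega>)"
  assumes ent: "\<And>j. entries M (N j) (t j) \<tau> (e j)"
    and N: "filterlim N at_top sequentially" and t: "filterlim t at_top sequentially"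
    and ratio: "(\<lambda>j. real (N j) / real (t j + \<tau>)) \<longlonglongrightarrow> c" and c: "c > 0"
    and lind: "\<And>\<eta>. \<eta> > 0 \<Longrightarrow> (\<lambda>j. entries.lindeberg M (N j) (t j) \<tau> (e j) \<eta>) \<longlonglongrightarrow> 0"
    and v: "v \<ge> 4 * c + 4"
  obtains w where "E \<longlonglongrightarrow> w" "(1 - (of_real c)\<^sup>2 * w\<^sup>2) * (of_real c + of_real c * z * w - 1)\<^sup>2 = 1" "1 - v * Im w \<le> 1 / v"
proof -
  have v0: "v > 0" using v c by simp
  have z: "Im z = v" "Im z > 0" "cmod z = v" unfolding z_def using v0 by (auto simp: norm_mult)
  have E_bound: "cmod (E j) \<le> 1 / v" for j
    using entries.raw_trace_mean_bound[OF ent z(2), of j] unfolding E_def z_def[symmetric] z(1) .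
  have rt: "filterlim (\<lambda>j. real (t j)) at_top sequentially" and rN: "filterlim (\<lambda>j. real (N j)) at_top sequentially"
    by (rule filterlim_compose[OF filterlim_real_sequentially t] filterlim_compose[OF filterlim_real_sequentially N])+
  have \<iota>: "(\<lambda>j. 1 / real (t j)) \<longlonglongrightarrow> 0"
    by (rule tendsto_divide_0[OF tendsto_const filterlim_at_top_imp_at_infinity[OF rt]])
  have t0: "real (t j) > 0" for j using entries.t[OF ent, of j] by simp
  have \<nu>: "(\<lambda>j. real (t j + \<tau>) / real (t j)) \<longlonglongrightarrow> 1" by (rule shift_ratio_tendsto_1[OF t])
  have \<rho>: "(\<lambda>j. real (N j) / real (t j)) \<longlonglongrightarrow> c"
  proof -
    have "real (N j) / real (t j + \<tau>) * (real (t j + \<tau>) / real (t j)) = real (N j) / real (t j)" for j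
      using t0[of j] by (simp del: of_nat_add)
    then show ?thesis using tendsto_mult[OF ratio \<nu>] by (simp only: mult_1_right)
  qed
  define P where "P l \<longleftrightarrow> cmod l \<le> 1 / v \<and> (\<exists>q. cmod q \<le> 1 / 2 \<and> of_real c * l = - 2 * q / (1 + q\<^sup>2) \<and> l * (symbol_const q * q - z) = 1)" for l
  have lim: "P l" if r: "strict_mono r" and Er: "(E \<circ> r) \<longlonglongrightarrow> l" for r l
  proof -
    note sub = LIMSEQ_subseq_LIMSEQ[OF _ r, unfolded comp_def]
    have Er': "(\<lambda>j. E (r j)) \<longlonglongrightarrow> l" using Er by (simp add: comp_def)
    have l: "cmod l \<le> 1 / v" by (rule Lim_norm_ubound[OF _ Er']) (use E_bound in auto)
    define a where "a = of_real c * l"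
    have a: "cmod a \<le> 1 / 4"
    proof -
      have "cmod a \<le> c * (1 / v)" unfolding a_def norm_mult using l c by (intro mult_mono) auto
      also have "\<dots> \<le> 1 / 4" using v v0 c by (simp add: field_simps)
      finally show ?thesis .
    qed
    define q where "q = small_root a"
    have a2: "cmod a \<le> 1 / 2" using a by simp
    have q: "cmod q \<le> 1 / 2" unfolding q_def using small_root_le[of a] a2 by simp
    define X where "X = 1 - l * (symbol_const q * q - z)"
    have X_le: "cmod X \<le> err_bound v \<tau> \<eta> \<eta> c 1 0 0 0" if \<eta>: "\<eta> > 0" for \<eta>
    proof -
      define \<Lambda> where "\<Lambda> j = entries.lindeberg M (N j) (t j) \<tau> (e j) \<eta>" for j
      define H where "H j = (LINT \<omega>|M. entries.trunc_trace M (N j) (t j) \<tau> (e j) \<eta> z \<omega>)" for j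
      have \<Lambda>: "\<Lambda> \<longlonglongrightarrow> 0" unfolding \<Lambda>_def by (rule lind[OF \<eta>])
      have EH: "(\<lambda>j. E j - H j) \<longlonglongrightarrow> 0"
      proof (rule tendstoI)
        fix \<epsilon> :: real assume \<epsilon>: "\<epsilon> > 0"
        \<comment> \<open>makes the part of the bound that does not vanish equal to \<epsilon> / 4\<close>
        define \<theta> where "\<theta> = \<epsilon> * v\<^sup>2 / 8"
        have \<theta>: "\<theta> > 0" unfolding \<theta>_def using \<epsilon> v0 by simp
        have "(\<lambda>j. 1 / v\<^sup>2 * (2 * \<Lambda> j / \<theta> + 2 * \<theta> * (real (t j + \<tau>) / real (t j)))) \<longlonglongrightarrow> 1 / v\<^sup>2 * (2 * 0 / \<theta> + 2 * \<theta> * 1)"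
          using \<theta> by (intro tendsto_intros \<Lambda> \<nu>) auto
        also have "1 / v\<^sup>2 * (2 * 0 / \<theta> + 2 * \<theta> * 1) = \<epsilon> / 4" unfolding \<theta>_def using v0 by simp
        finally have "eventually (\<lambda>j. 1 / v\<^sup>2 * (2 * \<Lambda> j / \<theta> + 2 * \<theta> * (real (t j + \<tau>) / real (t j))) < \<epsilon>) sequentially"
          by (rule order_tendstoD) (use \<epsilon> in simp)
        then show "eventually (\<lambda>j. dist (E j - H j) 0 < \<epsilon>) sequentially"
        proof eventually_elim
          case (elim j)
          have "cmod (E j - H j) \<le> 1 / v\<^sup>2 * (2 * \<Lambda> j / \<theta> + 2 * \<theta> * (real (t j + \<tau>) / real (t j)))"
            using entries.raw_trunc_trace_diff[OF ent \<eta> z(2) \<theta>, of j] unfolding E_def H_def \<Lambda>_def z(1) z_def[symmetric] by simp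
          then show ?case using elim by simp
        qed
      qed
      have H: "(\<lambda>j. H (r j)) \<longlonglongrightarrow> l" using tendsto_diff[OF Er' sub[OF EH]] by simp
      define b where "b j = of_real (N (r j) / t (r j)) * H (r j)" for j
      have b: "b \<longlonglongrightarrow> a" unfolding b_def a_def by (intro tendsto_intros H sub[OF \<rho>])
      have qj: "(\<lambda>j. small_root (b j)) \<longlonglongrightarrow> q" unfolding q_def by (rule isCont_tendsto_compose[OF isCont_small_root[OF a2] b])
      have "(\<lambda>j. cmod (b j)) \<longlonglongrightarrow> cmod a" by (intro tendsto_norm b)
      then have ev: "eventually (\<lambda>j. cmod (b j) < 1 / 2) sequentially"
        by (rule order_tendstoD) (use a in simp)
      define \<epsilon> where "\<epsilon> j = exp (- (\<eta>\<^sup>2 * v\<^sup>2 / 128 * real (N j)))" for j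
      have \<epsilon>: "\<epsilon> \<longlonglongrightarrow> 0"
      proof -
        have k: "\<eta>\<^sup>2 * v\<^sup>2 / 128 > 0" using \<eta> v0 by simp
        have "((\<lambda>x::real. exp (- (k * x))) \<longlongrightarrow> 0) at_top" if "k > 0" for k :: real using that by real_asymp
        from filterlim_compose[OF this[OF k] rN] show ?thesis unfolding \<epsilon>_def .
      qed
      have "(\<lambda>j. cmod (1 - H (r j) * (symbol_const (small_root (b j)) * small_root (b j) - z))) \<longlonglongrightarrow> cmod X"
        unfolding X_def symbol_const_def using one_pm_square_nonzero[OF q] by (intro tendsto_intros H qj) auto
      moreover have "(\<lambda>j. err_bound v \<tau> \<eta> \<eta> (N (r j) / t (r j)) (real (t (r j) + \<tau>) / t (r j)) (1 / t (r j)) (\<Lambda> (r j)) (\<epsilon> (r j)))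
        \<longlonglongrightarrow> err_bound v \<tau> \<eta> \<eta> c 1 0 0 0"
        unfolding err_bound_def err_frob_def using \<eta> v0
        by (intro tendsto_intros sub[OF \<rho>] sub[OF \<nu>] sub[OF \<iota>] sub[OF \<Lambda>] sub[OF \<epsilon>]) auto
      moreover have "eventually (\<lambda>j. cmod (1 - H (r j) * (symbol_const (small_root (b j)) * small_root (b j) - z))
          \<le> err_bound v \<tau> \<eta> \<eta> (N (r j) / t (r j)) (real (t (r j) + \<tau>) / t (r j)) (1 / t (r j)) (\<Lambda> (r j)) (\<epsilon> (r j))) sequentially"
        using ev
      proof eventually_elim
        case (elim j)
        then have bj: "cmod (b j) \<le> 1 / 2" by simp
        have "of_real (N (r j) / t (r j)) * (LINT \<omega>|M. entries.trunc_trace M (N (r j)) (t (r j)) \<tau> (e (r j)) \<eta> z \<omega>)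
            = - 2 * small_root (b j) / (1 + (small_root (b j))\<^sup>2)"
          using small_root_eq[OF bj] unfolding b_def H_def .
        from entries.trunc_trace_equation[OF ent \<eta> z(2) \<eta> order_trans[OF small_root_le bj] this]
        show ?case unfolding H_def[symmetric] \<Lambda>_def[symmetric] z(1) \<epsilon>_def[symmetric] .
      qed
      ultimately show ?thesis by (intro tendsto_le[OF sequentially_bot])
    qed
    have "cmod X \<le> 0"
      by (rule tendsto_lowerbound[OF err_bound_vanishes[OF v0, of \<tau> c] _ trivial_limit_at_right_real])
(rule eventually_mono[OF eventually_at_right_less X_le])
    then have "l * (symbol_const q * q - z) = 1" unfolding X_def by simp
    moreover have "of_real c * l = - 2 * q / (1 + q\<^sup>2)" unfolding q_def a_def[symmetric] by (rule small_root_eq[OF a2])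
    ultimately show ?thesis unfolding P_def using l q by blast
  qed
  have uniq: "l = l'" if Pl: "P l" "P l'" for l l'
  proof -
    from Pl(1) obtain q where q: "cmod q \<le> 1 / 2" "of_real c * l = - 2 * q / (1 + q\<^sup>2)" "l * (symbol_const q * q - z) = 1"
      unfolding P_def by blast
    from Pl(2) obtain q' where q': "cmod q' \<le> 1 / 2" "of_real c * l' = - 2 * q' / (1 + q'\<^sup>2)" "l' * (symbol_const q' * q' - z) = 1"
      unfolding P_def by blast
    have "q = q'" by (rule fixed_point_unique[OF q(1) q'(1) _ solution_identity(2)[OF q] solution_identity(2)[OF q']])
      (use z v c in simp)
    then have "of_real c * l = of_real c * l'" using q(2) q'(2) by simp
    then show ?thesis using c by simp
  qed
  obtain w where w: "E \<longlonglongrightarrow> w" and Pw: "P w"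
    by (rule bounded_unique_limit_point[of E "1 / v" P]) (use E_bound lim uniq in blast)+
  from Pw obtain q where wl: "cmod w \<le> 1 / v" and q: "cmod q \<le> 1 / 2" "of_real c * w = - 2 * q / (1 + q\<^sup>2)" "w * (symbol_const q * q - z) = 1"
    unfolding P_def by blast
  have "1 - v * Im w = Re (1 + z * w)" unfolding z_def by simp
  also have "1 + z * w = w * (symbol_const q * q)" using q(3) by (simp add: algebra_simps)
  also have "Re \<dots> \<le> cmod (w * (symbol_const q * q))" by (rule complex_Re_le_cmod)
  also have "\<dots> \<le> 1 / v * (5 / 3 * (1 / 2))"
    unfolding norm_mult using wl q(1) symbol_const_le[OF q(1)] v0 by (intro mult_mono) auto
  also have "\<dots> \<le> 1 / v" using v0 by (simp add: field_simps)
  finally have "1 - v * Im w \<le> 1 / v" .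
  then show ?thesis using that w solution_identity(1)[OF q] by blast
qed

section \<open>Almost sure convergence\<close>

lemma (in prob_space) indep_vars_reindex:
  assumes ind: "indep_vars (\<lambda>_. S) X I" and f: "inj_on f J" "f ` J \<subseteq> I"
  shows "indep_vars (\<lambda>_. S) (\<lambda>j. X (f j)) J"
proof -
  have "indep_vars (\<lambda>j. PiM {f j} (\<lambda>_. S)) (\<lambda>j \<omega>. restrict (\<lambda>i. X i \<omega>) {f j}) J"
    by (rule indep_vars_restrict[OF ind]) (use f in \<open>auto simp: disjoint_family_on_def inj_on_def\<close>)
  from indep_vars_compose2[OF this, of "\<lambda>j p. p (f j)" "\<lambda>_. S"]
  show ?thesis by simp
qed

text \<open>The sequence of dimensions may return to the same N arbitrarily often, so the exponents N j need
  not be summable over j. But the variables depend on the pair of dimensions only and T <= K N, so each N occurs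
  with at most K N + 1 different T, and the union bound over these is summable over N.\<close>
lemma (in prob_space) pair_borel_cantelli:
  fixes Z :: "nat \<Rightarrow> nat \<Rightarrow> 'a \<Rightarrow> real" and N T :: "nat \<Rightarrow> nat" and K :: nat and \<kappa> d :: real
  assumes Z [measurable]: "\<And>j. Z (N j) (T j) \<in> borel_measurable M" and \<kappa>: "\<kappa> > 0"
    and tail: "\<And>j. prob {\<omega> \<in> space M. d \<le> Z (N j) (T j) \<omega>} \<le> 4 * exp (- (\<kappa> * N j))"
    and N: "filterlim N at_top sequentially" and K: "eventually (\<lambda>j. T j \<le> K * N j) sequentially"
  shows "AE \<omega> in M. eventually (\<lambda>j. Z (N j) (T j) \<omega> < d) sequentially"
proof -
  \<comment> \<open>nothing is known about Z at pairs that the sequence does not visit, so these are left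
    out\<close>
  define B where "B \<nu> s = (if \<exists>j. N j = \<nu> \<and> T j = s then {\<omega> \<in> space M. d \<le> Z \<nu> s \<omega>} else {})" for \<nu> s
  define A where "A \<nu> = (\<Union>s\<le>K * \<nu>. B \<nu> s)" for \<nu>
  have B: "B \<nu> s \<in> sets M \<and> prob (B \<nu> s) \<le> 4 * exp (- (\<kappa> * \<nu>))" for \<nu> s
  proof (cases "\<exists>j. N j = \<nu> \<and> T j = s")
    case True
    then obtain j where j: "N j = \<nu>" "T j = s" by blast
    have "B \<nu> s = {\<omega> \<in> space M. d \<le> Z (N j) (T j) \<omega>}" using j True unfolding B_def by simp
    moreover have "{\<omega> \<in> space M. d \<le> Z (N j) (T j) \<omega>} \<in> sets M" by measurable
    ultimately show ?thesis using tail[of j] j by simp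
  next
    case False
    then have "B \<nu> s = {}" unfolding B_def by (rule if_not_P)
    then show ?thesis by simp
  qed
  have A: "A \<nu> \<in> sets M" for \<nu> unfolding A_def using B by (intro sets.finite_UN) auto
  have le: "prob (A \<nu>) \<le> (K * real \<nu> + 1) * (4 * exp (- (\<kappa> * \<nu>)))" for \<nu>
  proof -
    have "prob (A \<nu>) \<le> (\<Sum>s\<le>K * \<nu>. prob (B \<nu> s))"
      unfolding A_def using B by (intro finite_measure_subadditive_finite) auto
    also have "\<dots> \<le> (\<Sum>s\<le>K * \<nu>. 4 * exp (- (\<kappa> * \<nu>)))" using B by (intro sum_mono) auto
    finally show ?thesis by (simp add: algebra_simps)
  qed
  have "summable (\<lambda>\<nu>. (K * real \<nu> + 1) * (4 * exp (- (\<kappa> * \<nu>))))"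
  proof (rule summable_comparison_test_bigo)
    show "summable (\<lambda>\<nu>. norm (1 / real \<nu> ^ 2))" using inverse_power_summable[of 2, where ?'a = real] by (simp add: field_simps)
    have "(\<lambda>\<nu>. (k * real \<nu> + 1) * (4 * exp (- (\<kappa> * real \<nu>)))) \<in> O(\<lambda>\<nu>. 1 / real \<nu> ^ 2)" if "k > 0" for k :: real
      using that \<kappa> by real_asymp
    then have "(\<lambda>\<nu>. (real (K + 1) * real \<nu> + 1) * (4 * exp (- (\<kappa> * real \<nu>)))) \<in> O(\<lambda>\<nu>. 1 / real \<nu> ^ 2)" by simp
    moreover have "(\<lambda>\<nu>. (K * real \<nu> + 1) * (4 * exp (- (\<kappa> * \<nu>)))) \<in> O(\<lambda>\<nu>. (real (K + 1) * real \<nu> + 1) * (4 * exp (- (\<kappa> * real \<nu>))))"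
      by (intro bigoI[of _ 1] always_eventually allI) (simp add: mult_right_mono)
    ultimately show "(\<lambda>\<nu>. (K * real \<nu> + 1) * (4 * exp (- (\<kappa> * \<nu>)))) \<in> O(\<lambda>\<nu>. 1 / real \<nu> ^ 2)"
      using landau_o.big_trans by blast
  qed
  then have "summable (\<lambda>\<nu>. prob (A \<nu>))" by (rule summable_comparison_test'[of _ 0]) (use le in simp)
  then have "AE \<omega> in M. eventually (\<lambda>\<nu>. \<omega> \<in> space M - A \<nu>) sequentially"
    by (intro borel_cantelli_AE1 A) (simp add: emeasure_eq_measure)
  then show ?thesis
  proof eventually_elim
    case (elim \<omega>)
    from eventually_compose_filterlim[OF elim N] K show ?case
    proof eventually_elim
      case (elim j)
      then have "\<omega> \<notin> B (N j) (T j)" "\<omega> \<in> space M" unfolding A_def by auto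
      moreover have "B (N j) (T j) = {\<omega> \<in> space M. d \<le> Z (N j) (T j) \<omega>}" unfolding B_def by (rule if_P) blast
      ultimately show ?case by simp
    qed
  qed
qed

lemma autocov_mat_gram:
  assumes \<tau>: "\<tau> \<ge> 1" and T: "T > 0"
  shows "autocov_mat \<tau> N T a = mat N N (\<lambda>(i, j). gram (T + \<tau>) (lag_mat \<tau>) (\<lambda>i k. of_real (1 / sqrt T) * a (i + 1) (k + 1)) i j)"
proof (rule eq_matI)
  fix i j assume ij: "i < dim_row (mat N N (\<lambda>(i, j). gram (T + \<tau>) (lag_mat \<tau>) (\<lambda>i k. of_real (1 / sqrt T) * a (i + 1) (k + 1)) i j))"
    "j < dim_col (mat N N (\<lambda>(i, j). gram (T + \<tau>) (lag_mat \<tau>) (\<lambda>i k. of_real (1 / sqrt T) * a (i + 1) (k + 1)) i j))"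
  then have i: "i < N" and j: "j < N" by auto
  define Y where "Y i k = of_real (1 / sqrt T) * a (i + 1) (k + 1)" for i k
  have outer: "(gamma_col N T a k * mat_adjoint (gamma_col N T a l)) $$ (p, q)
      = 1 / 2 * (Y p (k - 1) * cnj (Y q (l - 1)))" if "p < N" "q < N" "k \<ge> 1" "l \<ge> 1" for k l p q
  proof -
    have "(gamma_col N T a k * mat_adjoint (gamma_col N T a l)) $$ (p, q) = gamma_col N T a k $$ (p, 0) * cnj (gamma_col N T a l $$ (q, 0))"
    proof -
      have "mat_adjoint (gamma_col N T a l) $$ (0, q) = cnj (gamma_col N T a l $$ (q, 0))"
        using that unfolding mat_adjoint_def gamma_col_def by (subst mat_of_rows_index) auto
      moreover have "dim_row (mat_adjoint (gamma_col N T a l)) = 1" "dim_col (mat_adjoint (gamma_col N T a l)) = N"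
        by (simp_all add: mat_adjoint_def gamma_col_def)
      ultimately show ?thesis using that by (simp add: gamma_col_def scalar_prod_def)
    qed
    also have "\<dots> = (1 / of_real (sqrt (2 * T))) * (1 / of_real (sqrt (2 * T))) * (a (p + 1) k * cnj (a (q + 1) l))"
      using that by (simp add: gamma_col_def)
    also have "(1 / of_real (sqrt (2 * T))) * (1 / of_real (sqrt (2 * T))) = (1 / 2 * (of_real (1 / sqrt T) * of_real (1 / sqrt T)) :: complex)"
    proof -
      have "1 / sqrt (2 * T) * (1 / sqrt (2 * T)) = 1 / 2 * (1 / sqrt T * (1 / sqrt T))"
        using T by simp
      from arg_cong[OF this, of complex_of_real] show ?thesis
        by (simp only: of_real_mult of_real_divide of_real_1 of_real_numeral)
    qed
    finally show ?thesis using that unfolding Y_def by (simp add: algebra_simps)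
  qed
  have "autocov_mat \<tau> N T a $$ (i, j) = (\<Sum>k=1..T. 1 / 2 * (Y i (k - 1) * cnj (Y j (k + \<tau> - 1))) + 1 / 2 * (Y i (k + \<tau> - 1) * cnj (Y j (k - 1))))"
  proof -
    have "(let g = gamma_col N T a k; h = gamma_col N T a (k + \<tau>) in g * mat_adjoint h + h * mat_adjoint g) $$ (i, j)
        = 1 / 2 * (Y i (k - 1) * cnj (Y j (k + \<tau> - 1))) + 1 / 2 * (Y i (k + \<tau> - 1) * cnj (Y j (k - 1)))" if "k \<ge> 1" for k
    proof -
      have d: "dim_row (gamma_col N T a k) = N" "dim_col (mat_adjoint (gamma_col N T a k)) = N" for k
        by (simp_all add: gamma_col_def mat_adjoint_def)
      have "(let g = gamma_col N T a k; h = gamma_col N T a (k + \<tau>) in g * mat_adjoint h + h * mat_adjoint g) $$ (i, j)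
        = (gamma_col N T a k * mat_adjoint (gamma_col N T a (k + \<tau>))) $$ (i, j) + (gamma_col N T a (k + \<tau>) * mat_adjoint (gamma_col N T a k)) $$ (i, j)"
        unfolding Let_def by (rule index_add_mat) (use i j d in simp_all)
      then show ?thesis using that i j by (simp only: outer[OF i j] le_add1 add_increasing2 trans_le_add1)
    qed
    then show ?thesis unfolding autocov_mat_def using i j by simp
  qed
  also have "\<dots> = (\<Sum>k<T. 1 / 2 * (Y i k * cnj (Y j (k + \<tau>))) + 1 / 2 * (Y i (k + \<tau>) * cnj (Y j k)))"
    unfolding One_nat_def sum.atLeast1_atMost_eq by simp
  also have "\<dots> = gram (T + \<tau>) (lag_mat \<tau>) Y i j"
  proof -
    have "gram (T + \<tau>) (lag_mat \<tau>) Y i j = (\<Sum>l<T + \<tau>. (\<Sum>k<T + \<tau>. Y i k * lag_mat \<tau> k l) * cnj (Y j l))"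
      unfolding gram_def sum_distrib_right by (rule sum.swap)
    also have "\<dots> = (\<Sum>l<T + \<tau>. if l \<in> {\<tau>..<T + \<tau>} then 1 / 2 * (Y i (l - \<tau>) * cnj (Y j l)) else 0)
        + (\<Sum>l<T + \<tau>. if l \<in> {..<T} then 1 / 2 * (Y i (l + \<tau>) * cnj (Y j l)) else 0)"
      unfolding sum.distrib[symmetric] sum_lag_mat[OF \<tau>] by (rule sum.cong) (auto simp: distrib_right)
    also have "(\<Sum>l<T + \<tau>. if l \<in> {\<tau>..<T + \<tau>} then 1 / 2 * (Y i (l - \<tau>) * cnj (Y j l)) else 0)
        = (\<Sum>l\<in>{\<tau>..<T + \<tau>}. 1 / 2 * (Y i (l - \<tau>) * cnj (Y j l)))"
      unfolding sum.inter_restrict[OF finite_lessThan, symmetric] by (rule sum.cong) auto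
    also have "\<dots> = (\<Sum>l<T. 1 / 2 * (Y i l * cnj (Y j (l + \<tau>))))"
      using sum.shift_bounds_nat_ivl[of "\<lambda>l. 1 / 2 * (Y i (l - \<tau>) * cnj (Y j l))" 0 \<tau> T] by (simp add: lessThan_atLeast0)
    also have "(\<Sum>l<T + \<tau>. if l \<in> {..<T} then 1 / 2 * (Y i (l + \<tau>) * cnj (Y j l)) else 0)
        = (\<Sum>l<T. 1 / 2 * (Y i (l + \<tau>) * cnj (Y j l)))"
      unfolding sum.inter_restrict[OF finite_lessThan, symmetric] by (rule sum.cong) auto
    finally show ?thesis unfolding sum.distrib ..
  qed
  finally show "autocov_mat \<tau> N T a $$ (i, j) = mat N N (\<lambda>(i, j). gram (T + \<tau>) (lag_mat \<tau>) (\<lambda>i k. of_real (1 / sqrt T) * a (i + 1) (k + 1)) i j) $$ (i, j)"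
    using i j unfolding Y_def[abs_def] by simp
qed (simp_all add: autocov_mat_def)

lemma (in entries) raw_trace_tail:
  assumes z: "Im z > 0" and d: "d > 0"
  shows "prob {\<omega> \<in> space M. d \<le> cmod (raw_trace z \<omega> - expectation (raw_trace z))} \<le> 4 * exp (- (d\<^sup>2 * (Im z)\<^sup>2 / 128 * N))"
  using norm_trace_tail[OF indep N hermitian_lag_mat z d] unfolding raw_trace_def[abs_def] .

lemma (in entries) raw_trace_stieltjes:
  assumes "Im z > 0"
  shows "raw_trace z \<omega> = stieltjes (spectral_measure (mat N N (\<lambda>(i, j). gram n (lag_mat \<tau>) (\<lambda>i k. of_real (1 / sqrt t) * e i k \<omega>) i j))) z"
proof -
  have "cavity n z (lag_mat \<tau>)" using hermitian_lag_mat assms by (intro cavity.intro) auto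
  from stieltjes_spectral_measure[OF cavity.hermitian_gram[OF this] assms N]
  show ?thesis unfolding raw_trace_def norm_trace_def by (rule sym)
qed

text \<open>The exceptional null set is a countable union over rational heights and rational accuracies;
  outside it, the deterministic continuity theorem applies to every realisation. One such realisation serves to
  produce the limit.\<close>
theorem gram_spectral_limit:
  fixes P :: "'w measure" and X :: "nat \<Rightarrow> nat \<Rightarrow> nat \<Rightarrow> nat \<Rightarrow> 'w \<Rightarrow> complex" and N T :: "nat \<Rightarrow> nat" and \<tau> :: nat and c :: real
  defines "A \<equiv> (\<lambda>j \<omega>. mat (N j) (N j) (\<lambda>(a, b). gram (T j + \<tau>) (lag_mat \<tau>) (\<lambda>i k. of_real (1 / sqrt (T j)) * X (N j) (T j) i k \<omega>) a b))"
  assumes ent: "\<And>j. entries P (N j) (T j) \<tau> (X (N j) (T j))"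
    and N: "filterlim N at_top sequentially" and T: "filterlim T at_top sequentially"
    and ratio: "(\<lambda>j. real (N j) / real (T j + \<tau>)) \<longlonglongrightarrow> c" and c: "c > 0"
    and lind: "\<And>\<eta>. \<eta> > 0 \<Longrightarrow> (\<lambda>j. entries.lindeberg P (N j) (T j) \<tau> (X (N j) (T j)) \<eta>) \<longlonglongrightarrow> 0"
  obtains \<mu> where "real_distribution \<mu>" "AE \<omega> in P. weak_conv (\<lambda>j. esd (A j \<omega>)) (cdf \<mu>)"
    and "\<And>z. Im z > 0 \<Longrightarrow> (1 - (of_real c)\<^sup>2 * (stieltjes \<mu> z)\<^sup>2) * (of_real c + of_real c * z * stieltjes \<mu> z - 1)\<^sup>2 = 1"
proof -
  interpret P: prob_space P using ent[of 0] by (simp add: entries_def)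
  define y0 where "y0 = 4 * c + 4"
  have y0: "y0 \<ge> 0" unfolding y0_def using c by simp
  define Z where "Z j v \<omega> = entries.raw_trace (N j) (T j) \<tau> (X (N j) (T j)) (\<i> * of_real v) \<omega>" for j and v :: real and \<omega>
  \<comment> \<open>a limit only for v above y0; elsewhere the value is irrelevant\<close>
  define s where "s v = lim (\<lambda>j. P.expectation (Z j v))" for v
  have s: "(\<lambda>j. P.expectation (Z j v)) \<longlonglongrightarrow> s v"
    "(1 - (of_real c)\<^sup>2 * (s v)\<^sup>2) * (of_real c + of_real c * (\<i> * of_real v) * s v - 1)\<^sup>2 = 1" "1 - v * Im (s v) \<le> 1 / v"
    if v: "v > y0" for v
  proof -
    have "v \<ge> 4 * c + 4" using v unfolding y0_def by simp
    from mean_limit[OF ent N T ratio c lind this] obtain w where w: "(\<lambda>j. P.expectation (Z j v)) \<longlonglongrightarrow> w"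
      "(1 - (of_real c)\<^sup>2 * w\<^sup>2) * (of_real c + of_real c * (\<i> * of_real v) * w - 1)\<^sup>2 = 1" "1 - v * Im w \<le> 1 / v"
      unfolding Z_def by blast
    moreover have "s v = w" unfolding s_def by (rule limI[OF w(1)])
    ultimately show "(\<lambda>j. P.expectation (Z j v)) \<longlonglongrightarrow> s v"
      "(1 - (of_real c)\<^sup>2 * (s v)\<^sup>2) * (of_real c + of_real c * (\<i> * of_real v) * s v - 1)\<^sup>2 = 1" "1 - v * Im (s v) \<le> 1 / v"
      by simp_all
  qed
  define K where "K = nat \<lceil>2 / c\<rceil>"
  have K: "eventually (\<lambda>j. T j \<le> K * N j) sequentially"
  proof -
    have "eventually (\<lambda>j. c / 2 < real (N j) / real (T j + \<tau>)) sequentially"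
      by (rule order_tendstoD(1)[OF ratio]) (use c in simp)
    then show ?thesis
    proof eventually_elim
      case (elim j)
      have t: "real (T j) > 0" using entries.t[OF ent, of j] by simp
      have "c / 2 * real (T j + \<tau>) < N j" using elim t by (simp add: less_divide_eq)
      moreover have "c / 2 * real (T j) \<le> c / 2 * real (T j + \<tau>)" using c by (intro mult_left_mono) auto
      ultimately have "c * real (T j) \<le> 2 * N j" by simp
      then have "real (T j) \<le> 2 / c * N j" using c by (simp add: field_simps)
      also have "\<dots> \<le> real K * N j" unfolding K_def by (intro mult_right_mono) linarith+
      finally show ?case unfolding of_nat_mult[symmetric] of_nat_le_iff .
    qed
  qed
  define G where "G = {\<omega>. \<forall>v\<in>\<rat> \<inter> {y0<..}. (\<lambda>j. Z j v \<omega>) \<longlonglongrightarrow> s v}"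
  have G: "AE \<omega> in P. \<omega> \<in> G"
  proof -
    have "AE \<omega> in P. \<forall>v\<in>\<rat> \<inter> {y0<..}. \<forall>i. eventually (\<lambda>j. cmod (Z j v \<omega> - P.expectation (Z j v)) < inverse (real (Suc i))) sequentially"
      unfolding AE_ball_countable[OF countable_Int1[OF countable_rat]] AE_all_countable
    proof (intro ballI allI)
      fix v i assume v: "v \<in> \<rat> \<inter> {y0<..}"
      then have z: "Im (\<i> * complex_of_real v) > 0" using y0 by simp
      define d where "d = inverse (real (Suc i))"
      have d: "d > 0" unfolding d_def by simp
      let ?m = "\<lambda>a b. entries.raw_trace a b \<tau> (X a b) (\<i> * of_real v)"
      show "AE \<omega> in P. eventually (\<lambda>j. cmod (Z j v \<omega> - P.expectation (Z j v)) < inverse (real (Suc i))) sequentially"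
        unfolding d_def[symmetric] Z_def
      proof (rule P.pair_borel_cantelli[where Z = "\<lambda>a b \<omega>. cmod (?m a b \<omega> - P.expectation (?m a b))", OF _ _ _ N K])
        show "d\<^sup>2 * (Im (\<i> * complex_of_real v))\<^sup>2 / 128 > 0" using d z by simp
        show "P.prob {\<omega> \<in> space P. d \<le> cmod (?m (N j) (T j) \<omega> - P.expectation (?m (N j) (T j)))}
          \<le> 4 * exp (- (d\<^sup>2 * (Im (\<i> * complex_of_real v))\<^sup>2 / 128 * real (N j)))" for j
          by (rule entries.raw_trace_tail[OF ent z d])
        have "?m (N j) (T j) \<in> borel_measurable P" for j
          by (rule borel_measurable_integrable[OF entries.raw_trace_integrable[OF ent z]])
        note this [measurable]
        show "(\<lambda>\<omega>. cmod (?m (N j) (T j) \<omega> - P.expectation (?m (N j) (T j)))) \<in> borel_measurable P" for j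
          by measurable
      qed
    qed
    then show ?thesis
    proof eventually_elim
      case (elim \<omega>)
      show ?case unfolding G_def
      proof (intro CollectI ballI)
        fix v assume v: "v \<in> \<rat> \<inter> {y0<..}"
        have "(\<lambda>j. Z j v \<omega> - P.expectation (Z j v)) \<longlonglongrightarrow> 0"
        proof (rule tendstoI)
          fix \<epsilon> :: real assume "\<epsilon> > 0"
          then obtain i where i: "inverse (real (Suc i)) < \<epsilon>" using reals_Archimedean by blast
          from elim v have "eventually (\<lambda>j. cmod (Z j v \<omega> - P.expectation (Z j v)) < inverse (real (Suc i))) sequentially" by blast
          then show "eventually (\<lambda>j. dist (Z j v \<omega> - P.expectation (Z j v)) 0 < \<epsilon>) sequentially"
            by (rule eventually_mono) (use i in \<open>simp del: of_nat_Suc\<close>)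
        qed
        from tendsto_add[OF this s(1)[of v]] v show "(\<lambda>j. Z j v \<omega>) \<longlonglongrightarrow> s v" by simp
      qed
    qed
  qed
  define \<nu> where "\<nu> \<omega> j = spectral_measure (A j \<omega>)" for \<omega> j
  have Npos: "N j > 0" for j using entries.N[OF ent] .
  have \<nu>: "real_distribution (\<nu> \<omega> j)" "cdf (\<nu> \<omega> j) = esd (A j \<omega>)" for \<omega> j
    unfolding \<nu>_def A_def by (rule real_distribution_spectral_measure[OF mat_carrier Npos] cdf_spectral_measure[OF mat_carrier Npos])+
  have \<nu>_lim: "(\<lambda>j. stieltjes (\<nu> \<omega> j) (\<i> * of_real v)) \<longlonglongrightarrow> s v" if "\<omega> \<in> G" "v \<in> \<rat>" "v > y0" for \<omega> v
  proof -
    have z: "Im (\<i> * complex_of_real v) > 0" using that y0 by simp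
    have "stieltjes (\<nu> \<omega> j) (\<i> * of_real v) = Z j v \<omega>" for j
      unfolding \<nu>_def A_def Z_def by (rule entries.raw_trace_stieltjes[OF ent z, symmetric])
    then show ?thesis using that unfolding G_def by simp
  qed
  have "\<exists>\<omega>. \<omega> \<in> G"
  proof (rule ccontr)
    assume "\<not> ?thesis"
    then have "AE \<omega> in P. False" using G by simp
    then show False using P.AE_False by simp
  qed
  then obtain \<omega>0 where \<omega>0: "\<omega>0 \<in> G" by blast
  have tail: "\<exists>y\<in>\<rat>. y > y0 \<and> 1 - y * Im (s y) < \<epsilon>" if "\<epsilon> > 0" for \<epsilon>
  proof -
    obtain k :: nat where k: "real k > max y0 (1 / \<epsilon>)" using reals_Archimedean2 by blast
    then have "1 / real k < \<epsilon>" using that y0 by (simp add: field_simps)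
    then have "1 - real k * Im (s (real k)) < \<epsilon>" using s(3)[of "real k"] k by simp
    then show ?thesis using k by (intro bexI[of _ "real k"]) auto
  qed
  from stieltjes_continuity[OF \<nu>(1) y0 \<nu>_lim[OF \<omega>0] tail]
  obtain \<mu> where \<mu>: "real_distribution \<mu>" "\<And>y. y \<in> \<rat> \<Longrightarrow> y > y0 \<Longrightarrow> stieltjes \<mu> (\<i> * of_real y) = s y"
    and conv: "\<And>\<nu>'. (\<And>n. real_distribution (\<nu>' n)) \<Longrightarrow>
       (\<And>y. y \<in> \<rat> \<Longrightarrow> y > y0 \<Longrightarrow> (\<lambda>n. stieltjes (\<nu>' n) (\<i> * of_real y)) \<longlonglongrightarrow> s y) \<Longrightarrow> weak_conv_m \<nu>' \<mu>"
    by blast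
  show thesis
  proof (rule that[OF \<mu>(1)])
    show "AE \<omega> in P. weak_conv (\<lambda>j. esd (A j \<omega>)) (cdf \<mu>)"
      using G
    proof eventually_elim
      case (elim \<omega>)
      have "weak_conv_m (\<nu> \<omega>) \<mu>" by (rule conv[OF \<nu>(1) \<nu>_lim[OF elim]])
      then show ?case unfolding weak_conv_m_def \<nu>(2) .
    qed
    show "(1 - (of_real c)\<^sup>2 * (stieltjes \<mu> z)\<^sup>2) * (of_real c + of_real c * z * stieltjes \<mu> z - 1)\<^sup>2 = 1" if "Im z > 0" for z
    proof (rule stieltjes_equation_extend[OF \<mu>(1) y0 _ that])
      fix y :: real assume y: "y \<in> \<rat>" "y > y0"
      show "(1 - (of_real c)\<^sup>2 * (stieltjes \<mu> (\<i> * of_real y))\<^sup>2) * (of_real c + of_real c * (\<i> * of_real y) * stieltjes \<mu> (\<i> * of_real y) - 1)\<^sup>2 = 1"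
        unfolding \<mu>(2)[OF y] by (rule s(2)[OF y(2)])
    qed
  qed
qed

theorem mainTheorem1:
  fixes P :: "'w measure"
    and \<epsilon> :: "nat \<Rightarrow> nat \<Rightarrow> nat \<Rightarrow> nat \<Rightarrow> 'w \<Rightarrow> complex"
    and N T :: "nat \<Rightarrow> nat"
    and \<tau> :: nat
    and c :: real
  assumes "prob_space P"
    and "\<tau> \<ge> 1" and "c > 0"
    and "filterlim N at_top sequentially"
    and "filterlim T at_top sequentially"
    and "(\<lambda>n. real (N n) / real (T n + \<tau>)) \<longlonglongrightarrow> c"
    and "\<And>n. prob_space.indep_vars P (\<lambda>_. borel) (\<lambda>(i, k). \<epsilon> (N n) (T n) i k)
                ({1..N n} \<times> {1..T n + \<tau>})"
    and "\<And>n i k. \<lbrakk>i \<in> {1..N n}; k \<in> {1..T n + \<tau>}\<rbrakk> \<Longrightarrow>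
           (LINT \<omega>|P. \<epsilon> (N n) (T n) i k \<omega>) = 0"
    and "\<And>n i k. \<lbrakk>i \<in> {1..N n}; k \<in> {1..T n + \<tau>}\<rbrakk> \<Longrightarrow>
           (LINT \<omega>|P. (cmod (\<epsilon> (N n) (T n) i k \<omega>))\<^sup>2) = 1"
    and "\<And>\<eta>::real. \<eta> > 0 \<Longrightarrow>
           (\<lambda>n. 1 / (\<eta>\<^sup>2 * real (N n) * real (T n + \<tau>)) *
                 (\<Sum>i=1..N n. \<Sum>k=1..T n + \<tau>.
                    LINT \<omega>|P. (cmod (\<epsilon> (N n) (T n) i k \<omega>))\<^sup>2 *
                      indicator {\<omega>. cmod (\<epsilon> (N n) (T n) i k \<omega>) \<ge> \<eta> * sqrt (real (T n + \<tau>))} \<omega>))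
           \<longlonglongrightarrow> 0"
  shows "\<exists>\<mu>. real_distribution \<mu> \<and>
           (AE \<omega> in P. weak_conv
              (\<lambda>n. esd (autocov_mat \<tau> (N n) (T n) (\<lambda>i k. \<epsilon> (N n) (T n) i k \<omega>))) (cdf \<mu>)) \<and>
           (\<forall>z. Im z > 0 \<longrightarrow>
              (1 - (of_real c)\<^sup>2 * (stieltjes \<mu> z)\<^sup>2) *
              (of_real c + of_real c * z * stieltjes \<mu> z - 1)\<^sup>2 = 1)"
proof -
  interpret prob_space P by fact
  have "eventually (\<lambda>n. 0 < N n \<and> 0 < T n) sequentially"
    using assms(4,5) by (intro eventually_conj) (auto simp: filterlim_at_top Suc_le_eq dest: spec[of _ 1])
  \<comment> \<open>finitely many initial dimensions may be 0 and are skipped\<close>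
  then obtain j0 where j0: "\<And>n. n \<ge> j0 \<Longrightarrow> 0 < N n \<and> 0 < T n" unfolding eventually_sequentially by blast
  define X where "X a b i k = \<epsilon> a b (Suc i) (Suc k)" for a b i k
  have ent: "entries P (N n) (T n) \<tau> (X (N n) (T n))" if n: "n \<ge> j0" for n
  proof (rule entries.intro[OF assms(1)], rule entries_axioms.intro)
    show "0 < N n" "0 < T n" using j0[OF n] by auto
    show "indep_vars (\<lambda>_. borel) (\<lambda>(i, k). X (N n) (T n) i k) ({..<N n} \<times> {..<T n + \<tau>})"
    proof -
      have "indep_vars (\<lambda>_. borel) (\<lambda>p. (\<lambda>(i, k). \<epsilon> (N n) (T n) i k) (map_prod Suc Suc p)) ({..<N n} \<times> {..<T n + \<tau>})"
        by (rule indep_vars_reindex[OF assms(7)]) (auto simp: inj_on_def)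
      also have "(\<lambda>p. (\<lambda>(i, k). \<epsilon> (N n) (T n) i k) (map_prod Suc Suc p)) = (\<lambda>(i, k). X (N n) (T n) i k)"
        by (auto simp: X_def fun_eq_iff)
      finally show ?thesis .
    qed
  qed (use assms(2,8,9) in \<open>simp_all add: X_def\<close>)
  have lind: "(\<lambda>n. entries.lindeberg P (N (n + j0)) (T (n + j0)) \<tau> (X (N (n + j0)) (T (n + j0))) \<eta>) \<longlonglongrightarrow> 0"
    if \<eta>: "\<eta> > 0" for \<eta>
  proof -
    define L where "L n = 1 / (\<eta>\<^sup>2 * real (N n) * real (T n + \<tau>)) * (\<Sum>i=1..N n. \<Sum>k=1..T n + \<tau>.
      LINT \<omega>|P. (cmod (\<epsilon> (N n) (T n) i k \<omega>))\<^sup>2 * indicator {\<omega>. cmod (\<epsilon> (N n) (T n) i k \<omega>) \<ge> \<eta> * sqrt (real (T n + \<tau>))} \<omega>)" for n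
    have eq: "entries.lindeberg P (N n) (T n) \<tau> (X (N n) (T n)) \<eta> = \<eta>\<^sup>2 * (real (T n + \<tau>) / real (T n)) * L n"
      if n: "n \<ge> j0" for n
    proof -
      define S where "S = (\<Sum>i<N n. \<Sum>k<T n + \<tau>. entries.tail_var P (T n) \<tau> (X (N n) (T n)) \<eta> i k)"
      have tv: "entries.tail_var P (T n) \<tau> (X (N n) (T n)) \<eta> i k = (LINT \<omega>|P. (cmod (\<epsilon> (N n) (T n) (Suc i) (Suc k) \<omega>))\<^sup>2 *
          indicator {\<omega>. cmod (\<epsilon> (N n) (T n) (Suc i) (Suc k) \<omega>) \<ge> \<eta> * sqrt (real (T n + \<tau>))} \<omega>)" for i k
        unfolding entries.tail_var_def[OF ent[OF n]]
        by (rule Bochner_Integration.integral_cong[OF refl])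
          (auto simp: entries.large_def[OF ent[OF n]] entries.level_def[OF ent[OF n]] X_def indicator_def)
      have "L n = 1 / (\<eta>\<^sup>2 * real (N n) * real (T n + \<tau>)) * S"
        unfolding L_def S_def tv One_nat_def sum.atLeast1_atMost_eq ..
      moreover have "s / (a * b) = \<eta>\<^sup>2 * (d / b) * (1 / (\<eta>\<^sup>2 * a * d) * s)" if "a > 0" "b > 0" "d > 0" for a b d s :: real
        using that \<eta> by simp
      ultimately show ?thesis
        unfolding entries.lindeberg_def[OF ent[OF n]] S_def[symmetric] of_nat_mult
        using j0[OF n] by simp
    qed
    have "L \<longlonglongrightarrow> 0" unfolding L_def by (rule assms(10)[OF \<eta>])
    from tendsto_mult[OF tendsto_mult[OF tendsto_const[of "\<eta>\<^sup>2"] shift_ratio_tendsto_1[OF assms(5), of \<tau>]] this]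
    have "(\<lambda>n. \<eta>\<^sup>2 * (real (T n + \<tau>) / real (T n)) * L n) \<longlonglongrightarrow> 0" by simp
    from LIMSEQ_ignore_initial_segment[OF this, of j0] show ?thesis by (simp only: eq le_add2)
  qed
  have N: "filterlim (\<lambda>n. N (n + j0)) at_top sequentially" and T: "filterlim (\<lambda>n. T (n + j0)) at_top sequentially"
    by (rule filterlim_compose[OF assms(4) filterlim_add_const_nat_at_top] filterlim_compose[OF assms(5) filterlim_add_const_nat_at_top])+
  from gram_spectral_limit[OF ent[OF le_add2] N T LIMSEQ_ignore_initial_segment[OF assms(6)] assms(3) lind]
  obtain \<mu> where \<mu>: "real_distribution \<mu>"
    and conv: "AE \<omega> in P. weak_conv (\<lambda>j. esd (mat (N (j + j0)) (N (j + j0)) (\<lambda>(a, b). gram (T (j + j0) + \<tau>) (lag_mat \<tau>)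
      (\<lambda>i k. of_real (1 / sqrt (T (j + j0))) * X (N (j + j0)) (T (j + j0)) i k \<omega>) a b))) (cdf \<mu>)"
    and eq: "\<And>z. Im z > 0 \<Longrightarrow> (1 - (of_real c)\<^sup>2 * (stieltjes \<mu> z)\<^sup>2) * (of_real c + of_real c * z * stieltjes \<mu> z - 1)\<^sup>2 = 1"
    by blast
  have mat: "autocov_mat \<tau> (N (j + j0)) (T (j + j0)) (\<lambda>i k. \<epsilon> (N (j + j0)) (T (j + j0)) i k \<omega>) =
    mat (N (j + j0)) (N (j + j0)) (\<lambda>(a, b). gram (T (j + j0) + \<tau>) (lag_mat \<tau>)
      (\<lambda>i k. of_real (1 / sqrt (T (j + j0))) * X (N (j + j0)) (T (j + j0)) i k \<omega>) a b)" for j \<omega>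
    using autocov_mat_gram[OF assms(2)] j0[of "j + j0"] unfolding X_def by simp
  from conv have "AE \<omega> in P. weak_conv (\<lambda>n. esd (autocov_mat \<tau> (N n) (T n) (\<lambda>i k. \<epsilon> (N n) (T n) i k \<omega>))) (cdf \<mu>)"
  proof eventually_elim
    case (elim \<omega>)
    then show ?case unfolding mat[symmetric] weak_conv_def by (blast intro: LIMSEQ_offset)
  qed
  then show ?thesis using \<mu> eq by blast
qed

end
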